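(* Let $M,\widehat M$ be oriented connected $n$-dimensional Riemannian manifolds and let $q_0:[0,\tau]\to Q$ be an intrinsic rolling of $M$ on $\widehat M$ with projection $(x(t),\widehat x(t))$ to $M\times\widehat M$. Denote by $k$ the dimension of the space of parallel tangent vector fields along $\widehat x(t)$ that are orthogonal to $\dot{\widehat x}(t)$ whenever the latter is defined. Then: (a) $q_0$ is the unique intrinsic rolling of $M$ on $\widehat M$ along $x(t)$ and $\widehat x(t)$ if and only if $k\le 1$. (b) If $k\ge 2$, then there exists an injective Lie group homomorphism $\zeta:\mathrm{SO}(k)\to\mathrm{SO}(n)$ such that for each $A'\in\mathrm{SO}(k)$ the map $t\mapsto q_0(t)\zeta(A')$ is an intrinsic rolling over $(x(t),\widehat x(t))$, and any intrinsic rolling over $(x(t),\widehat x(t))$ is of this form.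
   Context: $Q=\{q\in\mathrm{Isom}_0^+(T_xM,T_{\widehat x}\widehat M): x\in M,\widehat x\in\widehat M\}$, where $\mathrm{Isom}_0^+$ denotes linear orientation preserving isometries; it is a bundle over $M\times\widehat M$ with fiber diffeomorphic to $\mathrm{SO}(n)$. A vector field along an absolutely continuous curve is parallel if it is absolutely continuous and its (Levi-Civita) covariant derivative $\frac{D}{dt}$ along the curve vanishes for almost every $t$. An intrinsic rolling of $M$ on $\widehat M$ is an absolutely continuous curve $q:[0,\tau]\to Q$ such that, with $x(t),\widehat x(t)$ the projections of $q(t)$ to $M$ and $\widehat M$: (I') $\dot{\widehat x}(t)=q(t)\dot x(t)$ for almost all $t$; (II') a tangent vector field $Z(t)$ along $x(t)$ is parallel if and only if $q(t)Z(t)$ is parallel along $\widehat x(t)$. It is said to be along (or over) $(x(t),\widehat x(t))$. Right action: fix positively oriented orthonormal parallel frames $\{e_j(t)\}_{j=1}^n$ along $x(t)$ and $\{\hat e_i(t)\}_{i=1}^n$ along $\widehat x(t)$. For $q$ in the fiber over $(x(t),\widehat x(t))$ with matrix $A=(\langle\hat e_i(t),q\,e_j(t)\rangle)_{i,j}\in\mathrm{SO}(n)$ and $A_0\in\mathrm{SO}(n)$, $qA_0$ is the isometry over $(x(t),\widehat x(t))$ with matrix $AA_0$ in these frames. *)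

theory Defs
  imports "HOL-Analysis.Analysis" "HOL-Library.Function_Algebras"
begin

section \<open>Preliminaries from analysis\<close>

text \<open>Pointwise vector space structure on functions. It is used for tangent vectors (families of
  coordinate vectors indexed by charts) and for vector fields along curves.\<close>

instantiation "fun" :: (type, real_vector) real_vector
begin

definition scaleR_fun :: "real \<Rightarrow> ('a \<Rightarrow> 'b) \<Rightarrow> 'a \<Rightarrow> 'b"
  where "scaleR_fun r f = (\<lambda>x. r *\<^sub>R f x)"

instance
  by standard (auto simp: scaleR_fun_def fun_eq_iff plus_fun_def scaleR_add_right scaleR_add_left)

end

text \<open>All sets \<open>S\<close> to which this is applied are open.\<close>

primrec Ck_on :: "nat \<Rightarrow> ('a::real_normed_vector \<Rightarrow> 'b::real_normed_vector) \<Rightarrow> 'a set \<Rightarrow> bool"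
  where
    "Ck_on 0 f S \<longleftrightarrow> continuous_on S f"
  | "Ck_on (Suc k) f S \<longleftrightarrow>
      (\<forall>x\<in>S. f differentiable (at x)) \<and> (\<forall>v. Ck_on k (\<lambda>x. frechet_derivative f (at x) v) S)"

definition smooth_on :: "'a set \<Rightarrow> ('a::real_normed_vector \<Rightarrow> 'b::real_normed_vector) \<Rightarrow> bool"
  where "smooth_on S f \<longleftrightarrow> (\<forall>k. Ck_on k f S)"

text \<open>Smoothness on an arbitrary subset of a vector space, by smooth local extension to the ambient
  space; on an embedded submanifold this is smoothness with respect to its manifold structure.\<close>

definition smooth_on_subset :: "'a set \<Rightarrow> ('a::real_normed_vector \<Rightarrow> 'b::real_normed_vector) \<Rightarrow> bool"
  where "smooth_on_subset S f \<longleftrightarrow>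
    (\<forall>x\<in>S. \<exists>U F. open U \<and> x \<in> U \<and> smooth_on U F \<and> (\<forall>y\<in>S \<inter> U. F y = f y))"

definition abs_continuous :: "real \<Rightarrow> real \<Rightarrow> (real \<Rightarrow> 'b::real_normed_vector) \<Rightarrow> bool"
  where "abs_continuous a b f \<longleftrightarrow>
    (\<forall>\<epsilon>>0. \<exists>\<delta>>0. \<forall>D :: (real \<times> real) set.
       finite D \<and> (\<forall>(s, t)\<in>D. a \<le> s \<and> s \<le> t \<and> t \<le> b) \<and>
       pairwise (\<lambda>(s, t) (s', t'). {s<..<t} \<inter> {s'<..<t'} = {}) D \<and>
       (\<Sum>(s, t)\<in>D. t - s) < \<delta>
       \<longrightarrow> (\<Sum>(s, t)\<in>D. norm (f t - f s)) < \<epsilon>)"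


section \<open>Oriented Riemannian manifolds\<close>

text \<open>A chart is a pair of its domain and its coordinate map; the values of the coordinate map
  outside the domain are irrelevant.\<close>

type_synonym ('a, 'n) chart = "'a set \<times> ('a \<Rightarrow> real ^ 'n)"

text \<open>A tangent vector is the family of its coordinate vectors in all charts around its base point,
  extended by \<open>0\<close> to all other charts (see \<open>tangent_space\<close>).\<close>

type_synonym ('a, 'n) tvec = "('a, 'n) chart \<Rightarrow> real ^ 'n"

record ('a, 'n) rmanifold =
  mtop :: "'a topology"
  atlas :: "('a, 'n) chart set"
  metric :: "'a \<Rightarrow> ('a, 'n) tvec \<Rightarrow> ('a, 'n) tvec \<Rightarrow> real"

definition charts_at :: "('a, 'n::finite) rmanifold \<Rightarrow> 'a \<Rightarrow> ('a, 'n) chart set"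
  where "charts_at M p = {c \<in> atlas M. p \<in> fst c}"

definition chart_inv :: "('a, 'n::finite) chart \<Rightarrow> real ^ 'n \<Rightarrow> 'a"
  where "chart_inv c = inv_into (fst c) (snd c)"

definition transition :: "('a, 'n::finite) chart \<Rightarrow> ('a, 'n) chart \<Rightarrow> real ^ 'n \<Rightarrow> real ^ 'n"
  where "transition c d = snd d \<circ> chart_inv c"

abbreviation d_transition ::
    "('a, 'n::finite) chart \<Rightarrow> ('a, 'n) chart \<Rightarrow> 'a \<Rightarrow> real ^ 'n \<Rightarrow> real ^ 'n"
  where "d_transition c d p \<equiv> frechet_derivative (transition c d) (at (snd c p))"

text \<open>The orientation is given by the atlas: all transition maps have positive Jacobian, and the
  charts of the atlas are the positively oriented ones. The atlas need not be maximal.\<close>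

definition oriented_smooth_manifold :: "('a, 'n::finite) rmanifold \<Rightarrow> bool"
  where "oriented_smooth_manifold M \<longleftrightarrow>
    Hausdorff_space (mtop M) \<and> second_countable (mtop M) \<and>
    topspace (mtop M) = (\<Union>c\<in>atlas M. fst c) \<and>
    (\<forall>c\<in>atlas M. openin (mtop M) (fst c) \<and> open (snd c ` fst c) \<and>
       homeomorphic_map (subtopology (mtop M) (fst c)) (top_of_set (snd c ` fst c)) (snd c)) \<and>
    (\<forall>c\<in>atlas M. \<forall>d\<in>atlas M.
       smooth_on (snd c ` (fst c \<inter> fst d)) (transition c d) \<and>
       (\<forall>p\<in>fst c \<inter> fst d. det (matrix (d_transition c d p)) > 0))"

definition tangent_space :: "('a, 'n::finite) rmanifold \<Rightarrow> 'a \<Rightarrow> ('a, 'n) tvec set"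
  where "tangent_space M p =
    {v. (\<forall>c\<in>charts_at M p. \<forall>d\<in>charts_at M p. v d = d_transition c d p (v c)) \<and>
        (\<forall>c. c \<notin> charts_at M p \<longrightarrow> v c = 0)}"

text \<open>The tangent vector at \<open>p\<close> with coordinates \<open>u\<close> in the chart \<open>c\<close>, that is,
  \<open>\<Sum>i. u\<^sub>i \<partial>\<^sub>i\<close>.\<close>

definition tvec_of :: "('a, 'n::finite) rmanifold \<Rightarrow> ('a, 'n) chart \<Rightarrow> 'a \<Rightarrow> real ^ 'n \<Rightarrow> ('a, 'n) tvec"
  where "tvec_of M c p u = (\<lambda>d. if d \<in> charts_at M p then d_transition c d p u else 0)"

text \<open>The matrix \<open>(g\<^sub>i\<^sub>j)\<close> as a function of the coordinates of the chart \<open>c\<close>.\<close>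

definition metric_coeff :: "('a, 'n::finite) rmanifold \<Rightarrow> ('a, 'n) chart \<Rightarrow> real ^ 'n \<Rightarrow> real ^ 'n ^ 'n"
  where "metric_coeff M c z =
    (let p = chart_inv c z
     in \<chi> i j. metric M p (tvec_of M c p (axis i 1)) (tvec_of M c p (axis j 1)))"

definition inner_product_on :: "'v::real_vector set \<Rightarrow> ('v \<Rightarrow> 'v \<Rightarrow> real) \<Rightarrow> bool"
  where "inner_product_on V g \<longleftrightarrow>
    (\<forall>u\<in>V. \<forall>v\<in>V. g u v = g v u) \<and>
    (\<forall>u\<in>V. \<forall>v\<in>V. \<forall>w\<in>V. g (u + v) w = g u w + g v w) \<and>
    (\<forall>r. \<forall>u\<in>V. \<forall>v\<in>V. g (r *\<^sub>R u) v = r * g u v) \<and>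
    (\<forall>u\<in>V. u \<noteq> 0 \<longrightarrow> g u u > 0)"

definition oriented_riemannian_manifold :: "('a, 'n::finite) rmanifold \<Rightarrow> bool"
  where "oriented_riemannian_manifold M \<longleftrightarrow>
    oriented_smooth_manifold M \<and>
    (\<forall>p\<in>topspace (mtop M). inner_product_on (tangent_space M p) (metric M p)) \<and>
    (\<forall>c\<in>atlas M. smooth_on (snd c ` fst c) (metric_coeff M c))"


section \<open>Curves, the Levi-Civita covariant derivative, and parallel fields\<close>

text \<open>Curves are functions on \<open>real\<close> of which only the restriction to \<open>[0, \<tau>]\<close> matters.
  Derivatives at the end points are one-sided.\<close>

definition ac_curve :: "('a, 'n::finite) rmanifold \<Rightarrow> real \<Rightarrow> (real \<Rightarrow> 'a) \<Rightarrow> bool"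
  where "ac_curve M \<tau> x \<longleftrightarrow>
    continuous_map (top_of_set {0..\<tau>}) (mtop M) x \<and>
    (\<forall>c\<in>atlas M. \<forall>a b. 0 \<le> a \<and> a \<le> b \<and> b \<le> \<tau> \<and> x ` {a..b} \<subseteq> fst c
       \<longrightarrow> abs_continuous a b (\<lambda>t. snd c (x t)))"

definition has_velocity ::
    "('a, 'n::finite) rmanifold \<Rightarrow> real \<Rightarrow> (real \<Rightarrow> 'a) \<Rightarrow> real \<Rightarrow> ('a, 'n) tvec \<Rightarrow> bool"
  where "has_velocity M \<tau> x t v \<longleftrightarrow>
    v \<in> tangent_space M (x t) \<and>
    (\<forall>c\<in>charts_at M (x t). ((\<lambda>s. snd c (x s)) has_vector_derivative v c) (at t within {0..\<tau>}))"

definition tangent_field ::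
    "('a, 'n::finite) rmanifold \<Rightarrow> real \<Rightarrow> (real \<Rightarrow> 'a) \<Rightarrow> (real \<Rightarrow> ('a, 'n) tvec) \<Rightarrow> bool"
  where "tangent_field M \<tau> x Z \<longleftrightarrow> (\<forall>t\<in>{0..\<tau>}. Z t \<in> tangent_space M (x t))"

definition ac_tangent_field ::
    "('a, 'n::finite) rmanifold \<Rightarrow> real \<Rightarrow> (real \<Rightarrow> 'a) \<Rightarrow> (real \<Rightarrow> ('a, 'n) tvec) \<Rightarrow> bool"
  where "ac_tangent_field M \<tau> x Z \<longleftrightarrow>
    tangent_field M \<tau> x Z \<and>
    (\<forall>c\<in>atlas M. \<forall>a b. 0 \<le> a \<and> a \<le> b \<and> b \<le> \<tau> \<and> x ` {a..b} \<subseteq> fst c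
       \<longrightarrow> abs_continuous a b (\<lambda>t. Z t c))"

definition partial_deriv :: "'n::finite \<Rightarrow> (real ^ 'n \<Rightarrow> real) \<Rightarrow> real ^ 'n \<Rightarrow> real"
  where "partial_deriv i f z = frechet_derivative f (at z) (axis i 1)"

text \<open>\<open>christoffel G z k i j\<close> is the Christoffel symbol \<open>\<Gamma>\<^sup>k\<^sub>i\<^sub>j\<close> of the Levi-Civita connection of
  the metric with coefficients \<open>G\<close>. The lemmas \<open>christoffel_torsion_free\<close> and \<open>christoffel_metric\<close> state that
  this connection is torsion-free and metric, which determines it.\<close>

definition christoffel :: "(real ^ 'n \<Rightarrow> real ^ 'n ^ 'n) \<Rightarrow> real ^ 'n \<Rightarrow> 'n \<Rightarrow> 'n \<Rightarrow> 'n::finite \<Rightarrow> real"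
  where "christoffel G z k i j =
    (\<Sum>l\<in>UNIV. matrix_inv (G z) $ k $ l *
       (partial_deriv i (\<lambda>y. G y $ j $ l) z + partial_deriv j (\<lambda>y. G y $ i $ l) z
        - partial_deriv l (\<lambda>y. G y $ i $ j) z)) / 2"

lemma partial_deriv_cong:
  assumes "open S" "z \<in> S" "\<And>y. y \<in> S \<Longrightarrow> f y = g y"
  shows "partial_deriv i f z = partial_deriv i g z"
proof -
  have "(f has_derivative D) (at z) \<longleftrightarrow> (g has_derivative D) (at z)" for D
    using assms has_derivative_transform_within_open[of f D z UNIV S g]
      has_derivative_transform_within_open[of g D z UNIV S f] by auto
  then show ?thesis
    by (simp add: partial_deriv_def frechet_derivative_def)
qed

lemma partial_deriv_sym:
  assumes "open S" "z \<in> S" "\<And>y. y \<in> S \<Longrightarrow> transpose (G y) = G y"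
  shows "partial_deriv i (\<lambda>y. G y $ j $ l) z = partial_deriv i (\<lambda>y. G y $ l $ j) z"
proof (rule partial_deriv_cong[OF assms(1,2)])
  fix y assume "y \<in> S"
  then have "transpose (G y) $ j $ l = G y $ j $ l"
    using assms(3) by simp
  then show "G y $ j $ l = G y $ l $ j"
    by (simp add: transpose_def)
qed

lemma christoffel_torsion_free:
  assumes "open S" "z \<in> S" "\<And>y. y \<in> S \<Longrightarrow> transpose (G y) = G y"
  shows "christoffel G z k i j = christoffel G z k j i"
proof -
  have "partial_deriv l (\<lambda>y. G y $ i $ j) z = partial_deriv l (\<lambda>y. G y $ j $ i) z" for l
    using assms by (rule partial_deriv_sym)
  then show ?thesis
    unfolding christoffel_def by (simp only: add.commute)
qed

lemma christoffel_metric: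
  fixes G :: "real ^ 'n \<Rightarrow> real ^ 'n ^ 'n::finite"
  assumes sym: "open S" "z \<in> S" "\<And>y. y \<in> S \<Longrightarrow> transpose (G y) = G y"
    and inv: "invertible (G z)"
  shows "partial_deriv k (\<lambda>y. G y $ i $ j) z =
    (\<Sum>l\<in>UNIV. christoffel G z l k i * G z $ l $ j + christoffel G z l k j * G z $ i $ l)"
proof -
  define B where "B a b m =
    partial_deriv a (\<lambda>y. G y $ b $ m) z + partial_deriv b (\<lambda>y. G y $ a $ m) z
      - partial_deriv m (\<lambda>y. G y $ a $ b) z" for a b m
  have Gsym: "G z $ a $ b = G z $ b $ a" for a b
  proof -
    have "transpose (G z) $ a $ b = G z $ a $ b" using sym by simp
    then show ?thesis by (simp add: transpose_def)
  qed
  have "G z ** matrix_inv (G z) = mat 1"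
    using inv unfolding invertible_def matrix_inv_def by (metis (mono_tags, lifting) someI_ex)
  then have delta: "(\<Sum>l\<in>UNIV. G z $ b $ l * matrix_inv (G z) $ l $ m) = (if b = m then 1 else 0)"
    for b m
    unfolding vec_eq_iff matrix_matrix_mult_def mat_def by simp
  have lower: "(\<Sum>l\<in>UNIV. G z $ b $ l * christoffel G z l a c) = B a c b / 2" for a b c
  proof -
    have "(\<Sum>l\<in>UNIV. G z $ b $ l * christoffel G z l a c)
        = (\<Sum>l\<in>UNIV. \<Sum>m\<in>UNIV. G z $ b $ l * matrix_inv (G z) $ l $ m * (B a c m / 2))"
      unfolding christoffel_def B_def
      by (simp add: sum_distrib_left sum_divide_distrib mult.assoc)
    also have "\<dots> = (\<Sum>m\<in>UNIV. (\<Sum>l\<in>UNIV. G z $ b $ l * matrix_inv (G z) $ l $ m) * (B a c m / 2))"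
      by (subst sum.swap) (simp only: sum_distrib_right)
    also have "\<dots> = (\<Sum>m\<in>UNIV. if b = m then B a c m / 2 else 0)"
      unfolding delta by (rule sum.cong) auto
    also have "\<dots> = B a c b / 2"
      by simp
    finally show ?thesis .
  qed
  have swap: "partial_deriv a (\<lambda>y. G y $ b $ c) z = partial_deriv a (\<lambda>y. G y $ c $ b) z" for a b c
    using sym by (rule partial_deriv_sym)
  have "(\<Sum>l\<in>UNIV. christoffel G z l k i * G z $ l $ j + christoffel G z l k j * G z $ i $ l)
      = (\<Sum>l\<in>UNIV. G z $ j $ l * christoffel G z l k i) + (\<Sum>l\<in>UNIV. G z $ i $ l * christoffel G z l k j)"
    by (simp add: sum.distrib Gsym[of _ j] mult.commute)
  also have "\<dots> = B k i j / 2 + B k j i / 2"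
    by (simp only: lower)
  also have "\<dots> = partial_deriv k (\<lambda>y. G y $ i $ j) z"
    unfolding B_def
    by (simp add: swap[of k j i] field_simps)
  finally show ?thesis by simp
qed

text \<open>\<open>D Z / dt = W\<close> at time \<open>t\<close>, in coordinates
  \<open>W\<^sup>k = (Z\<^sup>k)' + \<Gamma>\<^sup>k\<^sub>i\<^sub>j (x\<^sup>i)' Z\<^sup>j\<close>.\<close>

definition has_covariant_derivative ::
    "('a, 'n::finite) rmanifold \<Rightarrow> real \<Rightarrow> (real \<Rightarrow> 'a) \<Rightarrow> (real \<Rightarrow> ('a, 'n) tvec) \<Rightarrow> real
      \<Rightarrow> ('a, 'n) tvec \<Rightarrow> bool"
  where "has_covariant_derivative M \<tau> x Z t W \<longleftrightarrow>
    W \<in> tangent_space M (x t) \<and>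
    (\<forall>c\<in>charts_at M (x t). \<exists>x' Z'.
       ((\<lambda>s. snd c (x s)) has_vector_derivative x') (at t within {0..\<tau>}) \<and>
       ((\<lambda>s. Z s c) has_vector_derivative Z') (at t within {0..\<tau>}) \<and>
       (\<forall>k. W c $ k = Z' $ k +
          (\<Sum>i\<in>UNIV. \<Sum>j\<in>UNIV.
             christoffel (metric_coeff M c) (snd c (x t)) k i j * x' $ i * Z t c $ j)))"

definition parallel ::
    "('a, 'n::finite) rmanifold \<Rightarrow> real \<Rightarrow> (real \<Rightarrow> 'a) \<Rightarrow> (real \<Rightarrow> ('a, 'n) tvec) \<Rightarrow> bool"
  where "parallel M \<tau> x Z \<longleftrightarrow>
    ac_tangent_field M \<tau> x Z \<and>
    (AE t in lebesgue. t \<in> {0..\<tau>} \<longrightarrow> has_covariant_derivative M \<tau> x Z t 0)"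

text \<open>The space of parallel fields along \<open>x\<close> orthogonal to the velocity wherever it exists. Fields
  are normalised to be \<open>0\<close> outside \<open>[0, \<tau>]\<close>, so that they are determined by their values on
  \<open>[0, \<tau>]\<close>.\<close>

definition normal_parallel_fields ::
    "('a, 'n::finite) rmanifold \<Rightarrow> real \<Rightarrow> (real \<Rightarrow> 'a) \<Rightarrow> (real \<Rightarrow> ('a, 'n) tvec) set"
  where "normal_parallel_fields M \<tau> x =
    {Z. parallel M \<tau> x Z \<and> (\<forall>t. t \<notin> {0..\<tau>} \<longrightarrow> Z t = 0) \<and>
        (\<forall>t\<in>{0..\<tau>}. \<forall>v. has_velocity M \<tau> x t v \<longrightarrow> metric M (x t) (Z t) v = 0)}"


section \<open>The configuration space and intrinsic rollings\<close>

text \<open>Isometries are made extensional functions on the tangent space, so that equality of functions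
  is equality of isometries. Surjectivity is automatic for reasons of dimension.\<close>

definition isom_plus ::
    "('a, 'n::finite) rmanifold \<Rightarrow> ('b, 'n) rmanifold \<Rightarrow> 'a \<Rightarrow> 'b \<Rightarrow> (('a, 'n) tvec \<Rightarrow> ('b, 'n) tvec) set"
  where "isom_plus M N p r =
    {A \<in> tangent_space M p \<rightarrow>\<^sub>E tangent_space N r.
       (\<forall>u\<in>tangent_space M p. \<forall>v\<in>tangent_space M p. A (u + v) = A u + A v) \<and>
       (\<forall>a. \<forall>u\<in>tangent_space M p. A (a *\<^sub>R u) = a *\<^sub>R A u) \<and>
       (\<forall>u\<in>tangent_space M p. \<forall>v\<in>tangent_space M p. metric N r (A u) (A v) = metric M p u v) \<and>
       (\<forall>c\<in>charts_at M p. \<forall>d\<in>charts_at N r. det (matrix (\<lambda>u. A (tvec_of M c p u) d)) > 0)}"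

type_synonym ('a, 'b, 'n) config = "'a \<times> 'b \<times> (('a, 'n) tvec \<Rightarrow> ('b, 'n) tvec)"

definition config_space ::
    "('a, 'n::finite) rmanifold \<Rightarrow> ('b, 'n) rmanifold \<Rightarrow> ('a, 'b, 'n) config set"
  where "config_space M N =
    {(p, r, A). p \<in> topspace (mtop M) \<and> r \<in> topspace (mtop N) \<and> A \<in> isom_plus M N p r}"

abbreviation base1 :: "('a, 'b, 'n) config \<Rightarrow> 'a" where "base1 q \<equiv> fst q"
abbreviation base2 :: "('a, 'b, 'n) config \<Rightarrow> 'b" where "base2 q \<equiv> fst (snd q)"
abbreviation isom :: "('a, 'b, 'n) config \<Rightarrow> ('a, 'n) tvec \<Rightarrow> ('b, 'n) tvec"
  where "isom q \<equiv> snd (snd q)"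

text \<open>Absolute continuity in the configuration space, as a submanifold of the bundle of linear maps
  between tangent spaces: a point \<open>q\<close> of this bundle has as coordinates, in charts \<open>c\<close> and \<open>d\<close>, the
  coordinates of its base points and the matrix of \<open>q\<close> in the coordinate frames.\<close>

definition ac_config_curve ::
    "('a, 'n::finite) rmanifold \<Rightarrow> ('b, 'n) rmanifold \<Rightarrow> real \<Rightarrow> (real \<Rightarrow> ('a, 'b, 'n) config) \<Rightarrow> bool"
  where "ac_config_curve M N \<tau> q \<longleftrightarrow>
    (\<forall>t\<in>{0..\<tau>}. q t \<in> config_space M N) \<and>
    ac_curve M \<tau> (\<lambda>t. base1 (q t)) \<and> ac_curve N \<tau> (\<lambda>t. base2 (q t)) \<and>
    (\<forall>c\<in>atlas M. \<forall>d\<in>atlas N. \<forall>a b.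
       0 \<le> a \<and> a \<le> b \<and> b \<le> \<tau> \<and>
       (\<lambda>t. base1 (q t)) ` {a..b} \<subseteq> fst c \<and> (\<lambda>t. base2 (q t)) ` {a..b} \<subseteq> fst d
       \<longrightarrow> abs_continuous a b (\<lambda>t. matrix (\<lambda>u. isom (q t) (tvec_of M c (base1 (q t)) u) d)))"

definition intrinsic_rolling ::
    "('a, 'n::finite) rmanifold \<Rightarrow> ('b, 'n) rmanifold \<Rightarrow> real \<Rightarrow> (real \<Rightarrow> ('a, 'b, 'n) config) \<Rightarrow> bool"
  where "intrinsic_rolling M N \<tau> q \<longleftrightarrow>
    ac_config_curve M N \<tau> q \<and>
    (AE t in lebesgue. t \<in> {0..\<tau>} \<longrightarrow>
       (\<exists>v. has_velocity M \<tau> (\<lambda>s. base1 (q s)) t v \<and>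
            has_velocity N \<tau> (\<lambda>s. base2 (q s)) t (isom (q t) v))) \<and>
    (\<forall>Z. tangent_field M \<tau> (\<lambda>t. base1 (q t)) Z \<longrightarrow>
       (parallel M \<tau> (\<lambda>t. base1 (q t)) Z \<longleftrightarrow>
        parallel N \<tau> (\<lambda>t. base2 (q t)) (\<lambda>t. isom (q t) (Z t))))"

definition intrinsic_rolling_along ::
    "('a, 'n::finite) rmanifold \<Rightarrow> ('b, 'n) rmanifold \<Rightarrow> real \<Rightarrow> (real \<Rightarrow> 'a) \<Rightarrow> (real \<Rightarrow> 'b)
      \<Rightarrow> (real \<Rightarrow> ('a, 'b, 'n) config) \<Rightarrow> bool"
  where "intrinsic_rolling_along M N \<tau> x y q \<longleftrightarrow>
    intrinsic_rolling M N \<tau> q \<and> (\<forall>t\<in>{0..\<tau>}. base1 (q t) = x t \<and> base2 (q t) = y t)"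


section \<open>The right action and homomorphisms of special orthogonal groups\<close>

definition parallel_frame ::
    "('a, 'n::finite) rmanifold \<Rightarrow> real \<Rightarrow> (real \<Rightarrow> 'a) \<Rightarrow> ('n \<Rightarrow> real \<Rightarrow> ('a, 'n) tvec) \<Rightarrow> bool"
  where "parallel_frame M \<tau> x e \<longleftrightarrow>
    (\<forall>j. parallel M \<tau> x (e j)) \<and>
    (\<forall>t\<in>{0..\<tau>}. \<forall>i j. metric M (x t) (e i t) (e j t) = (if i = j then 1 else 0)) \<and>
    (\<forall>t\<in>{0..\<tau>}. \<forall>c\<in>charts_at M (x t). det (\<chi> i j. e j t c $ i) > 0)"

definition frame_matrix ::
    "('b, 'n::finite) rmanifold \<Rightarrow> ('n \<Rightarrow> real \<Rightarrow> ('a, 'n) tvec) \<Rightarrow> ('n \<Rightarrow> real \<Rightarrow> ('b, 'n) tvec)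
      \<Rightarrow> real \<Rightarrow> ('a, 'b, 'n) config \<Rightarrow> real ^ 'n ^ 'n"
  where "frame_matrix N e f t q = (\<chi> i j. metric N (base2 q) (f i t) (isom q (e j t)))"

text \<open>For \<open>q\<close> in the fibre over the base points of the frames \<open>e\<close> and \<open>f\<close> at time \<open>t\<close>, and
  \<open>A\<close> a rotation matrix, there is exactly one such element.\<close>

definition right_action ::
    "('a, 'n::finite) rmanifold \<Rightarrow> ('b, 'n) rmanifold
      \<Rightarrow> ('n \<Rightarrow> real \<Rightarrow> ('a, 'n) tvec) \<Rightarrow> ('n \<Rightarrow> real \<Rightarrow> ('b, 'n) tvec)
      \<Rightarrow> real \<Rightarrow> ('a, 'b, 'n) config \<Rightarrow> real ^ 'n ^ 'n \<Rightarrow> ('a, 'b, 'n) config"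
  where "right_action M N e f t q A =
    (THE q'. q' \<in> config_space M N \<and> base1 q' = base1 q \<and> base2 q' = base2 q \<and>
       frame_matrix N e f t q' = frame_matrix N e f t q ** A)"

definition SO :: "(real ^ 'm ^ 'm) set"
  where "SO = {A. rotation_matrix A}"

definition lie_group_hom_SO :: "(real ^ 'k ^ 'k \<Rightarrow> real ^ 'n ^ 'n) \<Rightarrow> bool"
  where "lie_group_hom_SO \<zeta> \<longleftrightarrow>
    \<zeta> \<in> SO \<rightarrow> SO \<and> smooth_on_subset SO \<zeta> \<and> (\<forall>A\<in>SO. \<forall>B\<in>SO. \<zeta> (A ** B) = \<zeta> A ** \<zeta> B)"

end

theory Submission
  imports Defs
begin

text \<open>In charts, parallel transport along an absolutely continuous curve is a linear differential
  equation with integrable coefficients. Hence parallel orthonormal frames exist, and a family of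
  isometries maps parallel fields to parallel fields if and only if its matrix in such frames is
  constant. Any rolling over the given pair of curves therefore differs from \<open>q0\<close> by a constant
  rotation \<open>R\<close>, and the no-slip condition says that \<open>R\<close> fixes the frame coordinates of the velocity
  of \<open>x\<close> at almost every time. If \<open>S\<close> is the orthogonal complement of the span of these velocity
  coordinates, the admissible \<open>R\<close> are the rotations that fix \<open>S\<^sup>\<bottom>\<close> pointwise, i.e. a conjugate of a
  diagonal block \<open>SO(dim S)\<close>; this group is trivial if and only if \<open>dim S \<le> 1\<close>. Finally \<open>q0\<close> carries
  \<open>S\<close> to the parallel fields along \<open>y\<close> that are orthogonal to its velocity, so \<open>dim S = k\<close>.

  The definition of \<open>k\<close> asks for orthogonality at every time at which the velocity exists, whereas
  \<open>R\<close> is constrained only at almost every time. The two agree because the differential equation of a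
  parallel field holds at every time at which the underlying curve is differentiable.\<close>

section \<open>Absolutely continuous functions\<close>

text \<open>Low regularity is the obstacle: the coordinates of the curves have derivatives that are
  merely integrable and exist only almost everywhere. That they exist there at all is taken from the
  no-slip condition of \<open>q0\<close>, not deduced from absolute continuity. The fundamental
  theorem of calculus turns the equation of a parallel field into an integral equation, which a
  contraction solves on every interval with a small coefficient integral; pasting gives transport
  over \<open>{0..\<tau>}\<close>. To return from the integral equation to a derivative at one given
  time, no Lebesgue point is available. Instead the coefficients are differentiable functions of the
  coordinates, so they vary by O(h) wherever the coordinates are differentiable, and this suffices.
  A field is parallel if the equation holds in all charts around almost every point, whereas the
  equation is solved in one; the gap is closed by the transformation law of the Christoffel symbols,
  derived from the Koszul formula and the symmetry of second derivatives.\<close>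

definition nonoverlapping :: "real \<Rightarrow> real \<Rightarrow> 'i set \<Rightarrow> ('i \<Rightarrow> real) \<Rightarrow> ('i \<Rightarrow> real) \<Rightarrow> bool"
  where "nonoverlapping a b I l r \<longleftrightarrow> finite I \<and> (\<forall>i\<in>I. a \<le> l i \<and> l i \<le> r i \<and> r i \<le> b) \<and>
    (\<forall>i\<in>I. \<forall>j\<in>I. i \<noteq> j \<longrightarrow> {l i<..<r i} \<inter> {l j<..<r j} = {})"

text \<open>Indexed families are needed because clipped intervals and the cells of a division may
  coincide when they are degenerate. Two indices with the same pair of end points force the interval
  to be a point, for otherwise its midpoint would lie in two disjoint open intervals. Such terms are
  0 in both sums, so the family can be replaced by the set of its pairs.\<close>

lemma abs_continuous_familyD:
  fixes f :: "real \<Rightarrow> 'b::real_normed_vector"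
  assumes "abs_continuous a b f" "\<epsilon> > 0"
  shows "\<exists>\<delta>>0. \<forall>(I::'i set) l r. nonoverlapping a b I l r \<and> (\<Sum>i\<in>I. r i - l i) < \<delta> \<longrightarrow>
    (\<Sum>i\<in>I. norm (f (r i) - f (l i))) < \<epsilon>"
proof -
  obtain \<delta> where "\<delta> > 0" and \<delta>: "\<And>D. finite D \<Longrightarrow> (\<forall>(s, t)\<in>D. a \<le> s \<and> s \<le> t \<and> t \<le> b) \<Longrightarrow>
       pairwise (\<lambda>(s, t) (s', t'). {s<..<t} \<inter> {s'<..<t'} = {}) D \<Longrightarrow>
       (\<Sum>(s, t)\<in>D. t - s) < \<delta> \<Longrightarrow> (\<Sum>(s, t)\<in>D. norm (f t - f s)) < \<epsilon>"
    using assms unfolding abs_continuous_def by meson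
  have "(\<Sum>i\<in>I. norm (f (r i) - f (l i))) < \<epsilon>"
    if I: "finite I" "\<And>i. i \<in> I \<Longrightarrow> a \<le> l i \<and> l i \<le> r i \<and> r i \<le> b"
      "\<And>i j. i \<in> I \<Longrightarrow> j \<in> I \<Longrightarrow> i \<noteq> j \<Longrightarrow> {l i<..<r i} \<inter> {l j<..<r j} = {}" "(\<Sum>i\<in>I. r i - l i) < \<delta>"
    for I :: "'i set" and l r
  proof -
    let ?p = "\<lambda>i. (l i, r i)"
    have degenerate: "l i = r i" if "i \<in> I" "j \<in> I" "i \<noteq> j" "?p i = ?p j" for i j
    proof (rule ccontr)
      assume "l i \<noteq> r i"
      then have "(l i + r i) / 2 \<in> {l i<..<r i} \<inter> {l j<..<r j}"
        using I(2)[OF \<open>i \<in> I\<close>] that by auto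
      then show False using I(3) that by blast
    qed
    have "(\<Sum>(s, t)\<in>?p ` I. t - s) = (\<Sum>i\<in>I. r i - l i)"
    proof (subst sum.reindex_nontrivial[OF I(1)])
      show "(case ?p i of (s, t) \<Rightarrow> t - s) = 0" if "i \<in> I" "j \<in> I" "i \<noteq> j" "?p i = ?p j" for i j
        using degenerate[OF that] by simp
    qed (simp add: o_def)
    moreover have "(\<Sum>(s, t)\<in>?p ` I. norm (f t - f s)) = (\<Sum>i\<in>I. norm (f (r i) - f (l i)))"
    proof (subst sum.reindex_nontrivial[OF I(1)])
      show "(case ?p i of (s, t) \<Rightarrow> norm (f t - f s)) = 0" if "i \<in> I" "j \<in> I" "i \<noteq> j" "?p i = ?p j" for i j
        using degenerate[OF that] by simp
    qed (simp add: o_def)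
    moreover have "pairwise (\<lambda>(s, t) (s', t'). {s<..<t} \<inter> {s'<..<t'} = {}) (?p ` I)"
      unfolding pairwise_def using I(3) by fastforce
    ultimately show ?thesis
      using \<delta>[of "?p ` I"] I by auto
  qed
  then show ?thesis unfolding nonoverlapping_def by (intro exI[of _ \<delta>] conjI \<open>\<delta> > 0\<close>) simp
qed

lemma abs_continuous_subset:
  assumes "abs_continuous a b f" "a \<le> a'" "b' \<le> b"
  shows "abs_continuous a' b' f"
  unfolding abs_continuous_def
proof (intro allI impI)
  fix \<epsilon> :: real assume "\<epsilon> > 0"
  then obtain \<delta> where \<delta>: "\<delta> > 0" "\<And>D. finite D \<and> (\<forall>(s, t)\<in>D. a \<le> s \<and> s \<le> t \<and> t \<le> b) \<and>
       pairwise (\<lambda>(s, t) (s', t'). {s<..<t} \<inter> {s'<..<t'} = {}) D \<and>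
       (\<Sum>(s, t)\<in>D. t - s) < \<delta> \<Longrightarrow> (\<Sum>(s, t)\<in>D. norm (f t - f s)) < \<epsilon>"
    using assms(1) unfolding abs_continuous_def by meson
  show "\<exists>\<delta>>0. \<forall>D. finite D \<and> (\<forall>(s, t)\<in>D. a' \<le> s \<and> s \<le> t \<and> t \<le> b') \<and>
       pairwise (\<lambda>(s, t) (s', t'). {s<..<t} \<inter> {s'<..<t'} = {}) D \<and>
       (\<Sum>(s, t)\<in>D. t - s) < \<delta> \<longrightarrow> (\<Sum>(s, t)\<in>D. norm (f t - f s)) < \<epsilon>"
  proof (intro exI[of _ \<delta>] conjI allI impI \<delta>(1))
    fix D :: "(real \<times> real) set"
    assume D: "finite D \<and> (\<forall>(s, t)\<in>D. a' \<le> s \<and> s \<le> t \<and> t \<le> b') \<and>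
       pairwise (\<lambda>(s, t) (s', t'). {s<..<t} \<inter> {s'<..<t'} = {}) D \<and> (\<Sum>(s, t)\<in>D. t - s) < \<delta>"
    then have "\<forall>(s, t)\<in>D. a \<le> s \<and> s \<le> t \<and> t \<le> b"
      using assms(2,3) by fastforce
    with D show "(\<Sum>(s, t)\<in>D. norm (f t - f s)) < \<epsilon>"
      by (intro \<delta>(2)) simp
  qed
qed

lemma abs_continuous_imp_continuous_on:
  fixes f :: "real \<Rightarrow> 'b::real_normed_vector"
  assumes "abs_continuous a b f"
  shows "continuous_on {a..b} f"
  unfolding continuous_on_iff
proof (intro ballI allI impI)
  fix u \<epsilon> :: real assume "u \<in> {a..b}" "\<epsilon> > 0"
  obtain \<delta> where \<delta>: "\<delta> > 0" "\<And>(I::unit set) l r. nonoverlapping a b I l r \<Longrightarrow>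
      (\<Sum>i\<in>I. r i - l i) < \<delta> \<Longrightarrow> (\<Sum>i\<in>I. norm (f (r i) - f (l i))) < \<epsilon>"
    using abs_continuous_familyD[OF assms \<open>\<epsilon> > 0\<close>, where ?'i = "unit"] by blast
  have "dist (f v) (f u) < \<epsilon>" if "v \<in> {a..b}" "dist v u < \<delta>" for v
  proof (cases "u \<le> v")
    case True
    then show ?thesis
      using \<delta>(2)[of UNIV "\<lambda>_. u" "\<lambda>_. v"] that \<open>u \<in> {a..b}\<close>
      by (simp add: nonoverlapping_def dist_norm)
  next
    case False
    then show ?thesis
      using \<delta>(2)[of UNIV "\<lambda>_. v" "\<lambda>_. u"] that \<open>u \<in> {a..b}\<close>
      by (simp add: nonoverlapping_def dist_norm norm_minus_commute)
  qed
  then show "\<exists>d>0. \<forall>v\<in>{a..b}. dist v u < d \<longrightarrow> dist (f v) (f u) < \<epsilon>"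
    using \<delta>(1) by blast
qed

text \<open>The source of all closure properties below: domination of increments transfers absolute
  continuity, and two dominating functions are what sums and products need.\<close>

lemma abs_continuous_dominated2:
  fixes f :: "real \<Rightarrow> 'b::real_normed_vector" and g :: "real \<Rightarrow> 'c::real_normed_vector"
    and h :: "real \<Rightarrow> 'd::real_normed_vector"
  assumes g: "abs_continuous a b g" and h: "abs_continuous a b h"
    and le: "\<And>s t. a \<le> s \<Longrightarrow> s \<le> t \<Longrightarrow> t \<le> b \<Longrightarrow>
      norm (f t - f s) \<le> C * (norm (g t - g s) + norm (h t - h s))"
  shows "abs_continuous a b f"
  unfolding abs_continuous_def
proof (intro allI impI)
  fix \<epsilon> :: real assume "\<epsilon> > 0"
  \<comment> \<open>\<open>C\<close> may have either sign, so it is replaced by the positive factor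
    \<open>\<bar>C\<bar> + 1\<close>; the two dominating sums then contribute at most half of
    \<open>\<epsilon>\<close> each.\<close>
  define e where "e = \<epsilon> / (\<bar>C\<bar> + 1) / 2"
  have "e > 0" using \<open>\<epsilon> > 0\<close> by (simp add: e_def add_nonneg_pos)
  obtain \<delta>1 where \<delta>1: "\<delta>1 > 0" "\<And>D. finite D \<and> (\<forall>(s, t)\<in>D. a \<le> s \<and> s \<le> t \<and> t \<le> b) \<and>
       pairwise (\<lambda>(s, t) (s', t'). {s<..<t} \<inter> {s'<..<t'} = {}) D \<and>
       (\<Sum>(s, t)\<in>D. t - s) < \<delta>1 \<Longrightarrow> (\<Sum>(s, t)\<in>D. norm (g t - g s)) < e"
    using g \<open>e > 0\<close> unfolding abs_continuous_def by meson
  obtain \<delta>2 where \<delta>2: "\<delta>2 > 0" "\<And>D. finite D \<and> (\<forall>(s, t)\<in>D. a \<le> s \<and> s \<le> t \<and> t \<le> b) \<and>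
       pairwise (\<lambda>(s, t) (s', t'). {s<..<t} \<inter> {s'<..<t'} = {}) D \<and>
       (\<Sum>(s, t)\<in>D. t - s) < \<delta>2 \<Longrightarrow> (\<Sum>(s, t)\<in>D. norm (h t - h s)) < e"
    using h \<open>e > 0\<close> unfolding abs_continuous_def by meson
  have "(\<Sum>(s, t)\<in>D. norm (f t - f s)) < \<epsilon>"
    if D: "finite D \<and> (\<forall>(s, t)\<in>D. a \<le> s \<and> s \<le> t \<and> t \<le> b) \<and>
       pairwise (\<lambda>(s, t) (s', t'). {s<..<t} \<inter> {s'<..<t'} = {}) D \<and>
       (\<Sum>(s, t)\<in>D. t - s) < min \<delta>1 \<delta>2" for D
  proof -
    have "(\<Sum>(s, t)\<in>D. norm (f t - f s))
        \<le> (\<Sum>(s, t)\<in>D. (\<bar>C\<bar> + 1) * (norm (g t - g s) + norm (h t - h s)))"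
    proof (rule sum_mono, clarify)
      fix s t assume "(s, t) \<in> D"
      then have "norm (f t - f s) \<le> C * (norm (g t - g s) + norm (h t - h s))"
        using D le by auto
      also have "\<dots> \<le> (\<bar>C\<bar> + 1) * (norm (g t - g s) + norm (h t - h s))"
        by (intro mult_right_mono) auto
      finally show "norm (f t - f s) \<le> (\<bar>C\<bar> + 1) * (norm (g t - g s) + norm (h t - h s))" .
    qed
    also have "\<dots> = (\<bar>C\<bar> + 1) * ((\<Sum>(s, t)\<in>D. norm (g t - g s)) + (\<Sum>(s, t)\<in>D. norm (h t - h s)))"
      by (simp add: sum.distrib sum_distrib_left case_prod_unfold distrib_left)
    also have "\<dots> < (\<bar>C\<bar> + 1) * (e + e)"
      using \<delta>1(2)[of D] \<delta>2(2)[of D] D by (intro mult_strict_left_mono add_strict_mono) auto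
    also have "\<dots> = \<epsilon>"
    proof -
      have "\<bar>C\<bar> + 1 \<noteq> 0" by linarith
      then show ?thesis unfolding e_def by (metis field_sum_of_halves nonzero_mult_div_cancel_left times_divide_eq_right)
    qed
    finally show ?thesis .
  qed
  then show "\<exists>\<delta>>0. \<forall>D. finite D \<and> (\<forall>(s, t)\<in>D. a \<le> s \<and> s \<le> t \<and> t \<le> b) \<and>
       pairwise (\<lambda>(s, t) (s', t'). {s<..<t} \<inter> {s'<..<t'} = {}) D \<and>
       (\<Sum>(s, t)\<in>D. t - s) < \<delta> \<longrightarrow> (\<Sum>(s, t)\<in>D. norm (f t - f s)) < \<epsilon>"
    using \<delta>1(1) \<delta>2(1) by (intro exI[of _ "min \<delta>1 \<delta>2"]) simp
qed

lemma abs_continuous_dominated: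
  fixes f :: "real \<Rightarrow> 'b::real_normed_vector" and g :: "real \<Rightarrow> 'c::real_normed_vector"
  assumes "abs_continuous a b g"
    and "\<And>s t. a \<le> s \<Longrightarrow> s \<le> t \<Longrightarrow> t \<le> b \<Longrightarrow> norm (f t - f s) \<le> C * norm (g t - g s)"
  shows "abs_continuous a b f"
proof (rule abs_continuous_dominated2[OF assms(1) assms(1), where C = "C / 2"])
  fix s t assume "a \<le> s" "s \<le> t" "t \<le> b"
  from assms(2)[OF this] show "norm (f t - f s) \<le> C / 2 * (norm (g t - g s) + norm (g t - g s))"
    by simp
qed

lemma abs_continuous_const: "abs_continuous a b (\<lambda>t. c)"
  unfolding abs_continuous_def by (auto intro: exI[of _ 1])

lemma abs_continuous_bounded_linear:
  assumes "bounded_linear h" "abs_continuous a b f"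
  shows "abs_continuous a b (\<lambda>t. h (f t))"
proof -
  interpret bounded_linear h by fact
  obtain K where "\<And>x. norm (h x) \<le> norm x * K" using bounded by blast
  then show ?thesis
    by (intro abs_continuous_dominated[OF assms(2), of _ K]) (metis diff mult.commute)
qed

lemma abs_continuous_cong:
  assumes "\<And>t. a \<le> t \<Longrightarrow> t \<le> b \<Longrightarrow> f t = g t"
  shows "abs_continuous a b f \<longleftrightarrow> abs_continuous a b g"
proof -
  have "abs_continuous a b g" if "abs_continuous a b f" "\<And>t. a \<le> t \<Longrightarrow> t \<le> b \<Longrightarrow> f t = g t" for f g
    by (rule abs_continuous_dominated[OF that(1), where C = 1]) (auto simp: that(2))
  then show ?thesis using assms by metis
qed

lemma abs_continuous_add:
  assumes "abs_continuous a b f" "abs_continuous a b g"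
  shows "abs_continuous a b (\<lambda>t. f t + g t)"
proof (rule abs_continuous_dominated2[OF assms, where C = 1])
  fix s t
  have "f t + g t - (f s + g s) = (f t - f s) + (g t - g s)" by simp
  then show "norm (f t + g t - (f s + g s)) \<le> 1 * (norm (f t - f s) + norm (g t - g s))"
    using norm_triangle_ineq by (metis mult_1)
qed

lemma abs_continuous_sum:
  "(\<And>i. i \<in> I \<Longrightarrow> abs_continuous a b (f i)) \<Longrightarrow> abs_continuous a b (\<lambda>t. \<Sum>i\<in>I. f i t)"
  by (induction I rule: infinite_finite_induct) (auto intro: abs_continuous_const abs_continuous_add)

lemma abs_continuous_bounded_bilinear:
  fixes f :: "real \<Rightarrow> 'b::real_normed_vector" and g :: "real \<Rightarrow> 'c::real_normed_vector"
  assumes "bounded_bilinear h" and f: "abs_continuous a b f" and g: "abs_continuous a b g"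
  shows "abs_continuous a b (\<lambda>t. h (f t) (g t))"
proof -
  interpret bounded_bilinear h by fact
  obtain K where K: "K > 0" "\<And>x y. norm (h x y) \<le> norm x * norm y * K" using pos_bounded by blast
  obtain F where F: "F > 0" "\<And>t. t \<in> {a..b} \<Longrightarrow> norm (f t) \<le> F"
    using compact_imp_bounded[OF compact_continuous_image[OF abs_continuous_imp_continuous_on[OF f] compact_Icc]]
    unfolding bounded_pos by auto
  obtain G where G: "G > 0" "\<And>t. t \<in> {a..b} \<Longrightarrow> norm (g t) \<le> G"
    using compact_imp_bounded[OF compact_continuous_image[OF abs_continuous_imp_continuous_on[OF g] compact_Icc]]
    unfolding bounded_pos by auto
  show ?thesis
  proof (rule abs_continuous_dominated2[OF f g, where C = "(F + G) * K"])
    fix s t assume st: "a \<le> s" "s \<le> t" "t \<le> b"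
    have "h (f t) (g t) - h (f s) (g s) = h (f t - f s) (g t) + h (f s) (g t - g s)"
      by (simp add: diff_left diff_right)
    then have "norm (h (f t) (g t) - h (f s) (g s))
        \<le> norm (f t - f s) * norm (g t) * K + norm (f s) * norm (g t - g s) * K"
      using K(2) by (metis add_mono norm_triangle_le)
    also have "\<dots> \<le> norm (f t - f s) * G * K + F * norm (g t - g s) * K"
      using F G K st by (intro add_mono mult_right_mono mult_left_mono) auto
    also have "\<dots> \<le> (F + G) * K * (norm (f t - f s) + norm (g t - g s))"
      using F(1) G(1) K(1) by (simp add: algebra_simps)
    finally show "norm (h (f t) (g t) - h (f s) (g s))
        \<le> (F + G) * K * (norm (f t - f s) + norm (g t - g s))" .
  qed
qed

lemmas abs_continuous_mult = abs_continuous_bounded_bilinear[OF bounded_bilinear_mult]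
lemmas abs_continuous_scaleR = abs_continuous_bounded_bilinear[OF bounded_bilinear_scaleR]
lemmas abs_continuous_vec_nth = abs_continuous_bounded_linear[OF bounded_linear_vec_nth]

lemma abs_continuous_vec:
  fixes f :: "real \<Rightarrow> 'b::real_normed_vector ^ 'n::finite"
  assumes "\<And>i. abs_continuous a b (\<lambda>t. f t $ i)"
  shows "abs_continuous a b f"
proof -
  have bl: "bounded_linear (axis i :: 'b \<Rightarrow> 'b ^ 'n)" for i
  proof (rule bounded_linear_intro[where K = 1])
    fix x :: 'b
    show "norm (axis i x :: 'b ^ 'n) \<le> norm x * 1"
      by (simp add: norm_vec_def L2_set_def axis_def if_distrib[of norm] if_distrib[of "\<lambda>x. x\<^sup>2"] cong: if_cong)
  qed (auto simp: axis_def vec_eq_iff)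
  have "abs_continuous a b (\<lambda>t. \<Sum>i\<in>UNIV. axis i (f t $ i))"
    by (intro abs_continuous_sum abs_continuous_bounded_linear[OF bl] assms)
  moreover have "(\<Sum>i\<in>UNIV. axis i (v $ i)) = v" for v :: "'b ^ 'n"
    by (simp add: vec_eq_iff axis_def if_distrib if_distribR cong: if_cong)
  ultimately show ?thesis by simp
qed

text \<open>Every interval is clipped at \<open>b\<close> by \<open>min\<close> and by
  \<open>max\<close>. The increment of \<open>f\<close> is the sum of the two clipped increments,
  and each clipped family is nonoverlapping on its side of \<open>b\<close> with no larger total
  length.\<close>

lemma abs_continuous_combine:
  fixes f :: "real \<Rightarrow> 'b::real_normed_vector"
  assumes f1: "abs_continuous a b f" and f2: "abs_continuous b c f" and "a \<le> b" "b \<le> c"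
  shows "abs_continuous a c f"
  unfolding abs_continuous_def
proof (intro allI impI)
  fix \<epsilon> :: real assume "\<epsilon> > 0"
  then have e: "\<epsilon> / 2 > 0" by simp
  obtain \<delta>1 where \<delta>1: "\<delta>1 > 0" "\<And>(I::(real \<times> real) set) l r. nonoverlapping a b I l r \<Longrightarrow>
      (\<Sum>i\<in>I. r i - l i) < \<delta>1 \<Longrightarrow> (\<Sum>i\<in>I. norm (f (r i) - f (l i))) < \<epsilon> / 2"
    using abs_continuous_familyD[OF f1 e, where ?'i = "(real \<times> real)"] by blast
  obtain \<delta>2 where \<delta>2: "\<delta>2 > 0" "\<And>(I::(real \<times> real) set) l r. nonoverlapping b c I l r \<Longrightarrow>
      (\<Sum>i\<in>I. r i - l i) < \<delta>2 \<Longrightarrow> (\<Sum>i\<in>I. norm (f (r i) - f (l i))) < \<epsilon> / 2"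
    using abs_continuous_familyD[OF f2 e, where ?'i = "(real \<times> real)"] by blast
  have *: "(\<Sum>(s, t)\<in>D. norm (f t - f s)) < \<epsilon>"
    if D: "finite D" "\<And>s t. (s, t) \<in> D \<Longrightarrow> a \<le> s \<and> s \<le> t \<and> t \<le> c"
       "pairwise (\<lambda>(s, t) (s', t'). {s<..<t} \<inter> {s'<..<t'} = {}) D"
       "(\<Sum>(s, t)\<in>D. t - s) < min \<delta>1 \<delta>2" for D
  proof -
    have disj: "{s<..<t} \<inter> {s'<..<t'} = {}" if "(s, t) \<in> D" "(s', t') \<in> D" "(s, t) \<noteq> (s', t')" for s t s' t'
      using pairwiseD[OF D(3) that] by simp
    have ord: "a \<le> fst i" "fst i \<le> snd i" "snd i \<le> c" if "i \<in> D" for i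
      using D(2)[of "fst i" "snd i"] that by simp_all
    have len: "(\<Sum>i\<in>D. min (snd i) b - min (fst i) b) \<le> (\<Sum>i\<in>D. snd i - fst i)"
      "(\<Sum>i\<in>D. max (snd i) b - max (fst i) b) \<le> (\<Sum>i\<in>D. snd i - fst i)"
      by (rule sum_mono, drule ord(2), linarith)+
    have total: "(\<Sum>i\<in>D. snd i - fst i) < min \<delta>1 \<delta>2"
      using D(4) by (simp add: case_prod_unfold)
    have "(\<Sum>i\<in>D. norm (f (min (snd i) b) - f (min (fst i) b))) < \<epsilon> / 2"
    proof (rule \<delta>1(2), unfold nonoverlapping_def, intro conjI[OF D(1)] conjI[of "Ball _ _"] ballI impI)
      fix i j assume ij: "i \<in> D" "j \<in> D" "i \<noteq> j"
      have "{min (fst i) b<..<min (snd i) b} \<subseteq> {fst i<..<snd i}" for i :: "real \<times> real"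
        by (auto simp: min_def split: if_splits)
      moreover have "{fst i<..<snd i} \<inter> {fst j<..<snd j} = {}"
        using disj[of "fst i" "snd i" "fst j" "snd j"] ij by simp
      ultimately show "{min (fst i) b<..<min (snd i) b} \<inter> {min (fst j) b<..<min (snd j) b} = {}"
        by blast
    next
      fix i assume "i \<in> D"
      from ord[OF this] show "a \<le> min (fst i) b \<and> min (fst i) b \<le> min (snd i) b \<and> min (snd i) b \<le> b"
        using \<open>a \<le> b\<close> \<open>b \<le> c\<close> by auto
    qed (use total len in linarith)
    moreover have "(\<Sum>i\<in>D. norm (f (max (snd i) b) - f (max (fst i) b))) < \<epsilon> / 2"
    proof (rule \<delta>2(2), unfold nonoverlapping_def, intro conjI[OF D(1)] conjI[of "Ball _ _"] ballI impI)
      fix i j assume ij: "i \<in> D" "j \<in> D" "i \<noteq> j"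
      have "{max (fst i) b<..<max (snd i) b} \<subseteq> {fst i<..<snd i}" for i :: "real \<times> real"
        by (auto simp: max_def split: if_splits)
      moreover have "{fst i<..<snd i} \<inter> {fst j<..<snd j} = {}"
        using disj[of "fst i" "snd i" "fst j" "snd j"] ij by simp
      ultimately show "{max (fst i) b<..<max (snd i) b} \<inter> {max (fst j) b<..<max (snd j) b} = {}"
        by blast
    next
      fix i assume "i \<in> D"
      from ord[OF this] show "b \<le> max (fst i) b \<and> max (fst i) b \<le> max (snd i) b \<and> max (snd i) b \<le> c"
        using \<open>a \<le> b\<close> \<open>b \<le> c\<close> by auto
    qed (use total len in linarith)
    moreover have "(\<Sum>(s, t)\<in>D. norm (f t - f s)) \<le>
       (\<Sum>i\<in>D. norm (f (min (snd i) b) - f (min (fst i) b))) + (\<Sum>i\<in>D. norm (f (max (snd i) b) - f (max (fst i) b)))"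
      unfolding sum.distrib[symmetric]
    proof (rule sum_mono, clarify)
      fix s t assume "(s, t) \<in> D"
      have "f t - f s = (f (min t b) - f (min s b)) + (f (max t b) - f (max s b))"
        by (auto simp: min_def max_def)
      then show "norm (f t - f s) \<le> norm (f (min (snd (s, t)) b) - f (min (fst (s, t)) b))
          + norm (f (max (snd (s, t)) b) - f (max (fst (s, t)) b))"
        by (metis fst_conv snd_conv norm_triangle_ineq)
    qed
    ultimately show ?thesis by linarith
  qed
  then show "\<exists>\<delta>>0. \<forall>D. finite D \<and> (\<forall>(s, t)\<in>D. a \<le> s \<and> s \<le> t \<and> t \<le> c) \<and>
       pairwise (\<lambda>(s, t) (s', t'). {s<..<t} \<inter> {s'<..<t'} = {}) D \<and>
       (\<Sum>(s, t)\<in>D. t - s) < \<delta> \<longrightarrow> (\<Sum>(s, t)\<in>D. norm (f t - f s)) < \<epsilon>"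
  proof (intro exI[of _ "min \<delta>1 \<delta>2"] conjI allI impI)
    fix D :: "(real \<times> real) set"
    assume D: "finite D \<and> (\<forall>(s, t)\<in>D. a \<le> s \<and> s \<le> t \<and> t \<le> c) \<and>
       pairwise (\<lambda>(s, t) (s', t'). {s<..<t} \<inter> {s'<..<t'} = {}) D \<and> (\<Sum>(s, t)\<in>D. t - s) < min \<delta>1 \<delta>2"
    then have "a \<le> s \<and> s \<le> t \<and> t \<le> c" if "(s, t) \<in> D" for s t
      using that by blast
    with D show "(\<Sum>(s, t)\<in>D. norm (f t - f s)) < \<epsilon>"
      using * by blast
  qed (use \<delta>1(1) \<delta>2(1) in simp)
qed

text \<open>A property of intervals that is inherited by concatenation and holds on all short
  intervals around each point holds globally, by bisection. The same use of \<open>Bolzano\<close>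
  later yields global parallel transport and the constancy of inner products.\<close>

lemma abs_continuous_local:
  fixes f :: "real \<Rightarrow> 'b::real_normed_vector"
  assumes "a \<le> b" and loc: "\<And>t. a \<le> t \<Longrightarrow> t \<le> b \<Longrightarrow>
      \<exists>d>0. \<forall>u v. a \<le> u \<and> u \<le> t \<and> t \<le> v \<and> v \<le> b \<and> v - u < d \<longrightarrow> abs_continuous u v f"
  shows "abs_continuous a b f"
proof -
  let ?P = "\<lambda>u v. a \<le> u \<and> v \<le> b \<longrightarrow> abs_continuous u v f"
  have "?P a b"
  proof (rule Bolzano[where P = ?P, OF \<open>a \<le> b\<close>])
    fix u v w assume *: "?P u v" "?P v w" "u \<le> v" "v \<le> w"
    show "?P u w"
    proof
      assume "a \<le> u \<and> w \<le> b"
      with * show "abs_continuous u w f"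
        by (intro abs_continuous_combine[of u v f w]) simp_all
    qed
  next
    fix t assume "a \<le> t" "t \<le> b"
    from loc[OF this] obtain d where "d > 0" and d: "\<forall>u v. a \<le> u \<and> u \<le> t \<and> t \<le> v \<and> v \<le> b \<and> v - u < d \<longrightarrow>
        abs_continuous u v f"
      by (elim exE conjE)
    show "\<exists>d>0. \<forall>u v. u \<le> t \<and> t \<le> v \<and> v - u < d \<longrightarrow> ?P u v"
      by (intro exI[of _ d] conjI allI impI \<open>d > 0\<close> d[rule_format]) simp_all
  qed
  then show ?thesis by simp
qed

definition locally_lipschitz_on :: "'a::real_normed_vector set \<Rightarrow> ('a \<Rightarrow> 'b::real_normed_vector) \<Rightarrow> bool"
  where "locally_lipschitz_on S \<phi> \<longleftrightarrow>
    (\<forall>z\<in>S. \<exists>e>0. \<exists>L. \<forall>u\<in>ball z e. \<forall>v\<in>ball z e. norm (\<phi> u - \<phi> v) \<le> L * norm (u - v))"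

text \<open>Near each time \<open>f\<close> stays in a ball on which \<phi> has one Lipschitz
  constant, so increments of the composition are dominated by those of \<open>f\<close>. It is
  applied to metric coefficients and to derivatives of transition maps along a curve.\<close>

lemma abs_continuous_compose:
  fixes f :: "real \<Rightarrow> 'b::real_normed_vector"
  assumes "a \<le> b" and f: "abs_continuous a b f" and \<phi>: "locally_lipschitz_on S \<phi>" and S: "f ` {a..b} \<subseteq> S"
  shows "abs_continuous a b (\<lambda>t. \<phi> (f t))"
proof (rule abs_continuous_local[OF \<open>a \<le> b\<close>])
  fix t assume t: "a \<le> t" "t \<le> b"
  then have "f t \<in> S" using S by auto
  then obtain e L where "e > 0"
    and L: "\<And>u v. u \<in> ball (f t) e \<Longrightarrow> v \<in> ball (f t) e \<Longrightarrow> norm (\<phi> u - \<phi> v) \<le> L * norm (u - v)"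
    using \<phi> unfolding locally_lipschitz_on_def by meson
  obtain d where "d > 0" and d: "\<And>s. s \<in> {a..b} \<Longrightarrow> dist s t < d \<Longrightarrow> dist (f s) (f t) < e"
    using abs_continuous_imp_continuous_on[OF f] t \<open>e > 0\<close> unfolding continuous_on_iff
    by (meson atLeastAtMost_iff)
  have "abs_continuous u v (\<lambda>t. \<phi> (f t))"
    if uv: "a \<le> u" "u \<le> t" "t \<le> v" "v \<le> b" "v - u < d" for u v
  proof (rule abs_continuous_dominated[OF abs_continuous_subset[OF f], where C = L])
    fix s r assume sr: "u \<le> s" "s \<le> r" "r \<le> v"
    have "f p \<in> ball (f t) e" if "u \<le> p" "p \<le> v" for p
      using d[of p] that uv by (simp add: dist_commute) (simp add: dist_real_def)
    then show "norm (\<phi> (f r) - \<phi> (f s)) \<le> L * norm (f r - f s)"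
      using sr by (intro L) simp_all
  qed (use uv in auto)
  then show "\<exists>d>0. \<forall>u v. a \<le> u \<and> u \<le> t \<and> t \<le> v \<and> v \<le> b \<and> v - u < d \<longrightarrow>
      abs_continuous u v (\<lambda>t. \<phi> (f t))"
    using \<open>d > 0\<close> by blast
qed

section \<open>Integrals and the fundamental theorem of calculus\<close>

lemma nonoverlapping_sum_le_measure:
  assumes "nonoverlapping a b I l r" "U \<in> lmeasurable" "\<And>i. i \<in> I \<Longrightarrow> {l i<..<r i} \<subseteq> U"
  shows "(\<Sum>i\<in>I. r i - l i) \<le> measure lebesgue U"
proof -
  have "(\<Sum>i\<in>I. r i - l i) = (\<Sum>i\<in>I. measure lebesgue {l i<..<r i})"
    using assms(1) by (intro sum.cong) (auto simp: nonoverlapping_def)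
  also have "\<dots> = measure lebesgue (\<Union>i\<in>I. {l i<..<r i})"
    using assms(1)
    by (intro measure_UNION'[symmetric]) (auto simp: nonoverlapping_def pairwise_def disjnt_def)
  also have "\<dots> \<le> measure lebesgue U"
    using assms by (intro measure_mono_fmeasurable) (auto simp: nonoverlapping_def)
  finally show ?thesis .
qed

text \<open>Passing to open intervals changes no integral, and each time lies in at most one of
  them. Hence the truncations of \<open>h\<close> to these intervals add up to at most
  \<open>h\<close> pointwise.\<close>

lemma nonoverlapping_sum_integral_le:
  fixes h :: "real \<Rightarrow> real"
  assumes I: "nonoverlapping a b I l r" and h: "h integrable_on {a..b}"
    and pos: "\<And>t. t \<in> {a..b} \<Longrightarrow> 0 \<le> h t"
  shows "(\<Sum>i\<in>I. integral {l i..r i} h) \<le> integral {a..b} h"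
proof -
  let ?h = "\<lambda>i t. if t \<in> {l i<..<r i} then h t else 0"
  have sub: "{l i<..<r i} \<subseteq> {a..b}" "{l i..r i} \<subseteq> {a..b}" if "i \<in> I" for i
  proof -
    have "a \<le> l i" "l i \<le> r i" "r i \<le> b" using I that by (simp_all add: nonoverlapping_def)
    then show "{l i<..<r i} \<subseteq> {a..b}" "{l i..r i} \<subseteq> {a..b}" by auto
  qed
  have 0: "finite I" using I by (simp add: nonoverlapping_def)
  have int: "?h i integrable_on {a..b}" and eq: "integral {a..b} (?h i) = integral {l i..r i} h" if "i \<in> I" for i
  proof -
    have "h integrable_on {l i..r i}" using h sub(2)[OF that] integrable_on_subinterval by blast
    then have "h integrable_on {l i<..<r i}"
      using integrable_on_open_interval[of h "l i" "r i"] by (simp add: box_real)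
    moreover have "{a..b} \<inter> {l i<..<r i} = {l i<..<r i}" "{l i<..<r i} \<inter> {a..b} = {l i<..<r i}"
      using sub(1)[OF that] by blast+
    ultimately show "?h i integrable_on {a..b}" "integral {a..b} (?h i) = integral {l i..r i} h"
      using integral_open_interval[of "l i" "r i" h]
        integrable_restrict_Int[of "{l i<..<r i}" h "{a..b}"] integral_restrict_Int[of "{a..b}" "{l i<..<r i}" h]
      by (simp_all only: box_real)
  qed
  have "(\<Sum>i\<in>I. integral {l i..r i} h) = integral {a..b} (\<lambda>t. \<Sum>i\<in>I. ?h i t)"
    using eq int by (subst integral_sum[OF 0]) auto
  also have "\<dots> \<le> integral {a..b} h"
  proof (rule integral_le)
    show "(\<lambda>t. \<Sum>i\<in>I. ?h i t) integrable_on {a..b}" using int by (intro integrable_sum 0) auto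
    fix t assume t: "t \<in> {a..b}"
    show "(\<Sum>i\<in>I. ?h i t) \<le> h t"
    proof (cases "\<exists>i\<in>I. t \<in> {l i<..<r i}")
      case True
      then obtain i where i: "i \<in> I" "t \<in> {l i<..<r i}" by blast
      have "?h j t = 0" if "j \<in> I - {i}" for j
        using I i that unfolding nonoverlapping_def by (metis Diff_iff Int_iff empty_iff insertI1)
      then have "(\<Sum>i\<in>I. ?h i t) = ?h i t"
        by (simp add: sum.remove[OF 0 i(1)])
      then show ?thesis using i by simp
    next
      case False
      then have "(\<Sum>i\<in>I. ?h i t) = 0" by (intro sum.neutral) auto
      then show ?thesis using pos[OF t] by simp
    qed
  qed (use h in auto)
  finally show ?thesis .
qed

text \<open>The integrand is split into its truncation at height n and the excess
  \<open>gn n\<close>. The excess has small integral for large n by dominated convergence; the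
  truncated part contributes at most n times the total length of the intervals.\<close>

lemma abs_continuous_integral:
  fixes g :: "real \<Rightarrow> real"
  assumes g: "g integrable_on {a..b}" and pos: "\<And>t. t \<in> {a..b} \<Longrightarrow> 0 \<le> g t"
  shows "abs_continuous a b (\<lambda>t. integral {a..t} g)"
  unfolding abs_continuous_def
proof (intro allI impI)
  fix \<epsilon> :: real assume "\<epsilon> > 0"
  have gabs: "g absolutely_integrable_on {a..b}"
    using g pos absolutely_integrable_on_iff_nonneg[of "{a..b}" g] by blast
  define gn where "gn n t = g t - min (g t) (real n)" for n :: nat and t
  have gn_int: "gn n integrable_on {a..b}" for n
    unfolding gn_def
    using absolutely_integrable_min_1[OF gabs absolutely_integrable_on_const[of "{a..b}" "real n"]]
    by (intro integrable_diff g) (simp add: absolutely_integrable_on_def)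
  have "(\<lambda>n. integral {a..b} (gn n)) \<longlonglongrightarrow> integral {a..b} (\<lambda>t. 0 :: real)"
  proof (rule dominated_convergence(2)[where h = g])
    show "norm (gn n t) \<le> g t" if "t \<in> {a..b}" for n t
      using pos[OF that] by (simp add: gn_def min_def)
    show "(\<lambda>n. gn n t) \<longlonglongrightarrow> 0" for t
    proof (rule tendsto_eventually)
      show "\<forall>\<^sub>F n in sequentially. gn n t = 0"
        using eventually_ge_at_top[of "nat \<lceil>g t\<rceil>"]
      proof eventually_elim
        case (elim n)
        then have "g t \<le> real n" by linarith
        then show ?case by (simp add: gn_def)
      qed
    qed
  qed (use gn_int g in auto)
  then have "\<forall>\<^sub>F n in sequentially. integral {a..b} (gn n) < \<epsilon> / 2"
    using \<open>\<epsilon> > 0\<close> by (intro order_tendstoD(2)) auto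
  then obtain n where n: "integral {a..b} (gn n) < \<epsilon> / 2"
    using eventually_happens by force
  \<comment> \<open>With this choice the bounded part costs less than \<epsilon>/2; the summand 1
    covers the case n = 0.\<close>
  define \<delta> where "\<delta> = \<epsilon> / (2 * (real n + 1))"
  have "\<delta> > 0" using \<open>\<epsilon> > 0\<close> by (simp add: \<delta>_def)
  have "(\<Sum>(s, t)\<in>D. norm (integral {a..t} g - integral {a..s} g)) < \<epsilon>"
    if D: "finite D" "\<forall>(s, t)\<in>D. a \<le> s \<and> s \<le> t \<and> t \<le> b"
      "pairwise (\<lambda>(s, t) (s', t'). {s<..<t} \<inter> {s'<..<t'} = {}) D" "(\<Sum>(s, t)\<in>D. t - s) < \<delta>" for D
  proof -
    have no: "nonoverlapping a b D fst snd"
      using D unfolding nonoverlapping_def pairwise_def by (auto simp: case_prod_unfold)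
    have ord: "a \<le> fst i" "fst i \<le> snd i" "snd i \<le> b" if "i \<in> D" for i
      using no that by (auto simp: nonoverlapping_def)
    have int: "g integrable_on {fst i..snd i}" "gn n integrable_on {fst i..snd i}" if "i \<in> D" for i
      using integrable_on_subinterval[OF g] integrable_on_subinterval[OF gn_int[of n]] ord[OF that] by auto
    have "(\<Sum>(s, t)\<in>D. norm (integral {a..t} g - integral {a..s} g)) = (\<Sum>i\<in>D. integral {fst i..snd i} g)"
      unfolding case_prod_unfold
    proof (rule sum.cong[OF refl])
      fix i assume i: "i \<in> D"
      have "integral {a..fst i} g + integral {fst i..snd i} g = integral {a..snd i} g"
        using ord[OF i] integrable_on_subinterval[OF g, of a "snd i"]
        by (intro Henstock_Kurzweil_Integration.integral_combine) auto
      moreover have "0 \<le> integral {fst i..snd i} g"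
        using int(1)[OF i] pos ord[OF i] by (intro integral_nonneg) auto
      ultimately show "norm (integral {a..snd i} g - integral {a..fst i} g) = integral {fst i..snd i} g"
        by auto
    qed
    also have "\<dots> \<le> (\<Sum>i\<in>D. integral {fst i..snd i} (gn n) + real n * (snd i - fst i))"
    proof (rule sum_mono)
      fix i assume i: "i \<in> D"
      have "integral {fst i..snd i} g \<le> integral {fst i..snd i} (\<lambda>t. gn n t + real n)"
        using int[OF i] by (intro integral_le integrable_add) (simp_all only: integrable_const_ivl, simp add: gn_def)
      also have "\<dots> = integral {fst i..snd i} (gn n) + real n * (snd i - fst i)"
        using int(2)[OF i] ord[OF i] by (subst integral_add) auto
      finally show "integral {fst i..snd i} g \<le> integral {fst i..snd i} (gn n) + real n * (snd i - fst i)" .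
    qed
    also have "\<dots> = (\<Sum>i\<in>D. integral {fst i..snd i} (gn n)) + real n * (\<Sum>i\<in>D. snd i - fst i)"
      by (simp add: sum.distrib sum_distrib_left)
    also have "\<dots> \<le> integral {a..b} (gn n) + real n * \<delta>"
      using D(4) by (intro add_mono nonoverlapping_sum_integral_le[OF no gn_int] mult_left_mono)
        (auto simp: gn_def case_prod_unfold)
    also have "\<dots> < \<epsilon> / 2 + (real n + 1) * \<delta>"
      using n \<open>\<delta> > 0\<close> by (intro add_strict_mono mult_strict_right_mono) auto
    also have "\<dots> = \<epsilon>" proof -
      have "real n + 1 \<noteq> 0" by linarith
      then show ?thesis unfolding \<delta>_def by (simp add: divide_simps del: of_nat_Suc) (simp add: algebra_simps)
    qed
    finally show ?thesis .
  qed
  then show "\<exists>\<delta>>0. \<forall>D. finite D \<and> (\<forall>(s, t)\<in>D. a \<le> s \<and> s \<le> t \<and> t \<le> b) \<and>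
       pairwise (\<lambda>(s, t) (s', t'). {s<..<t} \<inter> {s'<..<t'} = {}) D \<and>
       (\<Sum>(s, t)\<in>D. t - s) < \<delta> \<longrightarrow> (\<Sum>(s, t)\<in>D. norm (integral {a..t} g - integral {a..s} g)) < \<epsilon>"
    by (intro exI[of _ \<delta>] conjI allI impI \<open>\<delta> > 0\<close>) blast
qed

text \<open>A gauge argument. At a tag where \<open>f\<close> is differentiable, the Riemann term
  differs from the increment by a small multiple of the length of the cell. Tags in the exceptional
  null set are confined to an open set so small that absolute continuity bounds the sum of the
  increments over their cells.\<close>

lemma abs_continuous_has_integral:
  fixes f :: "real \<Rightarrow> 'b::euclidean_space"
  assumes "a \<le> b" and f: "abs_continuous a b f"
    and AE: "AE t in lebesgue. t \<in> {a..b} \<longrightarrow> (f has_vector_derivative f' t) (at t within {a..b})"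
  shows "(f' has_integral f b - f a) {a..b}"
proof -
  from AE obtain N where N: "N \<in> null_sets lebesgue"
    and fN: "\<And>t. t \<notin> N \<Longrightarrow> t \<in> {a..b} \<Longrightarrow> (f has_vector_derivative f' t) (at t within {a..b})"
    unfolding eventually_ae_filter by auto
  \<comment> \<open>Setting the integrand to 0 on \<open>N\<close> kills the Riemann terms with tags
    in \<open>N\<close>; the null set is changed back at the very end.\<close>
  define g where "g t = (if t \<in> N then 0 else f' t)" for t
  have "(g has_integral f b - f a) {a..b}"
  proof (cases "a = b")
    case False
    then have "a < b" using \<open>a \<le> b\<close> by simp
    show ?thesis
      unfolding has_integral_factor_content_real
    proof (intro allI impI)
      fix e :: real assume "e > 0"
      \<comment> \<open>Half of the admissible error \<open>e * (b - a)\<close>; one half for the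
        tags inside \<open>N\<close> and one for the tags outside.\<close>
      define \<eta> where "\<eta> = e * (b - a) / 2"
      have "\<eta> > 0" using \<open>a < b\<close> \<open>e > 0\<close> by (simp add: \<eta>_def)
      obtain \<delta> where "\<delta> > 0" and \<delta>: "\<And>(I::(real \<times> real set) set) l r. nonoverlapping a b I l r \<Longrightarrow>
          (\<Sum>i\<in>I. r i - l i) < \<delta> \<Longrightarrow> (\<Sum>i\<in>I. norm (f (r i) - f (l i))) < \<eta>"
        using abs_continuous_familyD[OF f \<open>\<eta> > 0\<close>, where ?'i = "real \<times> real set"] by blast
      obtain U where U: "open U" "N \<subseteq> U" "U - N \<in> lmeasurable" "emeasure lebesgue (U - N) < ennreal \<delta>"
        using sets_lebesgue_outer_open[of N \<delta>] N \<open>\<delta> > 0\<close> by (auto simp: null_sets_def)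
      have "emeasure lebesgue U = emeasure lebesgue (U - N)"
        using N U(1) by (intro emeasure_Diff_null_set[symmetric]) auto
      then have Ue: "emeasure lebesgue U < ennreal \<delta>" using U(4) by simp
      have Ul: "U \<in> lmeasurable"
        using U(1) less_trans[OF Ue ennreal_less_top] by (intro fmeasurableI) auto
      have Um: "measure lebesgue U < \<delta>"
        using Ue emeasure_eq_measure2[OF Ul] by (simp add: ennreal_less_iff)
      have "\<exists>r>0. t \<notin> N \<and> t \<in> {a..b} \<longrightarrow> (\<forall>s\<in>{a..b}. \<bar>s - t\<bar> < r \<longrightarrow>
          norm (f s - f t - (s - t) *\<^sub>R g t) \<le> e / 2 * \<bar>s - t\<bar>)" for t
      proof (cases "t \<notin> N \<and> t \<in> {a..b}")
        case True
        then have "(f has_derivative (\<lambda>h. h *\<^sub>R g t)) (at t within {a..b})"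
          using fN by (simp add: g_def has_vector_derivative_def)
        then show ?thesis
          using half_gt_zero[OF \<open>e > 0\<close>] unfolding has_derivative_within_alt real_norm_def by meson
      qed (auto intro: exI[of _ 1])
      then obtain \<rho> where \<rho>: "\<And>t. \<rho> t > 0" and \<rho>f: "\<And>t s. t \<notin> N \<Longrightarrow> t \<in> {a..b} \<Longrightarrow> s \<in> {a..b} \<Longrightarrow>
          \<bar>s - t\<bar> < \<rho> t \<Longrightarrow> norm (f s - f t - (s - t) *\<^sub>R g t) \<le> e / 2 * \<bar>s - t\<bar>"
        by metis
      \<comment> \<open>For tags in \<open>N\<close> the gauge forces the cell into
        \<open>U\<close>, whose measure is below the \<delta> of absolute continuity; for the others
        it forces the cell into the range of the derivative estimate.\<close>
      define \<gamma> where "\<gamma> t = (if t \<in> N then U else ball t (\<rho> t))" for t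
      have "gauge \<gamma>" using U \<rho> by (auto simp: gauge_def \<gamma>_def)
      moreover have "norm ((\<Sum>(t, K)\<in>p. measure lborel K *\<^sub>R g t) - (f b - f a)) \<le> e * measure lborel {a..b}"
        if p: "p tagged_division_of {a..b}" "\<gamma> fine p" for p
      proof -
        note pD = tagged_division_ofD[OF p(1)]
        define l where "l i = Inf (snd i)" for i :: "real \<times> real set"
        define r where "r i = Sup (snd i)" for i :: "real \<times> real set"
        have K: "snd i = {l i..r i}" "l i \<le> r i" "l i \<le> fst i" "fst i \<le> r i" "a \<le> l i" "r i \<le> b"
          "{l i..r i} \<subseteq> \<gamma> (fst i)" if ip: "i \<in> p" for i
        proof -
          obtain t K where i: "i = (t, K)" by (cases i)
          obtain u v where uv: "K = {u..v}" using pD(4) ip i by (metis box_real(2))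
          have t: "t \<in> {u..v}" "{u..v} \<subseteq> {a..b}" using pD(2,3) ip i uv by blast+
          then have "l i = u" "r i = v" by (auto simp: l_def r_def i uv)
          then show "snd i = {l i..r i}" "l i \<le> r i" "l i \<le> fst i" "fst i \<le> r i" "a \<le> l i" "r i \<le> b"
            "{l i..r i} \<subseteq> \<gamma> (fst i)"
            using t i uv fineD[OF p(2), of t K] ip by auto
        qed
        have no: "nonoverlapping a b p l r"
          unfolding nonoverlapping_def
        proof (intro conjI ballI impI)
          fix i j assume ij: "i \<in> p" "j \<in> p" "i \<noteq> j"
          have "interior (snd i) \<inter> interior (snd j) = {}"
            using pD(5)[of "fst i" "snd i" "fst j" "snd j"] ij by simp
          then show "{l i<..<r i} \<inter> {l j<..<r j} = {}"
            using K(1) ij by (simp add: interior_atLeastAtMost_real)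
        qed (use K pD(1) in simp_all)
        let ?E = "\<lambda>i. (r i - l i) *\<^sub>R g (fst i) - (f (r i) - f (l i))"
        have "(\<Sum>(t, K)\<in>p. measure lborel K *\<^sub>R g t) - (f b - f a) = (\<Sum>i\<in>p. ?E i)"
        proof -
          have "(\<Sum>(t, K)\<in>p. measure lborel K *\<^sub>R g t) = (\<Sum>i\<in>p. (r i - l i) *\<^sub>R g (fst i))"
            unfolding case_prod_unfold
          proof (rule sum.cong[OF refl])
            fix i assume "i \<in> p"
            from content_real[OF K(2)[OF this]] K(1)[OF this]
            show "measure lborel (snd i) *\<^sub>R g (fst i) = (r i - l i) *\<^sub>R g (fst i)" by simp
          qed
          moreover have "(\<Sum>i\<in>p. f (r i) - f (l i)) = f b - f a"
            using additive_tagged_division_1[OF \<open>a \<le> b\<close> p(1), of f]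
            by (simp add: case_prod_unfold l_def r_def)
          ultimately show ?thesis by (simp add: sum_subtractf)
        qed
        also have "norm \<dots> \<le> (\<Sum>i\<in>p. norm (?E i))" by (rule norm_sum)
        also have "\<dots> = (\<Sum>i\<in>{i\<in>p. fst i \<in> N}. norm (?E i)) + (\<Sum>i\<in>{i\<in>p. fst i \<notin> N}. norm (?E i))"
        proof -
          have eq: "{i\<in>p. fst i \<in> N} \<union> {i\<in>p. fst i \<notin> N} = p" by blast
          have "finite {i\<in>p. fst i \<in> N}" "finite {i\<in>p. fst i \<notin> N}"
            "{i\<in>p. fst i \<in> N} \<inter> {i\<in>p. fst i \<notin> N} = {}" using pD(1) by auto
          from sum.union_disjoint[OF this, of "\<lambda>i. norm (?E i)"] show ?thesis unfolding eq .
        qed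
        also have "\<dots> \<le> \<eta> + \<eta>"
        proof (rule add_mono)
          have no': "nonoverlapping a b {i\<in>p. fst i \<in> N} l r"
            using no by (auto simp: nonoverlapping_def)
          have "(\<Sum>i\<in>{i\<in>p. fst i \<in> N}. r i - l i) \<le> measure lebesgue U"
          proof (rule nonoverlapping_sum_le_measure[OF no' Ul])
            fix i assume "i \<in> {i\<in>p. fst i \<in> N}"
            then show "{l i<..<r i} \<subseteq> U" using K(7)[of i] by (auto simp: \<gamma>_def)
          qed
          then have "(\<Sum>i\<in>{i\<in>p. fst i \<in> N}. norm (f (r i) - f (l i))) < \<eta>"
            using \<delta>[OF no'] Um by linarith
          then show "(\<Sum>i\<in>{i\<in>p. fst i \<in> N}. norm (?E i)) \<le> \<eta>"
            by (simp add: g_def norm_minus_commute)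
        next
          have "(\<Sum>i\<in>{i\<in>p. fst i \<notin> N}. norm (?E i)) \<le> (\<Sum>i\<in>{i\<in>p. fst i \<notin> N}. e / 2 * (r i - l i))"
          proof (rule sum_mono)
            fix i assume "i \<in> {i\<in>p. fst i \<notin> N}"
            then have i: "i \<in> p" "fst i \<notin> N" by auto
            note Ki = K[OF i(1)]
            let ?t = "fst i"
            have est: "norm (f s - f ?t - (s - ?t) *\<^sub>R g ?t) \<le> e / 2 * \<bar>s - ?t\<bar>" if "s \<in> {l i..r i}" for s
            proof (rule \<rho>f[OF i(2)])
              show "\<bar>s - ?t\<bar> < \<rho> ?t"
                using subsetD[OF Ki(7) that] i(2) by (simp add: \<gamma>_def dist_real_def abs_minus_commute)
            qed (use Ki that in auto)
            \<comment> \<open>The derivative estimate is centred at the tag, so the cell is split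
              there: both end points are compared with the tag, and the two distances add up to the
              length of the cell.\<close>
            have "?E i = (f (l i) - f ?t - (l i - ?t) *\<^sub>R g ?t) - (f (r i) - f ?t - (r i - ?t) *\<^sub>R g ?t)"
              by (simp add: algebra_simps)
            then have "norm (?E i) \<le> norm (f (l i) - f ?t - (l i - ?t) *\<^sub>R g ?t) + norm (f (r i) - f ?t - (r i - ?t) *\<^sub>R g ?t)"
              by (metis norm_triangle_ineq4)
            also have "\<dots> \<le> e / 2 * \<bar>l i - ?t\<bar> + e / 2 * \<bar>r i - ?t\<bar>"
              using Ki(2-4) by (intro add_mono est) simp_all
            also have "\<dots> = e / 2 * (r i - l i)"
            proof -
              have "\<bar>l i - ?t\<bar> = ?t - l i" "\<bar>r i - ?t\<bar> = r i - ?t" using Ki by simp_all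
              moreover have "e / 2 * (?t - l i) + e / 2 * (r i - ?t) = e / 2 * ((?t - l i) + (r i - ?t))"
                by (rule distrib_left[symmetric])
              ultimately show ?thesis by simp
            qed
            finally show "norm (?E i) \<le> e / 2 * (r i - l i)" .
          qed
          also have "\<dots> \<le> (\<Sum>i\<in>p. e / 2 * (r i - l i))"
            using pD(1) K(2) \<open>e > 0\<close> by (intro sum_mono2) auto
          also have "\<dots> = e / 2 * (\<Sum>i\<in>p. r i - l i)" by (simp add: sum_distrib_left)
          also have "(\<Sum>i\<in>p. r i - l i) = b - a"
            using additive_tagged_division_1[OF \<open>a \<le> b\<close> p(1), of id]
            by (simp add: case_prod_unfold l_def r_def)
          finally show "(\<Sum>i\<in>{i\<in>p. fst i \<notin> N}. norm (?E i)) \<le> \<eta>"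
            by (simp add: \<eta>_def)
        qed
        finally show ?thesis using \<open>a \<le> b\<close> by (simp add: \<eta>_def)
      qed
      ultimately show "\<exists>\<gamma>. gauge \<gamma> \<and> (\<forall>p. p tagged_division_of {a..b} \<and> \<gamma> fine p \<longrightarrow>
          norm ((\<Sum>(t, K)\<in>p. measure lborel K *\<^sub>R g t) - (f b - f a)) \<le> e * measure lborel {a..b})"
        by (intro exI[of _ \<gamma>] conjI allI impI) blast+
    qed
  qed (simp add: has_integral_refl)
  then show ?thesis
    by (rule has_integral_spike[rotated 2, where S = N]) (use N in \<open>auto simp: g_def negligible_iff_null_sets\<close>)
qed

lemma abs_continuous_zero_derivative:
  fixes f :: "real \<Rightarrow> 'b::euclidean_space"
  assumes "a \<le> b" "abs_continuous a b f"
    and "AE t in lebesgue. t \<in> {a..b} \<longrightarrow> (f has_vector_derivative 0) (at t within {a..b})"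
  shows "f b = f a"
  using has_integral_unique[OF abs_continuous_has_integral[OF assms] has_integral_0] by simp

text \<open>The fundamental theorem gives only a gauge integral. Integrals over the cells of a
  division are increments of \<open>f\<close>, so absolute continuity with \<epsilon> = 1 bounds the
  sums of their norms on short intervals; bounded variation of the indefinite integral there implies
  absolute integrability, and finitely many short intervals are joined.\<close>

lemma abs_continuous_derivative_absolutely_integrable:
  fixes f :: "real \<Rightarrow> 'b::euclidean_space"
  assumes "a \<le> b" and f: "abs_continuous a b f"
    and AE: "AE t in lebesgue. t \<in> {a..b} \<longrightarrow> (f has_vector_derivative f' t) (at t within {a..b})"
  shows "f' absolutely_integrable_on {a..b}"
proof -
  have ftc: "(f' has_integral f v - f u) {u..v}" if "a \<le> u" "u \<le> v" "v \<le> b" for u v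
  proof (rule abs_continuous_has_integral[OF that(2) abs_continuous_subset[OF f that(1,3)]])
    show "AE t in lebesgue. t \<in> {u..v} \<longrightarrow> (f has_vector_derivative f' t) (at t within {u..v})"
      using AE
    proof eventually_elim
      case (elim t)
      show ?case
      proof
        assume t: "t \<in> {u..v}"
        then have "(f has_vector_derivative f' t) (at t within {a..b})" using elim that by simp
        then show "(f has_vector_derivative f' t) (at t within {u..v})"
          by (rule has_vector_derivative_within_subset) (use that in simp)
      qed
    qed
  qed
  obtain \<delta> where "\<delta> > 0" and \<delta>: "\<And>(I::real set set) l r. nonoverlapping a b I l r \<Longrightarrow>
      (\<Sum>i\<in>I. r i - l i) < \<delta> \<Longrightarrow> (\<Sum>i\<in>I. norm (f (r i) - f (l i))) < 1"
    using abs_continuous_familyD[OF f zero_less_one, where ?'i = "real set"] by blast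
  have loc: "f' absolutely_integrable_on {u..v}" if "a \<le> u" "u \<le> v" "v \<le> b" "v - u < \<delta>" for u v
    unfolding box_real(2)[symmetric]
  proof (rule bounded_variation_absolutely_integrable_interval[where B = 1])
    show "f' integrable_on cbox u v" using ftc that by auto
    fix d assume d: "d division_of cbox u v"
    note dD = division_ofD[OF d]
    have K: "K = {Inf K..Sup K}" "Inf K \<le> Sup K" "u \<le> Inf K" "Sup K \<le> v" if Kd: "K \<in> d" for K
    proof -
      obtain p q where "K = {p..q}" using dD(4)[OF Kd] by (metis box_real(2))
      then show "K = {Inf K..Sup K}" "Inf K \<le> Sup K" "u \<le> Inf K" "Sup K \<le> v"
        using dD(2,3)[OF Kd] by auto
    qed
    have "nonoverlapping a b d Inf Sup"
      unfolding nonoverlapping_def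
    proof (intro conjI ballI impI)
      fix K L assume KL: "K \<in> d" "L \<in> d" "K \<noteq> L"
      have "interior {Inf K..Sup K} \<inter> interior {Inf L..Sup L} = {}"
        using dD(5)[OF KL] K(1)[OF KL(1)] K(1)[OF KL(2)] by simp
      then show "{Inf K<..<Sup K} \<inter> {Inf L<..<Sup L} = {}"
        by (simp add: interior_atLeastAtMost_real)
    next
      fix K assume "K \<in> d"
      from K[OF this] that show "a \<le> Inf K" "Inf K \<le> Sup K" "Sup K \<le> b" by auto
    qed (use dD(1) in auto)
    moreover have "(\<Sum>K\<in>d. Sup K - Inf K) = (\<Sum>K\<in>d. measure lborel K)"
    proof (rule sum.cong[OF refl])
      fix L assume "L \<in> d"
      from content_real[OF K(2)[OF this]] K(1)[OF this] show "Sup L - Inf L = measure lborel L" by simp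
    qed
    then have "(\<Sum>K\<in>d. Sup K - Inf K) < \<delta>"
      using that additive_content_division[OF d] by simp
    ultimately have "(\<Sum>K\<in>d. norm (f (Sup K) - f (Inf K))) < 1" by (rule \<delta>)
    moreover have "(\<Sum>K\<in>d. norm (integral K f')) = (\<Sum>K\<in>d. norm (f (Sup K) - f (Inf K)))"
    proof (rule sum.cong[OF refl])
      fix L assume L: "L \<in> d"
      have "integral {Inf L..Sup L} f' = f (Sup L) - f (Inf L)"
        using K[OF L] that by (intro integral_unique ftc) auto
      then show "norm (integral L f') = norm (f (Sup L) - f (Inf L))"
        using K(1)[OF L] by simp
    qed
    ultimately show "(\<Sum>K\<in>d. norm (integral K f')) \<le> 1" by linarith
  qed
  let ?P = "\<lambda>u v. a \<le> u \<and> v \<le> b \<longrightarrow> f' absolutely_integrable_on {u..v}"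
  have "?P a b"
  proof (rule Bolzano[where P = ?P, OF \<open>a \<le> b\<close>])
    fix u v w assume *: "?P u v" "?P v w" "u \<le> v" "v \<le> w"
    show "?P u w"
    proof
      assume "a \<le> u \<and> w \<le> b"
      with * show "f' absolutely_integrable_on {u..w}"
        by (intro absolutely_integrable_on_combine[of u v _ w]) simp_all
    qed
  next
    fix t assume "a \<le> t" "t \<le> b"
    show "\<exists>d>0. \<forall>u v. u \<le> t \<and> t \<le> v \<and> v - u < d \<longrightarrow> ?P u v"
      by (intro exI[of _ \<delta>] conjI allI impI \<open>\<delta> > 0\<close> loc) simp_all
  qed
  then show ?thesis by simp
qed

section \<open>Linear differential equations with integrable coefficients\<close>

lemma bounded_bilinear_matrix_vector_mult:
  "bounded_bilinear ((*v) :: real ^ 'n ^ 'm \<Rightarrow> real ^ 'n \<Rightarrow> real ^ 'm)"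
  by (simp flip: bilinear_conv_bounded_bilinear
      add: bilinear_def linear_iff matrix_vector_mult_add_rdistrib matrix_vector_right_distrib
        matrix_vector_mult_scaleR scaleR_matrix_vector_assoc)

text \<open>Picard iteration in the space of bounded continuous functions. The threshold
  \<open>c\<close> depends on the dimension only, neither on the interval nor on the coefficient,
  which is what permits the later choice of short intervals.\<close>

lemma linear_ode_small:
  shows "\<exists>c>0. \<forall>a b (A :: real \<Rightarrow> real ^ 'n ^ 'n) v. a \<le> b \<longrightarrow> A absolutely_integrable_on {a..b} \<longrightarrow>
    integral {a..b} (\<lambda>s. norm (A s)) \<le> c \<longrightarrow>
    (\<exists>Z. continuous_on {a..b} Z \<and> Z a = v \<and>
      (\<forall>t\<in>{a..b}. ((\<lambda>s. A s *v Z s) has_integral Z t - v) {a..t}))"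
proof -
  interpret bounded_bilinear "(*v) :: real ^ 'n ^ 'n \<Rightarrow> real ^ 'n \<Rightarrow> real ^ 'n"
    by (rule bounded_bilinear_matrix_vector_mult)
  obtain K where K: "K > 0" "\<And>(B :: real ^ 'n ^ 'n) z. norm (B *v z) \<le> norm B * norm z * K"
    using pos_bounded by blast
  have "\<exists>Z. continuous_on {a..b} Z \<and> Z a = v \<and>
      (\<forall>t\<in>{a..b}. ((\<lambda>s. A s *v Z s) has_integral Z t - v) {a..t})"
    if ab: "a \<le> b" and A: "A absolutely_integrable_on {a..b}"
      and small: "integral {a..b} (\<lambda>s. norm (A s)) \<le> 1 / (2 * K)"
    for a b and A :: "real \<Rightarrow> real ^ 'n ^ 'n" and v
  proof -
    have An: "(\<lambda>s. norm (A s)) integrable_on {a..b}"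
      using A by (simp add: absolutely_integrable_on_def)
    have bil: "bilinear (\<lambda>z (B :: real ^ 'n ^ 'n). B *v z)"
      by (rule flip[folded bilinear_conv_bounded_bilinear])
    have int: "(\<lambda>s. A s *v Z s) integrable_on {a..b}" if "continuous_on {a..b} Z" for Z :: "real \<Rightarrow> real ^ 'n"
    proof -
      have "(\<lambda>s. A s *v Z s) absolutely_integrable_on {a..b}"
      proof (rule absolutely_integrable_bounded_measurable_product[where h = "\<lambda>z B. B *v z"])
        show "Z \<in> borel_measurable (lebesgue_on {a..b})"
          using that by (intro continuous_imp_measurable_on_sets_lebesgue) auto
        show "bounded (Z ` {a..b})"
          using that by (intro compact_imp_bounded compact_continuous_image) auto
      qed (use bil A in auto)
      then show ?thesis by (simp add: absolutely_integrable_on_def)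
    qed
    define h where "h Z t = v + integral {a..t} (\<lambda>s. A s *v Z s)" for Z t
    \<comment> \<open>Bounded continuous functions live on the whole line, so the iterate is
      extended from \<open>{a..b}\<close> by constants through \<open>clamp\<close>.\<close>
    have "\<exists>g :: real \<Rightarrow>\<^sub>C (real ^ 'n). \<forall>t. apply_bcontfun g t = h (apply_bcontfun Z) (clamp a b t)"
      for Z :: "real \<Rightarrow>\<^sub>C (real ^ 'n)"
    proof -
      have "continuous_on (cbox a b) (h (apply_bcontfun Z))"
        unfolding h_def box_real(2)
        by (intro continuous_intros indefinite_integral_continuous_1 int) auto
      then obtain g :: "real \<Rightarrow>\<^sub>C (real ^ 'n)" where "\<And>t. apply_bcontfun g t = h (apply_bcontfun Z) (clamp a b t)"
        by (rule continuous_on_cbox_bcontfunE) blast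
      then show ?thesis by blast
    qed
    then obtain T where T: "\<And>Z t. apply_bcontfun (T Z) t = h (apply_bcontfun Z) (clamp a b t)"
      by metis
    have clamp: "clamp a b t \<in> {a..b}" for t
      using clamp_in_interval[of a b t] ab by (simp add: box_real)
    have "dist (T Z) (T W) \<le> 1 / 2 * dist Z W" for Z W
    proof (rule dist_bound)
      fix t
      let ?t = "clamp a b t" and ?D = "\<lambda>s. A s *v (apply_bcontfun Z s - apply_bcontfun W s)"
      have le: "{a..?t} \<subseteq> {a..b}" using clamp[of t] by auto
      have intZ: "(\<lambda>s. A s *v apply_bcontfun Z s) integrable_on {a..?t}" for Z
        by (rule integrable_on_subinterval[OF int le]) auto
      have "apply_bcontfun (T Z) t - apply_bcontfun (T W) t = integral {a..?t} ?D"
        using intZ[of Z] intZ[of W] by (simp add: T h_def diff_right flip: integral_diff)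
      also have "norm \<dots> \<le> integral {a..?t} (\<lambda>s. K * dist Z W * norm (A s))"
      proof (rule Henstock_Kurzweil_Integration.integral_norm_bound_integral)
        show "?D integrable_on {a..?t}"
          using integrable_diff[OF intZ[of Z] intZ[of W]] by (simp add: diff_right)
        show "(\<lambda>s. K * dist Z W * norm (A s)) integrable_on {a..?t}"
          using integrable_cmul[OF integrable_on_subinterval[OF An le], of "K * dist Z W"] by simp
        show "norm (?D s) \<le> K * dist Z W * norm (A s)" for s
        proof -
          have "norm (?D s) \<le> norm (A s) * dist (apply_bcontfun Z s) (apply_bcontfun W s) * K"
            using K(2) by (simp add: dist_norm)
          also have "\<dots> \<le> norm (A s) * dist Z W * K"
            using K(1) dist_bounded[of Z s W] by (intro mult_right_mono mult_left_mono) auto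
          finally show ?thesis by (simp add: mult_ac)
        qed
      qed
      also have "\<dots> = K * dist Z W * integral {a..?t} (\<lambda>s. norm (A s))" by simp
      \<comment> \<open>The threshold 1/(2K), with \<open>K\<close> the constant of the
        matrix-vector product, is chosen to make the contraction factor 1/2.\<close>
      also have "\<dots> \<le> K * dist Z W * (1 / (2 * K))"
      proof (rule mult_left_mono)
        have "integral {a..?t} (\<lambda>s. norm (A s)) \<le> integral {a..b} (\<lambda>s. norm (A s))"
          using An integrable_on_subinterval[OF An le] le by (intro integral_subset_le) auto
        then show "integral {a..?t} (\<lambda>s. norm (A s)) \<le> 1 / (2 * K)" using small by linarith
      qed (use K(1) in simp)
      also have "\<dots> = 1 / 2 * dist Z W" using K(1) by simp
      finally show "dist (apply_bcontfun (T Z) t) (apply_bcontfun (T W) t) \<le> 1 / 2 * dist Z W"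
        by (simp add: dist_norm)
    qed
    then obtain Z where Z: "T Z = Z"
      using banach_fix_type[of "1 / 2" T] by auto
    have ZT: "apply_bcontfun Z t = h (apply_bcontfun Z) t" if "t \<in> {a..b}" for t
    proof -
      have "clamp a b t = t" using that by (intro clamp_cancel_cbox) (simp add: box_real)
      then show ?thesis using T[of Z t] Z by simp
    qed
    show ?thesis
    proof (intro exI[of _ "apply_bcontfun Z"] conjI ballI)
      show "apply_bcontfun Z a = v" using ZT[of a] ab by (simp add: h_def)
      fix t assume t: "t \<in> {a..b}"
      have "(\<lambda>s. A s *v apply_bcontfun Z s) integrable_on {a..t}"
        by (rule integrable_on_subinterval[OF int]) (use t in auto)
      then show "((\<lambda>s. A s *v apply_bcontfun Z s) has_integral apply_bcontfun Z t - v) {a..t}"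
        using ZT[OF t] by (simp add: h_def has_integral_integral)
    qed auto
  qed
  then show ?thesis using K(1) by (intro exI[of _ "1 / (2 * K)"]) auto
qed

section \<open>Integral equations driven by a curve, and derivatives of their solutions at single
  points\<close>

lemma differentiable_imp_pointwise_lipschitz:
  fixes f :: "real \<Rightarrow> 'b::real_normed_vector"
  assumes f: "continuous_on {a..b} f" and D: "(f has_vector_derivative D) (at t within {a..b})"
  shows "\<exists>L\<ge>0. \<forall>s\<in>{a..b}. norm (f s - f t) \<le> L * \<bar>s - t\<bar>"
proof -
  obtain d where "d > 0" and d: "\<And>s. s \<in> {a..b} \<Longrightarrow> norm (s - t) < d \<Longrightarrow>
      norm (f s - f t - (s - t) *\<^sub>R D) \<le> 1 * norm (s - t)"
    using D unfolding has_vector_derivative_def has_derivative_within_alt by (meson zero_less_one)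
  obtain B where B: "B > 0" "\<And>s. s \<in> {a..b} \<Longrightarrow> norm (f s) \<le> B"
    using compact_imp_bounded[OF compact_continuous_image[OF f compact_Icc]]
    unfolding bounded_pos by auto
  \<comment> \<open>The first entry serves points closer to \<open>t\<close> than \<open>d\<close>,
    where the derivative controls the increment; for the others the increment is bounded and the
    distance is at least \<open>d\<close>.\<close>
  define L where "L = max (norm D + 1) ((B + norm (f t)) / d)"
  have "norm (f s - f t) \<le> L * \<bar>s - t\<bar>" if s: "s \<in> {a..b}" for s
  proof (cases "\<bar>s - t\<bar> < d")
    case True
    have "norm (f s - f t) \<le> norm (f s - f t - (s - t) *\<^sub>R D) + norm ((s - t) *\<^sub>R D)"
      using norm_triangle_ineq[of "f s - f t - (s - t) *\<^sub>R D" "(s - t) *\<^sub>R D"] by simp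
    also have "\<dots> \<le> (norm D + 1) * \<bar>s - t\<bar>"
      using d[OF s] True by (simp add: distrib_left mult.commute)
    also have "\<dots> \<le> L * \<bar>s - t\<bar>" by (intro mult_right_mono) (auto simp: L_def)
    finally show ?thesis .
  next
    case False
    have "norm (f s - f t) \<le> B + norm (f t)"
      using B(2)[OF s] norm_triangle_ineq4[of "f s" "f t"] by linarith
    also have "\<dots> = (B + norm (f t)) / d * d" using \<open>d > 0\<close> by simp
    also have "\<dots> \<le> L * \<bar>s - t\<bar>"
      using False \<open>d > 0\<close> B(1) by (intro mult_mono) (auto simp: L_def le_max_iff_disj)
    finally show ?thesis .
  qed
  moreover have "L \<ge> 0" by (simp add: L_def le_max_iff_disj)
  ultimately show ?thesis by blast
qed

text \<open>The integrated form of Y' = \<Sum> \<xi>'_i B_i. For parallel transport \<xi> is the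
  curve in a chart and \<open>B i\<close> a connection matrix applied to \<open>Y\<close>, so
  \<open>B\<close> may depend on the solution; for orthogonality to the velocity \<open>Y\<close> is
  constantly 0 and the \<open>B i\<close> are the components of a covector.\<close>

locale driven_curve =
  fixes a b :: real and \<xi> \<xi>' :: "real \<Rightarrow> real ^ 'm" and B :: "'m \<Rightarrow> real \<Rightarrow> 'e::euclidean_space"
    and Y :: "real \<Rightarrow> 'e"
  assumes \<xi>'_int: "\<xi>' absolutely_integrable_on {a..b}"
    and \<xi>_ftc: "\<And>u v. a \<le> u \<Longrightarrow> u \<le> v \<Longrightarrow> v \<le> b \<Longrightarrow> (\<xi>' has_integral \<xi> v - \<xi> u) {u..v}"
    and Y_ftc: "\<And>u v. a \<le> u \<Longrightarrow> u \<le> v \<Longrightarrow> v \<le> b \<Longrightarrow>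
      ((\<lambda>s. \<Sum>i\<in>UNIV. \<xi>' s $ i *\<^sub>R B i s) has_integral Y v - Y u) {u..v}"
begin

definition G :: "real \<Rightarrow> real" where "G t = integral {a..t} (\<lambda>s. norm (\<xi>' s))"

lemma norm_\<xi>'_integrable: "a \<le> u \<Longrightarrow> v \<le> b \<Longrightarrow> (\<lambda>s. norm (\<xi>' s)) integrable_on {u..v}"
  using \<xi>'_int integrable_on_subinterval[of "\<lambda>s. norm (\<xi>' s)" "{a..b}" u v]
  by (simp add: absolutely_integrable_on_def)

lemma continuous_on_G: "continuous_on {a..b} G"
  unfolding G_def by (rule indefinite_integral_continuous_1) (simp add: norm_\<xi>'_integrable)

lemma G_diff: "a \<le> u \<Longrightarrow> u \<le> v \<Longrightarrow> v \<le> b \<Longrightarrow> integral {u..v} (\<lambda>s. norm (\<xi>' s)) = G v - G u"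
  unfolding G_def
  using Henstock_Kurzweil_Integration.integral_combine[of a u v "\<lambda>s. norm (\<xi>' s)"] norm_\<xi>'_integrable[of a v]
  by simp

lemma G_mono: "a \<le> u \<Longrightarrow> u \<le> v \<Longrightarrow> v \<le> b \<Longrightarrow> G u \<le> G v"
  using G_diff[of u v] integral_nonneg[OF norm_\<xi>'_integrable, of u v] by simp

lemma G_near:
  assumes "t \<in> {a..b}" "e > 0"
  obtains d where "d > 0" "\<And>s. s \<in> {a..b} \<Longrightarrow> \<bar>s - t\<bar> < d \<Longrightarrow> \<bar>G s - G t\<bar> < e"
  using continuous_on_G assms unfolding continuous_on_iff dist_real_def by blast

text \<open>With constant coefficients \<open>c i\<close> the integral is exactly \<Sum> (\<xi> v -
  \<xi> u)_i c_i. What remains is an integral of \<xi>' against coefficients of norm at most \<eta>,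
  and \<open>G\<close> measures the variation of \<xi>.\<close>

lemma freeze_ordered:
  assumes uv: "a \<le> u" "u \<le> v" "v \<le> b"
    and \<eta>: "\<And>i s. u \<le> s \<Longrightarrow> s \<le> v \<Longrightarrow> norm (B i s - c i) \<le> \<eta>"
  shows "norm (Y v - Y u - (\<Sum>i\<in>UNIV. (\<xi> v - \<xi> u) $ i *\<^sub>R c i)) \<le> \<eta> * real CARD('m) * (G v - G u)"
proof -
  have "((\<lambda>s. \<Sum>i\<in>UNIV. \<xi>' s $ i *\<^sub>R c i) has_integral (\<Sum>i\<in>UNIV. (\<xi> v - \<xi> u) $ i *\<^sub>R c i)) {u..v}"
  proof (intro has_integral_sum finite_class.finite_UNIV)
    fix i
    have "bounded_linear (\<lambda>z :: real ^ 'm. z $ i *\<^sub>R c i)"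
      by (intro bounded_linear_scaleR_left[THEN bounded_linear_compose] bounded_linear_vec_nth)
    from has_integral_linear[OF \<xi>_ftc[OF uv] this]
    show "((\<lambda>s. \<xi>' s $ i *\<^sub>R c i) has_integral (\<xi> v - \<xi> u) $ i *\<^sub>R c i) {u..v}"
      by (simp add: o_def)
  qed
  from has_integral_diff[OF Y_ftc[OF uv] this]
  have d: "((\<lambda>s. \<Sum>i\<in>UNIV. \<xi>' s $ i *\<^sub>R (B i s - c i)) has_integral
      Y v - Y u - (\<Sum>i\<in>UNIV. (\<xi> v - \<xi> u) $ i *\<^sub>R c i)) {u..v}"
    by (simp add: scaleR_diff_right sum_subtractf)
  have "norm (integral {u..v} (\<lambda>s. \<Sum>i\<in>UNIV. \<xi>' s $ i *\<^sub>R (B i s - c i)))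
      \<le> integral {u..v} (\<lambda>s. \<eta> * real CARD('m) * norm (\<xi>' s))"
  proof (rule Henstock_Kurzweil_Integration.integral_norm_bound_integral)
    fix s assume "s \<in> {u..v}"
    then have s: "u \<le> s" "s \<le> v" by auto
    have "norm (\<Sum>i\<in>UNIV. \<xi>' s $ i *\<^sub>R (B i s - c i)) \<le> (\<Sum>i\<in>(UNIV :: 'm set). norm (\<xi>' s) * \<eta>)"
    proof (rule sum_norm_le)
      fix i
      have "\<bar>\<xi>' s $ i\<bar> * norm (B i s - c i) \<le> norm (\<xi>' s) * \<eta>"
        using \<eta>[OF s] component_le_norm_cart[of "\<xi>' s" i] by (intro mult_mono) auto
      then show "norm (\<xi>' s $ i *\<^sub>R (B i s - c i)) \<le> norm (\<xi>' s) * \<eta>" by simp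
    qed
    then show "norm (\<Sum>i\<in>UNIV. \<xi>' s $ i *\<^sub>R (B i s - c i)) \<le> \<eta> * real CARD('m) * norm (\<xi>' s)"
      by (simp add: mult_ac)
  next
    show "(\<lambda>s. \<Sum>i\<in>UNIV. \<xi>' s $ i *\<^sub>R (B i s - c i)) integrable_on {u..v}" using d by blast
    show "(\<lambda>s. \<eta> * real CARD('m) * norm (\<xi>' s)) integrable_on {u..v}"
      using integrable_cmul[OF norm_\<xi>'_integrable[OF uv(1,3)], of "\<eta> * real CARD('m)"] by simp
  qed
  then show ?thesis
    using integral_unique[OF d] G_diff[OF uv] by simp
qed

lemma freeze:
  assumes t: "t \<in> {a..b}" and s: "s \<in> {a..b}"
    and \<eta>: "\<And>i r. r \<in> {a..b} \<Longrightarrow> \<bar>r - t\<bar> \<le> \<bar>s - t\<bar> \<Longrightarrow> norm (B i r - B i t) \<le> \<eta>"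
  shows "norm (Y s - Y t - (\<Sum>i\<in>UNIV. (\<xi> s - \<xi> t) $ i *\<^sub>R B i t)) \<le> \<eta> * real CARD('m) * \<bar>G s - G t\<bar>"
proof (cases "t \<le> s")
  case True
  have "norm (Y s - Y t - (\<Sum>i\<in>UNIV. (\<xi> s - \<xi> t) $ i *\<^sub>R B i t)) \<le> \<eta> * real CARD('m) * (G s - G t)"
    using t s True by (intro freeze_ordered \<eta>) auto
  then show ?thesis using G_mono[of t s] t s True by simp
next
  case False
  have "norm (Y t - Y s - (\<Sum>i\<in>UNIV. (\<xi> t - \<xi> s) $ i *\<^sub>R B i t)) \<le> \<eta> * real CARD('m) * (G t - G s)"
    using t s False by (intro freeze_ordered \<eta>) auto
  moreover have "Y s - Y t - (\<Sum>i\<in>UNIV. (\<xi> s - \<xi> t) $ i *\<^sub>R B i t)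
      = - (Y t - Y s - (\<Sum>i\<in>UNIV. (\<xi> t - \<xi> s) $ i *\<^sub>R B i t))"
    by (simp add: algebra_simps sum_subtractf)
  ultimately have "norm (Y s - Y t - (\<Sum>i\<in>UNIV. (\<xi> s - \<xi> t) $ i *\<^sub>R B i t)) \<le> \<eta> * real CARD('m) * (G t - G s)"
    by (simp only: norm_minus_cancel)
  then show ?thesis using G_mono[of s t] t s False by simp
qed

text \<open>No Lebesgue point is needed here: since \<open>B\<close> varies by \<open>O(h)\<close> on an interval of length
  \<open>h\<close> around \<open>t\<close>, freezing it at \<open>t\<close> costs only \<open>O(h)\<close> times the variation of \<open>\<xi>\<close> on that
  interval, which is \<open>o(h)\<close>.\<close>

lemma has_vector_derivative_Y:
  assumes t: "t \<in> {a..b}" and D: "(\<xi> has_vector_derivative D) (at t within {a..b})"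
    and L: "L \<ge> 0" "\<And>i s. s \<in> {a..b} \<Longrightarrow> norm (B i s - B i t) \<le> L * \<bar>s - t\<bar>"
  shows "(Y has_vector_derivative (\<Sum>i\<in>UNIV. D $ i *\<^sub>R B i t)) (at t within {a..b})"
proof -
  define W where "W s = (\<Sum>i\<in>UNIV. \<xi> s $ i *\<^sub>R B i t)" for s
  have "bounded_linear (\<lambda>z :: real ^ 'm. \<Sum>i\<in>UNIV. z $ i *\<^sub>R B i t)"
    by (intro bounded_linear_sum bounded_linear_scaleR_left[THEN bounded_linear_compose] bounded_linear_vec_nth)
  from bounded_linear.has_vector_derivative[OF this D]
  have W: "(W has_vector_derivative (\<Sum>i\<in>UNIV. D $ i *\<^sub>R B i t)) (at t within {a..b})"
    unfolding W_def .
  have est: "norm ((Y s - W s) - (Y t - W t)) \<le> L * \<bar>s - t\<bar> * real CARD('m) * \<bar>G s - G t\<bar>"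
    if "s \<in> {a..b}" for s
  proof -
    have "norm (B i r - B i t) \<le> L * \<bar>s - t\<bar>" if r: "r \<in> {a..b}" "\<bar>r - t\<bar> \<le> \<bar>s - t\<bar>" for i r
      using L(2)[OF r(1), of i] mult_left_mono[OF r(2) L(1)] by linarith
    from freeze[OF t \<open>s \<in> {a..b}\<close> this]
    show ?thesis by (simp add: W_def algebra_simps sum_subtractf)
  qed
  have "((\<lambda>s. Y s - W s) has_vector_derivative 0) (at t within {a..b})"
    unfolding has_vector_derivative_def has_derivative_within_alt
  proof (intro conjI allI impI)
    fix e :: real assume "e > 0"
    then have "e / (L * real CARD('m) + 1) > 0" using L(1) by (simp add: add_nonneg_pos)
    then obtain d where "d > 0" and d: "\<And>s. s \<in> {a..b} \<Longrightarrow> \<bar>s - t\<bar> < d \<Longrightarrow> \<bar>G s - G t\<bar> < e / (L * real CARD('m) + 1)"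
      using G_near[OF t] by blast
    have "norm ((Y s - W s) - (Y t - W t) - (s - t) *\<^sub>R 0) \<le> e * norm (s - t)"
      if s: "s \<in> {a..b}" "norm (s - t) < d" for s
    proof -
      have "(L * real CARD('m)) * \<bar>G s - G t\<bar> \<le> (L * real CARD('m) + 1) * (e / (L * real CARD('m) + 1))"
        using d[of s] s L(1) by (intro mult_mono) auto
      also have "\<dots> = e"
      proof -
        have "L * real CARD('m) + 1 > 0" using L(1) by (simp add: add_nonneg_pos)
        then show ?thesis by simp
      qed
      finally have "\<bar>s - t\<bar> * ((L * real CARD('m)) * \<bar>G s - G t\<bar>) \<le> \<bar>s - t\<bar> * e"
        by (intro mult_left_mono) auto
      then show ?thesis using est[OF s(1)] by (simp add: mult_ac)
    qed
    then show "\<exists>d>0. \<forall>s\<in>{a..b}. norm (s - t) < d \<longrightarrow>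
        norm ((Y s - W s) - (Y t - W t) - (s - t) *\<^sub>R 0) \<le> e * norm (s - t)"
      using \<open>d > 0\<close> by blast
  qed simp
  from has_vector_derivative_add[OF this W] show ?thesis by simp
qed

text \<open>The bound on \<open>B\<close> involves \<open>Y\<close> itself, so the estimate has to
  be closed by absorption. If h is the distance to \<open>t\<close> and m the largest deviation of
  \<open>Y\<close> within that distance, freezing gives m \<le> (h + m)/2 + C2 h, hence m \<le> (2
  C2 + 1) h. The factor 1/2 comes from continuity of \<open>G\<close> at \<open>t\<close>.\<close>

lemma Y_pointwise_lipschitz:
  assumes t: "t \<in> {a..b}" and D: "(\<xi> has_vector_derivative D) (at t within {a..b})"
    and \<xi>: "continuous_on {a..b} \<xi>" and Y: "continuous_on {a..b} Y"
    and C: "C \<ge> 0" "\<And>i s. s \<in> {a..b} \<Longrightarrow> norm (B i s - B i t) \<le> C * (\<bar>s - t\<bar> + norm (Y s - Y t))"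
  shows "\<exists>L\<ge>0. \<forall>s\<in>{a..b}. norm (Y s - Y t) \<le> L * \<bar>s - t\<bar>"
proof -
  obtain L0 where L0: "L0 \<ge> 0" "\<And>s. s \<in> {a..b} \<Longrightarrow> norm (\<xi> s - \<xi> t) \<le> L0 * \<bar>s - t\<bar>"
    using differentiable_imp_pointwise_lipschitz[OF \<xi> D] by blast
  define C2 where "C2 = L0 * (\<Sum>i\<in>UNIV. norm (B i t))"
  define C1 where "C1 = C * real CARD('m)"
  have "C1 \<ge> 0" "C2 \<ge> 0" using C(1) L0(1) by (auto simp: C1_def C2_def intro!: sum_nonneg mult_nonneg_nonneg)
  then have "1 / (2 * (C1 + 1)) > 0" by simp
  then obtain d where "d > 0" and d: "\<And>s. s \<in> {a..b} \<Longrightarrow> \<bar>s - t\<bar> < d \<Longrightarrow> \<bar>G s - G t\<bar> < 1 / (2 * (C1 + 1))"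
    using G_near[OF t] by blast
  have near: "norm (Y s - Y t) \<le> (2 * C2 + 1) * \<bar>s - t\<bar>" if s: "s \<in> {a..b}" "\<bar>s - t\<bar> < d" for s
  proof -
    let ?h = "\<bar>s - t\<bar>"
    \<comment> \<open>Freezing is applied at a maximizer \<open>r\<close> of the deviation of
      \<open>Y\<close> on this interval, so that the resulting inequality contains no other value of
      the deviation.\<close>
    let ?I = "{a..b} \<inter> cball t ?h"
    have "compact ?I" by (intro compact_Int) auto
    moreover have "?I \<noteq> {}" using t by auto
    moreover have "continuous_on ?I Y" by (rule continuous_on_subset[OF Y]) simp
    then have "continuous_on ?I (\<lambda>r. norm (Y r - Y t))" by (intro continuous_intros)
    ultimately obtain r where r: "r \<in> ?I" "\<And>p. p \<in> ?I \<Longrightarrow> norm (Y p - Y t) \<le> norm (Y r - Y t)"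
      using continuous_attains_sup[of ?I "\<lambda>r. norm (Y r - Y t)"] by blast
    let ?m = "norm (Y r - Y t)"
    have rh: "r \<in> {a..b}" "\<bar>r - t\<bar> \<le> ?h" using r(1) by (auto simp: dist_real_def)
    have "norm (B i p - B i t) \<le> C * (?h + ?m)" if p: "p \<in> {a..b}" "\<bar>p - t\<bar> \<le> \<bar>r - t\<bar>" for i p
    proof -
      have "p \<in> ?I" using p rh by (auto simp: dist_real_def)
      then have "C * (\<bar>p - t\<bar> + norm (Y p - Y t)) \<le> C * (?h + ?m)"
        using p rh r(2) C(1) by (intro mult_left_mono add_mono) auto
      then show ?thesis using C(2)[OF p(1), of i] by linarith
    qed
    from freeze[OF t rh(1) this]
    have 1: "norm (Y r - Y t - (\<Sum>i\<in>UNIV. (\<xi> r - \<xi> t) $ i *\<^sub>R B i t)) \<le> (?h + ?m) * (C1 * \<bar>G r - G t\<bar>)"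
      by (simp add: C1_def mult_ac)
    have "norm (\<Sum>i\<in>UNIV. (\<xi> r - \<xi> t) $ i *\<^sub>R B i t) \<le> (\<Sum>i\<in>UNIV. L0 * ?h * norm (B i t))"
    proof (rule sum_norm_le)
      fix i
      have "\<bar>(\<xi> r - \<xi> t) $ i\<bar> \<le> L0 * ?h"
        using component_le_norm_cart[of "\<xi> r - \<xi> t" i] L0(2)[OF rh(1)] mult_left_mono[OF rh(2) L0(1)] by linarith
      then have "\<bar>(\<xi> r - \<xi> t) $ i\<bar> * norm (B i t) \<le> L0 * ?h * norm (B i t)" by (rule mult_right_mono) simp
      then show "norm ((\<xi> r - \<xi> t) $ i *\<^sub>R B i t) \<le> L0 * ?h * norm (B i t)" by simp
    qed
    also have "\<dots> = C2 * ?h" by (simp add: C2_def sum_distrib_left mult_ac)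
    finally have 2: "norm (\<Sum>i\<in>UNIV. (\<xi> r - \<xi> t) $ i *\<^sub>R B i t) \<le> C2 * ?h" .
    have "C1 * \<bar>G r - G t\<bar> \<le> (C1 + 1) * (1 / (2 * (C1 + 1)))"
      using d[OF rh(1)] rh(2) s(2) \<open>C1 \<ge> 0\<close> by (intro mult_mono) auto
    also have "\<dots> = 1 / 2" using \<open>C1 \<ge> 0\<close> by simp
    finally have "(?h + ?m) * (C1 * \<bar>G r - G t\<bar>) \<le> (?h + ?m) * (1 / 2)"
      by (intro mult_left_mono) auto
    moreover have "?m \<le> norm (Y r - Y t - (\<Sum>i\<in>UNIV. (\<xi> r - \<xi> t) $ i *\<^sub>R B i t))
        + norm (\<Sum>i\<in>UNIV. (\<xi> r - \<xi> t) $ i *\<^sub>R B i t)"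
      using norm_triangle_ineq[of "Y r - Y t - (\<Sum>i\<in>UNIV. (\<xi> r - \<xi> t) $ i *\<^sub>R B i t)"
          "\<Sum>i\<in>UNIV. (\<xi> r - \<xi> t) $ i *\<^sub>R B i t"] by simp
    ultimately have "?m \<le> (?h + ?m) * (1 / 2) + C2 * ?h" using 1 2 by linarith
    then have "?m \<le> (2 * C2 + 1) * ?h" by (simp add: algebra_simps)
    moreover have "norm (Y s - Y t) \<le> ?m" using s(1) by (intro r(2)) (auto simp: dist_real_def)
    ultimately show ?thesis by linarith
  qed
  obtain M where M: "M > 0" "\<And>s. s \<in> {a..b} \<Longrightarrow> norm (Y s) \<le> M"
    using compact_imp_bounded[OF compact_continuous_image[OF Y compact_Icc]]
    unfolding bounded_pos by auto
  define L where "L = max (2 * C2 + 1) (2 * M / d)"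
  have "norm (Y s - Y t) \<le> L * \<bar>s - t\<bar>" if s: "s \<in> {a..b}" for s
  proof (cases "\<bar>s - t\<bar> < d")
    case True
    have "(2 * C2 + 1) * \<bar>s - t\<bar> \<le> L * \<bar>s - t\<bar>" by (intro mult_right_mono) (auto simp: L_def)
    then show ?thesis using near[OF s True] by linarith
  next
    case False
    have "norm (Y s - Y t) \<le> 2 * M"
      using M(2)[OF s] M(2)[OF t] norm_triangle_ineq4[of "Y s" "Y t"] by linarith
    also have "\<dots> = 2 * M / d * d" using \<open>d > 0\<close> by simp
    also have "\<dots> \<le> L * \<bar>s - t\<bar>"
      using False \<open>d > 0\<close> M(1) \<open>C2 \<ge> 0\<close> by (intro mult_mono) (auto simp: L_def le_max_iff_disj)
    finally show ?thesis .
  qed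
  moreover have "L \<ge> 0" using \<open>C2 \<ge> 0\<close> by (simp add: L_def le_max_iff_disj)
  ultimately show ?thesis by blast
qed

text \<open>The Lipschitz bound for \<open>Y\<close> at \<open>t\<close> turns the self-referential
  bound on \<open>B\<close> into a bound by the distance alone, which is what
  \<open>has_vector_derivative_Y\<close> requires.\<close>

lemma has_vector_derivative_Y_nonlinear:
  assumes t: "t \<in> {a..b}" and D: "(\<xi> has_vector_derivative D) (at t within {a..b})"
    and \<xi>: "continuous_on {a..b} \<xi>" and Y: "continuous_on {a..b} Y"
    and C: "C \<ge> 0" "\<And>i s. s \<in> {a..b} \<Longrightarrow> norm (B i s - B i t) \<le> C * (\<bar>s - t\<bar> + norm (Y s - Y t))"
  shows "(Y has_vector_derivative (\<Sum>i\<in>UNIV. D $ i *\<^sub>R B i t)) (at t within {a..b})"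
proof -
  obtain L where L: "L \<ge> 0" "\<And>s. s \<in> {a..b} \<Longrightarrow> norm (Y s - Y t) \<le> L * \<bar>s - t\<bar>"
    using Y_pointwise_lipschitz[OF assms] by blast
  show ?thesis
  proof (rule has_vector_derivative_Y[OF t D, of "C * (1 + L)"])
    fix i s assume s: "s \<in> {a..b}"
    have "C * (\<bar>s - t\<bar> + norm (Y s - Y t)) \<le> C * (\<bar>s - t\<bar> + L * \<bar>s - t\<bar>)"
      using L(2)[OF s] C(1) by (intro mult_left_mono add_left_mono)
    then show "norm (B i s - B i t) \<le> C * (1 + L) * \<bar>s - t\<bar>"
      using C(2)[OF s, of i] by (simp add: algebra_simps)
  qed (use C(1) L(1) in simp)
qed

end

section \<open>Smooth functions\<close>

lemma smooth_on_imp_has_derivative: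
  "smooth_on S f \<Longrightarrow> z \<in> S \<Longrightarrow> (f has_derivative frechet_derivative f (at z)) (at z)"
  unfolding smooth_on_def using frechet_derivative_works Ck_on.simps(2) by blast

lemma smooth_on_directional_derivative:
  "smooth_on S f \<Longrightarrow> smooth_on S (\<lambda>z. frechet_derivative f (at z) v)"
  unfolding smooth_on_def using Ck_on.simps(2) by blast

lemma smooth_on_imp_continuous_on: "smooth_on S f \<Longrightarrow> continuous_on S f"
  unfolding smooth_on_def using Ck_on.simps(1) by blast

text \<open>\<open>Ck_on\<close> provides continuity of each directional derivative, not of the
  operator norm. The sum of the norms over a basis is continuous and dominates the operator norm,
  and the mean value inequality applies on a convex ball.\<close>

lemma smooth_on_imp_locally_lipschitz_on:
  fixes f :: "'a::euclidean_space \<Rightarrow> 'b::real_normed_vector"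
  assumes f: "smooth_on S f" and "open S"
  shows "locally_lipschitz_on S f"
  unfolding locally_lipschitz_on_def
proof
  fix z assume "z \<in> S"
  let ?D = "\<lambda>p. frechet_derivative f (at p)"
  have cont: "isCont (\<lambda>p. \<Sum>b\<in>Basis. norm (?D p b)) z"
    using smooth_on_imp_continuous_on[OF smooth_on_directional_derivative[OF f]] \<open>open S\<close> \<open>z \<in> S\<close>
    by (intro continuous_intros) (simp add: continuous_on_eq_continuous_at)
  define L where "L = (\<Sum>b\<in>Basis. norm (?D z b)) + 1"
  have "\<forall>\<^sub>F p in nhds z. (\<Sum>b\<in>Basis. norm (?D p b)) < L"
    using cont unfolding isCont_def tendsto_at_iff_tendsto_nhds[of "\<lambda>p. \<Sum>b\<in>Basis. norm (?D p b)" z]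
    by (rule order_tendstoD(2)) (simp add: L_def)
  moreover have "\<forall>\<^sub>F p in nhds z. p \<in> S"
    using \<open>open S\<close> \<open>z \<in> S\<close> by (rule eventually_nhds_in_open)
  ultimately have "\<forall>\<^sub>F p in nhds z. p \<in> S \<and> (\<Sum>b\<in>Basis. norm (?D p b)) < L"
    by eventually_elim simp
  then obtain e where "e > 0" and e: "\<And>p. dist p z < e \<Longrightarrow> p \<in> S \<and> (\<Sum>b\<in>Basis. norm (?D p b)) < L"
    unfolding eventually_nhds_metric by blast
  have "norm (f u - f v) \<le> L * norm (u - v)" if uv: "u \<in> ball z e" "v \<in> ball z e" for u v
  proof (rule differentiable_bound[OF convex_ball _ _ uv(1) uv(2)])
    fix p assume "p \<in> ball z e"
    then have p: "p \<in> S" "(\<Sum>b\<in>Basis. norm (?D p b)) < L" using e[of p] by (auto simp: dist_commute)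
    have D: "(f has_derivative ?D p) (at p)" by (rule smooth_on_imp_has_derivative[OF f p(1)])
    then show "(f has_derivative ?D p) (at p within ball z e)" by (rule has_derivative_at_withinI)
    have "onorm (?D p) \<le> (\<Sum>b\<in>Basis. norm (?D p b))"
    proof (rule onorm_bound)
      fix h
      interpret bounded_linear "?D p" using D by (rule has_derivative_bounded_linear)
      have "?D p h = ?D p (\<Sum>b\<in>Basis. (h \<bullet> b) *\<^sub>R b)" by (simp add: euclidean_representation)
      also have "norm \<dots> \<le> (\<Sum>b\<in>Basis. norm h * norm (?D p b))"
        unfolding sum scaleR
        by (intro sum_norm_le) (auto intro!: mult_right_mono simp: Basis_le_norm)
      finally show "norm (?D p h) \<le> (\<Sum>b\<in>Basis. norm (?D p b)) * norm h"
        by (simp add: sum_distrib_left mult.commute)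
    qed (auto intro: sum_nonneg)
    then show "onorm (?D p) \<le> L" using p(2) by linarith
  qed
  then show "\<exists>e>0. \<exists>L. \<forall>u\<in>ball z e. \<forall>v\<in>ball z e. norm (f u - f v) \<le> L * norm (u - v)"
    using \<open>e > 0\<close> by blast
qed

section \<open>Symmetry of second derivatives\<close>

lemma has_derivative_along_line:
  fixes f :: "'a::real_normed_vector \<Rightarrow> real"
  assumes "(f has_derivative F) (at (p + r *\<^sub>R u))"
  shows "((\<lambda>r. f (p + r *\<^sub>R u)) has_real_derivative F u) (at r)"
proof -
  have "((\<lambda>r. p + r *\<^sub>R u) has_derivative (\<lambda>h. h *\<^sub>R u)) (at r)"
    by (auto intro!: derivative_eq_intros)
  from has_derivative_compose[OF this assms]
  have "((\<lambda>r. f (p + r *\<^sub>R u)) has_derivative (\<lambda>h. F (h *\<^sub>R u))) (at r)" .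
  moreover have "(\<lambda>h. F (h *\<^sub>R u)) = (*) (F u)"
    using linear_scale[OF has_derivative_linear[OF assms]] by (auto simp: mult.commute)
  ultimately show ?thesis by (simp add: has_field_derivative_def)
qed

text \<open>The second difference is symmetric in \<open>u\<close> and \<open>v\<close>. Two
  applications of the mean value theorem, first in direction \<open>u\<close> and then in direction
  \<open>v\<close>, express it as s^2 times a mixed derivative at a nearby point, which continuity
  compares with the one at \<open>z\<close>.\<close>

lemma second_difference_estimate:
  fixes f :: "'a::real_normed_vector \<Rightarrow> real"
  assumes "open S" "z \<in> S" and F: "\<And>p. p \<in> S \<Longrightarrow> (f has_derivative F p) (at p)"
    and F2: "\<And>p. p \<in> S \<Longrightarrow> ((\<lambda>p. F p u) has_derivative F2 p) (at p)"
    and cont: "isCont (\<lambda>p. F2 p v) z" and "e > 0"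
  shows "\<forall>\<^sub>F s in at_right 0. \<bar>f (z + s *\<^sub>R u + s *\<^sub>R v) - f (z + s *\<^sub>R u) - f (z + s *\<^sub>R v) + f z - s\<^sup>2 * F2 z v\<bar> \<le> e * s\<^sup>2"
proof -
  have "\<forall>\<^sub>F p in nhds z. p \<in> S" using \<open>open S\<close> \<open>z \<in> S\<close> by (rule eventually_nhds_in_open)
  moreover have "\<forall>\<^sub>F p in nhds z. dist (F2 p v) (F2 z v) < e"
    using cont unfolding isCont_def tendsto_at_iff_tendsto_nhds[of "\<lambda>p. F2 p v" z]
    by (rule tendstoD) (rule \<open>e > 0\<close>)
  ultimately have "\<forall>\<^sub>F p in nhds z. p \<in> S \<and> dist (F2 p v) (F2 z v) < e" by eventually_elim simp
  then obtain r where "r > 0" and r: "\<And>p. dist p z < r \<Longrightarrow> p \<in> S \<and> \<bar>F2 p v - F2 z v\<bar> < e"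
    unfolding eventually_nhds_metric dist_real_def by blast
  define s0 where "s0 = r / (norm u + norm v + 1)"
  have pos: "norm u + norm v + 1 > 0" using norm_ge_zero[of u] norm_ge_zero[of v] by linarith
  have "s0 > 0" using \<open>r > 0\<close> pos by (simp add: s0_def)
  have near: "dist (z + a *\<^sub>R u + b *\<^sub>R v) z < r" if "0 \<le> a" "a < s0" "0 \<le> b" "b < s0" for a b
  proof -
    have "norm (a *\<^sub>R u + b *\<^sub>R v) \<le> a * norm u + b * norm v"
      using that norm_triangle_ineq[of "a *\<^sub>R u" "b *\<^sub>R v"] by simp
    also have "\<dots> \<le> s0 * norm u + s0 * norm v" using that by (intro add_mono mult_right_mono) auto
    also have "\<dots> < s0 * (norm u + norm v + 1)" using \<open>s0 > 0\<close> by (simp add: distrib_left)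
    also have "\<dots> = r" using pos by (simp add: s0_def)
    finally show ?thesis by (simp add: dist_norm add.assoc)
  qed
  have main: "\<bar>f (z + s *\<^sub>R u + s *\<^sub>R v) - f (z + s *\<^sub>R u) - f (z + s *\<^sub>R v) + f z - s\<^sup>2 * F2 z v\<bar> \<le> e * s\<^sup>2"
    if s: "0 < s" "s < s0" for s
  proof -
    let ?g = "\<lambda>a. f ((z + s *\<^sub>R v) + a *\<^sub>R u) - f (z + a *\<^sub>R u)"
    have "\<exists>a>0. a < s \<and> ?g s - ?g 0 = (s - 0) * (F ((z + s *\<^sub>R v) + a *\<^sub>R u) u - F (z + a *\<^sub>R u) u)"
    proof (rule MVT2[OF s(1)])
      fix a assume a: "0 \<le> a" "a \<le> s"
      have "(z + s *\<^sub>R v) + a *\<^sub>R u \<in> S" "z + a *\<^sub>R u \<in> S"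
        using r near[of a s] near[of a 0] a s by (auto simp: add_ac)
      then show "(?g has_real_derivative F ((z + s *\<^sub>R v) + a *\<^sub>R u) u - F (z + a *\<^sub>R u) u) (at a)"
        by (intro DERIV_diff has_derivative_along_line F)
    qed
    then obtain a where a: "0 < a" "a < s" and ga: "?g s - ?g 0 = s * (F ((z + s *\<^sub>R v) + a *\<^sub>R u) u - F (z + a *\<^sub>R u) u)"
      by auto
    let ?k = "\<lambda>b. F ((z + a *\<^sub>R u) + b *\<^sub>R v) u"
    have "\<exists>b>0. b < s \<and> ?k s - ?k 0 = (s - 0) * F2 ((z + a *\<^sub>R u) + b *\<^sub>R v) v"
    proof (rule MVT2[OF s(1)])
      fix b assume b: "0 \<le> b" "b \<le> s"
      have "(z + a *\<^sub>R u) + b *\<^sub>R v \<in> S" using r near[of a b] a b s by auto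
      then show "(?k has_real_derivative F2 ((z + a *\<^sub>R u) + b *\<^sub>R v) v) (at b)"
        by (intro has_derivative_along_line F2)
    qed
    then obtain b where b: "0 < b" "b < s" and kb: "?k s - ?k 0 = s * F2 ((z + a *\<^sub>R u) + b *\<^sub>R v) v"
      by auto
    have "f (z + s *\<^sub>R u + s *\<^sub>R v) - f (z + s *\<^sub>R u) - f (z + s *\<^sub>R v) + f z = ?g s - ?g 0"
      by (simp add: add_ac)
    also have "\<dots> = s * (?k s - ?k 0)" using ga by (simp add: add_ac)
    also have "\<dots> = s\<^sup>2 * F2 (z + a *\<^sub>R u + b *\<^sub>R v) v" using kb by (simp add: power2_eq_square)
    finally have "f (z + s *\<^sub>R u + s *\<^sub>R v) - f (z + s *\<^sub>R u) - f (z + s *\<^sub>R v) + f z - s\<^sup>2 * F2 z v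
        = s\<^sup>2 * (F2 (z + a *\<^sub>R u + b *\<^sub>R v) v - F2 z v)"
      by (simp add: right_diff_distrib)
    also have "\<bar>\<dots>\<bar> = s\<^sup>2 * \<bar>F2 (z + a *\<^sub>R u + b *\<^sub>R v) v - F2 z v\<bar>" by (simp add: abs_mult)
    also have "\<dots> \<le> s\<^sup>2 * e"
      using r[of "z + a *\<^sub>R u + b *\<^sub>R v"] near[of a b] a b s by (intro mult_left_mono) auto
    finally show ?thesis by (simp add: mult.commute)
  qed
  show ?thesis unfolding eventually_at_right_field
    using \<open>s0 > 0\<close> by (intro exI[of _ s0]) (use main in auto)
qed

lemma symmetric_second_derivative_real:
  fixes f :: "'a::real_normed_vector \<Rightarrow> real"
  assumes "open S" "z \<in> S" and F: "\<And>p. p \<in> S \<Longrightarrow> (f has_derivative F p) (at p)"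
    and F2: "\<And>p w. p \<in> S \<Longrightarrow> ((\<lambda>p. F p w) has_derivative F2 w p) (at p)"
    and cont: "\<And>w w'. isCont (\<lambda>p. F2 w p w') z"
  shows "F2 u z v = F2 v z u"
proof (rule ccontr)
  assume ne: "F2 u z v \<noteq> F2 v z u"
  \<comment> \<open>One second difference approximates both mixed derivatives up to
    \<open>e\<close>, so they differ by at most 2e, while their distance is 3e.\<close>
  define e where "e = \<bar>F2 u z v - F2 v z u\<bar> / 3"
  have "e > 0" using ne by (simp add: e_def)
  let ?d = "\<lambda>s u v. f (z + s *\<^sub>R u + s *\<^sub>R v) - f (z + s *\<^sub>R u) - f (z + s *\<^sub>R v) + f z"
  have "\<forall>\<^sub>F s in at_right 0. \<bar>?d s u v - s\<^sup>2 * F2 u z v\<bar> \<le> e * s\<^sup>2"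
    by (rule second_difference_estimate[OF assms(1,2) F F2 cont \<open>e > 0\<close>])
  moreover have "\<forall>\<^sub>F s in at_right 0. \<bar>?d s v u - s\<^sup>2 * F2 v z u\<bar> \<le> e * s\<^sup>2"
    by (rule second_difference_estimate[OF assms(1,2) F F2 cont \<open>e > 0\<close>])
  moreover have "\<forall>\<^sub>F s in at_right 0. (0::real) < s" by (rule eventually_at_right_less)
  ultimately have "\<forall>\<^sub>F s in at_right (0::real). False"
  proof eventually_elim
    case (elim s)
    have "?d s v u = ?d s u v" by (simp add: add_ac)
    then have "\<bar>s\<^sup>2 * F2 u z v - s\<^sup>2 * F2 v z u\<bar> \<le> 2 * (e * s\<^sup>2)" using elim by linarith
    moreover have "\<bar>s\<^sup>2 * F2 u z v - s\<^sup>2 * F2 v z u\<bar> = s\<^sup>2 * (3 * e)"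
      by (simp only: abs_mult e_def flip: right_diff_distrib) simp
    ultimately have "s\<^sup>2 * (3 * e) \<le> s\<^sup>2 * (2 * e)" by (simp add: mult_ac)
    then show False using \<open>e > 0\<close> elim by simp
  qed
  then show False by simp
qed

lemma symmetric_second_derivative:
  fixes f :: "'a::real_normed_vector \<Rightarrow> 'b::real_inner"
  assumes "open S" "z \<in> S" and f: "smooth_on S f"
  shows "frechet_derivative (\<lambda>p. frechet_derivative f (at p) u) (at z) v
       = frechet_derivative (\<lambda>p. frechet_derivative f (at p) v) (at z) u"
proof -
  let ?F = "\<lambda>p. frechet_derivative f (at p)"
  let ?F2 = "\<lambda>w p. frechet_derivative (\<lambda>p. ?F p w) (at p)"
  have "?F2 u z v \<bullet> w = ?F2 v z u \<bullet> w" for w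
  proof (rule symmetric_second_derivative_real[OF assms(1,2), where f = "\<lambda>p. f p \<bullet> w" and F = "\<lambda>p h. ?F p h \<bullet> w"
        and ?F2.0 = "\<lambda>k p h. ?F2 k p h \<bullet> w"])
    show "((\<lambda>p. f p \<bullet> w) has_derivative (\<lambda>h. ?F p h \<bullet> w)) (at p)" if "p \<in> S" for p
      using smooth_on_imp_has_derivative[OF f that] by (rule has_derivative_inner_left)
    show "((\<lambda>p. ?F p k \<bullet> w) has_derivative (\<lambda>h. ?F2 k p h \<bullet> w)) (at p)" if "p \<in> S" for p k
      using smooth_on_imp_has_derivative[OF smooth_on_directional_derivative[OF f] that]
      by (rule has_derivative_inner_left)
    show "isCont (\<lambda>p. ?F2 k p k' \<bullet> w) z" for k k'
      using smooth_on_imp_continuous_on[OF smooth_on_directional_derivative[OF smooth_on_directional_derivative[OF f]]]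
        assms(1,2)
      by (intro continuous_intros) (simp add: continuous_on_eq_continuous_at)
  qed
  then show ?thesis by (metis vector_eq_rdot)
qed

section \<open>Differentiability of determinants, inverse matrices and Christoffel symbols\<close>

lemma differentiable_prod:
  fixes f :: "'i \<Rightarrow> 'a::real_normed_vector \<Rightarrow> real"
  shows "(\<And>i. i \<in> I \<Longrightarrow> f i differentiable at x within S) \<Longrightarrow> (\<lambda>z. \<Prod>i\<in>I. f i z) differentiable at x within S"
proof (induction I rule: infinite_finite_induct)
  case (insert i I)
  then show ?case
  proof -
    obtain D where D: "(f i has_derivative D) (at x within S)"
      using insert.prems[of i] unfolding differentiable_def by auto
    obtain E where E: "((\<lambda>z. \<Prod>i\<in>I. f i z) has_derivative E) (at x within S)"
      using insert unfolding differentiable_def by auto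
    show ?thesis
      using has_derivative_mult[OF D E] insert.hyps unfolding differentiable_def by auto
  qed
qed auto

lemma differentiable_det:
  fixes A :: "'a::real_normed_vector \<Rightarrow> real ^ 'n ^ 'n"
  assumes "\<And>i j. (\<lambda>z. A z $ i $ j) differentiable (at z)"
  shows "(\<lambda>z. det (A z)) differentiable (at z)"
  unfolding det_def
proof (intro differentiable_sum differentiable_mult ballI)
  show "(\<lambda>z. \<Prod>i\<in>UNIV. A z $ i $ p i) differentiable (at z)" for p
    by (rule differentiable_prod) (rule assms)
qed simp_all

text \<open>Cramer's rule, used to see that the entries of the inverse metric are quotients of
  polynomials in the entries of the metric.\<close>

lemma matrix_inv_entry:
  fixes A :: "real ^ 'n ^ 'n"
  assumes "det A \<noteq> 0"
  shows "matrix_inv A $ k $ l = det (\<chi> i j. if j = k then axis l 1 $ i else A $ i $ j) / det A"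
proof -
  have inv: "A ** matrix_inv A = mat 1"
    using assms unfolding invertible_det_nz[symmetric] invertible_def matrix_inv_def
    by (metis (mono_tags, lifting) someI_ex)
  have "A *v (matrix_inv A *v axis l 1) = axis l 1"
    by (simp add: matrix_vector_mul_assoc inv)
  then have "matrix_inv A *v axis l 1 = (\<chi> k. det (\<chi> i j. if j = k then axis l 1 $ i else A $ i $ j) / det A)"
    using cramer[OF assms] by blast
  moreover have "(matrix_inv A *v axis l 1) $ k = matrix_inv A $ k $ l"
    by (simp add: matrix_vector_mult_basis column_def)
  ultimately show ?thesis by simp
qed

lemma partial_deriv_eq_component:
  assumes "smooth_on S G" "z \<in> S"
  shows "partial_deriv i (\<lambda>y. G y $ j $ l) z = frechet_derivative G (at z) (axis i 1) $ j $ l"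
proof -
  have "((\<lambda>y. G y $ j $ l) has_derivative (\<lambda>h. frechet_derivative G (at z) h $ j $ l)) (at z)"
    using smooth_on_imp_has_derivative[OF assms]
    by (intro bounded_linear.has_derivative[OF bounded_linear_vec_nth])
  then show ?thesis
    unfolding partial_deriv_def by (simp flip: frechet_derivative_at)
qed

text \<open>One derivative of the Christoffel symbols is what makes the coefficients of the
  transport equation vary by O(h) at each time at which the curve has a velocity.\<close>

lemma christoffel_differentiable:
  fixes G :: "real ^ 'n \<Rightarrow> real ^ 'n ^ 'n"
  assumes G: "smooth_on S G" and "open S" "z \<in> S" and nz: "\<And>z. z \<in> S \<Longrightarrow> det (G z) \<noteq> 0"
  shows "(\<lambda>z. christoffel G z k i j) differentiable (at z)"
proof -
  have comp: "(\<lambda>z. H z $ a $ b) differentiable (at z)" if "smooth_on S H"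
    for H :: "real ^ 'n \<Rightarrow> real ^ 'n ^ 'n" and a b
    unfolding differentiable_def
    by (rule exI, rule bounded_linear.has_derivative[OF bounded_linear_vec_nth],
        rule bounded_linear.has_derivative[OF bounded_linear_vec_nth],
        rule smooth_on_imp_has_derivative[OF that \<open>z \<in> S\<close>])
  have inv: "(\<lambda>z. matrix_inv (G z) $ a $ b) differentiable (at z)" for a b
  proof -
    have "(\<lambda>z. det (\<chi> p q. if q = a then axis b 1 $ p else G z $ p $ q) / det (G z)) differentiable (at z)"
    proof (intro differentiable_divide differentiable_det nz \<open>z \<in> S\<close>)
      fix p q
      show "(\<lambda>z. (\<chi> p q. if q = a then axis b 1 $ p else G z $ p $ q) $ p $ q) differentiable (at z)"
        using comp[OF G] by (cases "q = a") simp_all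
    qed (rule comp[OF G])
    then obtain D where D: "((\<lambda>z. det (\<chi> p q. if q = a then axis b 1 $ p else G z $ p $ q) / det (G z)) has_derivative D) (at z)"
      unfolding differentiable_def by blast
    have "((\<lambda>z. matrix_inv (G z) $ a $ b) has_derivative D) (at z)"
      by (rule has_derivative_transform_within_open[OF D \<open>open S\<close> \<open>z \<in> S\<close>]) (simp add: matrix_inv_entry nz)
    then show ?thesis unfolding differentiable_def by blast
  qed
  have pd: "(\<lambda>z. partial_deriv p (\<lambda>y. G y $ q $ r) z) differentiable (at z)" for p q r
  proof -
    obtain D where D: "((\<lambda>z. frechet_derivative G (at z) (axis p 1) $ q $ r) has_derivative D) (at z)"
      using comp[OF smooth_on_directional_derivative[OF G]] unfolding differentiable_def by blast
    have "((\<lambda>z. partial_deriv p (\<lambda>y. G y $ q $ r) z) has_derivative D) (at z)"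
      by (rule has_derivative_transform_within_open[OF D \<open>open S\<close> \<open>z \<in> S\<close>])
        (simp add: partial_deriv_eq_component[OF G])
    then show ?thesis unfolding differentiable_def by blast
  qed
  show ?thesis
    unfolding christoffel_def
    by (intro differentiable_divide differentiable_sum ballI differentiable_mult inv differentiable_diff
        differentiable_add pd differentiable_const) simp_all
qed

section \<open>Charts, tangent spaces and the metric in coordinates\<close>

lemma sum_fun_apply: "(\<Sum>i\<in>I. f i) x = (\<Sum>i\<in>I. f i x)"
  by (induction I rule: infinite_finite_induct) (simp_all add: zero_fun_def plus_fun_def)

locale oriented_riemannian =
  fixes M :: "('a, 'n::finite) rmanifold"
  assumes oriented_riemannian: "oriented_riemannian_manifold M"
begin

lemma oriented_smooth: "oriented_smooth_manifold M"
  using oriented_riemannian by (simp add: oriented_riemannian_manifold_def)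

lemma chart_openin: "c \<in> atlas M \<Longrightarrow> openin (mtop M) (fst c)"
  and chart_open: "c \<in> atlas M \<Longrightarrow> open (snd c ` fst c)"
  and chart_homeo: "c \<in> atlas M \<Longrightarrow>
    homeomorphic_map (subtopology (mtop M) (fst c)) (top_of_set (snd c ` fst c)) (snd c)"
  using oriented_smooth by (simp_all add: oriented_smooth_manifold_def)

lemma topspace_eq: "topspace (mtop M) = (\<Union>c\<in>atlas M. fst c)"
  using oriented_smooth by (simp add: oriented_smooth_manifold_def)

lemma charts_at_nonempty: "p \<in> topspace (mtop M) \<Longrightarrow> charts_at M p \<noteq> {}"
  by (auto simp: topspace_eq charts_at_def)

lemma chart_subset: "c \<in> atlas M \<Longrightarrow> fst c \<subseteq> topspace (mtop M)"
  by (auto simp: topspace_eq)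

lemma chart_inj: "c \<in> atlas M \<Longrightarrow> inj_on (snd c) (fst c)"
  using homeomorphic_imp_injective_map[OF chart_homeo] chart_subset by (simp add: topspace_subtopology Int_absorb1)

lemma chart_inv_chart [simp]: "c \<in> atlas M \<Longrightarrow> p \<in> fst c \<Longrightarrow> chart_inv c (snd c p) = p"
  by (simp add: chart_inv_def inv_into_f_f chart_inj)

lemma transition_chart [simp]: "c \<in> atlas M \<Longrightarrow> p \<in> fst c \<Longrightarrow> transition c d (snd c p) = snd d p"
  by (simp add: transition_def)

lemma chart_image_open:
  assumes "c \<in> atlas M" "openin (mtop M) U" "U \<subseteq> fst c"
  shows "open (snd c ` U)"
proof -
  have "openin (subtopology (mtop M) (fst c)) U"
    using assms by (metis openin_subtopology inf.absorb1)
  then have "openin (top_of_set (snd c ` fst c)) (snd c ` U)"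
    using homeomorphic_imp_open_map[OF chart_homeo[OF assms(1)]] by (simp add: open_map_def)
  then show ?thesis
    using chart_open[OF assms(1)] openin_open_trans by blast
qed

lemma overlap_open: "c \<in> atlas M \<Longrightarrow> d \<in> atlas M \<Longrightarrow> open (snd c ` (fst c \<inter> fst d))"
  by (rule chart_image_open) (auto intro: chart_openin)

lemma transition_smooth: "c \<in> atlas M \<Longrightarrow> d \<in> atlas M \<Longrightarrow> smooth_on (snd c ` (fst c \<inter> fst d)) (transition c d)"
  using oriented_smooth by (simp add: oriented_smooth_manifold_def)

lemma charts_atD: "c \<in> charts_at M p \<Longrightarrow> c \<in> atlas M" "c \<in> charts_at M p \<Longrightarrow> p \<in> fst c"
  by (auto simp: charts_at_def)

lemma charts_atI: "c \<in> atlas M \<Longrightarrow> p \<in> fst c \<Longrightarrow> c \<in> charts_at M p"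
  by (auto simp: charts_at_def)

lemma transition_has_derivative:
  "c \<in> charts_at M p \<Longrightarrow> d \<in> charts_at M p \<Longrightarrow>
    (transition c d has_derivative d_transition c d p) (at (snd c p))"
  by (rule smooth_on_imp_has_derivative[OF transition_smooth]) (simp_all add: charts_at_def)

lemma d_transition_linear: "c \<in> charts_at M p \<Longrightarrow> d \<in> charts_at M p \<Longrightarrow> linear (d_transition c d p)"
  using transition_has_derivative has_derivative_linear by blast

text \<open>The chain rule on the overlap of \<open>c\<close> and \<open>d\<close>. This cocycle
  identity shows that \<open>tvec_of\<close> produces tangent vectors and that the derivatives of
  transition maps are invertible.\<close>

lemma d_transition_comp:
  assumes c: "c \<in> charts_at M p" and d: "d \<in> charts_at M p" and e: "e \<in> charts_at M p"
  shows "d_transition d e p (d_transition c d p u) = d_transition c e p u"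
proof -
  let ?O = "snd c ` (fst c \<inter> fst d)"
  have dd: "(transition d e has_derivative d_transition d e p) (at (transition c d (snd c p)))"
    using transition_has_derivative[OF d e] charts_atD[OF c] by simp
  have "((\<lambda>z. transition d e (transition c d z)) has_derivative (\<lambda>u. d_transition d e p (d_transition c d p u))) (at (snd c p))"
    by (rule has_derivative_compose[OF transition_has_derivative[OF c d] dd])
  then have "(transition c e has_derivative (\<lambda>u. d_transition d e p (d_transition c d p u))) (at (snd c p))"
  proof (rule has_derivative_transform_within_open)
    show "open ?O" using charts_atD[OF c] charts_atD[OF d] by (intro overlap_open)
    show "snd c p \<in> ?O" using charts_atD[OF c] charts_atD[OF d] by blast
    show "transition d e (transition c d z) = transition c e z" if "z \<in> ?O" for z
      using that charts_atD(1)[OF c] charts_atD(1)[OF d] by auto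
  qed
  then have "d_transition c e p = (\<lambda>u. d_transition d e p (d_transition c d p u))"
    by (rule frechet_derivative_at[symmetric])
  then show ?thesis by simp
qed

lemma d_transition_self [simp]:
  assumes c: "c \<in> charts_at M p"
  shows "d_transition c c p u = u"
proof -
  have "((\<lambda>z. z) has_derivative (\<lambda>u. u)) (at (snd c p))" by (rule has_derivative_ident)
  then have "(transition c c has_derivative (\<lambda>u. u)) (at (snd c p))"
    by (rule has_derivative_transform_within_open[OF _ chart_open[OF charts_atD(1)[OF c]]])
      (use charts_atD[OF c] in auto)
  from frechet_derivative_at[OF this] show ?thesis by metis
qed

lemma d_transition_inverse:
  "c \<in> charts_at M p \<Longrightarrow> d \<in> charts_at M p \<Longrightarrow> d_transition c d p (d_transition d c p u) = u"
  by (simp add: d_transition_comp)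

lemma tangent_space_transition:
  "v \<in> tangent_space M p \<Longrightarrow> c \<in> charts_at M p \<Longrightarrow> d \<in> charts_at M p \<Longrightarrow> v d = d_transition c d p (v c)"
  and tangent_space_outside: "v \<in> tangent_space M p \<Longrightarrow> c \<notin> charts_at M p \<Longrightarrow> v c = 0"
  unfolding tangent_space_def by blast+

lemma tangent_spaceI:
  assumes "\<And>c d. c \<in> charts_at M p \<Longrightarrow> d \<in> charts_at M p \<Longrightarrow> v d = d_transition c d p (v c)"
    "\<And>c. c \<notin> charts_at M p \<Longrightarrow> v c = 0"
  shows "v \<in> tangent_space M p"
  unfolding tangent_space_def using assms by blast

lemma tangent_space_eqI:
  assumes u: "u \<in> tangent_space M p" and v: "v \<in> tangent_space M p" and c: "c \<in> charts_at M p" "u c = v c"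
  shows "u = v"
proof
  fix d show "u d = v d"
  proof (cases "d \<in> charts_at M p")
    case True
    show ?thesis
      by (simp only: tangent_space_transition[OF u c(1) True] tangent_space_transition[OF v c(1) True] c(2))
  next
    case False
    show ?thesis
      by (simp only: tangent_space_outside[OF u False] tangent_space_outside[OF v False])
  qed
qed

lemma tvec_of_in_tangent_space: "c \<in> charts_at M p \<Longrightarrow> tvec_of M c p u \<in> tangent_space M p"
  by (rule tangent_spaceI) (simp_all add: tvec_of_def d_transition_comp)

lemma tvec_of_chart [simp]: "c \<in> charts_at M p \<Longrightarrow> tvec_of M c p u c = u"
  by (simp add: tvec_of_def)

lemma tvec_of_eq: "v \<in> tangent_space M p \<Longrightarrow> c \<in> charts_at M p \<Longrightarrow> tvec_of M c p (v c) = v"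
  by (rule tangent_space_eqI[OF tvec_of_in_tangent_space]) auto

lemma subspace_tangent_space: "subspace (tangent_space M p)"
proof (rule subspaceI)
  show "0 \<in> tangent_space M p"
    by (rule tangent_spaceI) (simp_all add: zero_fun_def linear_0[OF d_transition_linear])
  show "u + v \<in> tangent_space M p" if u: "u \<in> tangent_space M p" and v: "v \<in> tangent_space M p" for u v
  proof (rule tangent_spaceI)
    fix c d assume cd: "c \<in> charts_at M p" "d \<in> charts_at M p"
    show "(u + v) d = d_transition c d p ((u + v) c)"
      by (simp only: plus_fun_def linear_add[OF d_transition_linear[OF cd]]
          tangent_space_transition[OF u cd] tangent_space_transition[OF v cd])
  qed (simp add: plus_fun_def tangent_space_outside[OF u] tangent_space_outside[OF v])
  show "r *\<^sub>R v \<in> tangent_space M p" if v: "v \<in> tangent_space M p" for r v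
  proof (rule tangent_spaceI)
    fix c d assume cd: "c \<in> charts_at M p" "d \<in> charts_at M p"
    show "(r *\<^sub>R v) d = d_transition c d p ((r *\<^sub>R v) c)"
      by (simp only: scaleR_fun_def linear_scale[OF d_transition_linear[OF cd]] tangent_space_transition[OF v cd])
  qed (simp add: scaleR_fun_def tangent_space_outside[OF v])
qed

lemma inner_product_metric: "p \<in> topspace (mtop M) \<Longrightarrow> inner_product_on (tangent_space M p) (metric M p)"
  using oriented_riemannian by (simp add: oriented_riemannian_manifold_def)

context
  fixes p assumes p: "p \<in> topspace (mtop M)"
begin

lemma metric_sym:
  "u \<in> tangent_space M p \<Longrightarrow> v \<in> tangent_space M p \<Longrightarrow> metric M p u v = metric M p v u"
  using inner_product_metric[OF p] by (simp add: inner_product_on_def)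

lemma metric_add_left:
  "u \<in> tangent_space M p \<Longrightarrow> v \<in> tangent_space M p \<Longrightarrow> w \<in> tangent_space M p \<Longrightarrow>
    metric M p (u + v) w = metric M p u w + metric M p v w"
  using inner_product_metric[OF p] by (simp add: inner_product_on_def)

lemma metric_scale_left:
  "u \<in> tangent_space M p \<Longrightarrow> v \<in> tangent_space M p \<Longrightarrow> metric M p (r *\<^sub>R u) v = r * metric M p u v"
  using inner_product_metric[OF p] by (simp add: inner_product_on_def)

lemma metric_pos: "u \<in> tangent_space M p \<Longrightarrow> u \<noteq> 0 \<Longrightarrow> metric M p u u > 0"
  using inner_product_metric[OF p] by (simp add: inner_product_on_def)

lemma metric_zero_left: "v \<in> tangent_space M p \<Longrightarrow> metric M p 0 v = 0"
  using metric_scale_left[of 0 v 0] subspace_0[OF subspace_tangent_space] by simp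

lemma metric_sum_left:
  assumes "\<And>i. i \<in> I \<Longrightarrow> f i \<in> tangent_space M p" "v \<in> tangent_space M p"
  shows "metric M p (\<Sum>i\<in>I. r i *\<^sub>R f i) v = (\<Sum>i\<in>I. r i * metric M p (f i) v)"
  using assms(1)
proof (induction I rule: infinite_finite_induct)
  case (insert i I)
  have "(\<Sum>i\<in>I. r i *\<^sub>R f i) \<in> tangent_space M p"
    using insert by (intro subspace_sum subspace_scale subspace_tangent_space) auto
  moreover have "r i *\<^sub>R f i \<in> tangent_space M p"
    using insert by (intro subspace_scale subspace_tangent_space) simp
  ultimately have "metric M p (r i *\<^sub>R f i + (\<Sum>i\<in>I. r i *\<^sub>R f i)) v = r i * metric M p (f i) v + (\<Sum>i\<in>I. r i * metric M p (f i) v)"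
    using insert assms(2) by (simp only: metric_add_left metric_scale_left insertI1 insertI2)
  then show ?case
    by (simp only: sum.insert[OF insert.hyps])
qed (simp_all add: metric_zero_left assms(2))

lemma metric_sum_right:
  assumes "\<And>i. i \<in> I \<Longrightarrow> f i \<in> tangent_space M p" "v \<in> tangent_space M p"
  shows "metric M p v (\<Sum>i\<in>I. r i *\<^sub>R f i) = (\<Sum>i\<in>I. r i * metric M p v (f i))"
proof -
  have "(\<Sum>i\<in>I. r i *\<^sub>R f i) \<in> tangent_space M p"
    using assms by (intro subspace_sum subspace_scale subspace_tangent_space) auto
  then have "metric M p v (\<Sum>i\<in>I. r i *\<^sub>R f i) = metric M p (\<Sum>i\<in>I. r i *\<^sub>R f i) v"
    by (rule metric_sym[OF assms(2)])
  also have "\<dots> = (\<Sum>i\<in>I. r i * metric M p (f i) v)"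
    using assms by (rule metric_sum_left)
  also have "\<dots> = (\<Sum>i\<in>I. r i * metric M p v (f i))"
    by (intro sum.cong refl arg_cong2[where f = "(*)"] metric_sym assms)
  finally show ?thesis .
qed

end

lemma metric_coeff_smooth: "c \<in> atlas M \<Longrightarrow> smooth_on (snd c ` fst c) (metric_coeff M c)"
  using oriented_riemannian by (simp add: oriented_riemannian_manifold_def)

lemma tangent_expansion:
  assumes v: "v \<in> tangent_space M p" and c: "c \<in> charts_at M p"
  shows "v = (\<Sum>i\<in>UNIV. v c $ i *\<^sub>R tvec_of M c p (axis i 1))"
proof (rule tangent_space_eqI[OF v _ c])
  show "(\<Sum>i\<in>UNIV. v c $ i *\<^sub>R tvec_of M c p (axis i 1)) \<in> tangent_space M p"
    by (intro subspace_sum subspace_scale subspace_tangent_space tvec_of_in_tangent_space c)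
  show "v c = (\<Sum>i\<in>UNIV. v c $ i *\<^sub>R tvec_of M c p (axis i 1)) c"
    using c by (simp add: sum_fun_apply scaleR_fun_def basis_expansion flip: scalar_mult_eq_scaleR)
qed

lemma metric_coords:
  assumes c: "c \<in> charts_at M p" and u: "u \<in> tangent_space M p" and v: "v \<in> tangent_space M p"
  shows "metric M p u v = u c \<bullet> (metric_coeff M c (snd c p) *v v c)"
proof -
  let ?t = "\<lambda>i. tvec_of M c p (axis i 1)"
  have p: "p \<in> topspace (mtop M)" using charts_atD[OF c] chart_subset by blast
  have t: "?t i \<in> tangent_space M p" for i by (rule tvec_of_in_tangent_space[OF c])
  have G: "metric_coeff M c (snd c p) $ i $ j = metric M p (?t i) (?t j)" for i j
    using charts_atD[OF c] by (simp add: metric_coeff_def Let_def)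
  have "metric M p u v = metric M p (\<Sum>i\<in>UNIV. u c $ i *\<^sub>R ?t i) (\<Sum>j\<in>UNIV. v c $ j *\<^sub>R ?t j)"
    using tangent_expansion[OF u c] tangent_expansion[OF v c] by simp
  also have "\<dots> = (\<Sum>i\<in>UNIV. u c $ i * metric M p (?t i) (\<Sum>j\<in>UNIV. v c $ j *\<^sub>R ?t j))"
    by (rule metric_sum_left[OF p t]) (intro subspace_sum subspace_scale subspace_tangent_space t)
  also have "\<dots> = (\<Sum>i\<in>UNIV. u c $ i * (\<Sum>j\<in>UNIV. v c $ j * metric M p (?t i) (?t j)))"
    by (simp only: metric_sum_right[OF p t t])
  also have "\<dots> = u c \<bullet> (metric_coeff M c (snd c p) *v v c)"
    by (simp add: inner_vec_def matrix_vector_mult_def G mult.commute)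
  finally show ?thesis .
qed

lemma metric_coeff_sym:
  assumes c: "c \<in> atlas M" and z: "z \<in> snd c ` fst c"
  shows "metric_coeff M c z $ i $ j = metric_coeff M c z $ j $ i"
proof -
  obtain p where p: "p \<in> fst c" "z = snd c p" using z by blast
  have "c \<in> charts_at M p" using charts_atI c p by blast
  moreover have "p \<in> topspace (mtop M)" using c p chart_subset by blast
  ultimately show ?thesis
    using c p by (simp add: metric_coeff_def Let_def metric_sym tvec_of_in_tangent_space)
qed

lemma metric_coeff_pos:
  assumes c: "c \<in> atlas M" and z: "z \<in> snd c ` fst c" and "u \<noteq> 0"
  shows "u \<bullet> (metric_coeff M c z *v u) > 0"
proof -
  obtain p where p: "p \<in> fst c" "z = snd c p" using z by blast
  have cp: "c \<in> charts_at M p" using charts_atI c p by blast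
  let ?u = "tvec_of M c p u"
  have "?u \<noteq> 0" using \<open>u \<noteq> 0\<close> tvec_of_chart[OF cp, of u] by (auto simp: zero_fun_def)
  then have "metric M p ?u ?u > 0"
    using metric_pos tvec_of_in_tangent_space[OF cp] c p chart_subset by blast
  then show ?thesis
    using metric_coords[OF cp tvec_of_in_tangent_space[OF cp] tvec_of_in_tangent_space[OF cp], of u u] p cp by simp
qed

lemma metric_coeff_inner_sym:
  assumes c: "c \<in> atlas M" and z: "z \<in> snd c ` fst c"
  shows "u \<bullet> (metric_coeff M c z *v v) = v \<bullet> (metric_coeff M c z *v u)"
proof -
  have "transpose (metric_coeff M c z) = metric_coeff M c z"
    using metric_coeff_sym[OF c z] by (simp add: transpose_def vec_eq_iff)
  then show ?thesis by (metis dot_lmul_matrix inner_commute transpose_matrix_vector vector_transpose_matrix)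
qed

text \<open>Positive definiteness excludes a kernel.\<close>

lemma det_metric_coeff:
  assumes c: "c \<in> atlas M" and z: "z \<in> snd c ` fst c"
  shows "det (metric_coeff M c z) \<noteq> 0"
proof -
  have "u = 0" if "metric_coeff M c z *v u = 0" for u
    using metric_coeff_pos[OF c z, of u] that by force
  then show ?thesis
    using matrix_left_invertible_ker invertible_left_inverse invertible_det_nz by blast
qed

end

text \<open>Treating the symbols as a bilinear form with values in coordinate space keeps the Koszul
  formula, the change of charts and the transport equation free of indices.\<close>

definition christoffel_form :: "(real ^ 'n \<Rightarrow> real ^ 'n ^ 'n) \<Rightarrow> real ^ 'n \<Rightarrow> real ^ 'n \<Rightarrow> real ^ 'n \<Rightarrow> real ^ 'n::finite"
  where "christoffel_form G z u w = (\<chi> k. \<Sum>i\<in>UNIV. \<Sum>j\<in>UNIV. christoffel G z k i j * u $ i * w $ j)"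

text \<open>In geometric notation (D_v g)(u, w): the first vector argument is the direction of
  differentiation.\<close>

abbreviation metric_deriv :: "(real ^ 'n \<Rightarrow> real ^ 'n ^ 'n) \<Rightarrow> real ^ 'n \<Rightarrow> real ^ 'n \<Rightarrow> real ^ 'n \<Rightarrow> real ^ 'n::finite \<Rightarrow> real"
  where "metric_deriv G z v u w \<equiv> u \<bullet> (frechet_derivative G (at z) v *v w)"

lemma metric_deriv_expansion:
  assumes "smooth_on S G" "z \<in> S"
  shows "metric_deriv G z v u w =
    (\<Sum>i\<in>UNIV. \<Sum>j\<in>UNIV. \<Sum>k\<in>UNIV. v $ i * u $ j * w $ k * partial_deriv i (\<lambda>y. G y $ j $ k) z)"
proof -
  let ?F = "frechet_derivative G (at z)"
  have lin: "linear ?F" using smooth_on_imp_has_derivative[OF assms] has_derivative_linear by blast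
  have "?F v = ?F (\<Sum>i\<in>UNIV. v $ i *\<^sub>R axis i 1)"
    by (simp add: basis_expansion flip: scalar_mult_eq_scaleR)
  also have "\<dots> = (\<Sum>i\<in>UNIV. v $ i *\<^sub>R ?F (axis i 1))"
    using lin by (simp add: linear_sum linear_scale)
  finally have "?F v $ j $ k = (\<Sum>i\<in>UNIV. v $ i * partial_deriv i (\<lambda>y. G y $ j $ k) z)" for j k
    by (simp add: partial_deriv_eq_component[OF assms])
  then have "metric_deriv G z v u w = (\<Sum>j\<in>UNIV. \<Sum>k\<in>UNIV. \<Sum>i\<in>UNIV. v $ i * u $ j * w $ k * partial_deriv i (\<lambda>y. G y $ j $ k) z)"
    by (simp add: inner_vec_def matrix_vector_mult_def sum_distrib_left sum_distrib_right mult_ac)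
  also have "\<dots> = (\<Sum>j\<in>UNIV. \<Sum>i\<in>UNIV. \<Sum>k\<in>UNIV. v $ i * u $ j * w $ k * partial_deriv i (\<lambda>y. G y $ j $ k) z)"
    by (intro sum.cong refl sum.swap)
  also have "\<dots> = (\<Sum>i\<in>UNIV. \<Sum>j\<in>UNIV. \<Sum>k\<in>UNIV. v $ i * u $ j * w $ k * partial_deriv i (\<lambda>y. G y $ j $ k) z)"
    by (rule sum.swap)
  finally show ?thesis .
qed

lemma metric_deriv_sym:
  assumes "smooth_on S G" "open S" "z \<in> S" "\<And>y. y \<in> S \<Longrightarrow> transpose (G y) = G y"
  shows "metric_deriv G z v u w = metric_deriv G z v w u"
  unfolding metric_deriv_expansion[OF assms(1,3)]
  by (rule sum.cong[OF refl], subst sum.swap, intro sum.cong refl)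
    (simp add: partial_deriv_sym[OF assms(2,3,4)] mult_ac)

text \<open>The Koszul formula for vector fields with constant coefficients. Lowering the index
  cancels the inverse metric inside \<open>christoffel\<close>, so the right-hand side contains only
  first derivatives of the metric; since the metric is nondegenerate, the formula determines the
  Christoffel form.\<close>

lemma koszul:
  assumes G: "smooth_on S G" "open S" "z \<in> S" "\<And>y. y \<in> S \<Longrightarrow> transpose (G y) = G y"
    and nz: "det (G z) \<noteq> 0"
  shows "2 * (christoffel_form G z u w \<bullet> (G z *v v)) =
    metric_deriv G z u w v + metric_deriv G z w u v - metric_deriv G z v u w"
proof -
  define P where "P a b m = partial_deriv a (\<lambda>y. G y $ b $ m) z" for a b m
  have Gsym: "G z $ a $ b = G z $ b $ a" for a b
    using arg_cong[OF G(4)[OF G(3)], of "\<lambda>A. A $ b $ a"] by (simp add: transpose_def)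
  have "G z ** matrix_inv (G z) = mat 1"
    using nz unfolding invertible_det_nz[symmetric] invertible_def matrix_inv_def
    by (metis (mono_tags, lifting) someI_ex)
  then have delta: "(\<Sum>l\<in>UNIV. G z $ b $ l * matrix_inv (G z) $ l $ m) = (if b = m then 1 else 0)" for b m
    unfolding vec_eq_iff matrix_matrix_mult_def mat_def by simp
  have lower: "2 * (\<Sum>l\<in>UNIV. G z $ b $ l * christoffel G z l a c) = P a c b + P c a b - P b a c" for a b c
  proof -
    let ?Q = "\<lambda>m. P a c m + P c a m - P m a c"
    have twice: "2 * christoffel G z l a c = (\<Sum>m\<in>UNIV. matrix_inv (G z) $ l $ m * ?Q m)" for l
      unfolding christoffel_def P_def by simp
    have "2 * (\<Sum>l\<in>UNIV. G z $ b $ l * christoffel G z l a c)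
        = (\<Sum>l\<in>UNIV. G z $ b $ l * (2 * christoffel G z l a c))"
      by (simp add: sum_distrib_left mult_ac)
    also have "\<dots> = (\<Sum>l\<in>UNIV. \<Sum>m\<in>UNIV. G z $ b $ l * matrix_inv (G z) $ l $ m * ?Q m)"
      unfolding twice by (simp only: sum_distrib_left mult.assoc)
    also have "\<dots> = (\<Sum>m\<in>UNIV. (\<Sum>l\<in>UNIV. G z $ b $ l * matrix_inv (G z) $ l $ m) * ?Q m)"
      by (subst sum.swap) (simp only: sum_distrib_right)
    also have "\<dots> = (\<Sum>m\<in>UNIV. if b = m then ?Q m else 0)"
      unfolding delta by (rule sum.cong) auto
    finally show ?thesis by simp
  qed
  have "christoffel_form G z u w \<bullet> (G z *v v)
      = (\<Sum>l\<in>UNIV. (\<Sum>b\<in>UNIV. G z $ b $ l * v $ b) * (\<Sum>a\<in>UNIV. \<Sum>c\<in>UNIV. christoffel G z l a c * u $ a * w $ c))"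
    by (simp add: inner_vec_def christoffel_form_def matrix_vector_mult_def Gsym[of _ l for l] mult.commute)
  also have "\<dots> = (\<Sum>l\<in>UNIV. \<Sum>b\<in>UNIV. G z $ b $ l * v $ b * (\<Sum>a\<in>UNIV. \<Sum>c\<in>UNIV. christoffel G z l a c * u $ a * w $ c))"
    by (simp only: sum_distrib_right)
  also have "\<dots> = (\<Sum>l\<in>UNIV. \<Sum>b\<in>UNIV. \<Sum>a\<in>UNIV. \<Sum>c\<in>UNIV. v $ b * u $ a * w $ c * (G z $ b $ l * christoffel G z l a c))"
    by (simp add: sum_distrib_left mult_ac)
  also have "\<dots> = (\<Sum>b\<in>UNIV. \<Sum>l\<in>UNIV. \<Sum>a\<in>UNIV. \<Sum>c\<in>UNIV. v $ b * u $ a * w $ c * (G z $ b $ l * christoffel G z l a c))"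
    by (rule sum.swap)
  also have "\<dots> = (\<Sum>b\<in>UNIV. \<Sum>a\<in>UNIV. \<Sum>l\<in>UNIV. \<Sum>c\<in>UNIV. v $ b * u $ a * w $ c * (G z $ b $ l * christoffel G z l a c))"
    by (rule sum.cong[OF refl], rule sum.swap)
  also have "\<dots> = (\<Sum>b\<in>UNIV. \<Sum>a\<in>UNIV. \<Sum>c\<in>UNIV. \<Sum>l\<in>UNIV. v $ b * u $ a * w $ c * (G z $ b $ l * christoffel G z l a c))"
    by (rule sum.cong[OF refl], rule sum.cong[OF refl], rule sum.swap)
  finally have "2 * (christoffel_form G z u w \<bullet> (G z *v v))
      = (\<Sum>b\<in>UNIV. \<Sum>a\<in>UNIV. \<Sum>c\<in>UNIV. v $ b * u $ a * w $ c * (2 * (\<Sum>l\<in>UNIV. G z $ b $ l * christoffel G z l a c)))"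
    by (simp add: sum_distrib_left mult_ac)
  also have "\<dots> = (\<Sum>b\<in>UNIV. \<Sum>a\<in>UNIV. \<Sum>c\<in>UNIV. v $ b * u $ a * w $ c * P a c b)
      + (\<Sum>b\<in>UNIV. \<Sum>a\<in>UNIV. \<Sum>c\<in>UNIV. v $ b * u $ a * w $ c * P c a b)
      - (\<Sum>b\<in>UNIV. \<Sum>a\<in>UNIV. \<Sum>c\<in>UNIV. v $ b * u $ a * w $ c * P b a c)"
    unfolding lower by (simp add: distrib_left right_diff_distrib sum.distrib sum_subtractf)
  also have "(\<Sum>b\<in>UNIV. \<Sum>a\<in>UNIV. \<Sum>c\<in>UNIV. v $ b * u $ a * w $ c * P a c b) = metric_deriv G z u w v"
    unfolding metric_deriv_expansion[OF G(1,3)] P_def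
    by (subst sum.swap, rule sum.cong[OF refl], subst sum.swap, intro sum.cong refl) (simp add: mult_ac)
  also have "(\<Sum>b\<in>UNIV. \<Sum>a\<in>UNIV. \<Sum>c\<in>UNIV. v $ b * u $ a * w $ c * P c a b) = metric_deriv G z w u v"
  proof -
    have "(\<Sum>b\<in>UNIV. \<Sum>a\<in>UNIV. \<Sum>c\<in>UNIV. v $ b * u $ a * w $ c * P c a b)
        = (\<Sum>b\<in>UNIV. \<Sum>c\<in>UNIV. \<Sum>a\<in>UNIV. v $ b * u $ a * w $ c * P c a b)"
      by (rule sum.cong[OF refl], rule sum.swap)
    also have "\<dots> = (\<Sum>c\<in>UNIV. \<Sum>b\<in>UNIV. \<Sum>a\<in>UNIV. v $ b * u $ a * w $ c * P c a b)"
      by (rule sum.swap)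
    also have "\<dots> = (\<Sum>c\<in>UNIV. \<Sum>a\<in>UNIV. \<Sum>b\<in>UNIV. v $ b * u $ a * w $ c * P c a b)"
      by (rule sum.cong[OF refl], rule sum.swap)
    finally show ?thesis
      unfolding metric_deriv_expansion[OF G(1,3)] P_def by (simp add: mult_ac)
  qed
  also have "(\<Sum>b\<in>UNIV. \<Sum>a\<in>UNIV. \<Sum>c\<in>UNIV. v $ b * u $ a * w $ c * P b a c) = metric_deriv G z v u w"
    unfolding metric_deriv_expansion[OF G(1,3)] P_def by (simp add: mult_ac)
  finally show ?thesis .
qed

section \<open>Change of coordinates for the Levi-Civita connection\<close>

context oriented_riemannian
begin

abbreviation \<Gamma> :: "('a, 'n) chart \<Rightarrow> real ^ 'n \<Rightarrow> real ^ 'n \<Rightarrow> real ^ 'n \<Rightarrow> real ^ 'n"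
  where "\<Gamma> c \<equiv> christoffel_form (metric_coeff M c)"

lemma metric_coeff_transpose:
  "c \<in> atlas M \<Longrightarrow> z \<in> snd c ` fst c \<Longrightarrow> transpose (metric_coeff M c z) = metric_coeff M c z"
  using metric_coeff_sym by (simp add: transpose_def vec_eq_iff)

lemma koszul_chart:
  assumes "c \<in> atlas M" "z \<in> snd c ` fst c"
  shows "2 * (\<Gamma> c z u w \<bullet> (metric_coeff M c z *v v)) =
    metric_deriv (metric_coeff M c) z u w v + metric_deriv (metric_coeff M c) z w u v
      - metric_deriv (metric_coeff M c) z v u w"
  by (rule koszul[OF metric_coeff_smooth[OF assms(1)] chart_open[OF assms(1)] assms(2)
        metric_coeff_transpose[OF assms(1)] det_metric_coeff[OF assms]])

lemma metric_transition:
  assumes c: "c \<in> atlas M" and d: "d \<in> atlas M" and q: "q \<in> snd c ` (fst c \<inter> fst d)"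
  shows "u \<bullet> (metric_coeff M c q *v w) =
    frechet_derivative (transition c d) (at q) u
      \<bullet> (metric_coeff M d (transition c d q) *v frechet_derivative (transition c d) (at q) w)"
proof -
  obtain p where p: "p \<in> fst c" "p \<in> fst d" "q = snd c p" using q by blast
  have cp: "c \<in> charts_at M p" and dp: "d \<in> charts_at M p" using c d p by (simp_all add: charts_atI)
  have v: "tvec_of M c p u d = d_transition c d p u" for u using dp by (simp add: tvec_of_def)
  have t: "tvec_of M c p u \<in> tangent_space M p" for u by (rule tvec_of_in_tangent_space[OF cp])
  show ?thesis
    using metric_coords[OF cp t t, of u w] metric_coords[OF dp t t, of u w] c p by (simp add: v tvec_of_chart[OF cp])
qed

text \<open>The inhomogeneous transformation law. The metric of \<open>c\<close> is the pullback of
  that of \<open>d\<close>; differentiating this relation and inserting it into both Koszul formulas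
  leaves the second derivative of the transition map as the only extra term. Nondegeneracy then
  removes the test vector.\<close>

lemma christoffel_transition:
  assumes c: "c \<in> charts_at M p" and d: "d \<in> charts_at M p"
  shows "d_transition c d p (\<Gamma> c (snd c p) u w) =
    \<Gamma> d (snd d p) (d_transition c d p u) (d_transition c d p w)
      + frechet_derivative (\<lambda>q. frechet_derivative (transition c d) (at q) w) (at (snd c p)) u"
proof -
  let ?O = "snd c ` (fst c \<inter> fst d)" and ?z = "snd c p" and ?\<phi> = "transition c d"
  let ?Gc = "metric_coeff M c" and ?Gd = "metric_coeff M d" and ?J = "d_transition c d p"
  define D2 where "D2 w u = frechet_derivative (\<lambda>q. frechet_derivative ?\<phi> (at q) w) (at ?z) u" for w u
  note cA = charts_atD[OF c] and dA = charts_atD[OF d]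
  have O: "open ?O" "?z \<in> ?O" using overlap_open cA dA by auto
  have z: "?z \<in> snd c ` fst c" and y: "snd d p \<in> snd d ` fst d" using cA dA by auto
  have \<phi>: "smooth_on ?O ?\<phi>" by (rule transition_smooth[OF cA(1) dA(1)])
  have \<phi>z: "?\<phi> ?z = snd d p" using cA by simp
  have D2: "((\<lambda>q. frechet_derivative ?\<phi> (at q) w) has_derivative D2 w) (at ?z)" for w
    unfolding D2_def using smooth_on_imp_has_derivative[OF smooth_on_directional_derivative[OF \<phi>] O(2)] .
  have D2_sym: "D2 u w = D2 w u" for u w
    unfolding D2_def by (rule symmetric_second_derivative[OF O \<phi>])
  have \<phi>': "(?\<phi> has_derivative ?J) (at ?z)" by (rule transition_has_derivative[OF c d])
  have Gd': "(?Gd has_derivative frechet_derivative ?Gd (at (?\<phi> ?z))) (at (?\<phi> ?z))"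
    unfolding \<phi>z by (rule smooth_on_imp_has_derivative[OF metric_coeff_smooth[OF dA(1)] y])
  have sym: "a \<bullet> (?Gd (snd d p) *v b) = b \<bullet> (?Gd (snd d p) *v a)" for a b
    by (rule metric_coeff_inner_sym[OF dA(1) y])
  \<comment> \<open>The product rule for the pullback relation: besides the derivative of the metric
    of \<open>d\<close>, each of the two transported arguments contributes a second derivative of
    the transition map.\<close>
  have pull: "metric_deriv ?Gc ?z v u w = D2 u v \<bullet> (?Gd (snd d p) *v ?J w)
      + metric_deriv ?Gd (snd d p) (?J v) (?J u) (?J w) + ?J u \<bullet> (?Gd (snd d p) *v D2 w v)" for u v w
  proof -
    let ?R = "\<lambda>q. frechet_derivative ?\<phi> (at q) u \<bullet> (?Gd (?\<phi> q) *v frechet_derivative ?\<phi> (at q) w)"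
    have "(?R has_derivative (\<lambda>v. ?J u \<bullet> (?Gd (?\<phi> ?z) *v D2 w v + frechet_derivative ?Gd (at (?\<phi> ?z)) (?J v) *v ?J w)
        + D2 u v \<bullet> (?Gd (?\<phi> ?z) *v ?J w))) (at ?z)"
      by (rule bounded_bilinear.FDERIV[OF bounded_bilinear_inner D2
          bounded_bilinear.FDERIV[OF bounded_bilinear_matrix_vector_mult has_derivative_compose[OF \<phi>' Gd'] D2]])
    then have "((\<lambda>q. u \<bullet> (?Gc q *v w)) has_derivative (\<lambda>v. ?J u \<bullet> (?Gd (?\<phi> ?z) *v D2 w v + frechet_derivative ?Gd (at (?\<phi> ?z)) (?J v) *v ?J w)
        + D2 u v \<bullet> (?Gd (?\<phi> ?z) *v ?J w))) (at ?z)"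
      by (rule has_derivative_transform_within_open[OF _ O]) (rule metric_transition[OF cA(1) dA(1), symmetric])
    moreover have "((\<lambda>q. u \<bullet> (?Gc q *v w)) has_derivative (\<lambda>v. u \<bullet> (?Gc ?z *v 0 + frechet_derivative ?Gc (at ?z) v *v w) + 0 \<bullet> (?Gc ?z *v w))) (at ?z)"
      by (rule bounded_bilinear.FDERIV[OF bounded_bilinear_inner has_derivative_const
          bounded_bilinear.FDERIV[OF bounded_bilinear_matrix_vector_mult
            smooth_on_imp_has_derivative[OF metric_coeff_smooth[OF cA(1)] z] has_derivative_const]])
    ultimately have "(\<lambda>v. ?J u \<bullet> (?Gd (?\<phi> ?z) *v D2 w v + frechet_derivative ?Gd (at (?\<phi> ?z)) (?J v) *v ?J w)
        + D2 u v \<bullet> (?Gd (?\<phi> ?z) *v ?J w)) = (\<lambda>v. u \<bullet> (?Gc ?z *v 0 + frechet_derivative ?Gc (at ?z) v *v w) + 0 \<bullet> (?Gc ?z *v w))"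
      by (rule has_derivative_unique)
    from fun_cong[OF this, of v] show ?thesis
      unfolding \<phi>z by (simp add: inner_add_right)
  qed
  have key: "?J (\<Gamma> c ?z u w) \<bullet> (?Gd (snd d p) *v ?J v) =
      (\<Gamma> d (snd d p) (?J u) (?J w) + D2 w u) \<bullet> (?Gd (snd d p) *v ?J v)" for v
  proof -
    have "?J (\<Gamma> c ?z u w) \<bullet> (?Gd (snd d p) *v ?J v) = \<Gamma> c ?z u w \<bullet> (?Gc ?z *v v)"
      using metric_transition[OF cA(1) dA(1) O(2), of "\<Gamma> c ?z u w" v] by (simp add: \<phi>z)
    then have "2 * (?J (\<Gamma> c ?z u w) \<bullet> (?Gd (snd d p) *v ?J v)) =
        metric_deriv ?Gc ?z u w v + metric_deriv ?Gc ?z w u v - metric_deriv ?Gc ?z v u w"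
      using koszul_chart[OF cA(1) z, of u w v] by simp
    \<comment> \<open>Six second-derivative terms occur. Symmetry of \<open>D2\<close> and of the
      metric cancels four of them and makes the other two equal.\<close>
    also have "\<dots> = (metric_deriv ?Gd (snd d p) (?J u) (?J w) (?J v) + metric_deriv ?Gd (snd d p) (?J w) (?J u) (?J v)
        - metric_deriv ?Gd (snd d p) (?J v) (?J u) (?J w)) + 2 * (D2 w u \<bullet> (?Gd (snd d p) *v ?J v))"
      unfolding pull using D2_sym[of u w] D2_sym[of u v] D2_sym[of v w]
        sym[of "?J w" "D2 v u"] sym[of "?J u" "D2 v w"] sym[of "?J u" "D2 w v"] by simp
    also have "\<dots> = 2 * (\<Gamma> d (snd d p) (?J u) (?J w) \<bullet> (?Gd (snd d p) *v ?J v)) + 2 * (D2 w u \<bullet> (?Gd (snd d p) *v ?J v))"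
      using koszul_chart[OF dA(1) y, of "?J u" "?J w" "?J v"] by simp
    finally show ?thesis by (simp add: inner_add_left)
  qed
  \<comment> \<open>Every vector is the image under \<open>?J\<close> of its back-transition, so the
    defect may be tested against itself, and positivity makes it vanish.\<close>
  let ?e = "?J (\<Gamma> c ?z u w) - (\<Gamma> d (snd d p) (?J u) (?J w) + D2 w u)"
  have "?e \<bullet> (?Gd (snd d p) *v ?J (d_transition d c p ?e)) = 0"
    using key[of "d_transition d c p ?e"] by (simp add: inner_diff_left)
  then have "?e \<bullet> (?Gd (snd d p) *v ?e) = 0"
    unfolding d_transition_inverse[OF c d] .
  then have "?e = 0" using metric_coeff_pos[OF dA(1) y, of ?e] by fastforce
  then show ?thesis unfolding D2_def by simp
qed

text \<open>Add the Koszul formulas for (u, v; w) and (u, w; v): the derivatives in the directions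
  \<open>v\<close> and \<open>w\<close> cancel, and the one in direction \<open>u\<close> appears
  twice.\<close>

lemma metric_compatible:
  assumes c: "c \<in> atlas M" and z: "z \<in> snd c ` fst c"
  shows "metric_deriv (metric_coeff M c) z u v w =
    \<Gamma> c z u v \<bullet> (metric_coeff M c z *v w) + v \<bullet> (metric_coeff M c z *v \<Gamma> c z u w)"
proof -
  have S: "metric_deriv (metric_coeff M c) z a b e = metric_deriv (metric_coeff M c) z a e b" for a b e
    by (rule metric_deriv_sym[OF metric_coeff_smooth[OF c] chart_open[OF c] z metric_coeff_transpose[OF c]])
  have "v \<bullet> (metric_coeff M c z *v \<Gamma> c z u w) = \<Gamma> c z u w \<bullet> (metric_coeff M c z *v v)"
    by (rule metric_coeff_inner_sym[OF c z])
  then show ?thesis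
    using koszul_chart[OF c z, of u v w] koszul_chart[OF c z, of u w v] S[of u v w] S[of v u w] S[of w u v] by linarith
qed

lemma christoffel_chart_differentiable:
  assumes "c \<in> atlas M" "z \<in> snd c ` fst c"
  shows "(\<lambda>z. christoffel (metric_coeff M c) z k i j) differentiable (at z)"
  by (rule christoffel_differentiable[OF metric_coeff_smooth[OF assms(1)] chart_open[OF assms(1)] assms(2)
        det_metric_coeff[OF assms(1)]])

text \<open>Along a curve both the base point and the vector move. The expansion into columns
  separates them: each column is a smooth function of the base point alone, so the product rule and
  absolute continuity apply summand by summand.\<close>

lemma transition_derivative_columns:
  assumes "c \<in> atlas M" "d \<in> atlas M" "q \<in> snd c ` (fst c \<inter> fst d)"
  shows "frechet_derivative (transition c d) (at q) w =
    (\<Sum>j\<in>UNIV. w $ j *\<^sub>R frechet_derivative (transition c d) (at q) (axis j 1))"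
proof -
  have lin: "linear (frechet_derivative (transition c d) (at q))"
    using smooth_on_imp_has_derivative[OF transition_smooth[OF assms(1,2)] assms(3)] has_derivative_linear by blast
  have "frechet_derivative (transition c d) (at q) w = frechet_derivative (transition c d) (at q) (\<Sum>j\<in>UNIV. w $ j *\<^sub>R axis j 1)"
    by (simp add: basis_expansion flip: scalar_mult_eq_scaleR)
  then show ?thesis using lin by (simp add: linear_sum linear_scale)
qed

lemma transition_derivative_moving:
  fixes \<xi> \<zeta> :: "real \<Rightarrow> real ^ 'n"
  assumes c: "c \<in> charts_at M p" and d: "d \<in> charts_at M p" and "\<xi> t = snd c p"
    and \<xi>: "(\<xi> has_vector_derivative x') (at t within S)" and \<zeta>: "(\<zeta> has_vector_derivative z') (at t within S)"
  shows "((\<lambda>s. \<Sum>j\<in>UNIV. \<zeta> s $ j *\<^sub>R frechet_derivative (transition c d) (at (\<xi> s)) (axis j 1)) has_vector_derivative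
    d_transition c d p z' + frechet_derivative (\<lambda>q. frechet_derivative (transition c d) (at q) (\<zeta> t)) (at (snd c p)) x')
      (at t within S)"
proof -
  let ?O = "snd c ` (fst c \<inter> fst d)" and ?z = "snd c p"
  let ?\<Phi> = "\<lambda>j q. frechet_derivative (transition c d) (at q) (axis j 1)"
  let ?F = "\<lambda>j. frechet_derivative (?\<Phi> j) (at ?z)"
  note cA = charts_atD[OF c] and dA = charts_atD[OF d]
  have O: "open ?O" "?z \<in> ?O" using overlap_open cA dA by auto
  have \<Phi>: "(?\<Phi> j has_derivative ?F j) (at ?z)" for j
    by (rule smooth_on_imp_has_derivative[OF smooth_on_directional_derivative[OF transition_smooth[OF cA(1) dA(1)]] O(2)])
  have \<Phi>\<xi>: "((\<lambda>s. ?\<Phi> j (\<xi> s)) has_vector_derivative ?F j x') (at t within S)" for j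
  proof -
    have "(?\<Phi> j has_derivative ?F j) (at (\<xi> t))" unfolding assms(3) by (rule \<Phi>)
    from has_derivative_compose[OF \<xi>[unfolded has_vector_derivative_def] this]
    show ?thesis
      unfolding has_vector_derivative_def
      by (simp add: linear_scale[OF has_derivative_linear[OF \<Phi>]])
  qed
  have \<zeta>j: "((\<lambda>s. \<zeta> s $ j) has_vector_derivative z' $ j) (at t within S)" for j
    by (rule bounded_linear.has_vector_derivative[OF bounded_linear_vec_nth \<zeta>])
  have 1: "((\<lambda>s. \<Sum>j\<in>UNIV. \<zeta> s $ j *\<^sub>R ?\<Phi> j (\<xi> s)) has_vector_derivative
      (\<Sum>j\<in>UNIV. \<zeta> t $ j *\<^sub>R ?F j x' + z' $ j *\<^sub>R ?\<Phi> j (\<xi> t))) (at t within S)"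
    by (intro has_vector_derivative_sum bounded_bilinear.has_vector_derivative[OF bounded_bilinear_scaleR] \<zeta>j \<Phi>\<xi>)
  have 2: "(\<Sum>j\<in>UNIV. z' $ j *\<^sub>R ?\<Phi> j (\<xi> t)) = d_transition c d p z'"
    unfolding assms(3) by (rule transition_derivative_columns[OF cA(1) dA(1) O(2), symmetric])
  have 3: "(\<Sum>j\<in>UNIV. \<zeta> t $ j *\<^sub>R ?F j x') = frechet_derivative (\<lambda>q. frechet_derivative (transition c d) (at q) (\<zeta> t)) (at ?z) x'"
  proof -
    have "((\<lambda>q. \<Sum>j\<in>UNIV. \<zeta> t $ j *\<^sub>R ?\<Phi> j q) has_derivative (\<lambda>h. \<Sum>j\<in>UNIV. \<zeta> t $ j *\<^sub>R ?F j h)) (at ?z)"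
      by (intro has_derivative_sum has_derivative_scaleR_right \<Phi>)
    then have "((\<lambda>q. frechet_derivative (transition c d) (at q) (\<zeta> t)) has_derivative (\<lambda>h. \<Sum>j\<in>UNIV. \<zeta> t $ j *\<^sub>R ?F j h)) (at ?z)"
      by (rule has_derivative_transform_within_open[OF _ O]) (rule transition_derivative_columns[OF cA(1) dA(1), symmetric])
    from fun_cong[OF frechet_derivative_at[OF this], of x'] show ?thesis .
  qed
  show ?thesis
    using 1 unfolding sum.distrib 2 3 by (simp only: add.commute)
qed

end

section \<open>Parallel fields along absolutely continuous curves\<close>

text \<open>Freezing with all constants equal to 0 bounds the increments of \<open>Y\<close> by a
  multiple of those of \<open>G\<close>, which is an indefinite integral of a nonnegative
  function.\<close>

lemma (in driven_curve) abs_continuous_Y: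
  assumes ab: "a \<le> b" and B: "\<And>i. continuous_on {a..b} (B i)"
  shows "abs_continuous a b Y"
proof -
  have "\<exists>C. \<forall>s\<in>{a..b}. norm (B i s) \<le> C" for i
    using compact_imp_bounded[OF compact_continuous_image[OF B compact_Icc]] unfolding bounded_iff by auto
  then obtain C where C: "\<And>i s. s \<in> {a..b} \<Longrightarrow> norm (B i s) \<le> C i" by metis
  define \<eta> where "\<eta> = (\<Sum>i\<in>UNIV. \<bar>C i\<bar>)"
  have \<eta>: "norm (B i s - 0) \<le> \<eta>" if "s \<in> {a..b}" for i s
  proof -
    have "\<bar>C i\<bar> \<le> \<eta>" unfolding \<eta>_def by (rule member_le_sum) auto
    then show ?thesis using C[OF that, of i] by simp
  qed
  have G: "abs_continuous a b G"
    unfolding G_def by (rule abs_continuous_integral) (simp_all add: norm_\<xi>'_integrable)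
  show ?thesis
  proof (rule abs_continuous_dominated[OF G])
    fix u v assume uv: "a \<le> u" "u \<le> v" "v \<le> b"
    have "norm (Y v - Y u - (\<Sum>i\<in>UNIV. (\<xi> v - \<xi> u) $ i *\<^sub>R (0::'e))) \<le> \<eta> * real CARD('m) * (G v - G u)"
      by (rule freeze_ordered[OF uv]) (use uv \<eta> in simp)
    then show "norm (Y v - Y u) \<le> \<eta> * real CARD('m) * norm (G v - G u)"
      using G_mono[OF uv] by simp
  qed
qed

text \<open>For coefficients of the form \<open>K i s *v \<zeta> s\<close> the increment splits into
  a change of \<open>K i\<close>, which is O(h) by differentiability at \<open>t\<close>, and a
  change of the solution \<zeta>; this is the bound that the absorption argument accepts.\<close>

lemma linear_ode_has_vector_derivative:
  fixes \<xi> :: "real \<Rightarrow> real ^ 'm" and K :: "'m \<Rightarrow> real \<Rightarrow> real ^ 'n ^ 'n" and \<zeta> :: "real \<Rightarrow> real ^ 'n"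
  assumes curve: "driven_curve a b \<xi> \<xi>' (\<lambda>i s. K i s *v \<zeta> s) \<zeta>"
    and \<xi>: "continuous_on {a..b} \<xi>" and K: "\<And>i. continuous_on {a..b} (K i)"
    and \<zeta>: "continuous_on {a..b} \<zeta>" and t: "t \<in> {a..b}"
    and D: "(\<xi> has_vector_derivative D) (at t within {a..b})"
    and KD: "\<And>i. \<exists>D. (K i has_vector_derivative D) (at t within {a..b})"
  shows "(\<zeta> has_vector_derivative (\<Sum>i\<in>UNIV. D $ i *\<^sub>R (K i t *v \<zeta> t))) (at t within {a..b})"
proof -
  interpret driven_curve a b \<xi> \<xi>' "\<lambda>i s. K i s *v \<zeta> s" \<zeta> by (rule curve)
  interpret mv: bounded_bilinear "(*v) :: real ^ 'n ^ 'n \<Rightarrow> real ^ 'n \<Rightarrow> real ^ 'n"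
    by (rule bounded_bilinear_matrix_vector_mult)
  obtain N where N: "N > 0" "\<And>(A :: real ^ 'n ^ 'n) z. norm (A *v z) \<le> norm A * norm z * N"
    using mv.pos_bounded by blast
  have "\<exists>L. L \<ge> 0 \<and> (\<forall>s\<in>{a..b}. norm (K i s - K i t) \<le> L * \<bar>s - t\<bar>)" for i
    using KD[of i] differentiable_imp_pointwise_lipschitz[OF K] by blast
  then obtain L where L: "\<And>i. L i \<ge> 0" "\<And>i s. s \<in> {a..b} \<Longrightarrow> norm (K i s - K i t) \<le> L i * \<bar>s - t\<bar>"
    by metis
  obtain R where R: "R > 0" "\<And>s. s \<in> {a..b} \<Longrightarrow> norm (\<zeta> s) \<le> R"
    using compact_imp_bounded[OF compact_continuous_image[OF \<zeta> compact_Icc]]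
    unfolding bounded_pos by auto
  \<comment> \<open>Summing over \<open>i\<close> gives one constant for all coefficients;
    \<open>N\<close> is the constant of the matrix-vector product, \<open>R\<close> a bound for the
    solution and \<open>L i\<close> the Lipschitz constant of \<open>K i\<close> at
    \<open>t\<close>.\<close>
  define C where "C = N * (\<Sum>i\<in>UNIV. L i * R + norm (K i t))"
  have Ci: "N * (L i * R) \<le> C" "N * norm (K i t) \<le> C" "C \<ge> 0" for i
  proof -
    have "L i * R + norm (K i t) \<le> (\<Sum>i\<in>UNIV. L i * R + norm (K i t))"
      using L(1) R(1) by (intro member_le_sum) (auto intro!: add_nonneg_nonneg mult_nonneg_nonneg)
    then have 1: "N * (L i * R + norm (K i t)) \<le> C"
      unfolding C_def using N(1) by (intro mult_left_mono) auto
    have 2: "0 \<le> N * (L i * R)" "0 \<le> N * norm (K i t)" using N(1) L(1) R(1) by simp_all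
    show "N * (L i * R) \<le> C" "N * norm (K i t) \<le> C" "C \<ge> 0"
      using 1 2 by (simp_all add: distrib_left)
  qed
  show ?thesis
  proof (rule has_vector_derivative_Y_nonlinear[OF t D \<xi> \<zeta> Ci(3)])
    fix i s assume s: "s \<in> {a..b}"
    have "K i s *v \<zeta> s - K i t *v \<zeta> t = (K i s - K i t) *v \<zeta> s + K i t *v (\<zeta> s - \<zeta> t)"
      by (simp add: mv.diff_left mv.diff_right)
    then have "norm (K i s *v \<zeta> s - K i t *v \<zeta> t) \<le> norm ((K i s - K i t) *v \<zeta> s) + norm (K i t *v (\<zeta> s - \<zeta> t))"
      using norm_triangle_ineq by simp
    also have "\<dots> \<le> norm (K i s - K i t) * norm (\<zeta> s) * N + norm (K i t) * norm (\<zeta> s - \<zeta> t) * N"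
      by (intro add_mono N(2))
    also have "\<dots> \<le> (L i * \<bar>s - t\<bar>) * R * N + norm (K i t) * norm (\<zeta> s - \<zeta> t) * N"
      using L(2)[OF s, of i] R(2)[OF s] N(1) L(1)[of i] by (intro add_mono mult_right_mono mult_mono) auto
    also have "\<dots> = (N * (L i * R)) * \<bar>s - t\<bar> + (N * norm (K i t)) * norm (\<zeta> s - \<zeta> t)"
      by (simp add: mult_ac)
    also have "\<dots> \<le> C * \<bar>s - t\<bar> + C * norm (\<zeta> s - \<zeta> t)"
      by (intro add_mono mult_right_mono Ci) auto
    finally show "norm (K i s *v \<zeta> s - K i t *v \<zeta> t) \<le> C * (\<bar>s - t\<bar> + norm (\<zeta> s - \<zeta> t))"
      by (simp add: distrib_left)
  qed
qed

text \<open>The existence of the velocity almost everywhere is part of the data; for the two curves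
  of a rolling it is supplied by the no-slip condition.\<close>

locale ac_path = oriented_riemannian M for M :: "('a, 'n::finite) rmanifold" +
  fixes \<tau> :: real and x :: "real \<Rightarrow> 'a"
  assumes \<tau>: "0 < \<tau>" and ac: "ac_curve M \<tau> x"
    and velocity: "AE t in lebesgue. t \<in> {0..\<tau>} \<longrightarrow> (\<exists>v. has_velocity M \<tau> x t v)"
begin

lemma x_continuous: "continuous_map (top_of_set {0..\<tau>}) (mtop M) x"
  using ac by (simp add: ac_curve_def)

lemma x_topspace: "t \<in> {0..\<tau>} \<Longrightarrow> x t \<in> topspace (mtop M)"
  using x_continuous by (auto simp: continuous_map_def)

lemma at_within_nontrivial: "t \<in> {0..\<tau>} \<Longrightarrow> at t within {0..\<tau>} \<noteq> bot"
  using \<tau> by (simp add: trivial_limit_within islimpt_Icc)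

lemma stays_in_chart:
  assumes t: "t \<in> {0..\<tau>}" and c: "c \<in> charts_at M (x t)"
  obtains d where "d > 0" "\<And>s. s \<in> {0..\<tau>} \<Longrightarrow> \<bar>s - t\<bar> < d \<Longrightarrow> x s \<in> fst c"
proof -
  have "openin (top_of_set {0..\<tau>}) {s \<in> topspace (top_of_set {0..\<tau>}). x s \<in> fst c}"
    using openin_continuous_map_preimage[OF x_continuous chart_openin[OF charts_atD(1)[OF c]]] .
  then obtain T where T: "open T" "{s \<in> {0..\<tau>}. x s \<in> fst c} = {0..\<tau>} \<inter> T"
    by (auto simp: openin_open)
  have "t \<in> T" using T(2) t charts_atD(2)[OF c] by blast
  then obtain d where "d > 0" "ball t d \<subseteq> T" using T(1) open_contains_ball by blast
  then show ?thesis
    using T(2) by (intro that[of d]) (auto simp: dist_real_def subset_iff abs_minus_commute)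
qed

lemma ac_chart:
  "c \<in> atlas M \<Longrightarrow> 0 \<le> a \<Longrightarrow> a \<le> b \<Longrightarrow> b \<le> \<tau> \<Longrightarrow> x ` {a..b} \<subseteq> fst c \<Longrightarrow> abs_continuous a b (\<lambda>t. snd c (x t))"
  using ac unfolding ac_curve_def by blast

text \<open>\<open>has_covariant_derivative\<close> speaks of all charts around the point at once.
  The condition in a single chart is isolated here so that it can be verified in the chart in which
  the equation is solved and then carried to the others.\<close>

definition covariantly_constant_at :: "('a, 'n) chart \<Rightarrow> (real \<Rightarrow> ('a, 'n) tvec) \<Rightarrow> real \<Rightarrow> bool"
  where "covariantly_constant_at c Z t \<longleftrightarrow> (\<exists>x'. ((\<lambda>s. snd c (x s)) has_vector_derivative x') (at t within {0..\<tau>}) \<and>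
    ((\<lambda>s. Z s c) has_vector_derivative - \<Gamma> c (snd c (x t)) x' (Z t c)) (at t within {0..\<tau>}))"

lemma has_covariant_derivative_0_iff:
  "has_covariant_derivative M \<tau> x Z t 0 \<longleftrightarrow> (\<forall>c\<in>charts_at M (x t). covariantly_constant_at c Z t)"
proof -
  have 0: "0 \<in> tangent_space M (x t)" by (rule subspace_0[OF subspace_tangent_space])
  have zero_eq: "(0 = p + q) = (p = - q)" for p q :: real by linarith
  have eq: "(\<forall>k. (0 :: ('a, 'n) tvec) c $ k = Z' $ k + (\<Sum>i\<in>UNIV. \<Sum>j\<in>UNIV.
      christoffel (metric_coeff M c) (snd c (x t)) k i j * x' $ i * Z t c $ j)) \<longleftrightarrow>
      Z' = - \<Gamma> c (snd c (x t)) x' (Z t c)" for c Z' x'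
    by (simp add: vec_eq_iff christoffel_form_def zero_eq)
  show ?thesis
    unfolding has_covariant_derivative_def eq covariantly_constant_at_def using 0 by simp
qed

lemma chart_change_field:
  assumes "Z \<in> tangent_space M (x s)" "c \<in> charts_at M (x s)" "d \<in> charts_at M (x s)"
  shows "Z d = (\<Sum>j\<in>UNIV. Z c $ j *\<^sub>R frechet_derivative (transition c d) (at (snd c (x s))) (axis j 1))"
proof -
  have "Z d = d_transition c d (x s) (Z c)" using assms by (rule tangent_space_transition)
  also have "\<dots> = (\<Sum>j\<in>UNIV. Z c $ j *\<^sub>R frechet_derivative (transition c d) (at (snd c (x s))) (axis j 1))"
    using charts_atD[OF assms(2)] charts_atD[OF assms(3)] by (intro transition_derivative_columns) auto
  finally show ?thesis .
qed

text \<open>Differentiating the new coordinates, which are a moving Jacobian applied to the old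
  ones, produces a second derivative of the transition map. It cancels the inhomogeneous term in the
  transformation law of the Christoffel form.\<close>

lemma covariantly_constant_at_chart_change:
  assumes t: "t \<in> {0..\<tau>}" and c: "c \<in> charts_at M (x t)" and d: "d \<in> charts_at M (x t)"
    and Z: "\<forall>\<^sub>F s in at t within {0..\<tau>}. Z s \<in> tangent_space M (x s)" "Z t \<in> tangent_space M (x t)"
    and cc: "covariantly_constant_at c Z t"
  shows "covariantly_constant_at d Z t"
proof -
  obtain x' where x': "((\<lambda>s. snd c (x s)) has_vector_derivative x') (at t within {0..\<tau>})"
    and Z': "((\<lambda>s. Z s c) has_vector_derivative - \<Gamma> c (snd c (x t)) x' (Z t c)) (at t within {0..\<tau>})"
    using cc unfolding covariantly_constant_at_def by blast
  let ?J = "d_transition c d (x t)"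
  obtain d1 where d1: "d1 > 0" "\<And>s. s \<in> {0..\<tau>} \<Longrightarrow> \<bar>s - t\<bar> < d1 \<Longrightarrow> x s \<in> fst c" by (rule stays_in_chart[OF t c]) blast
  obtain d2 where d2: "d2 > 0" "\<And>s. s \<in> {0..\<tau>} \<Longrightarrow> \<bar>s - t\<bar> < d2 \<Longrightarrow> x s \<in> fst d" by (rule stays_in_chart[OF t d]) blast
  obtain d3 where d3: "d3 > 0" "\<And>s. s \<in> {0..\<tau>} \<Longrightarrow> \<bar>s - t\<bar> < d3 \<Longrightarrow> Z s \<in> tangent_space M (x s)"
  proof -
    obtain d3 where "d3 > 0" and d3: "\<And>s. s \<in> {0..\<tau>} \<Longrightarrow> s \<noteq> t \<and> dist s t < d3 \<Longrightarrow> Z s \<in> tangent_space M (x s)"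
      using Z(1) unfolding eventually_at by blast
    have "Z s \<in> tangent_space M (x s)" if "s \<in> {0..\<tau>}" "\<bar>s - t\<bar> < d3" for s
      using d3[OF that(1)] that(2) Z(2) by (cases "s = t") (simp_all add: dist_real_def)
    with \<open>d3 > 0\<close> show thesis by (rule that)
  qed
  define e where "e = min d1 (min d2 d3)"
  have e: "e > 0" and near: "\<And>s. s \<in> {0..\<tau>} \<Longrightarrow> dist s t < e \<Longrightarrow> c \<in> charts_at M (x s) \<and> d \<in> charts_at M (x s) \<and> Z s \<in> tangent_space M (x s)"
    using d1 d2 d3 charts_atD(1)[OF c] charts_atD(1)[OF d] by (auto simp: e_def dist_real_def charts_atI)
  have "((\<lambda>s. transition c d (snd c (x s))) has_vector_derivative ?J x') (at t within {0..\<tau>})"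
    using has_derivative_compose[OF x'[unfolded has_vector_derivative_def] transition_has_derivative[OF c d]]
    unfolding has_vector_derivative_def by (simp add: linear_scale[OF d_transition_linear[OF c d]])
  then have 1: "((\<lambda>s. snd d (x s)) has_vector_derivative ?J x') (at t within {0..\<tau>})"
  proof (rule has_vector_derivative_transform_within[OF _ e t])
    fix s assume "s \<in> {0..\<tau>}" "dist s t < e"
    then show "transition c d (snd c (x s)) = snd d (x s)"
      using near charts_atD by (intro transition_chart) blast+
  qed
  have "((\<lambda>s. \<Sum>j\<in>UNIV. Z s c $ j *\<^sub>R frechet_derivative (transition c d) (at (snd c (x s))) (axis j 1)) has_vector_derivative
      ?J (- \<Gamma> c (snd c (x t)) x' (Z t c)) + frechet_derivative (\<lambda>q. frechet_derivative (transition c d) (at q) (Z t c)) (at (snd c (x t))) x')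
      (at t within {0..\<tau>})"
    by (rule transition_derivative_moving[OF c d refl x' Z'])
  moreover have "?J (- \<Gamma> c (snd c (x t)) x' (Z t c)) + frechet_derivative (\<lambda>q. frechet_derivative (transition c d) (at q) (Z t c)) (at (snd c (x t))) x'
      = - \<Gamma> d (snd d (x t)) (?J x') (Z t d)"
    unfolding linear_neg[OF d_transition_linear[OF c d]] christoffel_transition[OF c d] tangent_space_transition[OF Z(2) c d]
    by simp
  ultimately have "((\<lambda>s. \<Sum>j\<in>UNIV. Z s c $ j *\<^sub>R frechet_derivative (transition c d) (at (snd c (x s))) (axis j 1)) has_vector_derivative
      - \<Gamma> d (snd d (x t)) (?J x') (Z t d)) (at t within {0..\<tau>})" by (simp only:)
  then have "((\<lambda>s. Z s d) has_vector_derivative - \<Gamma> d (snd d (x t)) (?J x') (Z t d)) (at t within {0..\<tau>})"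
  proof (rule has_vector_derivative_transform_within[OF _ e t])
    fix s assume "s \<in> {0..\<tau>}" "dist s t < e"
    then show "(\<Sum>j\<in>UNIV. Z s c $ j *\<^sub>R frechet_derivative (transition c d) (at (snd c (x s))) (axis j 1)) = Z s d"
      using near by (intro chart_change_field[symmetric]) blast+
  qed
  with 1 show ?thesis unfolding covariantly_constant_at_def by blast
qed

text \<open>The new coordinates are sums of old coordinates times columns of the Jacobian along the
  curve, and these columns are locally Lipschitz functions of absolutely continuous
  coordinates.\<close>

lemma abs_continuous_chart_change:
  assumes ab: "0 \<le> a" "a \<le> b" "b \<le> \<tau>" and c: "c \<in> atlas M" and d: "d \<in> atlas M"
    and sub: "x ` {a..b} \<subseteq> fst c \<inter> fst d" and Z: "\<And>s. s \<in> {a..b} \<Longrightarrow> Z s \<in> tangent_space M (x s)"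
    and Zc: "abs_continuous a b (\<lambda>s. Z s c)"
  shows "abs_continuous a b (\<lambda>s. Z s d)"
proof -
  let ?O = "snd c ` (fst c \<inter> fst d)"
  have \<xi>: "abs_continuous a b (\<lambda>s. snd c (x s))" using sub by (intro ac_chart c ab) auto
  have "abs_continuous a b (\<lambda>s. frechet_derivative (transition c d) (at (snd c (x s))) (axis j 1))" for j
  proof (rule abs_continuous_compose[OF ab(2) \<xi>])
    show "locally_lipschitz_on ?O (\<lambda>q. frechet_derivative (transition c d) (at q) (axis j 1))"
      by (rule smooth_on_imp_locally_lipschitz_on[OF smooth_on_directional_derivative[OF transition_smooth[OF c d]] overlap_open[OF c d]])
    show "(\<lambda>s. snd c (x s)) ` {a..b} \<subseteq> ?O" using sub by auto
  qed
  then have "abs_continuous a b (\<lambda>s. \<Sum>j\<in>UNIV. Z s c $ j *\<^sub>R frechet_derivative (transition c d) (at (snd c (x s))) (axis j 1))"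
    by (intro abs_continuous_sum abs_continuous_scaleR abs_continuous_vec_nth Zc)
  moreover have "(\<Sum>j\<in>UNIV. Z s c $ j *\<^sub>R frechet_derivative (transition c d) (at (snd c (x s))) (axis j 1)) = Z s d"
    if "a \<le> s" "s \<le> b" for s
    using that sub c d by (intro chart_change_field[symmetric] Z charts_atI) auto
  ultimately show ?thesis by (subst (asm) abs_continuous_cong) auto
qed

text \<open>Even on a subinterval, derivatives are taken within \<open>{0..\<tau>}\<close>. This
  makes the pieces of a pasted field literally compatible, and it affects only the two end points, a
  null set.\<close>

definition parallel_on :: "real \<Rightarrow> real \<Rightarrow> (real \<Rightarrow> ('a, 'n) tvec) \<Rightarrow> bool"
  where "parallel_on a b Z \<longleftrightarrow> (\<forall>t\<in>{a..b}. Z t \<in> tangent_space M (x t)) \<and>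
    (\<forall>c\<in>atlas M. \<forall>u v. a \<le> u \<and> u \<le> v \<and> v \<le> b \<and> x ` {u..v} \<subseteq> fst c \<longrightarrow> abs_continuous u v (\<lambda>t. Z t c)) \<and>
    (AE t in lebesgue. t \<in> {a..b} \<longrightarrow> (\<forall>c\<in>charts_at M (x t). covariantly_constant_at c Z t))"

lemma parallel_iff_parallel_on: "parallel M \<tau> x Z \<longleftrightarrow> parallel_on 0 \<tau> Z"
  unfolding parallel_def ac_tangent_field_def tangent_field_def parallel_on_def has_covariant_derivative_0_iff
  by blast

lemma AE_neq: "AE t in lebesgue. t \<noteq> (b :: real)"
proof -
  have "{b} \<in> null_sets lebesgue"
    using negligible_sing[of b] by (simp add: negligible_iff_null_sets)
  from AE_not_in[OF this] show ?thesis by simp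
qed

text \<open>Away from the gluing time the new field agrees near \<open>t\<close> with one of the two
  pieces and inherits its derivative; the gluing time itself is a null set, and there continuity of
  the values makes the pieces combine.\<close>

lemma parallel_on_glue:
  assumes Z: "parallel_on a b Z" and W: "parallel_on b e W" and eq: "Z b = W b"
    and ab: "0 \<le> a" "a \<le> b" "b \<le> e" "e \<le> \<tau>"
  shows "parallel_on a e (\<lambda>t. if t \<le> b then Z t else W t)"
proof -
  let ?Y = "\<lambda>t. if t \<le> b then Z t else W t"
  have tan: "?Y t \<in> tangent_space M (x t)" if "t \<in> {a..e}" for t
    using Z W that unfolding parallel_on_def by auto
  have Zac: "abs_continuous u v (\<lambda>t. Z t c)" if "c \<in> atlas M" "a \<le> u" "u \<le> v" "v \<le> b" "x ` {u..v} \<subseteq> fst c" for c u v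
    using Z that unfolding parallel_on_def by blast
  have Wac: "abs_continuous u v (\<lambda>t. W t c)" if "c \<in> atlas M" "b \<le> u" "u \<le> v" "v \<le> e" "x ` {u..v} \<subseteq> fst c" for c u v
    using W that unfolding parallel_on_def by blast
  have ac: "abs_continuous u v (\<lambda>t. ?Y t c)"
    if c: "c \<in> atlas M" and uv: "a \<le> u" "u \<le> v" "v \<le> e" and sub: "x ` {u..v} \<subseteq> fst c" for c u v
  proof -
    have left: "abs_continuous u' v' (\<lambda>t. ?Y t c)" if "u \<le> u'" "u' \<le> v'" "v' \<le> b" "v' \<le> v" for u' v'
    proof -
      have "abs_continuous u' v' (\<lambda>t. Z t c)" using that uv sub by (intro Zac c) auto
      then show ?thesis using that by (subst abs_continuous_cong[where g = "\<lambda>t. Z t c"]) auto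
    qed
    have right: "abs_continuous u' v' (\<lambda>t. ?Y t c)" if "b \<le> u'" "u \<le> u'" "u' \<le> v'" "v' \<le> v" for u' v'
    proof -
      have "abs_continuous u' v' (\<lambda>t. W t c)" using that uv sub by (intro Wac c) auto
      moreover have "(if t \<le> b then Z t else W t) = W t" if "u' \<le> t" for t
        using that \<open>b \<le> u'\<close> eq by (cases "t = b") auto
      ultimately show ?thesis by (subst abs_continuous_cong[where g = "\<lambda>t. W t c"]) simp_all
    qed
    consider "v \<le> b" | "b \<le> u" | "u \<le> b" "b \<le> v" by linarith
    then show ?thesis
    proof cases
      case 3
      show ?thesis by (rule abs_continuous_combine[OF left right]) (use 3 in auto)
    qed (use left right uv in simp_all)
  qed
  have "AE t in lebesgue. t \<in> {a..b} \<longrightarrow> (\<forall>c\<in>charts_at M (x t). covariantly_constant_at c Z t)"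
    using Z unfolding parallel_on_def by blast
  moreover have "AE t in lebesgue. t \<in> {b..e} \<longrightarrow> (\<forall>c\<in>charts_at M (x t). covariantly_constant_at c W t)"
    using W unfolding parallel_on_def by blast
  ultimately have "AE t in lebesgue. t \<in> {a..e} \<longrightarrow> (\<forall>c\<in>charts_at M (x t). covariantly_constant_at c ?Y t)"
    using AE_neq[of b]
  proof eventually_elim
    case (elim t)
    show ?case
    proof (intro impI ballI)
      fix c assume t: "t \<in> {a..e}" and c: "c \<in> charts_at M (x t)"
      have t': "t \<in> {0..\<tau>}" using t ab by auto
      show "covariantly_constant_at c ?Y t"
      proof (cases "t < b")
        case True
        then have "covariantly_constant_at c Z t" using elim(1) t c by auto
        then obtain x' where x': "((\<lambda>s. snd c (x s)) has_vector_derivative x') (at t within {0..\<tau>})"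
          and Z': "((\<lambda>s. Z s c) has_vector_derivative - \<Gamma> c (snd c (x t)) x' (Z t c)) (at t within {0..\<tau>})"
          unfolding covariantly_constant_at_def by blast
        have "((\<lambda>s. ?Y s c) has_vector_derivative - \<Gamma> c (snd c (x t)) x' (Z t c)) (at t within {0..\<tau>})"
          by (rule has_vector_derivative_transform_within[OF Z' _ t', of "b - t"])
            (use True in \<open>auto simp: dist_real_def\<close>)
        with x' True show ?thesis unfolding covariantly_constant_at_def by auto
      next
        case False
        then have "t > b" using elim(3) by simp
        then have "covariantly_constant_at c W t" using elim(2) t c by auto
        then obtain x' where x': "((\<lambda>s. snd c (x s)) has_vector_derivative x') (at t within {0..\<tau>})"
          and W': "((\<lambda>s. W s c) has_vector_derivative - \<Gamma> c (snd c (x t)) x' (W t c)) (at t within {0..\<tau>})"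
          unfolding covariantly_constant_at_def by blast
        have "((\<lambda>s. ?Y s c) has_vector_derivative - \<Gamma> c (snd c (x t)) x' (W t c)) (at t within {0..\<tau>})"
          by (rule has_vector_derivative_transform_within[OF W' _ t', of "t - b"])
            (use \<open>t > b\<close> in \<open>auto simp: dist_real_def\<close>)
        with x' \<open>t > b\<close> show ?thesis unfolding covariantly_constant_at_def by auto
      qed
    qed
  qed
  then show ?thesis using tan ac unfolding parallel_on_def by blast
qed

end

lemma differentiable_matrix:
  fixes f :: "'m::finite \<Rightarrow> 'n::finite \<Rightarrow> 'a::real_normed_vector \<Rightarrow> real"
  assumes "\<And>k j. f k j differentiable (at z)"
  shows "(\<lambda>z. \<chi> k j. f k j z) differentiable (at z)"
proof -
  define D where "D k j = frechet_derivative (f k j) (at z)" for k j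
  have D: "(f k j has_derivative D k j) (at z)" for k j
    using assms unfolding D_def by (simp flip: frechet_derivative_works)
  have expand: "(\<chi> k j. g k j) = (\<Sum>k\<in>UNIV. \<Sum>j\<in>UNIV. g k j *\<^sub>R axis k (axis j (1::real)))"
    for g :: "'m \<Rightarrow> 'n \<Rightarrow> real"
  proof -
    have entry: "g k j * (axis k (axis j 1) :: real ^ 'n ^ 'm) $ p $ q = (if j = q then if k = p then g k j else 0 else 0)" for k j p q
      by (simp add: axis_def)
    have "(\<Sum>k\<in>UNIV. \<Sum>j\<in>UNIV. g k j *\<^sub>R (axis k (axis j 1) :: real ^ 'n ^ 'm)) $ p $ q = g p q" for p q
      by (simp add: entry)
    then show ?thesis by (simp add: vec_eq_iff)
  qed
  have "((\<lambda>z. \<chi> k j. f k j z) has_derivative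
      (\<lambda>h. \<Sum>k\<in>UNIV. \<Sum>j\<in>UNIV. D k j h *\<^sub>R axis k (axis j (1::real)))) (at z)"
    by (simp only: expand) (intro has_derivative_sum has_derivative_scaleR_left D)
  then show ?thesis unfolding differentiable_def by blast
qed

lemma has_integral_increment:
  fixes f :: "real \<Rightarrow> 'e::euclidean_space"
  assumes F: "\<And>t. t \<in> {a..b} \<Longrightarrow> (f has_integral F t - F a) {a..t}" and uv: "a \<le> u" "u \<le> v" "v \<le> b"
  shows "(f has_integral F v - F u) {u..v}"
proof -
  have v: "(f has_integral F v - F a) {a..v}" and u: "(f has_integral F u - F a) {a..u}"
    using F uv by auto
  have av: "f integrable_on {a..v}" using v by (rule has_integral_integrable)
  then have "f integrable_on {u..v}"
    by (rule integrable_on_subinterval) (use uv in simp)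
  then have "(f has_integral integral {u..v} f) {u..v}" by (rule integrable_integral)
  moreover have "integral {a..u} f + integral {u..v} f = integral {a..v} f"
    by (rule Henstock_Kurzweil_Integration.integral_combine[OF uv(1,2) av])
  then have "integral {u..v} f = integral {a..v} f - integral {a..u} f"
    by (metis add_diff_cancel_left')
  then have "integral {u..v} f = F v - F u"
    unfolding integral_unique[OF u] integral_unique[OF v] by simp
  ultimately show ?thesis by (simp only:)
qed

section \<open>The equation of parallel transport in a chart\<close>

context oriented_riemannian
begin

text \<open>The sign is chosen so that a parallel field solves \<zeta>' = \<Sum> \<xi>'_i K_i
  \<zeta> with these matrices as K_i.\<close>

definition connection_matrix :: "('a, 'n) chart \<Rightarrow> 'n \<Rightarrow> real ^ 'n \<Rightarrow> real ^ 'n ^ 'n"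
  where "connection_matrix c i z = (\<chi> k j. - christoffel (metric_coeff M c) z k i j)"

lemma connection_matrix_sum:
  "(\<Sum>i\<in>UNIV. u $ i *\<^sub>R (connection_matrix c i z *v w)) = - \<Gamma> c z u w"
  by (simp add: vec_eq_iff connection_matrix_def christoffel_form_def matrix_vector_mult_def
      sum_distrib_left sum_negf mult_ac)

lemma connection_matrix_differentiable:
  "c \<in> atlas M \<Longrightarrow> z \<in> snd c ` fst c \<Longrightarrow> connection_matrix c i differentiable (at z)"
  unfolding connection_matrix_def
  by (intro differentiable_matrix differentiable_minus christoffel_chart_differentiable)

end

context ac_path
begin

abbreviation \<xi>' :: "('a, 'n) chart \<Rightarrow> real \<Rightarrow> real ^ 'n"
  where "\<xi>' c t \<equiv> vector_derivative (\<lambda>s. snd c (x s)) (at t within {0..\<tau>})"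

lemma velocity_AE:
  "AE t in lebesgue. t \<in> {0..\<tau>} \<longrightarrow>
    (\<forall>c\<in>charts_at M (x t). ((\<lambda>s. snd c (x s)) has_vector_derivative \<xi>' c t) (at t within {0..\<tau>}))"
  using velocity
proof eventually_elim
  case (elim t)
  show ?case
  proof (intro impI ballI)
    fix c assume t: "t \<in> {0..\<tau>}" and c: "c \<in> charts_at M (x t)"
    obtain v where "has_velocity M \<tau> x t v" using elim t by blast
    then have D: "((\<lambda>s. snd c (x s)) has_vector_derivative v c) (at t within {0..\<tau>})"
      using c unfolding has_velocity_def by blast
    show "((\<lambda>s. snd c (x s)) has_vector_derivative \<xi>' c t) (at t within {0..\<tau>})"
      using vector_derivative_within[OF at_within_nontrivial[OF t] D] D by simp
  qed
qed

text \<open>The equality of the two filters permits switching between derivatives within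
  \<open>{a..b}\<close> and within \<open>{0..\<tau>}\<close> at \<open>t\<close>, also when
  \<open>t\<close> is 0 or \<tau>. The last property says that every short interval around
  \<open>t\<close> lies in the chart interval.\<close>

lemma chart_nbhd:
  assumes t: "t \<in> {0..\<tau>}" and c: "c \<in> charts_at M (x t)"
  obtains a b d where "0 \<le> a" "a \<le> t" "t \<le> b" "b \<le> \<tau>" "x ` {a..b} \<subseteq> fst c"
    "at t within {a..b} = at t within {0..\<tau>}" "d > 0"
    "\<And>u v. 0 \<le> u \<Longrightarrow> u \<le> t \<Longrightarrow> t \<le> v \<Longrightarrow> v \<le> \<tau> \<Longrightarrow> v - u < d \<Longrightarrow> a \<le> u \<and> v \<le> b"
proof -
  obtain d where d: "d > 0" "\<And>s. s \<in> {0..\<tau>} \<Longrightarrow> \<bar>s - t\<bar> < d \<Longrightarrow> x s \<in> fst c"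
    by (rule stays_in_chart[OF t c]) blast
  let ?a = "max 0 (t - d / 2)" and ?b = "min \<tau> (t + d / 2)"
  have "x ` {?a..?b} \<subseteq> fst c"
  proof (rule image_subsetI)
    fix s assume "s \<in> {?a..?b}"
    then show "x s \<in> fst c" using d(1) t by (intro d(2)) (auto simp: abs_less_iff)
  qed
  moreover have "at t within {?a..?b} = at t within {0..\<tau>}"
  proof (rule at_within_nhd[of t "{t - d / 2<..<t + d / 2}"])
    show "{?a..?b} \<inter> {t - d / 2<..<t + d / 2} - {t} = {0..\<tau>} \<inter> {t - d / 2<..<t + d / 2} - {t}"
      by auto
  qed (use d(1) in auto)
  ultimately show ?thesis
    using d(1) t by (intro that[of ?a ?b "d / 2"]) auto
qed

context
  fixes c a b assumes c: "c \<in> atlas M" and ab: "0 \<le> a" "a \<le> b" "b \<le> \<tau>" and sub: "x ` {a..b} \<subseteq> fst c"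
begin

lemma \<xi>_ac: "abs_continuous a b (\<lambda>s. snd c (x s))"
  by (rule ac_chart[OF c ab sub])

lemma \<xi>_continuous: "continuous_on {a..b} (\<lambda>s. snd c (x s))"
  by (rule abs_continuous_imp_continuous_on[OF \<xi>_ac])

lemma chart_at_interval: "s \<in> {a..b} \<Longrightarrow> c \<in> charts_at M (x s)"
  by (rule charts_atI[OF c]) (use sub in blast)

lemma within_subinterval: "(f has_vector_derivative D) (at t within {0..\<tau>}) \<Longrightarrow> (f has_vector_derivative D) (at t within {a..b})"
  by (rule has_vector_derivative_within_subset) (use ab in auto)

lemma \<xi>_derivative_AE:
  "AE t in lebesgue. t \<in> {a..b} \<longrightarrow> ((\<lambda>s. snd c (x s)) has_vector_derivative \<xi>' c t) (at t within {a..b})"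
  using velocity_AE
proof eventually_elim
  case (elim t)
  show ?case
  proof
    assume t: "t \<in> {a..b}"
    then have "((\<lambda>s. snd c (x s)) has_vector_derivative \<xi>' c t) (at t within {0..\<tau>})"
      using elim chart_at_interval[OF t] ab by auto
    then show "((\<lambda>s. snd c (x s)) has_vector_derivative \<xi>' c t) (at t within {a..b})"
      by (rule within_subinterval)
  qed
qed

lemma \<xi>'_absolutely_integrable: "\<xi>' c absolutely_integrable_on {a..b}"
  by (rule abs_continuous_derivative_absolutely_integrable[OF ab(2) \<xi>_ac \<xi>_derivative_AE])

lemma subinterval_AE:
  assumes "AE t in lebesgue. t \<in> {a..b} \<longrightarrow> (f has_vector_derivative f' t) (at t within {a..b})"
    and "a \<le> u" "v \<le> b"
  shows "AE t in lebesgue. t \<in> {u..v} \<longrightarrow> (f has_vector_derivative f' t) (at t within {u..v})"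
  using assms(1)
proof eventually_elim
  case (elim t)
  show ?case
  proof
    assume "t \<in> {u..v}"
    then have "(f has_vector_derivative f' t) (at t within {a..b})" using elim assms(2,3) by auto
    then show "(f has_vector_derivative f' t) (at t within {u..v})"
      by (rule has_vector_derivative_within_subset) (use assms(2,3) in auto)
  qed
qed

lemma \<xi>_ftc: "a \<le> u \<Longrightarrow> u \<le> v \<Longrightarrow> v \<le> b \<Longrightarrow> (\<xi>' c has_integral snd c (x v) - snd c (x u)) {u..v}"
  by (rule abs_continuous_has_integral[OF _ abs_continuous_subset[OF \<xi>_ac] subinterval_AE[OF \<xi>_derivative_AE]])

lemma connection_along_derivative:
  assumes t: "t \<in> {a..b}" and D: "((\<lambda>s. snd c (x s)) has_vector_derivative D) (at t within {a..b})"
  shows "\<exists>E. ((\<lambda>s. connection_matrix c i (snd c (x s))) has_vector_derivative E) (at t within {a..b})"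
proof -
  have "snd c (x t) \<in> snd c ` fst c" using sub t by blast
  then obtain F where F: "(connection_matrix c i has_derivative F) (at (snd c (x t)))"
    using connection_matrix_differentiable[OF c] unfolding differentiable_def by blast
  from has_derivative_compose[OF D[unfolded has_vector_derivative_def] this]
  show ?thesis
    unfolding has_vector_derivative_def by (auto simp: linear_scale[OF has_derivative_linear[OF F]])
qed

lemma connection_along_continuous: "continuous_on {a..b} (\<lambda>s. connection_matrix c i (snd c (x s)))"
proof (rule continuous_on_compose2[OF _ \<xi>_continuous])
  show "continuous_on (snd c ` fst c) (connection_matrix c i)"
    using connection_matrix_differentiable[OF c]
    by (intro continuous_at_imp_continuous_on ballI differentiable_imp_continuous_within)
  show "(\<lambda>s. snd c (x s)) ` {a..b} \<subseteq> snd c ` fst c" using sub by auto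
qed

text \<open>Absolute continuity of the coordinates together with the equation almost everywhere
  gives the integral equation; uniqueness of derivatives identifies the velocity that occurs in
  \<open>covariantly_constant_at\<close> with \<open>\<xi>'\<close>.\<close>

lemma driven_curve_parallel:
  assumes Z: "parallel_on a b Z"
  shows "driven_curve a b (\<lambda>s. snd c (x s)) (\<xi>' c) (\<lambda>i s. connection_matrix c i (snd c (x s)) *v Z s c) (\<lambda>s. Z s c)"
proof
  show "\<xi>' c absolutely_integrable_on {a..b}" by (rule \<xi>'_absolutely_integrable)
  fix u v assume uv: "a \<le> u" "u \<le> v" "v \<le> b"
  then show "(\<xi>' c has_integral snd c (x v) - snd c (x u)) {u..v}" by (rule \<xi>_ftc)
  have ac: "abs_continuous a b (\<lambda>s. Z s c)"
    using Z c ab(2) sub unfolding parallel_on_def by blast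
  have "AE t in lebesgue. t \<in> {a..b} \<longrightarrow> (\<forall>c\<in>charts_at M (x t). covariantly_constant_at c Z t)"
    using Z unfolding parallel_on_def by blast
  then have "AE t in lebesgue. t \<in> {a..b} \<longrightarrow> ((\<lambda>s. Z s c) has_vector_derivative
      (\<Sum>i\<in>UNIV. \<xi>' c t $ i *\<^sub>R (connection_matrix c i (snd c (x t)) *v Z t c))) (at t within {a..b})"
  proof eventually_elim
    case (elim t)
    show ?case
    proof
      assume t: "t \<in> {a..b}"
      then have "covariantly_constant_at c Z t" using elim chart_at_interval by blast
      then obtain x' where x': "((\<lambda>s. snd c (x s)) has_vector_derivative x') (at t within {0..\<tau>})"
        and Z': "((\<lambda>s. Z s c) has_vector_derivative - \<Gamma> c (snd c (x t)) x' (Z t c)) (at t within {0..\<tau>})"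
        unfolding covariantly_constant_at_def by blast
      have "\<xi>' c t = x'" by (rule vector_derivative_within[OF at_within_nontrivial x']) (use t ab in auto)
      with within_subinterval[OF Z'] show "((\<lambda>s. Z s c) has_vector_derivative
          (\<Sum>i\<in>UNIV. \<xi>' c t $ i *\<^sub>R (connection_matrix c i (snd c (x t)) *v Z t c))) (at t within {a..b})"
        unfolding connection_matrix_sum by simp
    qed
  qed
  from abs_continuous_has_integral[OF uv(2) abs_continuous_subset[OF ac uv(1,3)] subinterval_AE[OF this uv(1,3)]]
  show "((\<lambda>s. \<Sum>i\<in>UNIV. \<xi>' c s $ i *\<^sub>R (connection_matrix c i (snd c (x s)) *v Z s c)) has_integral Z v c - Z u c) {u..v}" .
qed

lemma parallel_transport_in_chart:
  assumes curve: "driven_curve a b (\<lambda>s. snd c (x s)) (\<xi>' c) (\<lambda>i s. connection_matrix c i (snd c (x s)) *v \<zeta> s) \<zeta>"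
    and \<zeta>: "continuous_on {a..b} \<zeta>" and t: "t \<in> {a..b}"
    and D: "((\<lambda>s. snd c (x s)) has_vector_derivative D) (at t within {a..b})"
  shows "(\<zeta> has_vector_derivative - \<Gamma> c (snd c (x t)) D (\<zeta> t)) (at t within {a..b})"
  using linear_ode_has_vector_derivative[OF curve \<xi>_continuous connection_along_continuous \<zeta> t D
      connection_along_derivative[OF t D]]
  unfolding connection_matrix_sum .

text \<open>Each summand is an integrable velocity component times a continuous, hence bounded,
  matrix.\<close>

lemma connection_along_absolutely_integrable:
  "(\<lambda>s. \<Sum>i\<in>UNIV. \<xi>' c s $ i *\<^sub>R connection_matrix c i (snd c (x s))) absolutely_integrable_on {a..b}"
proof (rule absolutely_integrable_sum)
  fix i :: 'n
  have g: "(\<lambda>s. \<xi>' c s $ i) absolutely_integrable_on {a..b}"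
    using absolutely_integrable_linear[OF \<xi>'_absolutely_integrable bounded_linear_vec_nth[of i]] by (simp add: o_def)
  show "(\<lambda>s. \<xi>' c s $ i *\<^sub>R connection_matrix c i (snd c (x s))) absolutely_integrable_on {a..b}"
  proof (rule absolutely_integrable_bounded_measurable_product[where h = "\<lambda>A r. r *\<^sub>R A"])
    show "bilinear (\<lambda>A r. r *\<^sub>R A :: real ^ 'n ^ 'n)"
      by (simp add: bilinear_def linear_iff algebra_simps)
    show "(\<lambda>s. connection_matrix c i (snd c (x s))) \<in> borel_measurable (lebesgue_on {a..b})"
      by (intro continuous_imp_measurable_on_sets_lebesgue connection_along_continuous) auto
    show "bounded ((\<lambda>s. connection_matrix c i (snd c (x s))) ` {a..b})"
      by (intro compact_imp_bounded compact_continuous_image connection_along_continuous) auto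
  qed (use g in auto)
qed simp

text \<open>A solution in one chart becomes a field parallel in the sense of all charts: absolute
  continuity and covariant constancy are first established in \<open>c\<close> and then transferred
  to every chart around the point.\<close>

lemma parallel_on_of_ode:
  assumes \<zeta>: "continuous_on {a..b} \<zeta>"
    and ode: "\<And>t. t \<in> {a..b} \<Longrightarrow> ((\<lambda>s. (\<Sum>i\<in>UNIV. \<xi>' c s $ i *\<^sub>R connection_matrix c i (snd c (x s))) *v \<zeta> s) has_integral \<zeta> t - \<zeta> a) {a..t}"
  shows "parallel_on a b (\<lambda>s. tvec_of M c (x s) (\<zeta> s))"
proof -
  let ?Z = "\<lambda>s. tvec_of M c (x s) (\<zeta> s)"
  interpret mv: bounded_bilinear "(*v) :: real ^ 'n ^ 'n \<Rightarrow> real ^ 'n \<Rightarrow> real ^ 'n"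
    by (rule bounded_bilinear_matrix_vector_mult)
  have rhs: "(\<Sum>i\<in>UNIV. \<xi>' c s $ i *\<^sub>R connection_matrix c i (snd c (x s))) *v \<zeta> s =
      (\<Sum>i\<in>UNIV. \<xi>' c s $ i *\<^sub>R (connection_matrix c i (snd c (x s)) *v \<zeta> s))" for s
    by (simp only: mv.sum_left mv.scaleR_left)
  have curve: "driven_curve a b (\<lambda>s. snd c (x s)) (\<xi>' c) (\<lambda>i s. connection_matrix c i (snd c (x s)) *v \<zeta> s) \<zeta>"
  proof
    fix u v assume uv: "a \<le> u" "u \<le> v" "v \<le> b"
    then show "(\<xi>' c has_integral snd c (x v) - snd c (x u)) {u..v}" by (rule \<xi>_ftc)
    show "((\<lambda>s. \<Sum>i\<in>UNIV. \<xi>' c s $ i *\<^sub>R (connection_matrix c i (snd c (x s)) *v \<zeta> s)) has_integral \<zeta> v - \<zeta> u) {u..v}"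
      using has_integral_increment[OF ode uv] unfolding rhs .
  qed (rule \<xi>'_absolutely_integrable)
  interpret driven_curve a b "\<lambda>s. snd c (x s)" "\<xi>' c" "\<lambda>i s. connection_matrix c i (snd c (x s)) *v \<zeta> s" \<zeta>
    by (rule curve)
  have \<zeta>_ac: "abs_continuous a b \<zeta>"
    by (intro abs_continuous_Y ab bounded_bilinear.continuous_on[OF bounded_bilinear_matrix_vector_mult]
        connection_along_continuous \<zeta>)
  have tan: "?Z s \<in> tangent_space M (x s)" if "s \<in> {a..b}" for s
    by (rule tvec_of_in_tangent_space[OF chart_at_interval[OF that]])
  have Zc: "?Z s c = \<zeta> s" if "s \<in> {a..b}" for s
    by (rule tvec_of_chart[OF chart_at_interval[OF that]])
  have ac: "abs_continuous u v (\<lambda>s. ?Z s d)"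
    if d: "d \<in> atlas M" and uv: "a \<le> u" "u \<le> v" "v \<le> b" and sub': "x ` {u..v} \<subseteq> fst d" for d u v
  proof (rule abs_continuous_chart_change[OF _ uv(2) _ c d])
    show "x ` {u..v} \<subseteq> fst c \<inter> fst d"
    proof (rule image_subsetI)
      fix s assume s: "s \<in> {u..v}"
      then have "s \<in> {a..b}" using uv by auto
      then show "x s \<in> fst c \<inter> fst d" using s sub sub' by blast
    qed
    show "abs_continuous u v (\<lambda>s. ?Z s c)"
      using abs_continuous_subset[OF \<zeta>_ac uv(1,3)] Zc uv by (subst abs_continuous_cong[where g = \<zeta>]) auto
    show "?Z s \<in> tangent_space M (x s)" if "s \<in> {u..v}" for s
      using that uv by (intro tan) auto
  qed (use uv ab in auto)
  \<comment> \<open>The end points are discarded because the equation is known only within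
    \<open>{a..b}\<close>; at interior times this is a two-sided derivative and therefore also one
    within \<open>{0..\<tau>}\<close>.\<close>
  have "AE t in lebesgue. t \<in> {a..b} \<longrightarrow> (\<forall>d\<in>charts_at M (x t). covariantly_constant_at d ?Z t)"
    using velocity_AE AE_neq[of a] AE_neq[of b]
  proof eventually_elim
    case (elim t)
    show ?case
    proof (intro impI ballI)
      fix d assume t: "t \<in> {a..b}" and d: "d \<in> charts_at M (x t)"
      then have t': "a < t" "t < b" using elim(2,3) by auto
      have t\<tau>: "t \<in> {0..\<tau>}" using t ab by auto
      note ct = chart_at_interval[OF t]
      have D: "((\<lambda>s. snd c (x s)) has_vector_derivative \<xi>' c t) (at t within {0..\<tau>})"
        using elim(1) t\<tau> ct by blast
      from parallel_transport_in_chart[OF curve \<zeta> t within_subinterval[OF D]]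
      have "(\<zeta> has_vector_derivative - \<Gamma> c (snd c (x t)) (\<xi>' c t) (\<zeta> t)) (at t)"
        unfolding at_within_Icc_at[OF t'] .
      then have "(\<zeta> has_vector_derivative - \<Gamma> c (snd c (x t)) (\<xi>' c t) (\<zeta> t)) (at t within {0..\<tau>})"
        by (rule has_vector_derivative_at_within)
      then have "((\<lambda>s. ?Z s c) has_vector_derivative - \<Gamma> c (snd c (x t)) (\<xi>' c t) (\<zeta> t)) (at t within {0..\<tau>})"
      proof (rule has_vector_derivative_transform_within[OF _ _ t\<tau>])
        show "min (t - a) (b - t) > 0" using t' by simp
        fix s assume "dist s t < min (t - a) (b - t)"
        then have "s \<in> {a..b}" by (auto simp: dist_real_def)
        then show "\<zeta> s = ?Z s c" by (rule Zc[symmetric])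
      qed
      then have cc: "covariantly_constant_at c ?Z t"
        using D Zc[OF t] unfolding covariantly_constant_at_def by auto
      show "covariantly_constant_at d ?Z t"
      proof (rule covariantly_constant_at_chart_change[where Z = ?Z, OF t\<tau> ct d _ tan[OF t] cc])
        show "\<forall>\<^sub>F s in at t within {0..\<tau>}. ?Z s \<in> tangent_space M (x s)"
          unfolding eventually_at
        proof (intro exI[of _ "min (t - a) (b - t)"] conjI ballI impI)
          fix s assume "s \<noteq> t \<and> dist s t < min (t - a) (b - t)"
          then have "s \<in> {a..b}" by (auto simp: dist_real_def)
          then show "?Z s \<in> tangent_space M (x s)" by (rule tan)
        qed (use t' in simp)
      qed
    qed
  qed
  then show ?thesis using tan ac unfolding parallel_on_def by blast
qed

end

lemma parallel_on_subset:
  assumes "parallel_on a b Z" "a \<le> a'" "b' \<le> b"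
  shows "parallel_on a' b' Z"
proof -
  have "AE t in lebesgue. t \<in> {a..b} \<longrightarrow> (\<forall>c\<in>charts_at M (x t). covariantly_constant_at c Z t)"
    using assms(1) unfolding parallel_on_def by blast
  then have "AE t in lebesgue. t \<in> {a'..b'} \<longrightarrow> (\<forall>c\<in>charts_at M (x t). covariantly_constant_at c Z t)"
    by eventually_elim (use assms(2,3) in auto)
  moreover have "\<forall>t\<in>{a'..b'}. Z t \<in> tangent_space M (x t)"
    using assms unfolding parallel_on_def by auto
  moreover have "\<forall>c\<in>atlas M. \<forall>u v. a' \<le> u \<and> u \<le> v \<and> v \<le> b' \<and> x ` {u..v} \<subseteq> fst c \<longrightarrow> abs_continuous u v (\<lambda>t. Z t c)"
    using assms unfolding parallel_on_def by (meson order_trans)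
  ultimately show ?thesis unfolding parallel_on_def by blast
qed

end

section \<open>Existence of parallel transport, its equation at single times, and inner
  products\<close>

context ac_path
begin

lemma parallel_transport_local:
  assumes t: "t \<in> {0..\<tau>}"
  shows "\<exists>d>0. \<forall>u v. 0 \<le> u \<and> u \<le> t \<and> t \<le> v \<and> v \<le> \<tau> \<and> v - u < d \<longrightarrow>
    (\<forall>w\<in>tangent_space M (x u). \<exists>Z. Z u = w \<and> parallel_on u v Z)"
proof -
  obtain c where c: "c \<in> charts_at M (x t)" using charts_at_nonempty[OF x_topspace[OF t]] by blast
  note cA = charts_atD(1)[OF c]
  obtain a b d where ab: "0 \<le> a" "a \<le> t" "t \<le> b" "b \<le> \<tau>" and sub: "x ` {a..b} \<subseteq> fst c"
    and "d > 0" and d: "\<And>u v. 0 \<le> u \<Longrightarrow> u \<le> t \<Longrightarrow> t \<le> v \<Longrightarrow> v \<le> \<tau> \<Longrightarrow> v - u < d \<Longrightarrow> a \<le> u \<and> v \<le> b"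
    by (rule chart_nbhd[OF t c]) blast
  have ab': "a \<le> b" using ab by simp
  let ?A = "\<lambda>s. \<Sum>i\<in>UNIV. \<xi>' c s $ i *\<^sub>R connection_matrix c i (snd c (x s))"
  have A: "?A absolutely_integrable_on {a..b}"
    by (rule connection_along_absolutely_integrable[OF cA ab(1) ab' ab(4) sub])
  then have An: "(\<lambda>s. norm (?A s)) integrable_on {a..b}"
    by (simp add: absolutely_integrable_on_def)
  obtain c0 where "c0 > 0" and ode: "\<And>u v (A :: real \<Rightarrow> real ^ 'n ^ 'n) w. u \<le> v \<Longrightarrow> A absolutely_integrable_on {u..v} \<Longrightarrow>
      integral {u..v} (\<lambda>s. norm (A s)) \<le> c0 \<Longrightarrow>
      \<exists>Z. continuous_on {u..v} Z \<and> Z u = w \<and> (\<forall>t\<in>{u..v}. ((\<lambda>s. A s *v Z s) has_integral Z t - w) {u..t})"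
    using linear_ode_small[where ?'n = 'n] by blast
  \<comment> \<open>The indefinite integral of the coefficient norm is continuous; within
    \<open>d'\<close> of \<open>t\<close> it changes by less than half the threshold, so its
    increment between two times on either side of \<open>t\<close> stays below the threshold
    \<open>c0\<close>.\<close>
  let ?F = "\<lambda>s. integral {a..s} (\<lambda>s. norm (?A s))"
  have "continuous_on {a..b} ?F" by (rule indefinite_integral_continuous_1[OF An])
  moreover have "c0 / 2 > 0" "t \<in> {a..b}" using \<open>c0 > 0\<close> ab by simp_all
  ultimately obtain d' where "d' > 0" and d': "\<And>s. s \<in> {a..b} \<Longrightarrow> dist s t < d' \<Longrightarrow> dist (?F s) (?F t) < c0 / 2"
    unfolding continuous_on_iff by blast
  have *: "\<exists>Z. Z u = w \<and> parallel_on u v Z"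
    if uv: "0 \<le> u" "u \<le> t" "t \<le> v" "v \<le> \<tau>" "v - u < min d d'" and w: "w \<in> tangent_space M (x u)" for u v w
  proof -
    have in_ab: "a \<le> u" "v \<le> b" and uv': "u \<le> v" using d[OF uv(1-4)] uv by auto
    have sub': "x ` {u..v} \<subseteq> fst c"
    proof (rule image_subsetI)
      fix s assume "s \<in> {u..v}"
      then have "s \<in> {a..b}" using in_ab by simp
      then show "x s \<in> fst c" using sub by blast
    qed
    have Auv: "?A absolutely_integrable_on {u..v}"
      by (rule absolutely_integrable_on_subinterval[OF A]) (use in_ab in simp)
    have "(\<lambda>s. norm (?A s)) integrable_on {a..v}"
      by (rule integrable_on_subinterval[OF An]) (use in_ab in simp)
    then have "?F u + integral {u..v} (\<lambda>s. norm (?A s)) = ?F v"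
      by (rule Henstock_Kurzweil_Integration.integral_combine[OF in_ab(1) uv'])
    moreover have "dist (?F u) (?F t) < c0 / 2" "dist (?F v) (?F t) < c0 / 2"
    proof (rule d'[of u], goal_cases)
      case 1 show ?case using uv in_ab ab by simp
    next
      case 2 show ?case using uv by (simp add: dist_real_def)
    next
      case 3 show ?case
        by (rule d') (use uv in_ab ab in \<open>simp_all add: dist_real_def\<close>)
    qed
    ultimately have small: "integral {u..v} (\<lambda>s. norm (?A s)) \<le> c0"
      unfolding dist_real_def by linarith
    obtain \<zeta> where \<zeta>: "continuous_on {u..v} \<zeta>" "\<zeta> u = w c"
      "\<And>s. s \<in> {u..v} \<Longrightarrow> ((\<lambda>s. ?A s *v \<zeta> s) has_integral \<zeta> s - w c) {u..s}"
      using ode[OF uv' Auv small, of "w c"] by blast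
    have cu: "c \<in> charts_at M (x u)" using cA sub' uv' by (intro charts_atI) auto
    have par: "parallel_on u v (\<lambda>s. tvec_of M c (x s) (\<zeta> s))"
      by (rule parallel_on_of_ode[OF cA uv(1) uv' uv(4) sub' \<zeta>(1)]) (unfold \<zeta>(2), rule \<zeta>(3))
    have "tvec_of M c (x u) (\<zeta> u) = w"
      unfolding \<zeta>(2) by (rule tvec_of_eq[OF w cu])
    with par show ?thesis
      by (intro exI[of _ "\<lambda>s. tvec_of M c (x s) (\<zeta> s)"] conjI)
  qed
  show ?thesis
  proof (intro exI[of _ "min d d'"] conjI allI impI ballI)
    show "min d d' > 0" using \<open>d > 0\<close> \<open>d' > 0\<close> by simp
    fix u v w assume "0 \<le> u \<and> u \<le> t \<and> t \<le> v \<and> v \<le> \<tau> \<and> v - u < min d d'" "w \<in> tangent_space M (x u)"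
    then show "\<exists>Z. Z u = w \<and> parallel_on u v Z" by (elim conjE) (rule *)
  qed
qed

lemma parallel_transport:
  assumes w: "w \<in> tangent_space M (x 0)"
  obtains Z where "Z 0 = w" "parallel_on 0 \<tau> Z"
proof -
  \<comment> \<open>All initial vectors at the left end are included, so that the end value of one
    piece can start the next.\<close>
  let ?P = "\<lambda>u v. 0 \<le> u \<and> v \<le> \<tau> \<longrightarrow> (\<forall>w\<in>tangent_space M (x u). \<exists>Z. Z u = w \<and> parallel_on u v Z)"
  have "?P 0 \<tau>"
  proof (rule Bolzano[where P = ?P, OF less_imp_le[OF \<tau>]])
    fix u v r assume uv: "?P u v" and vr: "?P v r" and le: "u \<le> v" "v \<le> r"
    show "?P u r"
    proof (intro impI ballI)
      fix w assume ur: "0 \<le> u \<and> r \<le> \<tau>" and w: "w \<in> tangent_space M (x u)"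
      then obtain Z where Z: "Z u = w" "parallel_on u v Z" using uv le by fastforce
      then have "Z v \<in> tangent_space M (x v)" using le unfolding parallel_on_def by auto
      then obtain W where W: "W v = Z v" "parallel_on v r W" using vr ur le by fastforce
      have "parallel_on u r (\<lambda>t. if t \<le> v then Z t else W t)"
        using ur le by (intro parallel_on_glue Z W) (simp_all add: W(1))
      then show "\<exists>Z. Z u = w \<and> parallel_on u r Z"
        using Z(1) le(1) by (intro exI[of _ "\<lambda>t. if t \<le> v then Z t else W t"]) simp
    qed
  next
    fix t assume "0 \<le> t" "t \<le> \<tau>"
    then obtain d where "d > 0" and d: "\<And>u v w. 0 \<le> u \<and> u \<le> t \<and> t \<le> v \<and> v \<le> \<tau> \<and> v - u < d \<Longrightarrow>
        w \<in> tangent_space M (x u) \<Longrightarrow> \<exists>Z. Z u = w \<and> parallel_on u v Z"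
      using parallel_transport_local[of t] by auto
    show "\<exists>d>0. \<forall>u v. u \<le> t \<and> t \<le> v \<and> v - u < d \<longrightarrow> ?P u v"
      by (intro exI[of _ d] conjI allI impI ballI \<open>d > 0\<close> d) auto
  qed
  then show ?thesis using w that by auto
qed

text \<open>Parallelism provides the equation for almost every time only. The integral equation
  restores it at every time at which the curve is differentiable, and with whichever derivative
  \<open>D\<close> is at hand.\<close>

lemma parallel_on_covariant_derivative:
  assumes Z: "parallel_on 0 \<tau> Z" and t: "t \<in> {0..\<tau>}" and c: "c \<in> charts_at M (x t)"
    and D: "((\<lambda>s. snd c (x s)) has_vector_derivative D) (at t within {0..\<tau>})"
  shows "((\<lambda>s. Z s c) has_vector_derivative - \<Gamma> c (snd c (x t)) D (Z t c)) (at t within {0..\<tau>})"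
proof -
  note cA = charts_atD(1)[OF c]
  obtain a b d where ab: "0 \<le> a" "a \<le> t" "t \<le> b" "b \<le> \<tau>" and sub: "x ` {a..b} \<subseteq> fst c"
    and within: "at t within {a..b} = at t within {0..\<tau>}"
    by (rule chart_nbhd[OF t c]) blast
  have ab': "a \<le> b" and t': "t \<in> {a..b}" using ab by simp_all
  have Zab: "parallel_on a b Z" by (rule parallel_on_subset[OF Z ab(1,4)])
  have "abs_continuous a b (\<lambda>s. Z s c)"
    using Zab cA ab' sub unfolding parallel_on_def by blast
  then have cont: "continuous_on {a..b} (\<lambda>s. Z s c)" by (rule abs_continuous_imp_continuous_on)
  show ?thesis
    using parallel_transport_in_chart[OF cA ab(1) ab' ab(4) sub
        driven_curve_parallel[OF cA ab(1) ab' ab(4) sub Zab] cont t'] D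
    unfolding within by blast
qed

lemma metric_coeff_along_derivative:
  assumes c: "c \<in> charts_at M (x t)" and D: "((\<lambda>s. snd c (x s)) has_vector_derivative D) (at t within S)"
  shows "((\<lambda>s. metric_coeff M c (snd c (x s))) has_vector_derivative
    frechet_derivative (metric_coeff M c) (at (snd c (x t))) D) (at t within S)"
proof -
  have "snd c (x t) \<in> snd c ` fst c" using charts_atD[OF c] by blast
  then have G: "(metric_coeff M c has_derivative frechet_derivative (metric_coeff M c) (at (snd c (x t)))) (at (snd c (x t)))"
    by (rule smooth_on_imp_has_derivative[OF metric_coeff_smooth[OF charts_atD(1)[OF c]]])
  from has_derivative_compose[OF D[unfolded has_vector_derivative_def] G]
  show ?thesis
    unfolding has_vector_derivative_def by (simp only: linear_scale[OF has_derivative_linear[OF G]])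
qed

lemma metric_coeff_along_ac:
  assumes "c \<in> atlas M" "0 \<le> a" "a \<le> b" "b \<le> \<tau>" "x ` {a..b} \<subseteq> fst c"
  shows "abs_continuous a b (\<lambda>s. metric_coeff M c (snd c (x s)))"
  by (rule abs_continuous_compose[OF assms(3) ac_chart[OF assms]
        smooth_on_imp_locally_lipschitz_on[OF metric_coeff_smooth[OF assms(1)] chart_open[OF assms(1)]]])
    (use assms(5) in auto)

text \<open>Inside a chart the product is an absolutely continuous function whose derivative
  vanishes almost everywhere by \<open>metric_compatible\<close>, hence a constant; chart intervals
  are then joined by bisection.\<close>

lemma parallel_metric_constant:
  assumes Z: "parallel_on 0 \<tau> Z" and W: "parallel_on 0 \<tau> W" and t: "t \<in> {0..\<tau>}"
  shows "metric M (x t) (Z t) (W t) = metric M (x 0) (Z 0) (W 0)"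
proof -
  let ?h = "\<lambda>s. metric M (x s) (Z s) (W s)"
  have tan: "Z s \<in> tangent_space M (x s)" "W s \<in> tangent_space M (x s)" if "s \<in> {0..\<tau>}" for s
    using Z W that unfolding parallel_on_def by blast+
  have loc: "?h v = ?h u" if c: "c \<in> atlas M" and uv: "0 \<le> u" "u \<le> v" "v \<le> \<tau>" and sub: "x ` {u..v} \<subseteq> fst c" for c u v
  proof -
    let ?g = "\<lambda>s. Z s c \<bullet> (metric_coeff M c (snd c (x s)) *v W s c)"
    have chart: "c \<in> charts_at M (x s)" if "s \<in> {u..v}" for s
      by (rule charts_atI[OF c]) (use sub that in blast)
    have hg: "?h s = ?g s" if "s \<in> {u..v}" for s
      using that uv by (intro metric_coords chart tan) auto
    have "abs_continuous u v (\<lambda>s. Z s c)" "abs_continuous u v (\<lambda>s. W s c)"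
      using Z W c uv sub unfolding parallel_on_def by blast+
    then have "abs_continuous u v ?g"
      by (intro abs_continuous_bounded_bilinear[OF bounded_bilinear_inner]
          abs_continuous_bounded_bilinear[OF bounded_bilinear_matrix_vector_mult] metric_coeff_along_ac c uv sub)
    moreover have "AE t in lebesgue. t \<in> {u..v} \<longrightarrow> (?g has_vector_derivative 0) (at t within {u..v})"
      using velocity_AE
    proof eventually_elim
      case (elim t)
      show ?case
      proof
        assume t: "t \<in> {u..v}"
        then have t\<tau>: "t \<in> {0..\<tau>}" using uv by auto
        note ct = chart[OF t]
        let ?z = "snd c (x t)" and ?D = "\<xi>' c t"
        have D: "((\<lambda>s. snd c (x s)) has_vector_derivative ?D) (at t within {0..\<tau>})"
          using elim t\<tau> ct by blast
        have "(?g has_vector_derivative Z t c \<bullet> (metric_coeff M c ?z *v (- \<Gamma> c ?z ?D (W t c))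
            + frechet_derivative (metric_coeff M c) (at ?z) ?D *v W t c)
            + (- \<Gamma> c ?z ?D (Z t c)) \<bullet> (metric_coeff M c ?z *v W t c)) (at t within {0..\<tau>})"
          by (rule bounded_bilinear.has_vector_derivative[OF bounded_bilinear_inner
              parallel_on_covariant_derivative[OF Z t\<tau> ct D]
              bounded_bilinear.has_vector_derivative[OF bounded_bilinear_matrix_vector_mult
                metric_coeff_along_derivative[OF ct D] parallel_on_covariant_derivative[OF W t\<tau> ct D]]])
        moreover have "Z t c \<bullet> (metric_coeff M c ?z *v (- \<Gamma> c ?z ?D (W t c))
            + frechet_derivative (metric_coeff M c) (at ?z) ?D *v W t c)
            + (- \<Gamma> c ?z ?D (Z t c)) \<bullet> (metric_coeff M c ?z *v W t c) = 0"
        proof -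
          have neg: "metric_coeff M c ?z *v (- w) = - (metric_coeff M c ?z *v w)" for w
            by (rule bounded_bilinear.minus_right[OF bounded_bilinear_matrix_vector_mult])
          have "?z \<in> snd c ` fst c" using charts_atD[OF ct] by blast
          from metric_compatible[OF c this, where u = ?D and v = "Z t c" and w = "W t c"] show ?thesis
            unfolding neg inner_add_right inner_minus_left inner_minus_right by linarith
        qed
        ultimately have "(?g has_vector_derivative 0) (at t within {0..\<tau>})" by (simp only:)
        then show "(?g has_vector_derivative 0) (at t within {u..v})"
          by (rule has_vector_derivative_within_subset) (use uv in auto)
      qed
    qed
    ultimately have "?g v = ?g u" by (rule abs_continuous_zero_derivative[OF uv(2)])
    then show ?thesis using hg[of u] hg[of v] uv by simp
  qed
  let ?P = "\<lambda>u v. 0 \<le> u \<and> v \<le> \<tau> \<longrightarrow> ?h v = ?h u"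
  have "?P 0 t"
  proof (rule Bolzano[where P = ?P])
    fix u v r assume "?P u v" "?P v r" "u \<le> v" "v \<le> r"
    then show "?P u r" by auto
  next
    fix s assume "0 \<le> s" "s \<le> t"
    then have s: "s \<in> {0..\<tau>}" using t by auto
    obtain c where c: "c \<in> charts_at M (x s)" using charts_at_nonempty[OF x_topspace[OF s]] by blast
    obtain d where "d > 0" and d: "\<And>r. r \<in> {0..\<tau>} \<Longrightarrow> \<bar>r - s\<bar> < d \<Longrightarrow> x r \<in> fst c"
      by (rule stays_in_chart[OF s c]) blast
    show "\<exists>d>0. \<forall>u v. u \<le> s \<and> s \<le> v \<and> v - u < d \<longrightarrow> ?P u v"
    proof (intro exI[of _ d] conjI allI impI \<open>d > 0\<close>)
      fix u v assume 1: "u \<le> s \<and> s \<le> v \<and> v - u < d" and 2: "0 \<le> u \<and> v \<le> \<tau>"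
      have "x ` {u..v} \<subseteq> fst c"
      proof (rule image_subsetI)
        fix r assume "r \<in> {u..v}"
        then show "x r \<in> fst c" using 1 2 by (intro d) auto
      qed
      then show "?h v = ?h u" using 1 2 by (intro loc[OF charts_atD(1)[OF c]]) auto
    qed
  qed (use t in auto)
  then show ?thesis using t by simp
qed

text \<open>The coordinate integral of \<open>g(Z, x')\<close> vanishes identically, and by
  \<open>has_vector_derivative_Y\<close> its derivative at \<open>t\<close> is the inner product at \<open>t\<close> itself.\<close>

lemma parallel_normal_everywhere:
  assumes Z: "parallel_on 0 \<tau> Z"
    and AE: "AE t in lebesgue. t \<in> {0..\<tau>} \<longrightarrow> (\<exists>v. has_velocity M \<tau> x t v \<and> metric M (x t) (Z t) v = 0)"
    and t: "t \<in> {0..\<tau>}" and v: "has_velocity M \<tau> x t v"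
  shows "metric M (x t) (Z t) v = 0"
proof -
  obtain c where c: "c \<in> charts_at M (x t)" using charts_at_nonempty[OF x_topspace[OF t]] by blast
  note cA = charts_atD(1)[OF c]
  obtain a b d where ab: "0 \<le> a" "a \<le> t" "t \<le> b" "b \<le> \<tau>" and sub: "x ` {a..b} \<subseteq> fst c"
    and within: "at t within {a..b} = at t within {0..\<tau>}"
    by (rule chart_nbhd[OF t c]) blast
  have ab': "a \<le> b" and t': "t \<in> {a..b}" using ab by simp_all
  have tan: "Z s \<in> tangent_space M (x s)" if "s \<in> {0..\<tau>}" for s
    using Z that unfolding parallel_on_def by blast
  have chart: "c \<in> charts_at M (x s)" if "s \<in> {a..b}" for s
    by (rule charts_atI[OF cA]) (use sub that in blast)
  define B where "B s = metric_coeff M c (snd c (x s)) *v Z s c" for s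
  have pairing: "(\<Sum>i\<in>UNIV. w c $ i *\<^sub>R (B s $ i)) = metric M (x s) (Z s) w"
    if s: "s \<in> {a..b}" and w: "w \<in> tangent_space M (x s)" for s w
  proof -
    have "snd c (x s) \<in> snd c ` fst c" using charts_atD[OF chart[OF s]] by blast
    from metric_coeff_inner_sym[OF cA this] have "w c \<bullet> B s = Z s c \<bullet> (metric_coeff M c (snd c (x s)) *v w c)"
      unfolding B_def .
    also have "\<dots> = metric M (x s) (Z s) w"
      using s ab by (intro metric_coords[symmetric] chart tan w) auto
    finally show ?thesis by (simp add: inner_vec_def)
  qed
  obtain N where N: "N \<in> null_sets lebesgue"
    and AEN: "\<And>s. s \<notin> N \<Longrightarrow> s \<in> {0..\<tau>} \<Longrightarrow> \<exists>v. has_velocity M \<tau> x s v \<and> metric M (x s) (Z s) v = 0"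
  proof -
    obtain N where N: "N \<in> null_sets lebesgue" and sub: "{t \<in> space lebesgue. \<not> (t \<in> {0..\<tau>} \<longrightarrow>
        (\<exists>v. has_velocity M \<tau> x t v \<and> metric M (x t) (Z t) v = 0))} \<subseteq> N"
      using AE unfolding eventually_ae_filter by blast
    have "\<exists>v. has_velocity M \<tau> x s v \<and> metric M (x s) (Z s) v = 0" if "s \<notin> N" "s \<in> {0..\<tau>}" for s
      using sub that by (auto simp: subset_iff)
    with N show thesis by (rule that)
  qed
  have zero: "(\<Sum>i\<in>UNIV. \<xi>' c s $ i *\<^sub>R (B s $ i)) = 0" if sab: "s \<in> {a..b}" and sN: "s \<notin> N" for s
  proof -
    have s: "s \<in> {0..\<tau>}" using sab ab by auto
    obtain v where v: "has_velocity M \<tau> x s v" "metric M (x s) (Z s) v = 0" using AEN[OF sN s] by blast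
    then have vt: "v \<in> tangent_space M (x s)" and "((\<lambda>s. snd c (x s)) has_vector_derivative v c) (at s within {0..\<tau>})"
      using chart[OF sab] unfolding has_velocity_def by blast+
    then have "\<xi>' c s = v c" using vector_derivative_within[OF at_within_nontrivial[OF s]] by blast
    then show ?thesis using pairing[OF sab vt] v(2) by simp
  qed
  interpret driven_curve a b "\<lambda>s. snd c (x s)" "\<xi>' c" "\<lambda>i s. B s $ i" "\<lambda>s. 0 :: real"
  proof
    show "\<xi>' c absolutely_integrable_on {a..b}" by (rule \<xi>'_absolutely_integrable[OF cA ab(1) ab' ab(4) sub])
    fix u v assume uv: "a \<le> u" "u \<le> v" "v \<le> b"
    show "(\<xi>' c has_integral snd c (x v) - snd c (x u)) {u..v}" by (rule \<xi>_ftc[OF cA ab(1) ab' ab(4) sub uv])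
    have "negligible N" using N by (simp add: negligible_iff_null_sets)
    then show "((\<lambda>s. \<Sum>i\<in>UNIV. \<xi>' c s $ i *\<^sub>R (B s $ i)) has_integral 0 - 0) {u..v}"
    proof (rule has_integral_spike)
      show "((\<lambda>s. 0 :: real) has_integral 0 - 0) {u..v}" by simp
      show "(\<Sum>i\<in>UNIV. \<xi>' c s $ i *\<^sub>R (B s $ i)) = 0" if "s \<in> {u..v} - N" for s
        using that uv by (intro zero) auto
    qed
  qed
  have vt: "v \<in> tangent_space M (x t)" and D: "((\<lambda>s. snd c (x s)) has_vector_derivative v c) (at t within {0..\<tau>})"
    using v c unfolding has_velocity_def by blast+
  have "abs_continuous a b (\<lambda>s. Z s c)"
    using parallel_on_subset[OF Z ab(1,4)] cA ab' sub unfolding parallel_on_def by blast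
  then have "abs_continuous a b B"
    unfolding B_def
    by (intro abs_continuous_bounded_bilinear[OF bounded_bilinear_matrix_vector_mult]
        metric_coeff_along_ac[OF cA ab(1) ab' ab(4) sub])
  then have Bc: "continuous_on {a..b} B" by (rule abs_continuous_imp_continuous_on)
  have "\<exists>E. (B has_vector_derivative E) (at t within {0..\<tau>})"
    unfolding B_def
    by (rule exI, rule bounded_bilinear.has_vector_derivative[OF bounded_bilinear_matrix_vector_mult
        metric_coeff_along_derivative[OF c D] parallel_on_covariant_derivative[OF Z t c D]])
  then obtain E where "(B has_vector_derivative E) (at t within {a..b})"
    unfolding within by (rule exE)
  from differentiable_imp_pointwise_lipschitz[OF Bc this] obtain L where L: "L \<ge> 0" "\<And>s. s \<in> {a..b} \<Longrightarrow> norm (B s - B t) \<le> L * \<bar>s - t\<bar>"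
    by blast
  have "((\<lambda>s. 0 :: real) has_vector_derivative (\<Sum>i\<in>UNIV. v c $ i *\<^sub>R (B t $ i))) (at t within {a..b})"
  proof (rule has_vector_derivative_Y[OF t' _ L(1)])
    show "((\<lambda>s. snd c (x s)) has_vector_derivative v c) (at t within {a..b})" unfolding within by (rule D)
    fix i s assume "s \<in> {a..b}"
    from L(2)[OF this] component_le_norm_cart[of "B s - B t" i]
    show "norm (B s $ i - B t $ i) \<le> L * \<bar>s - t\<bar>" by simp
  qed
  moreover have "((\<lambda>s. 0 :: real) has_vector_derivative 0) (at t within {a..b})" by simp
  moreover have "at t within {a..b} \<noteq> bot" unfolding within by (rule at_within_nontrivial[OF t])
  ultimately have "(\<Sum>i\<in>UNIV. v c $ i *\<^sub>R (B t $ i)) = 0"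
    using vector_derivative_unique_within by blast
  then show ?thesis using pairing[OF t' vt] by simp
qed

end

section \<open>Parallel orthonormal frames\<close>

lemma christoffel_form_sum:
  "christoffel_form G z u (\<Sum>j\<in>J. a j *\<^sub>R w j) = (\<Sum>j\<in>J. a j *\<^sub>R christoffel_form G z u (w j))"
proof -
  have add: "christoffel_form G z u (v + w) = christoffel_form G z u v + christoffel_form G z u w" for v w
    by (simp add: christoffel_form_def vec_eq_iff distrib_left sum.distrib)
  have scale: "christoffel_form G z u (r *\<^sub>R w) = r *\<^sub>R christoffel_form G z u w" for r w
    by (simp add: christoffel_form_def vec_eq_iff sum_distrib_left mult_ac)
  have lin: "linear (christoffel_form G z u)" by (rule linearI) (rule add scale)+
  then show ?thesis by (simp add: linear_sum linear_scale)
qed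

text \<open>An orthonormal set is independent, so one of maximal size exists. If it had fewer than n
  elements, the Gram-Schmidt remainder of a vector outside its span would enlarge it.\<close>

lemma orthonormal_basis_form:
  fixes G :: "real ^ 'n ^ 'n"
  assumes sym: "\<And>u v. u \<bullet> (G *v v) = v \<bullet> (G *v u)" and pos: "\<And>u. u \<noteq> 0 \<Longrightarrow> u \<bullet> (G *v u) > 0"
  obtains B :: "'n \<Rightarrow> real ^ 'n" where "\<And>i j. B i \<bullet> (G *v B j) = (if i = j then 1 else 0)"
proof -
  define on where "on X \<longleftrightarrow> finite X \<and> (\<forall>u\<in>X. \<forall>v\<in>X. u \<bullet> (G *v v) = (if u = v then 1 else 0))" for X :: "(real ^ 'n) set"
  interpret mv: bounded_bilinear "(*v) :: real ^ 'n ^ 'n \<Rightarrow> real ^ 'n \<Rightarrow> real ^ 'n"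
    by (rule bounded_bilinear_matrix_vector_mult)
  have coeff: "b \<bullet> (G *v (\<Sum>a\<in>X. r a *\<^sub>R a)) = r b" if X: "on X" and b: "b \<in> X" for X r b
  proof -
    have "b \<bullet> (G *v (\<Sum>a\<in>X. r a *\<^sub>R a)) = (\<Sum>a\<in>X. r a * (b \<bullet> (G *v a)))"
      by (simp add: mv.sum_right mv.scaleR_right inner_sum_right)
    also have "\<dots> = (\<Sum>a\<in>X. if a = b then r a else 0)"
      using X b by (intro sum.cong) (auto simp: on_def)
    also have "\<dots> = r b" using X b by (simp add: on_def)
    finally show ?thesis .
  qed
  have indep: "independent X" if X: "on X" for X
  proof -
    have "r a = 0" if "(\<Sum>a\<in>X. r a *\<^sub>R a) = 0" "a \<in> X" for r a
      using coeff[OF X that(2), of r] that(1) by simp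
    then show ?thesis
      using X independent_if_scalars_zero[of X] by (simp add: on_def)
  qed
  have card: "card X \<le> CARD('n)" if X: "on X" for X
    using independent_card_le_dim[OF subset_UNIV indep[OF X]] by simp
  obtain X where X: "on X" and max: "\<And>Y. on Y \<Longrightarrow> card Y \<le> card X"
  proof -
    have "on {}" by (simp add: on_def)
    then have "\<exists>X. on X \<and> (\<forall>Y. on Y \<longrightarrow> card Y \<le> card X)"
      using card by (intro ex_has_greatest_nat[of on "{}" card "CARD('n) + 1"]) (auto simp: le_imp_less_Suc)
    then show thesis using that by blast
  qed
  have "card X = CARD('n)"
  proof (rule ccontr)
    assume "card X \<noteq> CARD('n)"
    then have "card X < CARD('n)" using card[OF X] by simp
    moreover have "dim (span X) = card X" using indep[OF X] by (simp add: dim_eq_card_independent)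
    ultimately have "span X \<noteq> UNIV" by (metis dim_UNIV DIM_cart DIM_real mult.right_neutral order_less_irrefl)
    then obtain w where w: "w \<notin> span X" by blast
    \<comment> \<open>The projection of \<open>w\<close> to the span with respect to the form; the
      normalized remainder \<open>n\<close> below is the additional orthonormal vector.\<close>
    define p where "p = (\<Sum>a\<in>X. (a \<bullet> (G *v w)) *\<^sub>R a)"
    define u where "u = w - p"
    have "p \<in> span X" unfolding p_def by (intro span_sum span_scale span_base)
    then have "u \<noteq> 0" using w by (auto simp: u_def)
    then have uu: "u \<bullet> (G *v u) > 0" by (rule pos)
    have ou: "b \<bullet> (G *v u) = 0" if "b \<in> X" for b
      unfolding u_def p_def mv.diff_right inner_diff_right coeff[OF X that] by simp
    define n where "n = (1 / sqrt (u \<bullet> (G *v u))) *\<^sub>R u"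
    have nn: "n \<bullet> (G *v n) = 1"
    proof -
      have "n \<bullet> (G *v n) = (1 / sqrt (u \<bullet> (G *v u))) * (1 / sqrt (u \<bullet> (G *v u))) * (u \<bullet> (G *v u))"
        by (simp add: n_def mv.scaleR_right)
      also have "\<dots> = 1" using uu by (simp add: field_simps)
      finally show ?thesis .
    qed
    have on_n: "b \<bullet> (G *v n) = 0" "n \<bullet> (G *v b) = 0" if "b \<in> X" for b
      using ou[OF that] sym[of n b] by (simp_all add: n_def mv.scaleR_right)
    have "n \<notin> X" using on_n(1)[of n] nn by auto
    moreover have "on (insert n X)"
      unfolding on_def
    proof (intro conjI ballI)
      fix a b assume "a \<in> insert n X" "b \<in> insert n X"
      then show "a \<bullet> (G *v b) = (if a = b then 1 else 0)"
        using X \<open>n \<notin> X\<close> nn on_n unfolding on_def by (cases "a = n"; cases "b = n") auto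
    qed (use X in \<open>simp add: on_def\<close>)
    ultimately show False using max[of "insert n X"] X by (simp add: on_def)
  qed
  then obtain B :: "'n \<Rightarrow> real ^ 'n" where B: "bij_betw B UNIV X"
    using X finite_same_card_bij[of "UNIV :: 'n set" X] by (auto simp: on_def)
  have "B i \<bullet> (G *v B j) = (if i = j then 1 else 0)" for i j
  proof -
    have "B i \<in> X" "B j \<in> X" "B i = B j \<longleftrightarrow> i = j"
      using B by (auto simp: bij_betw_def inj_def)
    then show ?thesis using X unfolding on_def by simp
  qed
  then show ?thesis by (rule that)
qed

context ac_path
begin

lemma parallel_on_cong:
  assumes Z: "parallel_on 0 \<tau> Z" and eq: "\<And>t. t \<in> {0..\<tau>} \<Longrightarrow> Z' t = Z t"
  shows "parallel_on 0 \<tau> Z'"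
proof -
  have "\<forall>t\<in>{0..\<tau>}. Z' t \<in> tangent_space M (x t)"
    using Z eq unfolding parallel_on_def by simp
  moreover have "abs_continuous u v (\<lambda>t. Z' t c)"
    if "c \<in> atlas M" "0 \<le> u \<and> u \<le> v \<and> v \<le> \<tau> \<and> x ` {u..v} \<subseteq> fst c" for c u v
  proof -
    have "abs_continuous u v (\<lambda>t. Z t c)" using Z that unfolding parallel_on_def by blast
    moreover have "Z' t c = Z t c" if "u \<le> t" "t \<le> v" for t
      using that \<open>0 \<le> u \<and> _\<close> by (simp add: eq)
    ultimately show ?thesis using abs_continuous_cong[of u v "\<lambda>t. Z' t c" "\<lambda>t. Z t c"] by blast
  qed
  moreover have "AE t in lebesgue. t \<in> {0..\<tau>} \<longrightarrow> (\<forall>c\<in>charts_at M (x t). covariantly_constant_at c Z t)"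
    using Z unfolding parallel_on_def by blast
  then have "AE t in lebesgue. t \<in> {0..\<tau>} \<longrightarrow> (\<forall>c\<in>charts_at M (x t). covariantly_constant_at c Z' t)"
  proof eventually_elim
    case (elim t)
    show ?case
    proof (intro impI ballI)
      fix c assume t: "t \<in> {0..\<tau>}" and "c \<in> charts_at M (x t)"
      then have "covariantly_constant_at c Z t" using elim by blast
      then obtain x' where x': "((\<lambda>s. snd c (x s)) has_vector_derivative x') (at t within {0..\<tau>})"
        and Zd: "((\<lambda>s. Z s c) has_vector_derivative - \<Gamma> c (snd c (x t)) x' (Z t c)) (at t within {0..\<tau>})"
        unfolding covariantly_constant_at_def by blast
      have "((\<lambda>s. Z' s c) has_vector_derivative - \<Gamma> c (snd c (x t)) x' (Z t c)) (at t within {0..\<tau>})"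
        by (rule has_vector_derivative_transform[OF t _ Zd]) (simp add: eq)
      with x' show "covariantly_constant_at c Z' t"
        unfolding covariantly_constant_at_def eq[OF t] by blast
    qed
  qed
  ultimately show ?thesis unfolding parallel_on_def by blast
qed

text \<open>At a time with a velocity all summands satisfy the equation with the same
  \<open>\<xi>'\<close>, by \<open>parallel_on_covariant_derivative\<close>, and the equation is
  linear in the field.\<close>

lemma parallel_on_lincomb:
  fixes J :: "'j set"
  assumes Z: "\<And>j. j \<in> J \<Longrightarrow> parallel_on 0 \<tau> (Z j)" and "finite J"
  shows "parallel_on 0 \<tau> (\<lambda>t. \<Sum>j\<in>J. a j *\<^sub>R Z j t)"
proof -
  let ?S = "\<lambda>t. \<Sum>j\<in>J. a j *\<^sub>R Z j t"
  have Sc: "?S t c = (\<Sum>j\<in>J. a j *\<^sub>R Z j t c)" for t c by (simp add: sum_fun_apply scaleR_fun_def)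
  have "?S t \<in> tangent_space M (x t)" if "t \<in> {0..\<tau>}" for t
    using Z that unfolding parallel_on_def
    by (intro subspace_sum subspace_scale subspace_tangent_space) blast
  moreover have "abs_continuous u v (\<lambda>t. ?S t c)"
    if "c \<in> atlas M" "0 \<le> u \<and> u \<le> v \<and> v \<le> \<tau> \<and> x ` {u..v} \<subseteq> fst c" for c u v
    unfolding Sc using Z that unfolding parallel_on_def
    by (intro abs_continuous_sum abs_continuous_scaleR abs_continuous_const) blast
  moreover have "AE t in lebesgue. t \<in> {0..\<tau>} \<longrightarrow> (\<forall>c\<in>charts_at M (x t). covariantly_constant_at c ?S t)"
    using velocity_AE
  proof eventually_elim
    case (elim t)
    show ?case
    proof (intro impI ballI)
      fix c assume t: "t \<in> {0..\<tau>}" and c: "c \<in> charts_at M (x t)"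
      have D: "((\<lambda>s. snd c (x s)) has_vector_derivative \<xi>' c t) (at t within {0..\<tau>})" using elim t c by blast
      have "((\<lambda>s. \<Sum>j\<in>J. a j *\<^sub>R Z j s c) has_vector_derivative
          (\<Sum>j\<in>J. a j *\<^sub>R (- \<Gamma> c (snd c (x t)) (\<xi>' c t) (Z j t c)))) (at t within {0..\<tau>})"
        by (intro has_vector_derivative_sum
            bounded_linear.has_vector_derivative[OF bounded_linear_scaleR_right]
            parallel_on_covariant_derivative[OF Z t c D])
      moreover have "(\<Sum>j\<in>J. a j *\<^sub>R (- \<Gamma> c (snd c (x t)) (\<xi>' c t) (Z j t c))) = - \<Gamma> c (snd c (x t)) (\<xi>' c t) (?S t c)"
        unfolding Sc christoffel_form_sum by (simp add: sum_negf)
      ultimately have "((\<lambda>s. ?S s c) has_vector_derivative - \<Gamma> c (snd c (x t)) (\<xi>' c t) (?S t c)) (at t within {0..\<tau>})"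
        unfolding Sc by (simp only:)
      with D show "covariantly_constant_at c ?S t" unfolding covariantly_constant_at_def by blast
    qed
  qed
  ultimately show ?thesis unfolding parallel_on_def by blast
qed

text \<open>Orientation is treated separately: signs of determinants are obtained by comparing two
  orientation preserving isometries in the same pair of frames.\<close>

definition orthonormal_frame :: "('n \<Rightarrow> real \<Rightarrow> ('a, 'n) tvec) \<Rightarrow> bool"
  where "orthonormal_frame e \<longleftrightarrow> (\<forall>j. parallel_on 0 \<tau> (e j)) \<and>
    (\<forall>t\<in>{0..\<tau>}. \<forall>i j. metric M (x t) (e i t) (e j t) = (if i = j then 1 else 0))"

lemma orthonormal_frame_of_parallel_frame: "parallel_frame M \<tau> x e \<Longrightarrow> orthonormal_frame e"
  unfolding parallel_frame_def orthonormal_frame_def parallel_iff_parallel_on by blast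

text \<open>Transport an orthonormal basis from time 0; constancy of inner products keeps it
  orthonormal.\<close>

lemma orthonormal_frame_exists: obtains e where "orthonormal_frame e"
proof -
  have 0: "0 \<in> {0..\<tau>}" using \<tau> by simp
  obtain c where c: "c \<in> charts_at M (x 0)" using charts_at_nonempty[OF x_topspace[OF 0]] by blast
  note cA = charts_atD(1)[OF c]
  have z: "snd c (x 0) \<in> snd c ` fst c" using charts_atD[OF c] by blast
  obtain B :: "'n \<Rightarrow> real ^ 'n" where B: "\<And>i j. B i \<bullet> (metric_coeff M c (snd c (x 0)) *v B j) = (if i = j then 1 else 0)"
    using orthonormal_basis_form[OF metric_coeff_inner_sym[OF cA z] metric_coeff_pos[OF cA z]] by blast
  have "\<exists>Z. Z 0 = tvec_of M c (x 0) (B j) \<and> parallel_on 0 \<tau> Z" for j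
    using parallel_transport[OF tvec_of_in_tangent_space[OF c, of "B j"]] by blast
  then obtain e where e0: "\<And>j. e j 0 = tvec_of M c (x 0) (B j)" and e: "\<And>j. parallel_on 0 \<tau> (e j)"
    by metis
  have "metric M (x t) (e i t) (e j t) = (if i = j then 1 else 0)" if "t \<in> {0..\<tau>}" for t i j
  proof -
    have "metric M (x t) (e i t) (e j t) = metric M (x 0) (e i 0) (e j 0)"
      by (rule parallel_metric_constant[OF e e that])
    also have "\<dots> = B i \<bullet> (metric_coeff M c (snd c (x 0)) *v B j)"
      unfolding e0 metric_coords[OF c tvec_of_in_tangent_space[OF c] tvec_of_in_tangent_space[OF c]]
        tvec_of_chart[OF c] ..
    finally show ?thesis unfolding B .
  qed
  then have "orthonormal_frame e" unfolding orthonormal_frame_def using e by blast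
  then show ?thesis by (rule that)
qed

definition frame_coords :: "('n \<Rightarrow> real \<Rightarrow> ('a, 'n) tvec) \<Rightarrow> real \<Rightarrow> ('a, 'n) tvec \<Rightarrow> real ^ 'n"
  where "frame_coords e t v = (\<chi> j. metric M (x t) v (e j t))"

definition frame_in_chart :: "('n \<Rightarrow> real \<Rightarrow> ('a, 'n) tvec) \<Rightarrow> ('a, 'n) chart \<Rightarrow> real \<Rightarrow> real ^ 'n ^ 'n"
  where "frame_in_chart e c t = (\<chi> i j. e j t c $ i)"

text \<open>For the frame matrix F and the metric G, orthonormality reads F^T G F = 1, so this is
  the inverse of F. Writing it without inversion makes its absolute continuity visible.\<close>

definition coframe_in_chart :: "('n \<Rightarrow> real \<Rightarrow> ('a, 'n) tvec) \<Rightarrow> ('a, 'n) chart \<Rightarrow> real \<Rightarrow> real ^ 'n ^ 'n"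
  where "coframe_in_chart e c t = transpose (frame_in_chart e c t) ** metric_coeff M c (snd c (x t))"

context
  fixes e assumes e: "orthonormal_frame e"
begin

lemma frame_parallel: "parallel_on 0 \<tau> (e j)"
  using e unfolding orthonormal_frame_def by blast

lemma frame_tangent: "t \<in> {0..\<tau>} \<Longrightarrow> e j t \<in> tangent_space M (x t)"
  using frame_parallel unfolding parallel_on_def by blast

lemma frame_orthonormal: "t \<in> {0..\<tau>} \<Longrightarrow> metric M (x t) (e i t) (e j t) = (if i = j then 1 else 0)"
  using e unfolding orthonormal_frame_def by blast

lemma lincomb_tangent: "t \<in> {0..\<tau>} \<Longrightarrow> (\<Sum>j\<in>UNIV. a $ j *\<^sub>R e j t) \<in> tangent_space M (x t)"
  by (intro subspace_sum subspace_scale subspace_tangent_space frame_tangent)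

lemma frame_coords_lincomb:
  assumes t: "t \<in> {0..\<tau>}"
  shows "frame_coords e t (\<Sum>j\<in>UNIV. a $ j *\<^sub>R e j t) = a"
  unfolding frame_coords_def
  by (simp add: vec_eq_iff metric_sum_left[OF x_topspace[OF t] frame_tangent[OF t] frame_tangent[OF t]]
      frame_orthonormal[OF t] if_distrib cong: if_cong)

lemma metric_lincomb:
  assumes t: "t \<in> {0..\<tau>}" and v: "v \<in> tangent_space M (x t)"
  shows "metric M (x t) v (\<Sum>j\<in>UNIV. a $ j *\<^sub>R e j t) = frame_coords e t v \<bullet> a"
  unfolding metric_sum_right[OF x_topspace[OF t] frame_tangent[OF t] v] frame_coords_def
  by (simp add: inner_vec_def mult.commute)

lemma coframe_apply:
  assumes t: "t \<in> {0..\<tau>}" and c: "c \<in> charts_at M (x t)" and v: "v \<in> tangent_space M (x t)"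
  shows "coframe_in_chart e c t *v v c = frame_coords e t v"
proof -
  have "(coframe_in_chart e c t *v v c) $ j = metric M (x t) v (e j t)" for j
  proof -
    have "metric M (x t) v (e j t) = metric M (x t) (e j t) v"
      by (rule metric_sym[OF x_topspace[OF t] v frame_tangent[OF t]])
    also have "\<dots> = e j t c \<bullet> (metric_coeff M c (snd c (x t)) *v v c)"
      by (rule metric_coords[OF c frame_tangent[OF t] v])
    finally show ?thesis
      unfolding coframe_in_chart_def matrix_vector_mul_assoc[symmetric]
      by (simp add: matrix_vector_mult_def transpose_def frame_in_chart_def inner_vec_def)
  qed
  then show ?thesis by (simp add: frame_coords_def vec_eq_iff)
qed

lemma lincomb_in_chart: "(\<Sum>j\<in>UNIV. a $ j *\<^sub>R e j t) c = frame_in_chart e c t *v a"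
  by (simp add: sum_fun_apply scaleR_fun_def vec_eq_iff matrix_vector_mult_def frame_in_chart_def mult.commute)

lemma frame_coframe:
  assumes t: "t \<in> {0..\<tau>}" and c: "c \<in> charts_at M (x t)"
  shows "coframe_in_chart e c t ** frame_in_chart e c t = mat 1"
    and "frame_in_chart e c t ** coframe_in_chart e c t = mat 1"
proof -
  have "(coframe_in_chart e c t ** frame_in_chart e c t) *v a = mat 1 *v a" for a
    using coframe_apply[OF t c lincomb_tangent[OF t, of a]] frame_coords_lincomb[OF t, of a]
    by (simp add: lincomb_in_chart flip: matrix_vector_mul_assoc)
  then show "coframe_in_chart e c t ** frame_in_chart e c t = mat 1"
    using matrix_eq by blast
  then show "frame_in_chart e c t ** coframe_in_chart e c t = mat 1"
    using matrix_left_right_inverse by blast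
qed

lemma frame_expansion:
  assumes t: "t \<in> {0..\<tau>}" and v: "v \<in> tangent_space M (x t)"
  shows "(\<Sum>j\<in>UNIV. frame_coords e t v $ j *\<^sub>R e j t) = v"
proof -
  obtain c where c: "c \<in> charts_at M (x t)" using charts_at_nonempty[OF x_topspace[OF t]] by blast
  show ?thesis
  proof (rule tangent_space_eqI[OF lincomb_tangent[OF t] v c])
    show "(\<Sum>j\<in>UNIV. frame_coords e t v $ j *\<^sub>R e j t) c = v c"
      unfolding lincomb_in_chart coframe_apply[OF t c v, symmetric]
      by (simp add: matrix_vector_mul_assoc frame_coframe[OF t c])
  qed
qed

lemma metric_frame_coords:
  assumes t: "t \<in> {0..\<tau>}" and u: "u \<in> tangent_space M (x t)" and v: "v \<in> tangent_space M (x t)"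
  shows "metric M (x t) u v = frame_coords e t u \<bullet> frame_coords e t v"
  using metric_lincomb[OF t u, of "frame_coords e t v"] unfolding frame_expansion[OF t v] .

text \<open>Coordinates in the frame are inner products of two parallel fields, hence constant;
  conversely a combination of the frame with constant coefficients is parallel by linearity.\<close>

lemma parallel_on_iff_constant_coords:
  assumes tan: "\<And>t. t \<in> {0..\<tau>} \<Longrightarrow> Z t \<in> tangent_space M (x t)"
  shows "parallel_on 0 \<tau> Z \<longleftrightarrow> (\<forall>t\<in>{0..\<tau>}. frame_coords e t (Z t) = frame_coords e 0 (Z 0))"
proof
  assume Z: "parallel_on 0 \<tau> Z"
  show "\<forall>t\<in>{0..\<tau>}. frame_coords e t (Z t) = frame_coords e 0 (Z 0)"
    unfolding frame_coords_def vec_eq_iff vec_lambda_beta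
    by (intro ballI allI parallel_metric_constant[OF Z frame_parallel])
next
  assume const: "\<forall>t\<in>{0..\<tau>}. frame_coords e t (Z t) = frame_coords e 0 (Z 0)"
  have "parallel_on 0 \<tau> (\<lambda>t. \<Sum>j\<in>UNIV. frame_coords e 0 (Z 0) $ j *\<^sub>R e j t)"
    by (intro parallel_on_lincomb frame_parallel) simp
  then show "parallel_on 0 \<tau> Z"
  proof (rule parallel_on_cong)
    fix t assume t: "t \<in> {0..\<tau>}"
    show "Z t = (\<Sum>j\<in>UNIV. frame_coords e 0 (Z 0) $ j *\<^sub>R e j t)"
      using frame_expansion[OF t tan[OF t]] unfolding const[rule_format, OF t] by (rule sym)
  qed
qed

lemma frame_in_chart_ac:
  assumes "c \<in> atlas M" "0 \<le> a" "a \<le> b" "b \<le> \<tau>" "x ` {a..b} \<subseteq> fst c"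
  shows "abs_continuous a b (frame_in_chart e c)"
proof -
  have "abs_continuous a b (\<lambda>t. e j t c)" for j
    using frame_parallel[of j] assms unfolding parallel_on_def by blast
  then show ?thesis
    by (intro abs_continuous_vec) (simp add: frame_in_chart_def abs_continuous_vec_nth)
qed

end

text \<open>Every time of \<open>{0..\<tau>}\<close> is a limit point of the interval because \<tau>
  is positive, so derivatives within it are unique, and one chart determines a tangent
  vector.\<close>

lemma velocity_unique:
  assumes t: "t \<in> {0..\<tau>}" and "has_velocity M \<tau> x t v" "has_velocity M \<tau> x t w"
  shows "v = w"
proof -
  obtain c where c: "c \<in> charts_at M (x t)" using charts_at_nonempty[OF x_topspace[OF t]] by blast
  have "v c = w c"
    using assms(2,3) c vector_derivative_unique_within[OF at_within_nontrivial[OF t]]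
    unfolding has_velocity_def by blast
  then show ?thesis
    using assms(2,3) c tangent_space_eqI unfolding has_velocity_def by blast
qed

end

lemma abs_continuous_matrix_mult:
  fixes A :: "real \<Rightarrow> real ^ 'n ^ 'm" and B :: "real \<Rightarrow> real ^ 'p ^ 'n"
  assumes "abs_continuous a b A" "abs_continuous a b B"
  shows "abs_continuous a b (\<lambda>t. A t ** B t)"
  by (intro abs_continuous_vec, simp add: matrix_matrix_mult_def)
    (intro abs_continuous_sum abs_continuous_mult abs_continuous_vec_nth assms)

section \<open>Rollings in parallel frames\<close>

text \<open>A rolling along \<open>x\<close> and \<open>y\<close> has base curves that agree with
  \<open>x\<close> and \<open>y\<close> on \<open>{0..\<tau>}\<close> only; this and the next
  congruences let the base curves be exchanged.\<close>

lemma has_velocity_cong: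
  fixes M :: "('a, 'n::finite) rmanifold"
  assumes t: "t \<in> {0..\<tau>}" and eq: "\<And>s. s \<in> {0..\<tau>} \<Longrightarrow> x' s = x s"
  shows "has_velocity M \<tau> x' t v \<longleftrightarrow> has_velocity M \<tau> x t v"
proof -
  have "((\<lambda>s. snd c (x' s)) has_vector_derivative D) (at t within {0..\<tau>}) \<longleftrightarrow>
      ((\<lambda>s. snd c (x s)) has_vector_derivative D) (at t within {0..\<tau>})" for c :: "('a, 'n) chart" and D
    using has_vector_derivative_transform[OF t, of "\<lambda>s. snd c (x' s)" "\<lambda>s. snd c (x s)" D]
      has_vector_derivative_transform[OF t, of "\<lambda>s. snd c (x s)" "\<lambda>s. snd c (x' s)" D] eq by auto
  then show ?thesis unfolding has_velocity_def eq[OF t] by simp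
qed

lemma ac_curve_cong:
  fixes M :: "('a, 'n::finite) rmanifold"
  assumes eq: "\<And>s. s \<in> {0..\<tau>} \<Longrightarrow> x' s = x s" and x': "ac_curve M \<tau> x'"
  shows "ac_curve M \<tau> x"
proof -
  have "continuous_map (top_of_set {0..\<tau>}) (mtop M) x"
    using x' eq unfolding ac_curve_def by (auto intro: continuous_map_eq[of _ _ x'])
  moreover have "abs_continuous a b (\<lambda>t. snd c (x t))"
    if "c \<in> atlas M" and ab: "0 \<le> a \<and> a \<le> b \<and> b \<le> \<tau> \<and> x ` {a..b} \<subseteq> fst c" for c a b
  proof -
    have eq': "x' t = x t" if "a \<le> t" "t \<le> b" for t
      using that ab by (intro eq) simp
    then have "x' ` {a..b} = x ` {a..b}" by (intro image_cong) auto
    then have "abs_continuous a b (\<lambda>t. snd c (x' t))"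
      using x' that unfolding ac_curve_def by simp
    then show ?thesis using abs_continuous_cong[of a b "\<lambda>t. snd c (x' t)" "\<lambda>t. snd c (x t)"] eq' by simp
  qed
  ultimately show ?thesis unfolding ac_curve_def by blast
qed

lemma parallel_cong:
  fixes M :: "('a, 'n::finite) rmanifold"
  assumes eq: "\<And>s. s \<in> {0..\<tau>} \<Longrightarrow> x' s = x s" and Z: "parallel M \<tau> x' Z"
  shows "parallel M \<tau> x Z"
proof -
  have "tangent_field M \<tau> x Z"
    using Z eq unfolding parallel_def ac_tangent_field_def tangent_field_def by simp
  moreover have "abs_continuous a b (\<lambda>t. Z t c)"
    if "c \<in> atlas M" and ab: "0 \<le> a \<and> a \<le> b \<and> b \<le> \<tau> \<and> x ` {a..b} \<subseteq> fst c" for c a b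
  proof -
    have "x' t = x t" if "a \<le> t" "t \<le> b" for t
      using that ab by (intro eq) simp
    then have "x' ` {a..b} = x ` {a..b}" by (intro image_cong) auto
    then show ?thesis
      using Z that unfolding parallel_def ac_tangent_field_def by simp
  qed
  moreover have "AE t in lebesgue. t \<in> {0..\<tau>} \<longrightarrow> has_covariant_derivative M \<tau> x' Z t 0"
    using Z unfolding parallel_def by blast
  then have "AE t in lebesgue. t \<in> {0..\<tau>} \<longrightarrow> has_covariant_derivative M \<tau> x Z t 0"
  proof eventually_elim
    case (elim t)
    show ?case
    proof
      assume t: "t \<in> {0..\<tau>}"
      have "((\<lambda>s. snd c (x s)) has_vector_derivative D) (at t within {0..\<tau>})"
        if "((\<lambda>s. snd c (x' s)) has_vector_derivative D) (at t within {0..\<tau>})" for c :: "('a, 'n) chart" and D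
        by (rule has_vector_derivative_transform[OF t _ that]) (simp add: eq)
      then show "has_covariant_derivative M \<tau> x Z t 0"
        using elim t unfolding has_covariant_derivative_def eq[OF t] by blast
    qed
  qed
  ultimately show ?thesis unfolding parallel_def ac_tangent_field_def by blast
qed

lemma parallel_cong_iff:
  assumes "\<And>s. s \<in> {0..\<tau>} \<Longrightarrow> x' s = x s"
  shows "parallel M \<tau> x' Z \<longleftrightarrow> parallel M \<tau> x Z"
  using parallel_cong[of \<tau> x' x M Z] parallel_cong[of \<tau> x x' M Z] assms by auto

text \<open>The velocities required by \<open>ac_path\<close> are those that the no-slip condition
  provides for both base curves.\<close>

lemma ac_path_of_rolling:
  assumes M: "oriented_riemannian_manifold M" and N: "oriented_riemannian_manifold N" and "0 < \<tau>"
    and q: "intrinsic_rolling_along M N \<tau> x y q"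
  shows "ac_path M \<tau> x" "ac_path N \<tau> y"
proof -
  have base: "base1 (q t) = x t" "base2 (q t) = y t" if "t \<in> {0..\<tau>}" for t
    using q that unfolding intrinsic_rolling_along_def by blast+
  have q': "intrinsic_rolling M N \<tau> q" using q unfolding intrinsic_rolling_along_def by blast
  have "ac_curve M \<tau> (\<lambda>t. base1 (q t))" "ac_curve N \<tau> (\<lambda>t. base2 (q t))"
    using q' unfolding intrinsic_rolling_def ac_config_curve_def by blast+
  then have ac: "ac_curve M \<tau> x" "ac_curve N \<tau> y"
    using ac_curve_cong[of \<tau> "\<lambda>t. base1 (q t)" x M] ac_curve_cong[of \<tau> "\<lambda>t. base2 (q t)" y N] base by blast+
  have AE: "AE t in lebesgue. t \<in> {0..\<tau>} \<longrightarrow>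
       (\<exists>v. has_velocity M \<tau> (\<lambda>s. base1 (q s)) t v \<and> has_velocity N \<tau> (\<lambda>s. base2 (q s)) t (isom (q t) v))"
    using q' unfolding intrinsic_rolling_def by blast
  have "AE t in lebesgue. t \<in> {0..\<tau>} \<longrightarrow> (\<exists>v. has_velocity M \<tau> x t v)"
    using AE by eventually_elim (use has_velocity_cong[of _ \<tau> "\<lambda>t. base1 (q t)" x M] base in blast)
  moreover have "AE t in lebesgue. t \<in> {0..\<tau>} \<longrightarrow> (\<exists>v. has_velocity N \<tau> y t v)"
    using AE by eventually_elim (use has_velocity_cong[of _ \<tau> "\<lambda>t. base2 (q t)" y N] base in blast)
  ultimately show "ac_path M \<tau> x" "ac_path N \<tau> y"
    using M N \<open>0 < \<tau>\<close> ac by (simp_all add: ac_path_def ac_path_axioms_def oriented_riemannian_def)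
qed

locale rolling_paths = M: ac_path M \<tau> x + N: ac_path N \<tau> y
  for M :: "('a, 'n::finite) rmanifold" and N :: "('b, 'n) rmanifold" and \<tau> x y
begin

lemma rolling_iff:
  "intrinsic_rolling_along M N \<tau> x y q \<longleftrightarrow>
    (\<forall>t\<in>{0..\<tau>}. base1 (q t) = x t \<and> base2 (q t) = y t \<and> isom (q t) \<in> isom_plus M N (x t) (y t)) \<and>
    (\<forall>c\<in>atlas M. \<forall>d\<in>atlas N. \<forall>a b. 0 \<le> a \<and> a \<le> b \<and> b \<le> \<tau> \<and> x ` {a..b} \<subseteq> fst c \<and> y ` {a..b} \<subseteq> fst d
       \<longrightarrow> abs_continuous a b (\<lambda>t. matrix (\<lambda>u. isom (q t) (tvec_of M c (x t) u) d))) \<and>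
    (AE t in lebesgue. t \<in> {0..\<tau>} \<longrightarrow>
       (\<exists>v. has_velocity M \<tau> x t v \<and> has_velocity N \<tau> y t (isom (q t) v))) \<and>
    (\<forall>Z. (\<forall>t\<in>{0..\<tau>}. Z t \<in> tangent_space M (x t)) \<longrightarrow>
       (M.parallel_on 0 \<tau> Z \<longleftrightarrow> N.parallel_on 0 \<tau> (\<lambda>t. isom (q t) (Z t))))"
    (is "_ \<longleftrightarrow> ?B \<and> ?AC \<and> ?V \<and> ?P")
proof (cases "\<forall>t\<in>{0..\<tau>}. base1 (q t) = x t \<and> base2 (q t) = y t")
  case True
  then have b1: "base1 (q t) = x t" and b2: "base2 (q t) = y t" if "t \<in> {0..\<tau>}" for t
    using that by blast+
  have cfg: "(\<forall>t\<in>{0..\<tau>}. q t \<in> config_space M N) \<longleftrightarrow> ?B"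
  proof -
    have "q t \<in> config_space M N \<longleftrightarrow> isom (q t) \<in> isom_plus M N (x t) (y t)" if "t \<in> {0..\<tau>}" for t
      using b1[OF that] b2[OF that] M.x_topspace[OF that] N.x_topspace[OF that]
      by (cases "q t") (simp add: config_space_def)
    then show ?thesis using True by blast
  qed
  have curves: "ac_curve M \<tau> (\<lambda>t. base1 (q t))" "ac_curve N \<tau> (\<lambda>t. base2 (q t))"
    using ac_curve_cong[OF _ M.ac, of "\<lambda>t. base1 (q t)"] ac_curve_cong[OF _ N.ac, of "\<lambda>t. base2 (q t)"] b1 b2 by simp_all
  have AC: "(\<forall>c\<in>atlas M. \<forall>d\<in>atlas N. \<forall>a b.
       0 \<le> a \<and> a \<le> b \<and> b \<le> \<tau> \<and>
       (\<lambda>t. base1 (q t)) ` {a..b} \<subseteq> fst c \<and> (\<lambda>t. base2 (q t)) ` {a..b} \<subseteq> fst d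
       \<longrightarrow> abs_continuous a b (\<lambda>t. matrix (\<lambda>u. isom (q t) (tvec_of M c (base1 (q t)) u) d))) \<longleftrightarrow> ?AC"
  proof (intro ball_cong refl all_cong1)
    fix c d and a b :: real
    show "(0 \<le> a \<and> a \<le> b \<and> b \<le> \<tau> \<and>
       (\<lambda>t. base1 (q t)) ` {a..b} \<subseteq> fst c \<and> (\<lambda>t. base2 (q t)) ` {a..b} \<subseteq> fst d
       \<longrightarrow> abs_continuous a b (\<lambda>t. matrix (\<lambda>u. isom (q t) (tvec_of M c (base1 (q t)) u) d))) \<longleftrightarrow>
      (0 \<le> a \<and> a \<le> b \<and> b \<le> \<tau> \<and> x ` {a..b} \<subseteq> fst c \<and> y ` {a..b} \<subseteq> fst d
       \<longrightarrow> abs_continuous a b (\<lambda>t. matrix (\<lambda>u. isom (q t) (tvec_of M c (x t) u) d)))"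
    proof (cases "0 \<le> a \<and> a \<le> b \<and> b \<le> \<tau>")
      case True
      have t: "t \<in> {0..\<tau>}" if "t \<in> {a..b}" for t using that True by auto
      have "(\<lambda>t. base1 (q t)) ` {a..b} = x ` {a..b}" "(\<lambda>t. base2 (q t)) ` {a..b} = y ` {a..b}"
        using b1 b2 t by (auto intro!: image_cong)
      moreover have "abs_continuous a b (\<lambda>t. matrix (\<lambda>u. isom (q t) (tvec_of M c (base1 (q t)) u) d)) \<longleftrightarrow>
          abs_continuous a b (\<lambda>t. matrix (\<lambda>u. isom (q t) (tvec_of M c (x t) u) d))"
      proof (rule abs_continuous_cong)
        fix s assume "a \<le> s" "s \<le> b"
        then have "base1 (q s) = x s" by (intro b1 t) simp
        then show "matrix (\<lambda>u. isom (q s) (tvec_of M c (base1 (q s)) u) d) = matrix (\<lambda>u. isom (q s) (tvec_of M c (x s) u) d)"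
          by (simp only:)
      qed
      ultimately show ?thesis by simp
    qed blast
  qed
  have vel: "has_velocity M \<tau> (\<lambda>s. base1 (q s)) t v \<longleftrightarrow> has_velocity M \<tau> x t v"
      "has_velocity N \<tau> (\<lambda>s. base2 (q s)) t w \<longleftrightarrow> has_velocity N \<tau> y t w" if "t \<in> {0..\<tau>}" for t v w
    by (rule has_velocity_cong[OF that b1], assumption, rule has_velocity_cong[OF that b2], assumption)
  have V: "(AE t in lebesgue. t \<in> {0..\<tau>} \<longrightarrow>
       (\<exists>v. has_velocity M \<tau> (\<lambda>s. base1 (q s)) t v \<and>
            has_velocity N \<tau> (\<lambda>s. base2 (q s)) t (isom (q t) v))) \<longleftrightarrow> ?V"
  proof -
    have "(t \<in> {0..\<tau>} \<longrightarrow> (\<exists>v. has_velocity M \<tau> (\<lambda>s. base1 (q s)) t v \<and> has_velocity N \<tau> (\<lambda>s. base2 (q s)) t (isom (q t) v)))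
        \<longleftrightarrow> (t \<in> {0..\<tau>} \<longrightarrow> (\<exists>v. has_velocity M \<tau> x t v \<and> has_velocity N \<tau> y t (isom (q t) v)))" for t
      using vel[of t] by blast
    then show ?thesis by (simp only:)
  qed
  have P: "(\<forall>Z. tangent_field M \<tau> (\<lambda>t. base1 (q t)) Z \<longrightarrow>
       (parallel M \<tau> (\<lambda>t. base1 (q t)) Z \<longleftrightarrow>
        parallel N \<tau> (\<lambda>t. base2 (q t)) (\<lambda>t. isom (q t) (Z t)))) \<longleftrightarrow> ?P"
    unfolding tangent_field_def M.parallel_iff_parallel_on[symmetric] N.parallel_iff_parallel_on[symmetric]
    using parallel_cong_iff[of \<tau> "\<lambda>t. base1 (q t)" x M, OF b1] parallel_cong_iff[of \<tau> "\<lambda>t. base2 (q t)" y N, OF b2]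
    by (simp add: b1 del: atLeastAtMost_iff cong: ball_cong)
  show ?thesis
    unfolding intrinsic_rolling_along_def intrinsic_rolling_def ac_config_curve_def cfg AC V P
    using curves True by blast
next
  case False
  then show ?thesis unfolding intrinsic_rolling_along_def by blast
qed

lemma isom_plusD:
  assumes "A \<in> isom_plus M N p r"
  shows "A \<in> tangent_space M p \<rightarrow>\<^sub>E tangent_space N r"
    and "\<And>u v. u \<in> tangent_space M p \<Longrightarrow> v \<in> tangent_space M p \<Longrightarrow> A (u + v) = A u + A v"
    and "\<And>a u. u \<in> tangent_space M p \<Longrightarrow> A (a *\<^sub>R u) = a *\<^sub>R A u"
    and "\<And>u v. u \<in> tangent_space M p \<Longrightarrow> v \<in> tangent_space M p \<Longrightarrow> metric N r (A u) (A v) = metric M p u v"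
    and "\<And>c d. c \<in> charts_at M p \<Longrightarrow> d \<in> charts_at N r \<Longrightarrow> det (matrix (\<lambda>u. A (tvec_of M c p u) d)) > 0"
  using assms unfolding isom_plus_def by blast+

lemma isom_plus_sum:
  assumes A: "A \<in> isom_plus M N p r" and w: "\<And>j. j \<in> J \<Longrightarrow> w j \<in> tangent_space M p"
  shows "A (\<Sum>j\<in>J. a j *\<^sub>R w j) = (\<Sum>j\<in>J. a j *\<^sub>R A (w j))"
  using w
proof (induction J rule: infinite_finite_induct)
  case (insert j J)
  have "(\<Sum>j\<in>J. a j *\<^sub>R w j) \<in> tangent_space M p"
    using insert.prems by (intro subspace_sum subspace_scale M.subspace_tangent_space) simp
  moreover have "a j *\<^sub>R w j \<in> tangent_space M p"
    using insert.prems by (intro subspace_scale M.subspace_tangent_space) simp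
  ultimately have "A (a j *\<^sub>R w j + (\<Sum>j\<in>J. a j *\<^sub>R w j)) = a j *\<^sub>R A (w j) + (\<Sum>j\<in>J. a j *\<^sub>R A (w j))"
    using insert by (simp only: isom_plusD(2,3)[OF A] insertI1 insertI2)
  then show ?case by (simp only: sum.insert[OF insert.hyps])
next
  case (infinite J)
  have "A (0 *\<^sub>R 0) = 0 *\<^sub>R A 0" by (rule isom_plusD(3)[OF A subspace_0[OF M.subspace_tangent_space]])
  then show ?case unfolding sum.infinite[OF infinite.hyps] scale_zero_left .
next
  case empty
  have "A (0 *\<^sub>R 0) = 0 *\<^sub>R A 0" by (rule isom_plusD(3)[OF A subspace_0[OF M.subspace_tangent_space]])
  then show ?case unfolding sum.empty scale_zero_left .
qed

context
  fixes e f
  assumes e: "M.orthonormal_frame e" and f: "N.orthonormal_frame f"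
begin

text \<open>The restriction makes the map extensional, as membership in \<open>isom_plus\<close>
  requires, so that equal matrices give equal elements of the configuration space.\<close>

definition isom_of_matrix :: "real ^ 'n ^ 'n \<Rightarrow> real \<Rightarrow> ('a, 'n) tvec \<Rightarrow> ('b, 'n) tvec"
  where "isom_of_matrix C t =
    restrict (\<lambda>v. \<Sum>i\<in>UNIV. (C *v M.frame_coords e t v) $ i *\<^sub>R f i t) (tangent_space M (x t))"

lemma frame_coords_isom_of_matrix:
  assumes t: "t \<in> {0..\<tau>}" and v: "v \<in> tangent_space M (x t)"
  shows "N.frame_coords f t (isom_of_matrix C t v) = C *v M.frame_coords e t v"
  using v by (simp add: isom_of_matrix_def N.frame_coords_lincomb[OF f t])

lemma isom_of_matrix_tangent:
  assumes t: "t \<in> {0..\<tau>}" and v: "v \<in> tangent_space M (x t)"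
  shows "isom_of_matrix C t v \<in> tangent_space N (y t)"
  using v N.lincomb_tangent[OF f t] by (simp add: isom_of_matrix_def)

lemma frame_matrix_columns:
  assumes t: "t \<in> {0..\<tau>}" and "A \<in> isom_plus M N (x t) (y t)"
  shows "frame_matrix N e f t (p, y t, A) $ i $ j = N.frame_coords f t (A (e j t)) $ i"
proof -
  have "A (e j t) \<in> tangent_space N (y t)"
    using isom_plusD(1)[OF assms(2)] M.frame_tangent[OF e t] by blast
  from N.metric_sym[OF N.x_topspace[OF t] N.frame_tangent[OF f t] this]
  show ?thesis by (simp add: frame_matrix_def N.frame_coords_def)
qed

text \<open>A linear map is determined by the coordinates of its values on the frame. The component
  \<open>p\<close> is free because \<open>frame_matrix\<close> looks only at the second base
  point.\<close>

lemma isom_eq_isom_of_matrix: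
  assumes t: "t \<in> {0..\<tau>}" and A: "A \<in> isom_plus M N (x t) (y t)"
  shows "A = isom_of_matrix (frame_matrix N e f t (p, y t, A)) t"
proof
  fix v
  let ?C = "frame_matrix N e f t (p, y t, A)"
  show "A v = isom_of_matrix ?C t v"
  proof (cases "v \<in> tangent_space M (x t)")
    case v: True
    let ?a = "M.frame_coords e t v"
    have Ae: "A (e j t) \<in> tangent_space N (y t)" for j
      using isom_plusD(1)[OF A] M.frame_tangent[OF e t] by blast
    have Av: "A v \<in> tangent_space N (y t)" using isom_plusD(1)[OF A] v by blast
    have "A v = A (\<Sum>j\<in>UNIV. ?a $ j *\<^sub>R e j t)" using M.frame_expansion[OF e t v] by simp
    also have "\<dots> = (\<Sum>j\<in>UNIV. ?a $ j *\<^sub>R A (e j t))"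
      by (rule isom_plus_sum[OF A M.frame_tangent[OF e t]])
    finally have "N.frame_coords f t (A v) $ i = (\<Sum>j\<in>UNIV. ?a $ j * N.frame_coords f t (A (e j t)) $ i)" for i
      unfolding N.frame_coords_def
      by (simp add: N.metric_sum_left[OF N.x_topspace[OF t] Ae N.frame_tangent[OF f t]])
    then have "N.frame_coords f t (A v) = ?C *v ?a"
      by (simp add: vec_eq_iff matrix_vector_mult_def frame_matrix_columns[OF t A] mult.commute)
    then have "A v = (\<Sum>i\<in>UNIV. (?C *v ?a) $ i *\<^sub>R f i t)"
      using N.frame_expansion[OF f t Av] by simp
    then show ?thesis using v by (simp add: isom_of_matrix_def)
  next
    case False
    have "A v = undefined" by (rule PiE_arb[OF isom_plusD(1)[OF A] False])
    then show ?thesis using False by (simp add: isom_of_matrix_def)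
  qed
qed

lemma frame_matrix_orthogonal:
  assumes t: "t \<in> {0..\<tau>}" and A: "A \<in> isom_plus M N (x t) (y t)"
  shows "orthogonal_matrix (frame_matrix N e f t (p, y t, A))"
proof -
  let ?C = "frame_matrix N e f t (p, y t, A)"
  have Ae: "A (e j t) \<in> tangent_space N (y t)" for j
    using isom_plusD(1)[OF A] M.frame_tangent[OF e t] by blast
  have "(transpose ?C ** ?C) $ j $ k = mat 1 $ j $ k" for j k
  proof -
    have "(transpose ?C ** ?C) $ j $ k = N.frame_coords f t (A (e j t)) \<bullet> N.frame_coords f t (A (e k t))"
      by (simp add: matrix_matrix_mult_def transpose_def frame_matrix_columns[OF t A] inner_vec_def)
    also have "\<dots> = metric N (y t) (A (e j t)) (A (e k t))"
      by (rule N.metric_frame_coords[OF f t Ae Ae, symmetric])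
    also have "\<dots> = metric M (x t) (e j t) (e k t)"
      by (rule isom_plusD(4)[OF A M.frame_tangent[OF e t] M.frame_tangent[OF e t]])
    finally show ?thesis by (simp add: M.frame_orthonormal[OF e t] mat_def)
  qed
  then show ?thesis by (simp add: orthogonal_matrix vec_eq_iff)
qed

text \<open>The matrix in coordinate frames is the frame matrix of \<open>C\<close> between the two
  changes of frame. Both uses depend on this product form: the sign of the determinant and absolute
  continuity.\<close>

lemma isom_of_matrix_in_charts:
  assumes t: "t \<in> {0..\<tau>}" and c: "c \<in> charts_at M (x t)"
  shows "matrix (\<lambda>u. isom_of_matrix C t (tvec_of M c (x t) u) d) =
    N.frame_in_chart f d t ** C ** M.coframe_in_chart e c t"
proof -
  have "isom_of_matrix C t (tvec_of M c (x t) u) d = (N.frame_in_chart f d t ** C ** M.coframe_in_chart e c t) *v u" for u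
  proof -
    have T: "tvec_of M c (x t) u \<in> tangent_space M (x t)" by (rule M.tvec_of_in_tangent_space[OF c])
    have "M.frame_coords e t (tvec_of M c (x t) u) = M.coframe_in_chart e c t *v u"
      using M.coframe_apply[OF e t c T] by (simp add: M.tvec_of_chart[OF c])
    then show ?thesis
      using T by (simp add: isom_of_matrix_def N.lincomb_in_chart[OF f] flip: matrix_vector_mul_assoc)
  qed
  then show ?thesis by simp
qed

lemma frame_coords_add:
  assumes t: "t \<in> {0..\<tau>}" and u: "u \<in> tangent_space M (x t)" and v: "v \<in> tangent_space M (x t)"
  shows "M.frame_coords e t (u + v) = M.frame_coords e t u + M.frame_coords e t v"
  by (simp add: M.frame_coords_def vec_eq_iff M.metric_add_left[OF M.x_topspace[OF t] u v M.frame_tangent[OF e t]])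

lemma frame_coords_scale:
  assumes t: "t \<in> {0..\<tau>}" and v: "v \<in> tangent_space M (x t)"
  shows "M.frame_coords e t (r *\<^sub>R v) = r *\<^sub>R M.frame_coords e t v"
  by (simp add: M.frame_coords_def vec_eq_iff M.metric_scale_left[OF M.x_topspace[OF t] v M.frame_tangent[OF e t]])

lemma isom_of_matrix_isom_plus:
  assumes t: "t \<in> {0..\<tau>}" and C: "orthogonal_matrix C"
    and det: "\<And>c d. c \<in> charts_at M (x t) \<Longrightarrow> d \<in> charts_at N (y t) \<Longrightarrow>
      det (N.frame_in_chart f d t) * det C * det (M.coframe_in_chart e c t) > 0"
  shows "isom_of_matrix C t \<in> isom_plus M N (x t) (y t)"
proof -
  let ?A = "isom_of_matrix C t"
  have ext: "?A \<in> tangent_space M (x t) \<rightarrow>\<^sub>E tangent_space N (y t)"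
    using isom_of_matrix_tangent[OF t] by (auto simp: isom_of_matrix_def)
  have add: "?A (u + v) = ?A u + ?A v" if "u \<in> tangent_space M (x t)" "v \<in> tangent_space M (x t)" for u v
    using that subspace_add[OF M.subspace_tangent_space that]
    by (simp add: isom_of_matrix_def frame_coords_add[OF t that] matrix_vector_right_distrib
        scaleR_add_left sum.distrib)
  have scale: "?A (r *\<^sub>R v) = r *\<^sub>R ?A v" if "v \<in> tangent_space M (x t)" for r v
    using that subspace_scale[OF M.subspace_tangent_space that, of r]
    by (simp add: isom_of_matrix_def frame_coords_scale[OF t that] matrix_vector_mult_scaleR
        scaleR_sum_right)
  have isom: "metric N (y t) (?A u) (?A v) = metric M (x t) u v"
    if u: "u \<in> tangent_space M (x t)" and v: "v \<in> tangent_space M (x t)" for u v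
  proof -
    have "metric N (y t) (?A u) (?A v) = (C *v M.frame_coords e t u) \<bullet> (C *v M.frame_coords e t v)"
      unfolding N.metric_frame_coords[OF f t isom_of_matrix_tangent[OF t u] isom_of_matrix_tangent[OF t v]]
        frame_coords_isom_of_matrix[OF t u] frame_coords_isom_of_matrix[OF t v] ..
    also have "\<dots> = M.frame_coords e t u \<bullet> M.frame_coords e t v"
      using C orthogonal_transformation_matrix[of "(*v) C"] unfolding orthogonal_transformation_def by simp
    finally show ?thesis unfolding M.metric_frame_coords[OF e t u v] .
  qed
  have "det (matrix (\<lambda>u. ?A (tvec_of M c (x t) u) d)) > 0"
    if "c \<in> charts_at M (x t)" "d \<in> charts_at N (y t)" for c d
    using det[OF that] by (simp add: isom_of_matrix_in_charts[OF t that(1)] det_mul)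
  then show ?thesis
    unfolding isom_plus_def using ext add scale isom by blast
qed

lemma isom_det_pos:
  assumes t: "t \<in> {0..\<tau>}" and A: "A \<in> isom_plus M N (x t) (y t)"
    and cd: "c \<in> charts_at M (x t)" "d \<in> charts_at N (y t)"
  shows "det (N.frame_in_chart f d t) * det (frame_matrix N e f t (p, y t, A)) * det (M.coframe_in_chart e c t) > 0"
proof -
  have "det (matrix (\<lambda>u. isom_of_matrix (frame_matrix N e f t (p, y t, A)) t (tvec_of M c (x t) u) d)) > 0"
    using isom_plusD(5)[OF A cd] unfolding isom_eq_isom_of_matrix[OF t A, of p, symmetric] .
  then show ?thesis by (simp add: isom_of_matrix_in_charts[OF t cd(1)] det_mul)
qed

text \<open>A rotation on the right has determinant 1 and so preserves the sign that characterizes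
  orientation preserving maps in charts.\<close>

lemma isom_of_matrix_rotated:
  assumes t: "t \<in> {0..\<tau>}" and A: "A \<in> isom_plus M N (x t) (y t)" and R: "R \<in> SO"
  shows "isom_of_matrix (frame_matrix N e f t (p, y t, A) ** R) t \<in> isom_plus M N (x t) (y t)"
proof (rule isom_of_matrix_isom_plus[OF t])
  show "orthogonal_matrix (frame_matrix N e f t (p, y t, A) ** R)"
    using frame_matrix_orthogonal[OF t A] R by (simp add: orthogonal_matrix_mul SO_def rotation_matrix_def)
  show "det (N.frame_in_chart f d t) * det (frame_matrix N e f t (p, y t, A) ** R) * det (M.coframe_in_chart e c t) > 0"
    if "c \<in> charts_at M (x t)" "d \<in> charts_at N (y t)" for c d
    using isom_det_pos[OF t A that, of p] R by (simp add: det_mul SO_def rotation_matrix_def)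
qed

lemma frame_matrix_isom_of_matrix:
  assumes t: "t \<in> {0..\<tau>}" and "isom_of_matrix C t \<in> isom_plus M N (x t) (y t)"
  shows "frame_matrix N e f t (p, y t, isom_of_matrix C t) = C"
proof -
  have "M.frame_coords e t (e j t) = axis j 1" for j
    using M.frame_orthonormal[OF e t] by (simp add: M.frame_coords_def vec_eq_iff axis_def)
  then have "N.frame_coords f t (isom_of_matrix C t (e j t)) = column j C" for j
    unfolding frame_coords_isom_of_matrix[OF t M.frame_tangent[OF e t]] by (simp only: matrix_vector_mult_basis)
  then have "frame_matrix N e f t (p, y t, isom_of_matrix C t) $ i $ j = C $ i $ j" for i j
    unfolding frame_matrix_columns[OF t assms(2)] by (simp add: column_def)
  then show ?thesis by (simp add: vec_eq_iff)
qed

text \<open>Evaluates the definite description: the element exists by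
  \<open>isom_of_matrix_rotated\<close>, and it is unique because an isometry is recovered from its
  matrix.\<close>

lemma right_action_eq:
  assumes t: "t \<in> {0..\<tau>}" and A: "A \<in> isom_plus M N (x t) (y t)" and R: "R \<in> SO"
  shows "right_action M N e f t (x t, y t, A) R =
    (x t, y t, isom_of_matrix (frame_matrix N e f t (x t, y t, A) ** R) t)"
  unfolding right_action_def
proof (rule the_equality)
  let ?C = "frame_matrix N e f t (x t, y t, A) ** R"
  note rot = isom_of_matrix_rotated[OF t A R, of "x t"]
  show "(x t, y t, isom_of_matrix ?C t) \<in> config_space M N \<and>
      base1 (x t, y t, isom_of_matrix ?C t) = base1 (x t, y t, A) \<and>
      base2 (x t, y t, isom_of_matrix ?C t) = base2 (x t, y t, A) \<and>
      frame_matrix N e f t (x t, y t, isom_of_matrix ?C t) = ?C"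
    using rot M.x_topspace[OF t] N.x_topspace[OF t] frame_matrix_isom_of_matrix[OF t rot]
    by (simp add: config_space_def)
  fix q' assume q': "q' \<in> config_space M N \<and> base1 q' = base1 (x t, y t, A) \<and>
      base2 q' = base2 (x t, y t, A) \<and> frame_matrix N e f t q' = ?C"
  obtain p r B where "q' = (p, r, B)" by (cases q')
  then have q'_eq: "q' = (x t, y t, B)" and B: "B \<in> isom_plus M N (x t) (y t)"
    using q' by (auto simp: config_space_def)
  have "B = isom_of_matrix ?C t"
    using isom_eq_isom_of_matrix[OF t B, of "x t"] q' q'_eq by simp
  then show "q' = (x t, y t, isom_of_matrix ?C t)" using q'_eq by simp
qed

end

end

text \<open>The target is a space of vector fields without any norm or finite dimension, so the
  dimension is computed from the image of a finite basis.\<close>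

lemma dim_linear_image_inj:
  fixes \<Phi> :: "'a::euclidean_space \<Rightarrow> 'v::real_vector"
  assumes lin: "linear \<Phi>" and inj: "inj \<Phi>" and "subspace S"
  shows "dim (\<Phi> ` S) = dim S"
proof -
  obtain B where B: "independent B" "card B = dim S" "span B = S"
    using orthonormal_basis_subspace[OF \<open>subspace S\<close>] by blast
  have "inj_on \<Phi> (span B)" using inj by (rule inj_on_subset) simp
  from linear_independent_injective_image[OF lin B(1) this]
  have ind: "independent (\<Phi> ` B)" .
  have "span (\<Phi> ` B) = \<Phi> ` S" using linear_span_image[OF lin, of B] B(3) by simp
  moreover have "span (\<Phi> ` S) = \<Phi> ` S"
    by (rule span_eq_iff[THEN iffD2]) (rule linear_subspace_image[OF lin \<open>subspace S\<close>])
  ultimately have "span (\<Phi> ` B) = span (\<Phi> ` S)" by (simp only:)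
  from real_vector.dim_eq_card[OF this ind]
  have "dim (\<Phi> ` S) = card (\<Phi> ` B)" .
  also have "\<dots> = card B" by (rule card_image) (use inj in \<open>rule inj_on_subset\<close>, simp)
  finally show ?thesis using B(2) by simp
qed

section \<open>Rollings as constant rotations, and the meaning of k\<close>

context rolling_paths
begin

definition fixes_velocity :: "('n \<Rightarrow> real \<Rightarrow> ('a, 'n) tvec) \<Rightarrow> real ^ 'n ^ 'n \<Rightarrow> bool"
  where "fixes_velocity e R \<longleftrightarrow> (AE t in lebesgue. t \<in> {0..\<tau>} \<longrightarrow>
    (\<forall>v. has_velocity M \<tau> x t v \<longrightarrow> R *v M.frame_coords e t v = M.frame_coords e t v))"

text \<open>The subspace S of the overview, described directly by orthogonality almost everywhere,
  so that null sets of velocities do not enlarge the span they are compared with.\<close>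

definition normal_coords :: "('n \<Rightarrow> real \<Rightarrow> ('a, 'n) tvec) \<Rightarrow> (real ^ 'n) set"
  where "normal_coords e = {s. AE t in lebesgue. t \<in> {0..\<tau>} \<longrightarrow>
    (\<forall>v. has_velocity M \<tau> x t v \<longrightarrow> s \<bullet> M.frame_coords e t v = 0)}"

lemma subspace_normal_coords: "subspace (normal_coords e)"
proof (rule subspaceI)
  show "0 \<in> normal_coords e" by (simp add: normal_coords_def)
  show "u + v \<in> normal_coords e" if "u \<in> normal_coords e" "v \<in> normal_coords e" for u v
  proof -
    have "AE t in lebesgue. t \<in> {0..\<tau>} \<longrightarrow> (\<forall>w. has_velocity M \<tau> x t w \<longrightarrow> u \<bullet> M.frame_coords e t w = 0)"
      "AE t in lebesgue. t \<in> {0..\<tau>} \<longrightarrow> (\<forall>w. has_velocity M \<tau> x t w \<longrightarrow> v \<bullet> M.frame_coords e t w = 0)"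
      using that by (simp_all add: normal_coords_def)
    then have "AE t in lebesgue. t \<in> {0..\<tau>} \<longrightarrow> (\<forall>w. has_velocity M \<tau> x t w \<longrightarrow> (u + v) \<bullet> M.frame_coords e t w = 0)"
      by eventually_elim (simp add: inner_add_left)
    then show ?thesis by (simp add: normal_coords_def)
  qed
  show "r *\<^sub>R v \<in> normal_coords e" if "v \<in> normal_coords e" for r v
  proof -
    have "AE t in lebesgue. t \<in> {0..\<tau>} \<longrightarrow> (\<forall>w. has_velocity M \<tau> x t w \<longrightarrow> v \<bullet> M.frame_coords e t w = 0)"
      using that by (simp add: normal_coords_def)
    then have "AE t in lebesgue. t \<in> {0..\<tau>} \<longrightarrow> (\<forall>w. has_velocity M \<tau> x t w \<longrightarrow> (r *\<^sub>R v) \<bullet> M.frame_coords e t w = 0)"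
      by eventually_elim simp
    then show ?thesis by (simp add: normal_coords_def)
  qed
qed

text \<open>Both directions work with the vectors \<open>R *v w - w\<close> or their transposed
  analogues. If R fixes a velocity then so does its transpose, so these vectors lie in S and
  anything orthogonal to S is fixed. Conversely, if R fixes the complement of S, the vectors R^T w -
  w are orthogonal to that complement and hence lie in S.\<close>

lemma fixes_velocity_iff:
  assumes R: "orthogonal_matrix R"
  shows "fixes_velocity e R \<longleftrightarrow> (\<forall>z\<in>(normal_coords e)\<^sup>\<bottom>. R *v z = z)"
proof
  have RR: "transpose R ** R = mat 1" "R ** transpose R = mat 1" using R by (simp_all add: orthogonal_matrix_def)
  have adj: "(R *v w) \<bullet> u = w \<bullet> (transpose R *v u)" for w u
    by (metis dot_lmul_matrix inner_commute transpose_matrix_vector vector_transpose_matrix)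
  {
    assume "fixes_velocity e R"
    then have AE: "AE t in lebesgue. t \<in> {0..\<tau>} \<longrightarrow>
      (\<forall>v. has_velocity M \<tau> x t v \<longrightarrow> R *v M.frame_coords e t v = M.frame_coords e t v)"
      by (simp add: fixes_velocity_def)
    have mem: "R *v w - w \<in> normal_coords e" for w
    proof -
      have "AE t in lebesgue. t \<in> {0..\<tau>} \<longrightarrow>
        (\<forall>v. has_velocity M \<tau> x t v \<longrightarrow> (R *v w - w) \<bullet> M.frame_coords e t v = 0)"
        using AE
      proof eventually_elim
        case (elim t)
        show ?case
        proof (intro impI allI)
          fix v assume "t \<in> {0..\<tau>}" "has_velocity M \<tau> x t v"
          then have u: "R *v M.frame_coords e t v = M.frame_coords e t v" (is "R *v ?u = ?u") using elim by blast
          have "transpose R *v ?u = transpose R *v (R *v ?u)" using u by simp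
          also have "\<dots> = ?u" by (simp add: matrix_vector_mul_assoc RR)
          finally show "(R *v w - w) \<bullet> ?u = 0" by (simp add: inner_diff_left adj)
        qed
      qed
      then show ?thesis by (simp add: normal_coords_def)
    qed
    show "\<forall>z\<in>(normal_coords e)\<^sup>\<bottom>. R *v z = z"
    proof
      fix z assume z: "z \<in> (normal_coords e)\<^sup>\<bottom>"
      have "w \<bullet> (transpose R *v z) = w \<bullet> z" for w
        using z mem[of w] by (auto simp: orthogonal_comp_def orthogonal_def inner_diff_left adj)
      then have "transpose R *v z = z" by (metis vector_eq_ldot)
      then have "R *v z = R *v (transpose R *v z)" by (simp only:)
      also have "\<dots> = z" by (simp only: matrix_vector_mul_assoc RR matrix_vector_mul_lid)
      finally show "R *v z = z" .
    qed
  next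
    assume fix_perp: "\<forall>z\<in>(normal_coords e)\<^sup>\<bottom>. R *v z = z"
    have "AE t in lebesgue. t \<in> {0..\<tau>} \<longrightarrow>
      (\<forall>v. has_velocity M \<tau> x t v \<longrightarrow> (transpose R *v axis i 1 - axis i 1) \<bullet> M.frame_coords e t v = 0)" for i
    proof -
      have "transpose R *v axis i 1 - axis i 1 \<in> (normal_coords e)\<^sup>\<bottom>\<^sup>\<bottom>"
        unfolding orthogonal_comp_def[of "(normal_coords e)\<^sup>\<bottom>"]
      proof (intro CollectI ballI)
        fix z assume "z \<in> (normal_coords e)\<^sup>\<bottom>"
        then have "R *v z = z" using fix_perp by blast
        then show "orthogonal z (transpose R *v axis i 1 - axis i 1)"
          unfolding orthogonal_def inner_diff_right adj[symmetric] by simp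
      qed
      then have "transpose R *v axis i 1 - axis i 1 \<in> normal_coords e"
        unfolding orthogonal_comp_self[OF subspace_normal_coords] .
      then show ?thesis by (simp add: normal_coords_def)
    qed
    \<comment> \<open>Testing against the finitely many coordinate vectors allows the exceptional
      null sets to be united into one.\<close>
    then have "AE t in lebesgue. \<forall>i. t \<in> {0..\<tau>} \<longrightarrow>
      (\<forall>v. has_velocity M \<tau> x t v \<longrightarrow> (transpose R *v axis i 1 - axis i 1) \<bullet> M.frame_coords e t v = 0)"
      by (rule eventually_all_finite)
    then have "AE t in lebesgue. t \<in> {0..\<tau>} \<longrightarrow>
      (\<forall>v. has_velocity M \<tau> x t v \<longrightarrow> R *v M.frame_coords e t v = M.frame_coords e t v)"
    proof eventually_elim
      case (elim t)
      show ?case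
      proof (intro impI allI)
        fix v assume t: "t \<in> {0..\<tau>}" and v: "has_velocity M \<tau> x t v"
        let ?u = "M.frame_coords e t v"
        have "axis i 1 \<bullet> (R *v ?u) = axis i 1 \<bullet> ?u" for i
        proof -
          have "(transpose R *v axis i 1 - axis i 1) \<bullet> ?u = 0" using elim t v by blast
          then have "(transpose R *v axis i 1) \<bullet> ?u = axis i 1 \<bullet> ?u" by (simp add: inner_diff_left)
          then show ?thesis using adj[of ?u "axis i 1"] by (simp add: inner_commute)
        qed
        then show "R *v ?u = ?u" by (simp add: vec_eq_iff inner_axis')
      qed
    qed
    then show "fixes_velocity e R" by (simp add: fixes_velocity_def)
  }
qed

context
  fixes e f q0
  assumes e: "M.orthonormal_frame e" and f: "N.orthonormal_frame f"
    and q0: "intrinsic_rolling_along M N \<tau> x y q0"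
begin

lemma zero_in_interval: "0 \<in> {0..\<tau>}" using M.\<tau> by simp

lemma rollingD:
  assumes q: "intrinsic_rolling_along M N \<tau> x y q"
  shows "t \<in> {0..\<tau>} \<Longrightarrow> q t = (x t, y t, isom (q t))"
    and "t \<in> {0..\<tau>} \<Longrightarrow> isom (q t) \<in> isom_plus M N (x t) (y t)"
    and "AE t in lebesgue. t \<in> {0..\<tau>} \<longrightarrow> (\<exists>v. has_velocity M \<tau> x t v \<and> has_velocity N \<tau> y t (isom (q t) v))"
    and "(\<And>t. t \<in> {0..\<tau>} \<Longrightarrow> Z t \<in> tangent_space M (x t)) \<Longrightarrow>
      M.parallel_on 0 \<tau> Z \<longleftrightarrow> N.parallel_on 0 \<tau> (\<lambda>t. isom (q t) (Z t))"
proof -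
  note q' = q[unfolded rolling_iff]
  note B = conjunct1[OF q', rule_format]
  show "q t = (x t, y t, isom (q t))" if "t \<in> {0..\<tau>}"
    using B[OF that] by (cases "q t") simp
  show "isom (q t) \<in> isom_plus M N (x t) (y t)" if "t \<in> {0..\<tau>}" using B[OF that] by (elim conjE)
  show "AE t in lebesgue. t \<in> {0..\<tau>} \<longrightarrow> (\<exists>v. has_velocity M \<tau> x t v \<and> has_velocity N \<tau> y t (isom (q t) v))"
    by (rule conjunct1[OF conjunct2[OF conjunct2[OF q']]])
  show "M.parallel_on 0 \<tau> Z \<longleftrightarrow> N.parallel_on 0 \<tau> (\<lambda>t. isom (q t) (Z t))"
    if "\<And>t. t \<in> {0..\<tau>} \<Longrightarrow> Z t \<in> tangent_space M (x t)"
    by (rule conjunct2[OF conjunct2[OF conjunct2[OF q']], rule_format]) (rule that)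
qed

text \<open>By (II') the rolling maps the parallel frame along \<open>x\<close> to parallel fields
  along \<open>y\<close>, and their inner products with the frame \<open>f\<close> are
  constant.\<close>

lemma frame_matrix_constant:
  assumes q: "intrinsic_rolling_along M N \<tau> x y q" and t: "t \<in> {0..\<tau>}"
  shows "frame_matrix N e f t (q t) = frame_matrix N e f 0 (q 0)"
proof -
  have "N.parallel_on 0 \<tau> (\<lambda>t. isom (q t) (e j t))" for j
    using rollingD(4)[OF q, of "e j"] M.frame_tangent[OF e] M.frame_parallel[OF e] by blast
  from N.parallel_metric_constant[OF N.frame_parallel[OF f] this t]
  have "metric N (y t) (f i t) (isom (q t) (e j t)) = metric N (y 0) (f i 0) (isom (q 0) (e j 0))" for i j .
  moreover have "base2 (q t) = y t" "base2 (q 0) = y 0"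
    using q t zero_in_interval unfolding intrinsic_rolling_along_def by blast+
  ultimately show ?thesis by (simp add: frame_matrix_def)
qed

lemma rolling_isom:
  assumes q: "intrinsic_rolling_along M N \<tau> x y q" and t: "t \<in> {0..\<tau>}"
  shows "isom (q t) = isom_of_matrix e f (frame_matrix N e f 0 (q 0)) t"
proof -
  have "isom (q t) = isom_of_matrix e f (frame_matrix N e f t (x t, y t, isom (q t))) t"
    by (rule isom_eq_isom_of_matrix[OF e f t rollingD(2)[OF q t]])
  then show ?thesis
    unfolding rollingD(1)[OF q t, symmetric] frame_matrix_constant[OF q t] .
qed

lemma frame_matrix_rolling_orthogonal:
  assumes q: "intrinsic_rolling_along M N \<tau> x y q"
  shows "orthogonal_matrix (frame_matrix N e f 0 (q 0))"
  using frame_matrix_orthogonal[OF e f zero_in_interval rollingD(2)[OF q zero_in_interval], of "x 0"]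
  unfolding rollingD(1)[OF q zero_in_interval, symmetric] .

lemma right_action_rolling:
  assumes t: "t \<in> {0..\<tau>}" and R: "R \<in> SO"
  shows "right_action M N e f t (q0 t) R = (x t, y t, isom_of_matrix e f (frame_matrix N e f 0 (q0 0) ** R) t)"
  using right_action_eq[OF e f t rollingD(2)[OF q0 t] R]
  unfolding rollingD(1)[OF q0 t, symmetric] frame_matrix_constant[OF q0 t] .

lemma rolling_imp_right_action:
  assumes q: "intrinsic_rolling_along M N \<tau> x y q"
  obtains R where "R \<in> SO" "fixes_velocity e R" "\<And>t. t \<in> {0..\<tau>} \<Longrightarrow> q t = right_action M N e f t (q0 t) R"
proof -
  let ?P = "frame_matrix N e f 0 (q0 0)" and ?Q = "frame_matrix N e f 0 (q 0)"
  define R where "R = transpose ?P ** ?Q"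
  have O: "orthogonal_matrix ?P" "orthogonal_matrix ?Q"
    using frame_matrix_rolling_orthogonal[OF q0] frame_matrix_rolling_orthogonal[OF q] .
  have Q0R: "?P ** R = ?Q"
    using O(1) by (simp add: R_def matrix_mul_assoc orthogonal_matrix_def)
  have OR: "orthogonal_matrix R"
    unfolding R_def using O by (intro orthogonal_matrix_mul) simp_all
  obtain c d where cd: "c \<in> charts_at M (x 0)" "d \<in> charts_at N (y 0)"
    using M.charts_at_nonempty[OF M.x_topspace[OF zero_in_interval]] N.charts_at_nonempty[OF N.x_topspace[OF zero_in_interval]] by blast
  have pos: "det (N.frame_in_chart f d 0) * det (frame_matrix N e f 0 (q' 0)) * det (M.coframe_in_chart e c 0) > 0"
    if "intrinsic_rolling_along M N \<tau> x y q'" for q'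
    using isom_det_pos[OF e f zero_in_interval rollingD(2)[OF that zero_in_interval] cd, of "x 0"]
    unfolding rollingD(1)[OF that zero_in_interval, symmetric] .
  have "det ?Q = det ?P * det R" using arg_cong[OF Q0R, of det] by (simp add: det_mul)
  \<comment> \<open>Both rollings preserve orientation, so \<open>?P\<close> and \<open>?Q\<close>
    have determinants of the same sign relative to the same pair of charts.\<close>
  then have "det R \<noteq> - 1" using pos[OF q0] pos[OF q] by auto
  then have R: "R \<in> SO"
    using OR det_orthogonal_matrix[OF OR] by (auto simp: SO_def rotation_matrix_def)
  have "fixes_velocity e R"
    unfolding fixes_velocity_def using rollingD(3)[OF q0] rollingD(3)[OF q]
  proof eventually_elim
    case (elim t)
    show ?case
    proof (intro impI allI)
      fix v assume t: "t \<in> {0..\<tau>}" and v: "has_velocity M \<tau> x t v"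
      then have vt: "v \<in> tangent_space M (x t)" by (simp add: has_velocity_def)
      obtain v0 where v0: "has_velocity M \<tau> x t v0" "has_velocity N \<tau> y t (isom (q0 t) v0)" using elim(1) t by blast
      obtain v1 where v1: "has_velocity M \<tau> x t v1" "has_velocity N \<tau> y t (isom (q t) v1)" using elim(2) t by blast
      \<comment> \<open>Both isometries send the velocity of \<open>x\<close> to a velocity of
        \<open>y\<close> at the same time, so uniqueness of velocities makes them agree on
        it.\<close>
      have "v0 = v" "v1 = v" using M.velocity_unique[OF t] v v0 v1 by blast+
      then have eq: "isom (q t) v = isom (q0 t) v" using N.velocity_unique[OF t] v0 v1 by blast
      have "?Q *v M.frame_coords e t v = ?P *v M.frame_coords e t v"
        using arg_cong[OF eq, of "N.frame_coords f t"]
        unfolding rolling_isom[OF q t] rolling_isom[OF q0 t] frame_coords_isom_of_matrix[OF e f t vt] .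
      then show "R *v M.frame_coords e t v = M.frame_coords e t v"
        using O(1) unfolding R_def orthogonal_matrix_def
        by (metis matrix_vector_mul_assoc matrix_vector_mul_lid)
    qed
  qed
  moreover have "q t = right_action M N e f t (q0 t) R" if t: "t \<in> {0..\<tau>}" for t
    unfolding right_action_rolling[OF t R] Q0R rolling_isom[OF q t, symmetric] by (rule rollingD(1)[OF q t])
  ultimately show ?thesis using R that by blast
qed

text \<open>The rotated curve has the constant matrix \<open>?C\<close> in the frames. Its matrix in
  charts is therefore a product of absolutely continuous factors, it keeps the no-slip condition
  because R fixes the velocity coordinates, and constant coordinates correspond to constant
  coordinates because \<open>?C\<close> is injective.\<close>

lemma right_action_imp_rolling:
  assumes R: "R \<in> SO" and fix_vel: "fixes_velocity e R"
  shows "intrinsic_rolling_along M N \<tau> x y (\<lambda>t. right_action M N e f t (q0 t) R)"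
proof -
  let ?C = "frame_matrix N e f 0 (q0 0) ** R" and ?q = "\<lambda>t. right_action M N e f t (q0 t) R"
  have q: "?q t = (x t, y t, isom_of_matrix e f ?C t)" if "t \<in> {0..\<tau>}" for t
    by (rule right_action_rolling[OF that R])
  have OC: "transpose ?C ** ?C = mat 1"
    using orthogonal_matrix_mul[OF frame_matrix_rolling_orthogonal[OF q0], of R] R
    by (simp add: SO_def rotation_matrix_def orthogonal_matrix)
  have isom: "isom_of_matrix e f ?C t \<in> isom_plus M N (x t) (y t)" if t: "t \<in> {0..\<tau>}" for t
    using isom_of_matrix_rotated[OF e f t rollingD(2)[OF q0 t] R, of "x t"]
    unfolding rollingD(1)[OF q0 t, symmetric] frame_matrix_constant[OF q0 t] .
  show ?thesis
    unfolding rolling_iff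
  proof (intro conjI ballI allI impI)
    fix t assume t: "t \<in> {0..\<tau>}"
    show "base1 (?q t) = x t" "base2 (?q t) = y t" "isom (?q t) \<in> isom_plus M N (x t) (y t)"
      using isom[OF t] by (simp_all add: q[OF t])
  next
    fix c d and a b :: real
    assume c: "c \<in> atlas M" and d: "d \<in> atlas N"
      and *: "0 \<le> a \<and> a \<le> b \<and> b \<le> \<tau> \<and> x ` {a..b} \<subseteq> fst c \<and> y ` {a..b} \<subseteq> fst d"
    have F: "abs_continuous a b (N.frame_in_chart f d)"
      using * by (intro N.frame_in_chart_ac[OF f d]) auto
    have E: "abs_continuous a b (M.frame_in_chart e c)"
      using * by (intro M.frame_in_chart_ac[OF e c]) auto
    have "abs_continuous a b (\<lambda>t. transpose (M.frame_in_chart e c t))"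
      by (intro abs_continuous_vec) (simp add: transpose_def abs_continuous_vec_nth E)
    then have "abs_continuous a b (M.coframe_in_chart e c)"
      unfolding M.coframe_in_chart_def
      using * by (intro abs_continuous_matrix_mult M.metric_coeff_along_ac c) auto
    then have "abs_continuous a b (\<lambda>t. N.frame_in_chart f d t ** ?C ** M.coframe_in_chart e c t)"
      by (intro abs_continuous_matrix_mult F abs_continuous_const)
    moreover have "N.frame_in_chart f d t ** ?C ** M.coframe_in_chart e c t = matrix (\<lambda>u. isom (?q t) (tvec_of M c (x t) u) d)"
      if "a \<le> t" "t \<le> b" for t
    proof -
      have t: "t \<in> {0..\<tau>}" using that * by auto
      have "x t \<in> fst c" using that * by auto
      then have "c \<in> charts_at M (x t)" by (rule M.charts_atI[OF c])
      from isom_of_matrix_in_charts[OF e f t this, of ?C d] show ?thesis by (simp add: q[OF t])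
    qed
    ultimately show "abs_continuous a b (\<lambda>t. matrix (\<lambda>u. isom (?q t) (tvec_of M c (x t) u) d))"
      using abs_continuous_cong[of a b "\<lambda>t. N.frame_in_chart f d t ** ?C ** M.coframe_in_chart e c t"
          "\<lambda>t. matrix (\<lambda>u. isom (?q t) (tvec_of M c (x t) u) d)"] by blast
  next
    show "AE t in lebesgue. t \<in> {0..\<tau>} \<longrightarrow> (\<exists>v. has_velocity M \<tau> x t v \<and> has_velocity N \<tau> y t (isom (?q t) v))"
      using rollingD(3)[OF q0] fix_vel[unfolded fixes_velocity_def]
    proof eventually_elim
      case (elim t)
      show ?case
      proof
        assume t: "t \<in> {0..\<tau>}"
        then obtain v where v: "has_velocity M \<tau> x t v" "has_velocity N \<tau> y t (isom (q0 t) v)" using elim(1) by blast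
        then have "R *v M.frame_coords e t v = M.frame_coords e t v" using elim(2) t by blast
        then have "isom_of_matrix e f ?C t v = isom_of_matrix e f (frame_matrix N e f 0 (q0 0)) t v"
          by (simp add: isom_of_matrix_def[OF e f] flip: matrix_vector_mul_assoc)
        then have "isom (?q t) v = isom (q0 t) v" by (simp add: q[OF t] rolling_isom[OF q0 t])
        then show "\<exists>v. has_velocity M \<tau> x t v \<and> has_velocity N \<tau> y t (isom (?q t) v)" using v by auto
      qed
    qed
  next
    fix Z assume "\<forall>t\<in>{0..\<tau>}. Z t \<in> tangent_space M (x t)"
    then have Z: "Z t \<in> tangent_space M (x t)" if "t \<in> {0..\<tau>}" for t using that by blast
    have iq: "isom (?q t) (Z t) = isom_of_matrix e f ?C t (Z t)" if "t \<in> {0..\<tau>}" for t by (simp add: q[OF that])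
    have tan: "isom (?q t) (Z t) \<in> tangent_space N (y t)" if "t \<in> {0..\<tau>}" for t
      unfolding iq[OF that] by (rule isom_of_matrix_tangent[OF e f that Z[OF that]])
    have coords: "N.frame_coords f t (isom (?q t) (Z t)) = ?C *v M.frame_coords e t (Z t)" if "t \<in> {0..\<tau>}" for t
      unfolding iq[OF that] by (rule frame_coords_isom_of_matrix[OF e f that Z[OF that]])
    have inj: "?C *v u = ?C *v w \<longleftrightarrow> u = w" for u w
      using OC by (metis matrix_vector_mul_assoc matrix_vector_mul_lid)
    show "M.parallel_on 0 \<tau> Z \<longleftrightarrow> N.parallel_on 0 \<tau> (\<lambda>t. isom (?q t) (Z t))"
    proof -
      have "M.parallel_on 0 \<tau> Z \<longleftrightarrow> (\<forall>t\<in>{0..\<tau>}. M.frame_coords e t (Z t) = M.frame_coords e 0 (Z 0))"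
        by (rule M.parallel_on_iff_constant_coords[OF e]) (rule Z)
      also have "\<dots> \<longleftrightarrow> (\<forall>t\<in>{0..\<tau>}. N.frame_coords f t (isom (?q t) (Z t)) = N.frame_coords f 0 (isom (?q 0) (Z 0)))"
        by (intro ball_cong refl) (simp only: coords zero_in_interval inj)
      also have "\<dots> \<longleftrightarrow> N.parallel_on 0 \<tau> (\<lambda>t. isom (?q t) (Z t))"
        by (rule N.parallel_on_iff_constant_coords[OF f, symmetric]) (rule tan)
      finally show ?thesis .
    qed
  qed
qed

text \<open>Freeness of the action, already at time 0: the matrix of the result is \<open>?P\<close>
  times the rotation, and \<open>?P\<close> is invertible.\<close>

lemma right_action_rolling_eq_iff:
  assumes R: "R \<in> SO" and R': "R' \<in> SO" and "right_action M N e f 0 (q0 0) R = right_action M N e f 0 (q0 0) R'"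
  shows "R = R'"
proof -
  let ?P = "frame_matrix N e f 0 (q0 0)"
  have fm: "frame_matrix N e f 0 (right_action M N e f 0 (q0 0) S) = ?P ** S" if S: "S \<in> SO" for S
  proof -
    have "isom_of_matrix e f (?P ** S) 0 \<in> isom_plus M N (x 0) (y 0)"
      using isom_of_matrix_rotated[OF e f zero_in_interval rollingD(2)[OF q0 zero_in_interval] S, of "x 0"]
      unfolding rollingD(1)[OF q0 zero_in_interval, symmetric] .
    then show ?thesis
      unfolding right_action_rolling[OF zero_in_interval S]
      by (rule frame_matrix_isom_of_matrix[OF e f zero_in_interval])
  qed
  have "transpose ?P ** (?P ** R) = transpose ?P ** (?P ** R')"
    using fm[OF R] fm[OF R'] assms(3) by simp
  then show ?thesis
    using frame_matrix_rolling_orthogonal[OF q0] by (simp add: matrix_mul_assoc orthogonal_matrix_def)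
qed

text \<open>The constant matrix of \<open>q0\<close> gives a linear injection from S onto the fields
  counted by k. It preserves inner products, and by no-slip the velocity of \<open>y\<close> is the
  image of that of \<open>x\<close>, so orthogonality to one means orthogonality to the
  other.\<close>

lemma dim_normal_parallel_fields: "dim (normal_parallel_fields N \<tau> y) = dim (normal_coords e)"
proof -
  let ?P = "frame_matrix N e f 0 (q0 0)"
  have O: "transpose ?P ** ?P = mat 1" "?P ** transpose ?P = mat 1"
    using frame_matrix_rolling_orthogonal[OF q0] by (simp_all add: orthogonal_matrix_def)
  have isometry: "(?P *v u) \<bullet> (?P *v w) = u \<bullet> w" for u w
    using frame_matrix_rolling_orthogonal[OF q0] orthogonal_transformation_matrix[of "(*v) ?P"]
    unfolding orthogonal_transformation_def by simp
  \<comment> \<open>The image under \<open>q0\<close> of the parallel field with constant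
    coordinates \<open>s\<close>, extended by 0 to match the normalization in
    \<open>normal_parallel_fields\<close>.\<close>
  define \<Psi> where "\<Psi> s = (\<lambda>t. if t \<in> {0..\<tau>} then \<Sum>i\<in>UNIV. (?P *v s) $ i *\<^sub>R f i t else 0)" for s
  have \<Psi>_in: "\<Psi> s t = (\<Sum>i\<in>UNIV. (?P *v s) $ i *\<^sub>R f i t)" if "t \<in> {0..\<tau>}" for s t
    using that by (simp add: \<Psi>_def)
  have \<Psi>_out: "\<Psi> s t = 0" if "t \<notin> {0..\<tau>}" for s t
    unfolding \<Psi>_def using that by (simp only: if_False)
  have \<Psi>_par: "N.parallel_on 0 \<tau> (\<Psi> s)" for s
  proof (rule N.parallel_on_cong)
    show "N.parallel_on 0 \<tau> (\<lambda>t. \<Sum>i\<in>UNIV. (?P *v s) $ i *\<^sub>R f i t)"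
      by (intro N.parallel_on_lincomb N.frame_parallel[OF f]) simp
  qed (simp add: \<Psi>_def)
  have \<Psi>_coords: "N.frame_coords f t (\<Psi> s t) = ?P *v s" if "t \<in> {0..\<tau>}" for s t
    using that by (simp add: \<Psi>_def N.frame_coords_lincomb[OF f that])
  have pairing: "metric N (y t) (\<Psi> s t) (isom (q0 t) v) = s \<bullet> M.frame_coords e t v"
    if t: "t \<in> {0..\<tau>}" and v: "v \<in> tangent_space M (x t)" for s t v
  proof -
    have "\<Psi> s t \<in> tangent_space N (y t)" using \<Psi>_par t unfolding N.parallel_on_def by blast
    moreover have "isom (q0 t) v \<in> tangent_space N (y t)"
      using isom_plusD(1)[OF rollingD(2)[OF q0 t]] v by blast
    ultimately have "metric N (y t) (\<Psi> s t) (isom (q0 t) v) = (?P *v s) \<bullet> N.frame_coords f t (isom (q0 t) v)"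
      unfolding \<Psi>_coords[OF t, symmetric] by (rule N.metric_frame_coords[OF f t])
    also have "\<dots> = (?P *v s) \<bullet> (?P *v M.frame_coords e t v)"
      unfolding rolling_isom[OF q0 t] frame_coords_isom_of_matrix[OF e f t v] ..
    finally show ?thesis unfolding isometry .
  qed
  have "\<Psi> s \<in> normal_parallel_fields N \<tau> y" if s: "s \<in> normal_coords e" for s
  proof -
    have "AE t in lebesgue. t \<in> {0..\<tau>} \<longrightarrow> (\<exists>v. has_velocity N \<tau> y t v \<and> metric N (y t) (\<Psi> s t) v = 0)"
      using rollingD(3)[OF q0] s[unfolded normal_coords_def mem_Collect_eq]
    proof eventually_elim
      case (elim t)
      show ?case
      proof
        assume t: "t \<in> {0..\<tau>}"
        then obtain v where v: "has_velocity M \<tau> x t v" "has_velocity N \<tau> y t (isom (q0 t) v)" using elim(1) by blast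
        then have "v \<in> tangent_space M (x t)" by (simp add: has_velocity_def)
        from pairing[OF t this] have "metric N (y t) (\<Psi> s t) (isom (q0 t) v) = 0" using elim(2) t v(1) by simp
        then show "\<exists>v. has_velocity N \<tau> y t v \<and> metric N (y t) (\<Psi> s t) v = 0" using v(2) by blast
      qed
    qed
    \<comment> \<open>Membership asks for orthogonality at every time with a velocity, whereas S
      provides it only almost everywhere; this is the place where the gap is closed.\<close>
    from N.parallel_normal_everywhere[OF \<Psi>_par this] show ?thesis
      unfolding normal_parallel_fields_def N.parallel_iff_parallel_on using \<Psi>_par by (simp add: \<Psi>_def)
  qed
  moreover have "Z \<in> \<Psi> ` normal_coords e" if Z: "Z \<in> normal_parallel_fields N \<tau> y" for Z
  proof -
    have par: "N.parallel_on 0 \<tau> Z" and out: "\<And>t. t \<notin> {0..\<tau>} \<Longrightarrow> Z t = 0"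
      and nor: "\<And>t v. t \<in> {0..\<tau>} \<Longrightarrow> has_velocity N \<tau> y t v \<Longrightarrow> metric N (y t) (Z t) v = 0"
      using Z unfolding normal_parallel_fields_def N.parallel_iff_parallel_on by blast+
    have tan: "Z t \<in> tangent_space N (y t)" if "t \<in> {0..\<tau>}" for t
      using par that unfolding N.parallel_on_def by blast
    define s where "s = transpose ?P *v N.frame_coords f 0 (Z 0)"
    have Qs: "?P *v s = N.frame_coords f 0 (Z 0)" by (simp only: s_def matrix_vector_mul_assoc O matrix_vector_mul_lid)
    have "Z = \<Psi> s"
    proof
      fix t show "Z t = \<Psi> s t"
      proof (cases "t \<in> {0..\<tau>}")
        case True
        have "N.frame_coords f t (Z t) = ?P *v s"
          using par True N.parallel_on_iff_constant_coords[OF f, of Z] tan unfolding Qs by blast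
        then show ?thesis using N.frame_expansion[OF f True tan[OF True]] True by (simp add: \<Psi>_def)
      next
        case False
        then show ?thesis unfolding \<Psi>_def out[OF False] by (simp only: if_False)
      qed
    qed
    moreover have "AE t in lebesgue. t \<in> {0..\<tau>} \<longrightarrow> (\<forall>v. has_velocity M \<tau> x t v \<longrightarrow> s \<bullet> M.frame_coords e t v = 0)"
      using rollingD(3)[OF q0]
    proof eventually_elim
      case (elim t)
      show ?case
      proof (intro impI allI)
        fix v assume t: "t \<in> {0..\<tau>}" and v: "has_velocity M \<tau> x t v"
        obtain w where w: "has_velocity M \<tau> x t w" "has_velocity N \<tau> y t (isom (q0 t) w)" using elim t by blast
        have "w = v" by (rule M.velocity_unique[OF t w(1) v])
        moreover have "v \<in> tangent_space M (x t)" using v by (simp add: has_velocity_def)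
        ultimately show "s \<bullet> M.frame_coords e t v = 0"
          using pairing[OF t, of v s] nor[OF t w(2)] \<open>Z = \<Psi> s\<close> by simp
      qed
    qed
    ultimately show ?thesis by (auto simp: normal_coords_def)
  qed
  ultimately have img: "normal_parallel_fields N \<tau> y = \<Psi> ` normal_coords e" by blast
  have "linear \<Psi>"
  proof (rule linearI)
    show "\<Psi> (u + w) = \<Psi> u + \<Psi> w" for u w
    proof
      fix t
      have "(\<Sum>i\<in>UNIV. (?P *v (u + w)) $ i *\<^sub>R f i t) = (\<Sum>i\<in>UNIV. (?P *v u) $ i *\<^sub>R f i t) + (\<Sum>i\<in>UNIV. (?P *v w) $ i *\<^sub>R f i t)"
        by (simp only: matrix_vector_right_distrib vector_add_component scaleR_add_left sum.distrib)
      then show "\<Psi> (u + w) t = (\<Psi> u + \<Psi> w) t"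
        unfolding plus_fun_apply[of "\<Psi> u" "\<Psi> w" t]
        by (cases "t \<in> {0..\<tau>}") (simp_all only: \<Psi>_in \<Psi>_out add_0_left not_False_eq_True)
    qed
    show "\<Psi> (r *\<^sub>R w) = r *\<^sub>R \<Psi> w" for r w
    proof
      fix t
      have "(\<Sum>i\<in>UNIV. (?P *v (r *\<^sub>R w)) $ i *\<^sub>R f i t) = r *\<^sub>R (\<Sum>i\<in>UNIV. (?P *v w) $ i *\<^sub>R f i t)"
        by (simp only: matrix_vector_mult_scaleR vector_scaleR_component scaleR_sum_right real_scaleR_def scaleR_scaleR)
      moreover have "(r *\<^sub>R \<Psi> w) t = r *\<^sub>R \<Psi> w t" by (simp only: scaleR_fun_def[of r "\<Psi> w"])
      ultimately show "\<Psi> (r *\<^sub>R w) t = (r *\<^sub>R \<Psi> w) t"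
        by (cases "t \<in> {0..\<tau>}") (simp_all only: \<Psi>_in \<Psi>_out scale_zero_right not_False_eq_True)
    qed
  qed
  moreover have "inj \<Psi>"
  proof (rule injI)
    fix u w assume "\<Psi> u = \<Psi> w"
    then have "?P *v u = ?P *v w"
      using \<Psi>_coords[OF zero_in_interval, of u] \<Psi>_coords[OF zero_in_interval, of w] by simp
    then show "u = w" using O(1) by (metis matrix_vector_mul_assoc matrix_vector_mul_lid)
  qed
  ultimately show ?thesis
    unfolding img using dim_linear_image_inj subspace_normal_coords by blast
qed

end

end

section \<open>Rotations fixing the orthogonal complement of a subspace\<close>

text \<open>The form that a matrix fixing the complement of S takes in a basis adapted to S, where
  \<open>J\<close> numbers the basis vectors of S.\<close>

definition block_on :: "'n set \<Rightarrow> real ^ 'n ^ 'n \<Rightarrow> bool"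
  where "block_on J E \<longleftrightarrow> (\<forall>i j. i \<notin> J \<or> j \<notin> J \<longrightarrow> E $ i $ j = (if i = j then 1 else 0))"

definition block_embed :: "('k \<Rightarrow> 'n) \<Rightarrow> real ^ 'k ^ 'k \<Rightarrow> real ^ 'n ^ 'n"
  where "block_embed \<iota> A = (\<chi> i j. if i \<in> range \<iota> \<and> j \<in> range \<iota> then A $ inv \<iota> i $ inv \<iota> j
    else if i = j then 1 else 0)"

lemma block_on_block_embed: "block_on (range \<iota>) (block_embed \<iota> A)"
  by (auto simp: block_on_def block_embed_def)

lemma block_embed_inside: "inj \<iota> \<Longrightarrow> block_embed \<iota> A $ \<iota> a $ \<iota> b = A $ a $ b"
  by (simp add: block_embed_def)

lemma block_embed_outside:
  "i \<notin> range \<iota> \<or> j \<notin> range \<iota> \<Longrightarrow> block_embed \<iota> A $ i $ j = (if i = j then 1 else 0)"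
  by (auto simp: block_embed_def)

lemma block_embed_eqI:
  assumes "inj \<iota>" "block_on (range \<iota>) E" "\<And>a b. E $ \<iota> a $ \<iota> b = A $ a $ b"
  shows "block_embed \<iota> A = E"
proof -
  have "block_embed \<iota> A $ i $ j = E $ i $ j" for i j
  proof (cases "i \<in> range \<iota> \<and> j \<in> range \<iota>")
    case True
    then obtain a b where "i = \<iota> a" "j = \<iota> b" by blast
    then show ?thesis using assms by (simp add: block_embed_inside)
  next
    case False
    then show ?thesis using assms(2) by (auto simp: block_on_def block_embed_outside)
  qed
  then show ?thesis by (simp add: vec_eq_iff)
qed

lemma block_embed_inj: "inj \<iota> \<Longrightarrow> block_embed \<iota> A = block_embed \<iota> B \<Longrightarrow> A = B"
  using block_embed_inside[of \<iota>] by (metis vec_eq_iff)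

lemma block_embed_one: "inj \<iota> \<Longrightarrow> block_embed \<iota> (mat 1) = mat 1"
  by (rule block_embed_eqI) (auto simp: block_on_def mat_def inj_eq)

lemma block_embed_transpose: "inj \<iota> \<Longrightarrow> block_embed \<iota> (transpose A) = transpose (block_embed \<iota> A)"
  by (rule block_embed_eqI) (auto simp: block_on_def transpose_def block_embed_inside block_embed_outside)

text \<open>Rows and columns outside the range of \<iota> are those of the identity matrix, so the
  sum over intermediate indices either collapses to one term or runs over the range only.\<close>

lemma block_embed_mult:
  fixes \<iota> :: "'k::finite \<Rightarrow> 'n::finite"
  assumes \<iota>: "inj \<iota>"
  shows "block_embed \<iota> (A ** B) = block_embed \<iota> A ** block_embed \<iota> B"
proof (rule block_embed_eqI[OF \<iota>])
  let ?A = "block_embed \<iota> A" and ?B = "block_embed \<iota> B"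
  show "block_on (range \<iota>) (?A ** ?B)"
    unfolding block_on_def
  proof (intro allI impI)
    fix i j assume "i \<notin> range \<iota> \<or> j \<notin> range \<iota>"
    then show "(?A ** ?B) $ i $ j = (if i = j then 1 else 0)"
    proof
      assume i: "i \<notin> range \<iota>"
      have "(?A ** ?B) $ i $ j = (\<Sum>m\<in>UNIV. if i = m then ?B $ m $ j else 0)"
        unfolding matrix_matrix_mult_def vec_lambda_beta
      proof (rule sum.cong[OF refl])
        fix m show "?A $ i $ m * ?B $ m $ j = (if i = m then ?B $ m $ j else 0)"
          using i by (simp add: block_embed_outside)
      qed
      then show ?thesis using i by (simp add: block_embed_outside)
    next
      assume j: "j \<notin> range \<iota>"
      have "(?A ** ?B) $ i $ j = (\<Sum>m\<in>UNIV. if m = j then ?A $ i $ m else 0)"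
        unfolding matrix_matrix_mult_def vec_lambda_beta
      proof (rule sum.cong[OF refl])
        fix m show "?A $ i $ m * ?B $ m $ j = (if m = j then ?A $ i $ m else 0)"
          using j by (simp add: block_embed_outside)
      qed
      then show ?thesis using j by (simp add: block_embed_outside)
    qed
  qed
  fix a b
  have "(?A ** ?B) $ \<iota> a $ \<iota> b = (\<Sum>m\<in>range \<iota>. ?A $ \<iota> a $ m * ?B $ m $ \<iota> b)"
    unfolding matrix_matrix_mult_def
    by (simp, rule sum.mono_neutral_right) (auto simp: block_embed_outside)
  also have "\<dots> = (\<Sum>c\<in>UNIV. A $ a $ c * B $ c $ b)"
    by (subst sum.reindex[OF \<iota>]) (simp add: block_embed_inside[OF \<iota>])
  finally show "(?A ** ?B) $ \<iota> a $ \<iota> b = (A ** B) $ a $ b"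
    by (simp add: matrix_matrix_mult_def)
qed

lemma det_elementary_add:
  fixes m n :: "'n::finite"
  assumes "m \<noteq> n"
  shows "det (\<chi> i j. of_bool (i = m \<and> j = n \<or> i = j) :: real ^ 'n ^ 'n) = 1"
proof -
  have "(\<chi> i j. of_bool (i = m \<and> j = n \<or> i = j) :: real ^ 'n ^ 'n)
      = (\<chi> k. if k = m then row m (mat 1) + 1 *s row n (mat 1) else row k (mat 1))"
    using assms by (auto simp: vec_eq_iff row_def mat_def)
  then show ?thesis using det_row_operation[OF assms, of "mat 1 :: real ^ 'n ^ 'n" 1] by simp
qed

lemma det_elementary_swap:
  fixes p q :: "'n::finite"
  assumes "p \<noteq> q"
  shows "det (\<chi> i j. mat 1 $ i $ Transposition.transpose p q j :: real ^ 'n ^ 'n) = - 1"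
proof -
  have "Transposition.transpose p q permutes UNIV" by (simp add: permutes_swap_id)
  from det_permute_columns[OF this, of "mat 1 :: real ^ 'n ^ 'n"]
  show ?thesis using assms by (simp add: sign_swap_id)
qed

text \<open>Induction over products of elementary matrices: the claim is multiplicative, and the
  embedding of a swap, of a row addition, of a diagonal matrix or of a matrix with a zero row is
  again of that kind.\<close>

lemma det_block_embed:
  fixes \<iota> :: "'k::finite \<Rightarrow> 'n::finite"
  assumes \<iota>: "inj \<iota>"
  shows "det (block_embed \<iota> A) = det A"
proof (rule induct_matrix_elementary_alt[of "\<lambda>A. det (block_embed \<iota> A) = det A"])
  fix A B :: "real ^ 'k ^ 'k"
  assume "det (block_embed \<iota> A) = det A" "det (block_embed \<iota> B) = det B"
  then show "det (block_embed \<iota> (A ** B)) = det (A ** B)" by (simp add: block_embed_mult[OF \<iota>] det_mul)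
next
  fix A :: "real ^ 'k ^ 'k" and i
  assume zero_row: "row i A = 0"
  have "A $ i $ b = 0" for b using zero_row by (simp add: row_def vec_eq_iff)
  then have "block_embed \<iota> A $ \<iota> i $ j = 0" for j
    using \<iota> by (auto simp: block_embed_def)
  then have "row (\<iota> i) (block_embed \<iota> A) = 0" by (simp add: row_def vec_eq_iff)
  then show "det (block_embed \<iota> A) = det A" using zero_row det_zero_row(2) by metis
next
  fix A :: "real ^ 'k ^ 'k"
  assume diagonal: "\<And>i j. i \<noteq> j \<Longrightarrow> A $ i $ j = 0"
  have "det (block_embed \<iota> A) = (\<Prod>i\<in>UNIV. block_embed \<iota> A $ i $ i)"
    using \<iota> by (intro det_diagonal) (auto simp: block_embed_def intro!: diagonal)
  also have "\<dots> = (\<Prod>i\<in>range \<iota>. block_embed \<iota> A $ i $ i)"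
    by (rule prod.mono_neutral_right) (auto simp: block_embed_outside)
  also have "\<dots> = (\<Prod>a\<in>UNIV. A $ a $ a)"
    by (subst prod.reindex[OF \<iota>]) (simp add: block_embed_inside[OF \<iota>])
  also have "\<dots> = det A" using diagonal by (intro det_diagonal[symmetric]) auto
  finally show "det (block_embed \<iota> A) = det A" .
next
  fix m n :: 'k
  assume swap1: "m \<noteq> n"
  have "block_embed \<iota> (\<chi> i j. mat 1 $ i $ Transposition.transpose m n j) =
      (\<chi> i j. mat 1 $ i $ Transposition.transpose (\<iota> m) (\<iota> n) j)"
    using \<iota> by (intro block_embed_eqI) (auto simp: block_on_def mat_def Transposition.transpose_def inj_eq)
  then show "det (block_embed \<iota> (\<chi> i j. mat 1 $ i $ Transposition.transpose m n j)) = det ((\<chi> i j. mat 1 $ i $ Transposition.transpose m n j) :: real ^ 'k ^ 'k)" using swap1 \<iota> by (simp add: det_elementary_swap inj_eq)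
next
  fix m n :: 'k
  assume idplus: "m \<noteq> n"
  have "block_embed \<iota> (\<chi> i j. of_bool (i = m \<and> j = n \<or> i = j)) =
      (\<chi> i j. of_bool (i = \<iota> m \<and> j = \<iota> n \<or> i = j))"
    using \<iota> by (intro block_embed_eqI) (auto simp: block_on_def inj_eq)
  then show "det (block_embed \<iota> (\<chi> i j. of_bool (i = m \<and> j = n \<or> i = j))) = det ((\<chi> i j. of_bool (i = m \<and> j = n \<or> i = j)) :: real ^ 'k ^ 'k)" using idplus \<iota> by (simp only: det_elementary_add inj_eq not_False_eq_True)
qed

text \<open>The columns of \<open>U\<close> are an orthonormal basis of S together with one of its
  complement, and \<open>J\<close> consists of the columns taken from S. Being orthogonal to S means
  that the coordinates in \<open>J\<close> vanish.\<close>

lemma adapted_orthonormal_basis: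
  fixes S :: "(real ^ 'n) set"
  assumes S: "subspace S"
  obtains U :: "real ^ 'n ^ 'n" and J where "orthogonal_matrix U" "card J = dim S"
    "\<And>z. z \<in> S\<^sup>\<bottom> \<longleftrightarrow> (\<forall>j\<in>J. (transpose U *v z) $ j = 0)"
proof -
  obtain B1 where B1: "B1 \<subseteq> S" "pairwise orthogonal B1" "\<And>x. x \<in> B1 \<Longrightarrow> norm x = 1"
    "independent B1" "card B1 = dim S" "span B1 = S"
    using orthonormal_basis_subspace[OF S] by blast
  obtain B2 where B2: "B2 \<subseteq> S\<^sup>\<bottom>" "pairwise orthogonal B2" "\<And>x. x \<in> B2 \<Longrightarrow> norm x = 1"
    "independent B2" "card B2 = dim (S\<^sup>\<bottom>)" "span B2 = S\<^sup>\<bottom>"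
    using orthonormal_basis_subspace[OF subspace_orthogonal_comp] by blast
  have fin: "finite B1" "finite B2" using B1(4) B2(4) by (simp_all add: finiteI_independent)
  have perp: "orthogonal u v" if "u \<in> B1" "v \<in> B2" for u v
    using that B1(1) B2(1) by (auto simp: orthogonal_comp_def)
  have disj: "B1 \<inter> B2 = {}"
  proof (rule ccontr)
    assume "B1 \<inter> B2 \<noteq> {}"
    then obtain u where "u \<in> B1" "u \<in> B2" by blast
    then have "u \<bullet> u = 0" "norm u = 1" using perp[of u u] B1(3)[of u] by (simp_all only: orthogonal_def)
    then show False by (simp add: dot_square_norm)
  qed
  have "dim {y \<in> UNIV. \<forall>x\<in>S. orthogonal x y} + dim S = dim (UNIV :: (real ^ 'n) set)"
    by (rule dim_subspace_orthogonal_to_vectors[OF S]) auto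
  then have "dim (S\<^sup>\<bottom>) + dim S = CARD('n)" by (simp add: orthogonal_comp_def)
  then have card: "card (B1 \<union> B2) = CARD('n)" using card_Un_disjoint[OF fin disj] B1(5) B2(5) by simp
  then obtain b :: "'n \<Rightarrow> real ^ 'n" where b: "bij_betw b UNIV (B1 \<union> B2)"
    using finite_same_card_bij[of "UNIV :: 'n set" "B1 \<union> B2"] fin by auto
  have inj: "inj b" and ran: "range b = B1 \<union> B2" using b by (auto simp: bij_betw_def)
  have on: "b i \<bullet> b j = (if i = j then 1 else 0)" for i j
  proof (cases "i = j")
    case True
    have "b i \<in> B1 \<union> B2" using ran by blast
    then have "norm (b i) = 1" using B1(3) B2(3) by blast
    then show ?thesis using True by (simp add: dot_square_norm)
  next
    case False
    then have ne: "b i \<noteq> b j" using inj by (auto simp: inj_eq)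
    have "b i \<in> B1 \<union> B2" "b j \<in> B1 \<union> B2" using ran by blast+
    then have "orthogonal (b i) (b j)"
      using ne perp perp[THEN orthogonal_commute[THEN iffD1]] pairwiseD[OF B1(2)] pairwiseD[OF B2(2)] by (elim UnE) simp_all
    then show ?thesis using False by (simp add: orthogonal_def)
  qed
  define U :: "real ^ 'n ^ 'n" where "U = (\<chi> i j. b j $ i)"
  have Ut: "(transpose U *v z) $ j = b j \<bullet> z" for z j
    by (simp add: matrix_vector_mult_def transpose_def U_def inner_vec_def)
  have "transpose U ** U = mat 1"
    using on by (simp add: vec_eq_iff matrix_matrix_mult_def transpose_def U_def mat_def inner_vec_def)
  then have "orthogonal_matrix U" by (simp add: orthogonal_matrix)
  moreover have bJ: "b ` {j. b j \<in> B1} = B1" using ran by auto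
  have "card {j. b j \<in> B1} = dim S"
    using card_image[OF inj_on_subset[OF inj subset_UNIV], of "{j. b j \<in> B1}"] bJ B1(5) by simp
  moreover have "z \<in> S\<^sup>\<bottom> \<longleftrightarrow> (\<forall>j\<in>{j. b j \<in> B1}. (transpose U *v z) $ j = 0)" for z
  proof
    assume "z \<in> S\<^sup>\<bottom>"
    then show "\<forall>j\<in>{j. b j \<in> B1}. (transpose U *v z) $ j = 0"
      using B1(1) unfolding Ut by (auto simp: orthogonal_comp_def orthogonal_def)
  next
    assume *: "\<forall>j\<in>{j. b j \<in> B1}. (transpose U *v z) $ j = 0"
    have "orthogonal z u" if u: "u \<in> B1" for u
    proof -
      have "u \<in> range b" unfolding ran using u by (rule UnI1)
      then obtain j where j: "u = b j" by (rule rangeE)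
      then have "(transpose U *v z) $ j = 0" using * u by (simp only: Ball_def mem_Collect_eq)
      then show ?thesis unfolding Ut j orthogonal_def by (simp only: inner_commute)
    qed
    then have "orthogonal z s" if "s \<in> S" for s
      using orthogonal_to_span[of s B1 z] that B1(6) by blast
    then show "z \<in> S\<^sup>\<bottom>" by (simp add: orthogonal_comp_def orthogonal_commute)
  qed
  ultimately show ?thesis by (rule that)
qed

text \<open>After conjugation by \<open>U\<close> the complement of S is spanned by the coordinate
  vectors outside \<open>J\<close>, so fixing it prescribes the columns of these indices;
  orthogonality prescribes the rows as well.\<close>

lemma fixes_orthogonal_comp_iff:
  fixes R U :: "real ^ 'n ^ 'n"
  assumes U: "orthogonal_matrix U" and R: "orthogonal_matrix R"
    and J: "\<And>z. z \<in> S\<^sup>\<bottom> \<longleftrightarrow> (\<forall>j\<in>J. (transpose U *v z) $ j = 0)"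
  shows "(\<forall>z\<in>S\<^sup>\<bottom>. R *v z = z) \<longleftrightarrow> block_on J (transpose U ** R ** U)"
proof
  let ?E = "transpose U ** R ** U"
  have UU: "transpose U ** U = mat 1" "U ** transpose U = mat 1" using U by (simp_all add: orthogonal_matrix_def)
  have "orthogonal_matrix ?E"
    by (intro orthogonal_matrix_mul R U) (use U in \<open>simp add: orthogonal_matrix_def\<close>)
  then have E: "transpose ?E ** ?E = mat 1" by (rule orthogonal_matrix[THEN iffD1])
  {
    assume fix_perp: "\<forall>z\<in>S\<^sup>\<bottom>. R *v z = z"
    have col: "?E *v axis j 1 = axis j 1" if j: "j \<notin> J" for j
    proof -
      let ?b = "U *v axis j 1"
      have Ub: "transpose U *v ?b = axis j 1" by (simp only: matrix_vector_mul_assoc UU matrix_vector_mul_lid)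
      have "?b \<in> S\<^sup>\<bottom>" unfolding J Ub using j by (auto simp: axis_def)
      then have "R *v ?b = ?b" using fix_perp by blast
      then show ?thesis using Ub by (simp only: matrix_vector_mul_assoc[symmetric])
    qed
    \<comment> \<open>If E fixes a coordinate vector then so does its inverse, which is the
      transpose.\<close>
    have row: "transpose ?E *v axis i 1 = axis i 1" if i: "i \<notin> J" for i
    proof -
      have "transpose ?E *v axis i 1 = transpose ?E *v (?E *v axis i 1)" by (simp only: col[OF i])
      also have "\<dots> = axis i 1" by (simp only: matrix_vector_mul_assoc E matrix_vector_mul_lid)
      finally show ?thesis .
    qed
    show "block_on J ?E"
      unfolding block_on_def
    proof (intro allI impI)
      fix i j assume "i \<notin> J \<or> j \<notin> J"
      then show "?E $ i $ j = (if i = j then 1 else 0)"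
      proof
        assume "j \<notin> J"
        from arg_cong[OF col[OF this], of "\<lambda>v. v $ i"] show ?thesis
          unfolding matrix_vector_mult_basis column_def by (simp add: axis_def)
      next
        assume "i \<notin> J"
        from arg_cong[OF row[OF this], of "\<lambda>v. v $ j"] show ?thesis
          unfolding matrix_vector_mult_basis column_def transpose_def by (simp add: axis_def)
      qed
    qed
  next
    assume block: "block_on J ?E"
    show "\<forall>z\<in>S\<^sup>\<bottom>. R *v z = z"
    proof
      fix z assume "z \<in> S\<^sup>\<bottom>"
      then have w: "\<And>j. j \<in> J \<Longrightarrow> (transpose U *v z) $ j = 0" using J by blast
      let ?w = "transpose U *v z"
      have "(?E *v ?w) $ i = ?w $ i" for i
      proof -
        have "(?E *v ?w) $ i = (\<Sum>j\<in>UNIV. if i = j then ?w $ j else 0)"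
          unfolding matrix_vector_mult_def[of ?E] vec_lambda_beta
        proof (rule sum.cong[OF refl])
          fix j show "?E $ i $ j * ?w $ j = (if i = j then ?w $ j else 0)"
            using block w[of j] unfolding block_on_def by (cases "j \<in> J") auto
        qed
        then show ?thesis by simp
      qed
      then have "?E *v ?w = ?w" by (simp only: vec_eq_iff) simp
      then have "U *v (?E *v ?w) = U *v ?w" by (simp only:)
      moreover have "U *v ?w = z" by (simp only: matrix_vector_mul_assoc UU matrix_vector_mul_lid)
      moreover have "U *v (?E *v ?w) = R *v z"
      proof -
        have "U ** (transpose U ** R ** U ** transpose U) = R"
          by (simp only: matrix_mul_assoc UU matrix_mul_lid) (simp only: matrix_mul_assoc[symmetric] UU matrix_mul_rid)
        then show ?thesis by (simp only: matrix_vector_mul_assoc matrix_mul_assoc)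
      qed
      ultimately show "R *v z = z" by (simp only:)
    qed
  }
qed

lemma rotation_conjugate:
  fixes U E :: "real ^ 'n ^ 'n"
  assumes U: "orthogonal_matrix U" and E: "orthogonal_matrix E" "det E = 1"
  shows "U ** E ** transpose U \<in> SO"
proof -
  have "orthogonal_matrix (U ** E ** transpose U)"
    using U E by (intro orthogonal_matrix_mul) (simp_all add: orthogonal_matrix_def)
  moreover have "det (U ** E ** transpose U) = 1"
  proof -
    have "det U * det U = 1" using det_orthogonal_matrix[OF U] by auto
    then show ?thesis using E by (simp add: det_mul)
  qed
  ultimately show ?thesis by (simp add: SO_def rotation_matrix_def)
qed

lemma rotation_unconjugate:
  fixes U R :: "real ^ 'n ^ 'n"
  assumes U: "orthogonal_matrix U" and R: "R \<in> SO"
  shows "orthogonal_matrix (transpose U ** R ** U)" "det (transpose U ** R ** U) = 1"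
    "U ** (transpose U ** R ** U) ** transpose U = R"
proof -
  have "transpose U ** R ** transpose (transpose U) \<in> SO"
    using U R by (intro rotation_conjugate) (simp_all add: orthogonal_matrix_def SO_def rotation_matrix_def)
  then show "orthogonal_matrix (transpose U ** R ** U)" "det (transpose U ** R ** U) = 1"
    by (simp_all add: SO_def rotation_matrix_def)
  show "U ** (transpose U ** R ** U) ** transpose U = R"
    using U by (simp only: matrix_mul_assoc orthogonal_matrix_def matrix_mul_lid)
      (simp only: matrix_mul_assoc[symmetric] matrix_mul_rid)
qed

lemma conjugate_unconjugate:
  "orthogonal_matrix U \<Longrightarrow> transpose U ** (U ** E ** transpose U) ** U = (E :: real ^ 'n ^ 'n)"
  by (simp only: matrix_mul_assoc orthogonal_matrix_def matrix_mul_lid)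
    (simp only: matrix_mul_assoc[symmetric] matrix_mul_rid)

text \<open>With at most one index in \<open>J\<close> the conjugated matrix is diagonal and all its
  entries outside \<open>J\<close> are 1, so the remaining entry, if there is one, equals the
  determinant 1.\<close>

lemma stabilizer_trivial:
  fixes S :: "(real ^ 'n) set"
  assumes S: "subspace S" "dim S \<le> 1" and R: "R \<in> SO" and fix_perp: "\<forall>z\<in>S\<^sup>\<bottom>. R *v z = z"
  shows "R = mat 1"
proof -
  obtain U :: "real ^ 'n ^ 'n" and J where U: "orthogonal_matrix U" and J: "card J = dim S"
    "\<And>z. z \<in> S\<^sup>\<bottom> \<longleftrightarrow> (\<forall>j\<in>J. (transpose U *v z) $ j = 0)"
    by (rule adapted_orthonormal_basis[OF S(1)]) blast
  let ?E = "transpose U ** R ** U"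
  have block: "block_on J ?E"
    using fixes_orthogonal_comp_iff[OF U _ J(2)] R fix_perp by (simp add: SO_def rotation_matrix_def)
  have J1: "i = j" if "i \<in> J" "j \<in> J" for i j
    using J(1) S(2) that card_le_Suc0_iff_eq[of J] by auto
  have diag: "?E $ i $ j = 0" if "i \<noteq> j" for i j
    using block J1 that unfolding block_on_def by metis
  have "?E $ i $ i = 1" for i
  proof (cases "i \<in> J")
    case True
    have "det ?E = (\<Prod>j\<in>UNIV. ?E $ j $ j)" by (rule det_diagonal) (rule diag)
    also have "\<dots> = (\<Prod>j\<in>{i}. ?E $ j $ j)"
    proof (rule prod.mono_neutral_right)
      show "\<forall>j\<in>UNIV - {i}. ?E $ j $ j = 1"
      proof
        fix j assume "j \<in> UNIV - {i}"
        then have "j \<notin> J" using J1 True by blast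
        then show "?E $ j $ j = 1" using block unfolding block_on_def by simp
      qed
    qed auto
    finally show ?thesis using rotation_unconjugate(2)[OF U R] by simp
  next
    case False
    then show ?thesis using block unfolding block_on_def by simp
  qed
  then have "?E $ i $ j = (mat 1 :: real ^ 'n ^ 'n) $ i $ j" for i j
    using diag[of i j] by (cases "i = j") (simp_all add: mat_def)
  then have "?E = mat 1" by (simp only: vec_eq_iff) simp
  then show ?thesis
    using rotation_unconjugate(3)[OF U R] U by (simp add: orthogonal_matrix_def)
qed

text \<open>A half turn in a plane inside S: two signs are changed, so the determinant stays
  1.\<close>

lemma stabilizer_nontrivial:
  fixes S :: "(real ^ 'n) set"
  assumes S: "subspace S" "2 \<le> dim S"
  obtains R where "R \<in> SO" "\<forall>z\<in>S\<^sup>\<bottom>. R *v z = z" "R \<noteq> mat 1"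
proof -
  obtain U :: "real ^ 'n ^ 'n" and J where U: "orthogonal_matrix U" and J: "card J = dim S"
    "\<And>z. z \<in> S\<^sup>\<bottom> \<longleftrightarrow> (\<forall>j\<in>J. (transpose U *v z) $ j = 0)"
    by (rule adapted_orthonormal_basis[OF S(1)]) blast
  obtain T where T: "T \<subseteq> J" "card T = 2" using obtain_subset_with_card_n[of 2 J] J(1) S(2) by auto
  then have "T \<noteq> {}" by auto
  then obtain p where p: "p \<in> T" by blast
  define E :: "real ^ 'n ^ 'n" where "E = (\<chi> i j. if i = j then if i \<in> T then - 1 else 1 else 0)"
  have "(transpose E ** E) $ i $ j = (mat 1 :: real ^ 'n ^ 'n) $ i $ j" for i j
  proof -
    have "(transpose E ** E) $ i $ j = (\<Sum>m\<in>UNIV. if m = i then (mat 1 :: real ^ 'n ^ 'n) $ i $ j else 0)"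
      unfolding matrix_matrix_mult_def vec_lambda_beta
    proof (rule sum.cong[OF refl])
      fix m show "transpose E $ i $ m * E $ m $ j = (if m = i then (mat 1 :: real ^ 'n ^ 'n) $ i $ j else 0)"
        by (simp add: transpose_def E_def mat_def)
    qed
    then show ?thesis by simp
  qed
  then have "transpose E ** E = mat 1" by (simp only: vec_eq_iff) simp
  then have OE: "orthogonal_matrix E" by (simp add: orthogonal_matrix)
  have "det E = (\<Prod>i\<in>UNIV. if i \<in> T then - 1 else 1)" by (subst det_diagonal) (auto simp: E_def)
  also have "\<dots> = (\<Prod>i\<in>T. - 1)" by (simp add: prod.If_cases)
  also have "\<dots> = 1" using T(2) by simp
  finally have R: "U ** E ** transpose U \<in> SO" by (rule rotation_conjugate[OF U OE])
  have "block_on J E" using T(1) by (auto simp: block_on_def E_def)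
  then have "\<forall>z\<in>S\<^sup>\<bottom>. (U ** E ** transpose U) *v z = z"
    using fixes_orthogonal_comp_iff[OF U _ J(2), of "U ** E ** transpose U"] R
    by (simp add: conjugate_unconjugate[OF U] SO_def rotation_matrix_def)
  moreover have "U ** E ** transpose U \<noteq> mat 1"
  proof
    assume "U ** E ** transpose U = mat 1"
    then have "transpose U ** (U ** E ** transpose U) ** U = mat 1" using U by (simp add: orthogonal_matrix_def)
    then have "E = mat 1" unfolding conjugate_unconjugate[OF U] .
    then have "E $ p $ p = 1" by (simp add: mat_def)
    then show False using p by (simp add: E_def)
  qed
  ultimately show ?thesis using R that by blast
qed

section \<open>The parametrization of the stabilizer by SO(k)\<close>

lemma Ck_on_const: "Ck_on k (\<lambda>x. c) S"
  by (induction k arbitrary: c) (simp_all add: frechet_derivative_const)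

lemma smooth_on_affine:
  assumes "bounded_linear L"
  shows "smooth_on S (\<lambda>x. L x + c)"
proof -
  have D: "((\<lambda>x. L x + c) has_derivative L) (at x)" for x
    using bounded_linear_imp_has_derivative[OF assms] by (auto intro!: derivative_eq_intros)
  have "Ck_on k (\<lambda>x. L x + c) S" for k
  proof (cases k)
    case 0
    have "continuous_on S (\<lambda>x. L x + c)"
      by (rule has_derivative_continuous_on[OF has_derivative_at_withinI[OF D]])
    then show ?thesis using 0 by simp
  next
    case (Suc m)
    have "(\<lambda>x. L x + c) differentiable (at x)" for x using D unfolding differentiable_def by blast
    moreover have "frechet_derivative (\<lambda>x. L x + c) (at x) v = L v" for x v
      using frechet_derivative_at[OF D] by metis
    ultimately show ?thesis using Suc by (simp add: Ck_on_const)
  qed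
  then show ?thesis by (simp add: smooth_on_def)
qed

lemma matrix_add_rdistrib: "(B + C) ** A = B ** A + C ** (A :: real ^ 'm ^ 'n)"
  by (simp add: vec_eq_iff matrix_matrix_mult_def sum.distrib distrib_right)

text \<open>Because of the entries 1 outside the block, the map is affine and not linear;
  subtracting its value at 0 isolates the linear part \<open>L\<close>.\<close>

lemma smooth_on_block_conjugate:
  fixes U :: "real ^ 'n ^ 'n" and \<iota> :: "'k::finite \<Rightarrow> 'n"
  shows "smooth_on X (\<lambda>A. U ** block_embed \<iota> A ** transpose U)"
proof -
  define L where "L A = U ** (block_embed \<iota> A - block_embed \<iota> 0) ** transpose U" for A
  have diff: "(block_embed \<iota> A - block_embed \<iota> 0) $ i $ j = (if i \<in> range \<iota> \<and> j \<in> range \<iota> then A $ inv \<iota> i $ inv \<iota> j else 0)" for A i j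
    by (simp add: block_embed_def)
  have "linear L"
  proof (rule linearI)
    fix A B :: "real ^ 'k ^ 'k" and r :: real
    have "block_embed \<iota> (A + B) - block_embed \<iota> 0 = (block_embed \<iota> A - block_embed \<iota> 0) + (block_embed \<iota> B - block_embed \<iota> 0)"
      unfolding vec_eq_iff vector_add_component diff by simp
    then show "L (A + B) = L A + L B"
      unfolding L_def by (simp only: matrix_add_ldistrib matrix_add_rdistrib)
    have "block_embed \<iota> (r *\<^sub>R A) - block_embed \<iota> 0 = r *\<^sub>R (block_embed \<iota> A - block_embed \<iota> 0)"
      unfolding vec_eq_iff vector_scaleR_component diff by simp
    then show "L (r *\<^sub>R A) = r *\<^sub>R L A"
      unfolding L_def by (simp only: matrix_scalar_ac flip: scalar_matrix_assoc)
  qed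
  then have "bounded_linear L" by (simp add: linear_linear)
  then have "smooth_on X (\<lambda>A. L A + U ** block_embed \<iota> 0 ** transpose U)" by (rule smooth_on_affine)
  moreover have "(\<lambda>A. L A + U ** block_embed \<iota> 0 ** transpose U) = (\<lambda>A. U ** block_embed \<iota> A ** transpose U)"
    unfolding L_def by (simp flip: matrix_add_ldistrib matrix_add_rdistrib)
  ultimately show ?thesis by (simp only:)
qed

text \<open>\<zeta> is block embedding followed by conjugation with \<open>U\<close>. It is smooth
  on all matrices, so it is its own smooth extension near SO; injectivity and surjectivity onto the
  stabilizer follow by undoing the conjugation and reading off the block.\<close>

lemma stabilizer_parametrization:
  fixes S :: "(real ^ 'n) set"
  assumes S: "subspace S" "dim S = CARD('k::finite)"
  obtains \<zeta> :: "real ^ 'k ^ 'k \<Rightarrow> real ^ 'n ^ 'n" where "lie_group_hom_SO \<zeta>" "inj_on \<zeta> SO"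
    "\<And>A. A \<in> SO \<Longrightarrow> \<forall>z\<in>S\<^sup>\<bottom>. \<zeta> A *v z = z"
    "\<And>R. R \<in> SO \<Longrightarrow> \<forall>z\<in>S\<^sup>\<bottom>. R *v z = z \<Longrightarrow> \<exists>A\<in>SO. R = \<zeta> A"
proof -
  obtain U :: "real ^ 'n ^ 'n" and J where U: "orthogonal_matrix U" and J: "card J = dim S"
    "\<And>z. z \<in> S\<^sup>\<bottom> \<longleftrightarrow> (\<forall>j\<in>J. (transpose U *v z) $ j = 0)"
    by (rule adapted_orthonormal_basis[OF S(1)]) blast
  obtain \<iota> :: "'k \<Rightarrow> 'n" where \<iota>: "bij_betw \<iota> UNIV J"
    using finite_same_card_bij[of "UNIV :: 'k set" J] J(1) S(2) by auto
  then have inj: "inj \<iota>" and ran: "range \<iota> = J" by (auto simp: bij_betw_def)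
  define \<zeta> where "\<zeta> A = U ** block_embed \<iota> A ** transpose U" for A
  have ortho: "orthogonal_matrix (block_embed \<iota> A) \<longleftrightarrow> orthogonal_matrix A" for A
  proof -
    have "transpose (block_embed \<iota> A) ** block_embed \<iota> A = block_embed \<iota> (transpose A ** A)"
      by (simp only: block_embed_mult[OF inj] block_embed_transpose[OF inj])
    then show ?thesis
      unfolding orthogonal_matrix using block_embed_inj[OF inj] block_embed_one[OF inj] by metis
  qed
  have mem: "\<zeta> A \<in> SO" if "A \<in> SO" for A
    unfolding \<zeta>_def using that
    by (intro rotation_conjugate U) (simp_all add: ortho det_block_embed[OF inj] SO_def rotation_matrix_def)
  have mult: "\<zeta> (A ** B) = \<zeta> A ** \<zeta> B" for A B
  proof -
    have "\<zeta> A ** \<zeta> B = U ** block_embed \<iota> A ** (transpose U ** U) ** block_embed \<iota> B ** transpose U"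
      unfolding \<zeta>_def by (simp only: matrix_mul_assoc)
    also have "\<dots> = \<zeta> (A ** B)"
      using U unfolding \<zeta>_def by (simp add: orthogonal_matrix_def block_embed_mult[OF inj] matrix_mul_assoc)
    finally show ?thesis ..
  qed
  have unconj: "transpose U ** \<zeta> A ** U = block_embed \<iota> A" for A
    unfolding \<zeta>_def by (rule conjugate_unconjugate[OF U])
  have hom: "lie_group_hom_SO \<zeta>"
    unfolding lie_group_hom_SO_def smooth_on_subset_def
    using mem mult smooth_on_block_conjugate[of UNIV U \<iota>] unfolding \<zeta>_def[abs_def]
    by (intro conjI ballI exI[of _ UNIV] exI[of _ "\<lambda>A. U ** block_embed \<iota> A ** transpose U"]) auto
  have "inj_on \<zeta> SO"
    by (rule inj_onI) (metis unconj block_embed_inj[OF inj])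
  moreover have "\<forall>z\<in>S\<^sup>\<bottom>. \<zeta> A *v z = z" if "A \<in> SO" for A
    using fixes_orthogonal_comp_iff[OF U _ J(2), of "\<zeta> A"] mem[OF that] block_on_block_embed[of \<iota> A]
    by (simp add: unconj ran SO_def rotation_matrix_def)
  moreover have "\<exists>A\<in>SO. R = \<zeta> A" if R: "R \<in> SO" "\<forall>z\<in>S\<^sup>\<bottom>. R *v z = z" for R
  proof -
    let ?E = "transpose U ** R ** U"
    define A :: "real ^ 'k ^ 'k" where "A = (\<chi> a b. ?E $ \<iota> a $ \<iota> b)"
    have "block_on J ?E"
      using fixes_orthogonal_comp_iff[OF U _ J(2), of R] R by (simp add: SO_def rotation_matrix_def)
    then have E: "block_embed \<iota> A = ?E"
      by (intro block_embed_eqI[OF inj]) (simp_all add: ran A_def)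
    have "A \<in> SO"
      using rotation_unconjugate(1,2)[OF U R(1)] det_block_embed[OF inj, of A] ortho[of A]
      unfolding E by (simp add: SO_def rotation_matrix_def)
    moreover have "R = \<zeta> A" unfolding \<zeta>_def E by (rule rotation_unconjugate(3)[OF U R(1), symmetric])
    ultimately show ?thesis by blast
  qed
  ultimately show ?thesis using hom that by blast
qed

lemma mat_1_in_SO: "mat 1 \<in> SO"
  by (simp add: SO_def rotation_matrix_def orthogonal_matrix_def)

lemma SO_orthogonal: "R \<in> SO \<Longrightarrow> orthogonal_matrix R"
  by (simp add: SO_def rotation_matrix_def)

section \<open>Uniqueness and parametrization of the rollings\<close>

context rolling_paths
begin

text \<open>If k is at least 2, a half turn in S yields a rolling that differs from
  \<open>q0\<close> already at time 0. If k is at most 1, the stabilizer is trivial, so every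
  rolling arises from \<open>q0\<close> by the identity rotation.\<close>

lemma rolling_unique_iff:
  assumes q0: "intrinsic_rolling_along M N \<tau> x y q0"
  shows "(\<forall>q. intrinsic_rolling_along M N \<tau> x y q \<longrightarrow> (\<forall>t\<in>{0..\<tau>}. q t = q0 t)) \<longleftrightarrow>
    dim (normal_parallel_fields N \<tau> y) \<le> 1"
proof -
  obtain e where e: "M.orthonormal_frame e" by (rule M.orthonormal_frame_exists)
  obtain f where f: "N.orthonormal_frame f" by (rule N.orthonormal_frame_exists)
  note dim_eq = dim_normal_parallel_fields[OF e f q0]
  have one: "fixes_velocity e (mat 1)"
    using fixes_velocity_iff[OF SO_orthogonal[OF mat_1_in_SO]] by simp
  show ?thesis
  proof
    assume uniq: "\<forall>q. intrinsic_rolling_along M N \<tau> x y q \<longrightarrow> (\<forall>t\<in>{0..\<tau>}. q t = q0 t)"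
    show "dim (normal_parallel_fields N \<tau> y) \<le> 1"
    proof (rule ccontr)
      assume "\<not> dim (normal_parallel_fields N \<tau> y) \<le> 1"
      then have "2 \<le> dim (normal_coords e)" unfolding dim_eq by simp
      then obtain R where R: "R \<in> SO" "\<forall>z\<in>(normal_coords e)\<^sup>\<bottom>. R *v z = z" "R \<noteq> mat 1"
        by (rule stabilizer_nontrivial[OF subspace_normal_coords])
      have fix_R: "fixes_velocity e R" using fixes_velocity_iff[OF SO_orthogonal[OF R(1)]] R(2) by simp
      have 0: "0 \<in> {0..\<tau>}" using M.\<tau> by simp
      have at_0: "right_action M N e f 0 (q0 0) P = q0 0" if P: "P \<in> SO" "fixes_velocity e P" for P
        using uniq[THEN spec, THEN mp, OF right_action_imp_rolling[OF e f q0 P]] 0 by (rule bspec)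
      have "R = mat 1"
        by (rule right_action_rolling_eq_iff[OF e f q0 R(1) mat_1_in_SO])
          (simp only: at_0[OF R(1) fix_R] at_0[OF mat_1_in_SO one])
      with R(3) show False by (rule notE)
    qed
  next
    assume "dim (normal_parallel_fields N \<tau> y) \<le> 1"
    then have dim_le: "dim (normal_coords e) \<le> 1" unfolding dim_eq .
    \<comment> \<open>Applied to \<open>q0\<close> itself as well, so both \<open>q\<close> and
      \<open>q0\<close> equal the same expression and need not be compared with the identity action
      directly.\<close>
    have action: "q t = right_action M N e f t (q0 t) (mat 1)"
      if q: "intrinsic_rolling_along M N \<tau> x y q" and t: "t \<in> {0..\<tau>}" for q t
    proof -
      obtain R where R: "R \<in> SO" "fixes_velocity e R"
        "\<And>t. t \<in> {0..\<tau>} \<Longrightarrow> q t = right_action M N e f t (q0 t) R"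
        by (rule rolling_imp_right_action[OF e f q0 q]) blast
      have "R = mat 1"
        by (rule stabilizer_trivial[OF subspace_normal_coords dim_le R(1)])
          (rule fixes_velocity_iff[THEN iffD1, OF SO_orthogonal[OF R(1)] R(2)])
      then show ?thesis using R(3)[OF t] by (simp only:)
    qed
    show "\<forall>q. intrinsic_rolling_along M N \<tau> x y q \<longrightarrow> (\<forall>t\<in>{0..\<tau>}. q t = q0 t)"
    proof (intro allI impI ballI)
      fix q t assume q: "intrinsic_rolling_along M N \<tau> x y q" and t: "t \<in> {0..\<tau>}"
      show "q t = q0 t" unfolding action[OF q t] by (rule action[OF q0 t, symmetric])
    qed
  qed
qed

lemma rollings_parametrized_by_SO:
  assumes q0: "intrinsic_rolling_along M N \<tau> x y q0"
    and dim_k: "dim (normal_parallel_fields N \<tau> y) = CARD('k::finite)"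
    and e: "parallel_frame M \<tau> x e" and f: "parallel_frame N \<tau> y f"
  obtains \<zeta> :: "real ^ 'k ^ 'k \<Rightarrow> real ^ 'n ^ 'n" where "lie_group_hom_SO \<zeta>" "inj_on \<zeta> SO"
    "\<And>A. A \<in> SO \<Longrightarrow> intrinsic_rolling_along M N \<tau> x y (\<lambda>t. right_action M N e f t (q0 t) (\<zeta> A))"
    "\<And>q. intrinsic_rolling_along M N \<tau> x y q \<Longrightarrow>
      \<exists>A\<in>SO. \<forall>t\<in>{0..\<tau>}. q t = right_action M N e f t (q0 t) (\<zeta> A)"
proof -
  note e' = M.orthonormal_frame_of_parallel_frame[OF e]
  note f' = N.orthonormal_frame_of_parallel_frame[OF f]
  have "dim (normal_coords e) = CARD('k)" using dim_normal_parallel_fields[OF e' f' q0] dim_k by simp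
  then obtain \<zeta> :: "real ^ 'k ^ 'k \<Rightarrow> real ^ 'n ^ 'n" where hom: "lie_group_hom_SO \<zeta>" "inj_on \<zeta> SO"
    and fixed: "\<And>A. A \<in> SO \<Longrightarrow> \<forall>z\<in>(normal_coords e)\<^sup>\<bottom>. \<zeta> A *v z = z"
    and onto: "\<And>R. R \<in> SO \<Longrightarrow> \<forall>z\<in>(normal_coords e)\<^sup>\<bottom>. R *v z = z \<Longrightarrow> \<exists>A\<in>SO. R = \<zeta> A"
    by (rule stabilizer_parametrization[OF subspace_normal_coords]) blast
  from hom show ?thesis
  proof (rule that)
    fix A :: "real ^ 'k ^ 'k" assume A: "A \<in> SO"
    have R: "\<zeta> A \<in> SO" using hom(1) A by (auto simp: lie_group_hom_SO_def)
    show "intrinsic_rolling_along M N \<tau> x y (\<lambda>t. right_action M N e f t (q0 t) (\<zeta> A))"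
      by (rule right_action_imp_rolling[OF e' f' q0 R])
        (rule fixes_velocity_iff[THEN iffD2, OF SO_orthogonal[OF R] fixed[OF A]])
  next
    fix q assume q: "intrinsic_rolling_along M N \<tau> x y q"
    obtain R where R: "R \<in> SO" "fixes_velocity e R"
      "\<And>t. t \<in> {0..\<tau>} \<Longrightarrow> q t = right_action M N e f t (q0 t) R"
      by (rule rolling_imp_right_action[OF e' f' q0 q]) blast
    obtain A where "A \<in> SO" "R = \<zeta> A"
      using onto[OF R(1) fixes_velocity_iff[THEN iffD1, OF SO_orthogonal[OF R(1)] R(2)]] by (rule bexE)
    then show "\<exists>A\<in>SO. \<forall>t\<in>{0..\<tau>}. q t = right_action M N e f t (q0 t) (\<zeta> A)"
      using R(3) by (intro bexI[of _ A] ballI) (simp_all only:)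
  qed
qed

end

text \<open>Sizes of matrices are types, so SO(k) is formed over an index type \<open>'k\<close>
  with k elements. The frames that define the right action are arbitrary, and \<zeta> may depend on
  them.\<close>

theorem theorem2:
  fixes M :: "('a, 'n::finite) rmanifold" and N :: "('b, 'n) rmanifold"
    and \<tau> :: real and q0 :: "real \<Rightarrow> ('a, 'b, 'n) config"
    and x :: "real \<Rightarrow> 'a" and y :: "real \<Rightarrow> 'b" and k :: nat
  assumes "oriented_riemannian_manifold M" and "connected_space (mtop M)"
    and "oriented_riemannian_manifold N" and "connected_space (mtop N)"
    and "0 < \<tau>"
    and "intrinsic_rolling_along M N \<tau> x y q0"
    and "k = dim (normal_parallel_fields N \<tau> y)"
  shows
    "((\<forall>q. intrinsic_rolling_along M N \<tau> x y q \<longrightarrow> (\<forall>t\<in>{0..\<tau>}. q t = q0 t)) \<longleftrightarrow> k \<le> 1) \<and>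
     (2 \<le> k \<and> CARD('k::finite) = k \<longrightarrow>
        (\<forall>e f. parallel_frame M \<tau> x e \<and> parallel_frame N \<tau> y f \<longrightarrow>
           (\<exists>\<zeta> :: real ^ 'k ^ 'k \<Rightarrow> real ^ 'n ^ 'n.
              lie_group_hom_SO \<zeta> \<and> inj_on \<zeta> SO \<and>
              (\<forall>A\<in>SO. intrinsic_rolling_along M N \<tau> x y
                         (\<lambda>t. right_action M N e f t (q0 t) (\<zeta> A))) \<and>
              (\<forall>q. intrinsic_rolling_along M N \<tau> x y q \<longrightarrow>
                 (\<exists>A\<in>SO. \<forall>t\<in>{0..\<tau>}. q t = right_action M N e f t (q0 t) (\<zeta> A))))))"
proof (intro conjI)
  note paths = ac_path_of_rolling[OF assms(1,3,5,6)]
  interpret rolling_paths M N \<tau> x y by (rule rolling_paths.intro) (rule paths)+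
  show "(\<forall>q. intrinsic_rolling_along M N \<tau> x y q \<longrightarrow> (\<forall>t\<in>{0..\<tau>}. q t = q0 t)) \<longleftrightarrow> k \<le> 1"
    unfolding assms(7) by (rule rolling_unique_iff[OF assms(6)])
  show "2 \<le> k \<and> CARD('k::finite) = k \<longrightarrow>
        (\<forall>e f. parallel_frame M \<tau> x e \<and> parallel_frame N \<tau> y f \<longrightarrow>
           (\<exists>\<zeta> :: real ^ 'k ^ 'k \<Rightarrow> real ^ 'n ^ 'n.
              lie_group_hom_SO \<zeta> \<and> inj_on \<zeta> SO \<and>
              (\<forall>A\<in>SO. intrinsic_rolling_along M N \<tau> x y
                         (\<lambda>t. right_action M N e f t (q0 t) (\<zeta> A))) \<and>
              (\<forall>q. intrinsic_rolling_along M N \<tau> x y q \<longrightarrow>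
                 (\<exists>A\<in>SO. \<forall>t\<in>{0..\<tau>}. q t = right_action M N e f t (q0 t) (\<zeta> A)))))"
  proof (intro allI impI, elim conjE)
    fix e f
    assume k: "CARD('k) = k" and e: "parallel_frame M \<tau> x e" and f: "parallel_frame N \<tau> y f"
    have "dim (normal_parallel_fields N \<tau> y) = CARD('k)" using k assms(7) by simp
    then obtain \<zeta> :: "real ^ 'k ^ 'k \<Rightarrow> real ^ 'n ^ 'n" where "lie_group_hom_SO \<zeta>" "inj_on \<zeta> SO"
      "\<And>A. A \<in> SO \<Longrightarrow> intrinsic_rolling_along M N \<tau> x y (\<lambda>t. right_action M N e f t (q0 t) (\<zeta> A))"
      "\<And>q. intrinsic_rolling_along M N \<tau> x y q \<Longrightarrow>
        \<exists>A\<in>SO. \<forall>t\<in>{0..\<tau>}. q t = right_action M N e f t (q0 t) (\<zeta> A)"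
      by (rule rollings_parametrized_by_SO[OF assms(6) _ e f]) blast
    then show "\<exists>\<zeta> :: real ^ 'k ^ 'k \<Rightarrow> real ^ 'n ^ 'n.
        lie_group_hom_SO \<zeta> \<and> inj_on \<zeta> SO \<and>
        (\<forall>A\<in>SO. intrinsic_rolling_along M N \<tau> x y (\<lambda>t. right_action M N e f t (q0 t) (\<zeta> A))) \<and>
        (\<forall>q. intrinsic_rolling_along M N \<tau> x y q \<longrightarrow>
           (\<exists>A\<in>SO. \<forall>t\<in>{0..\<tau>}. q t = right_action M N e f t (q0 t) (\<zeta> A)))"
      by (intro exI[of _ \<zeta>] conjI ballI allI impI)
  qed
qed

end
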